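(* Let $\Gamma$ be a finitely generated virtually nilpotent group and let $\alpha$ be a Noetherian action of $\Gamma$ on a compact metrizable abelian group $X$. Then the set of $\alpha$-periodic points is dense in $X$.
   Context: An algebraic $\Gamma$-action $(X,\alpha)$ of a countable (discrete) group $\Gamma$ is an action $\alpha$ of $\Gamma$ on a compact metrizable abelian group $X$ by continuous automorphisms. The dual action of $\Gamma$ by automorphisms of the Pontryagin dual $\widehat{X}$ makes $\widehat{X}$ a module over the integral group ring $\mathbb{Z}[\Gamma]$. The action $\alpha$ is Noetherian if $\widehat{X}$ is a Noetherian $\mathbb{Z}[\Gamma]$-module; equivalently, every decreasing sequence $X = X_0\supset X_1\supset X_2\supset\cdots$ of closed $\Gamma$-invariant subgroups stabilizes. A point $x\in X$ is $\alpha$-periodic if its $\Gamma$-orbit is finite. *)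

theory Defs
  imports "HOL-Analysis.Analysis" "HOL-Algebra.Module" "HOL-Algebra.Generated_Groups" "HOL-Algebra.Group_Action"
begin

subsection \<open>Finitely generated and virtually nilpotent groups\<close>

definition finitely_generated_group :: "('g, 'm) monoid_scheme \<Rightarrow> bool" where
  "finitely_generated_group G \<longleftrightarrow>
     group G \<and> (\<exists>S \<subseteq> carrier G. finite S \<and> generate G S = carrier G)"

primrec lower_central_series :: "('g, 'm) monoid_scheme \<Rightarrow> nat \<Rightarrow> 'g set" where
  "lower_central_series G 0 = carrier G"
| "lower_central_series G (Suc n) =
     generate G (\<Union>x \<in> lower_central_series G n. \<Union>y \<in> carrier G.
                   {x \<otimes>\<^bsub>G\<^esub> y \<otimes>\<^bsub>G\<^esub> inv\<^bsub>G\<^esub> x \<otimes>\<^bsub>G\<^esub> inv\<^bsub>G\<^esub> y})"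

definition nilpotent_group :: "('g, 'm) monoid_scheme \<Rightarrow> bool" where
  "nilpotent_group G \<longleftrightarrow> group G \<and> (\<exists>n. lower_central_series G n = {\<one>\<^bsub>G\<^esub>})"

definition virtually_nilpotent_group :: "('g, 'm) monoid_scheme \<Rightarrow> bool" where
  "virtually_nilpotent_group G \<longleftrightarrow>
     group G \<and>
     (\<exists>H. subgroup H G \<and> finite (rcosets\<^bsub>G\<^esub> H) \<and> nilpotent_group (G\<lparr>carrier := H\<rparr>))"


subsection \<open>Noetherian modules over a possibly noncommutative ring\<close>

text \<open>The locale \<open>module\<close> of the library requires a commutative ring of scalars. Its record type
  and the locale \<open>submodule\<close> do not, and are reused here. The ring multiplication of the
  record \<open>M\<close> plays no role.\<close>

locale left_module = R?: ring R + M?: abelian_group M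
  for R :: "('r, 'k) ring_scheme" (structure) and M :: "('r, 'e, 'l) module_scheme" (structure) +
  assumes smult_closed:
      "\<lbrakk>a \<in> carrier R; x \<in> carrier M\<rbrakk> \<Longrightarrow> a \<odot>\<^bsub>M\<^esub> x \<in> carrier M"
    and smult_l_distr:
      "\<lbrakk>a \<in> carrier R; b \<in> carrier R; x \<in> carrier M\<rbrakk> \<Longrightarrow>
       (a \<oplus>\<^bsub>R\<^esub> b) \<odot>\<^bsub>M\<^esub> x = a \<odot>\<^bsub>M\<^esub> x \<oplus>\<^bsub>M\<^esub> b \<odot>\<^bsub>M\<^esub> x"
    and smult_r_distr:
      "\<lbrakk>a \<in> carrier R; x \<in> carrier M; y \<in> carrier M\<rbrakk> \<Longrightarrow>
       a \<odot>\<^bsub>M\<^esub> (x \<oplus>\<^bsub>M\<^esub> y) = a \<odot>\<^bsub>M\<^esub> x \<oplus>\<^bsub>M\<^esub> a \<odot>\<^bsub>M\<^esub> y"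
    and smult_assoc:
      "\<lbrakk>a \<in> carrier R; b \<in> carrier R; x \<in> carrier M\<rbrakk> \<Longrightarrow>
       (a \<otimes>\<^bsub>R\<^esub> b) \<odot>\<^bsub>M\<^esub> x = a \<odot>\<^bsub>M\<^esub> (b \<odot>\<^bsub>M\<^esub> x)"
    and smult_one:
      "x \<in> carrier M \<Longrightarrow> \<one>\<^bsub>R\<^esub> \<odot>\<^bsub>M\<^esub> x = x"

locale noetherian_left_module = left_module +
  assumes ascending_chain_condition:
    "\<lbrakk>\<And>n::nat. submodule (N n) R M; \<And>n. N n \<subseteq> N (Suc n)\<rbrakk> \<Longrightarrow> \<exists>n. \<forall>m \<ge> n. N m = N n"


subsection \<open>The integral group ring\<close>

definition support :: "('g \<Rightarrow> int) \<Rightarrow> 'g set" where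
  "support f = {g. f g \<noteq> 0}"

definition integral_group_ring :: "('g, 'm) monoid_scheme \<Rightarrow> ('g \<Rightarrow> int) ring" where
  "integral_group_ring G =
     \<lparr>carrier = {f. finite (support f) \<and> support f \<subseteq> carrier G},
      mult = (\<lambda>f h x. if x \<in> carrier G
                      then \<Sum>y \<in> support f. f y * h (inv\<^bsub>G\<^esub> y \<otimes>\<^bsub>G\<^esub> x) else 0),
      one = (\<lambda>x. if x = \<one>\<^bsub>G\<^esub> then 1 else 0),
      zero = (\<lambda>_. 0),
      add = (\<lambda>f h x. f x + h x)\<rparr>"

lemma sum_support:
  assumes "finite S" "support f \<subseteq> S"
  shows "(\<Sum>y\<in>support f. f y * k y) = (\<Sum>y\<in>S. f y * (k y :: int))"
  using assms by (intro sum.mono_neutral_left) (auto simp: support_def)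

lemma prod_support:
  assumes "finite S" "support f \<subseteq> S"
  shows "(\<Prod>y\<in>support f. k y powi f y) = (\<Prod>y\<in>S. (k y :: complex) powi f y)"
  using assms by (intro prod.mono_neutral_left) (auto simp: support_def)

lemma (in group) translate_reindex:
  assumes "y \<in> carrier G" "B \<subseteq> carrier G"
  shows "inj_on (\<lambda>w. y \<otimes> w) B"
    and "z \<in> carrier G \<Longrightarrow> inv y \<otimes> z \<in> B \<Longrightarrow> z \<in> (\<lambda>w. y \<otimes> w) ` B"
proof -
  show "inj_on (\<lambda>w. y \<otimes> w) B"
    using assms by (meson inj_on_cmult inj_on_subset)
  show "z \<in> carrier G \<Longrightarrow> inv y \<otimes> z \<in> B \<Longrightarrow> z \<in> (\<lambda>w. y \<otimes> w) ` B"
    using assms by (metis image_eqI inv_solve_left' inv_closed subsetD)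
qed

lemma (in group) sum_translate:
  assumes y: "y \<in> carrier G" and B: "support h \<subseteq> carrier G" and S: "finite S" "S \<subseteq> carrier G"
    and sub: "(\<lambda>w. y \<otimes> w) ` support h \<subseteq> S"
  shows "(\<Sum>z\<in>S. h (inv y \<otimes> z) * k z) = (\<Sum>w\<in>support h. h w * (k (y \<otimes> w) :: int))"
proof -
  have "(\<Sum>z\<in>S. h (inv y \<otimes> z) * k z) = (\<Sum>z\<in>(\<lambda>w. y \<otimes> w) ` support h. h (inv y \<otimes> z) * k z)"
    using S sub translate_reindex(2)[OF y B] proof (intro sum.mono_neutral_right ballI)
    fix z assume z: "z \<in> S - (\<lambda>w. y \<otimes> w) ` support h"
    then have "inv y \<otimes> z \<notin> support h" using S translate_reindex(2)[OF y B] by blast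
    then show "h (inv y \<otimes> z) * k z = 0" by (simp add: support_def)
  qed auto
  also have "\<dots> = (\<Sum>w\<in>support h. h (inv y \<otimes> (y \<otimes> w)) * k (y \<otimes> w))"
    by (simp add: sum.reindex[OF translate_reindex(1)[OF y B]])
  also have "\<dots> = (\<Sum>w\<in>support h. h w * (k (y \<otimes> w) :: int))"
    using B y by (intro sum.cong) (auto simp flip: m_assoc)
  finally show ?thesis .
qed

lemma (in group) prod_translate:
  assumes y: "y \<in> carrier G" and B: "support h \<subseteq> carrier G" and S: "finite S" "S \<subseteq> carrier G"
    and sub: "(\<lambda>w. y \<otimes> w) ` support h \<subseteq> S"
  shows "(\<Prod>z\<in>S. k z powi h (inv y \<otimes> z)) = (\<Prod>w\<in>support h. (k (y \<otimes> w) :: complex) powi h w)"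
proof -
  have "(\<Prod>z\<in>S. k z powi h (inv y \<otimes> z)) = (\<Prod>z\<in>(\<lambda>w. y \<otimes> w) ` support h. k z powi h (inv y \<otimes> z))"
    using S sub translate_reindex(2)[OF y B] proof (intro prod.mono_neutral_right ballI)
    fix z assume z: "z \<in> S - (\<lambda>w. y \<otimes> w) ` support h"
    then have "inv y \<otimes> z \<notin> support h" using S translate_reindex(2)[OF y B] by blast
    then show "k z powi h (inv y \<otimes> z) = 1" by (simp add: support_def)
  qed auto
  also have "\<dots> = (\<Prod>w\<in>support h. k (y \<otimes> w) powi h (inv y \<otimes> (y \<otimes> w)))"
    by (simp add: prod.reindex[OF translate_reindex(1)[OF y B]])
  also have "\<dots> = (\<Prod>w\<in>support h. (k (y \<otimes> w) :: complex) powi h w)"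
    using B y by (intro prod.cong) (auto simp flip: m_assoc)
  finally show ?thesis .
qed

abbreviation (in group) (input) gr_mult where "gr_mult \<equiv> mult (integral_group_ring G)"

lemma (in group) gr_mult_eq:
  assumes "finite S" "support f \<subseteq> S" "x \<in> carrier G"
  shows "gr_mult f h x = (\<Sum>y\<in>S. f y * h (inv y \<otimes> x))"
  using assms by (simp add: integral_group_ring_def sum_support[OF assms(1,2)])

lemma (in group) gr_mult_support:
  assumes "support f \<subseteq> carrier G" 
  shows "support (gr_mult f h) \<subseteq> (\<lambda>(y,w). y \<otimes> w) ` (support f \<times> support h)"
proof
  fix x assume x: "x \<in> support (gr_mult f h)"
  then have xc: "x \<in> carrier G" by (auto simp: support_def integral_group_ring_def split: if_splits)
  with x have "(\<Sum>y\<in>support f. f y * h (inv y \<otimes> x)) \<noteq> 0"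
    by (simp add: support_def integral_group_ring_def)
  then obtain y where "y \<in> support f" "f y * h (inv y \<otimes> x) \<noteq> 0" by (meson sum.neutral)
  then have "y \<in> support f" "inv y \<otimes> x \<in> support h" "x = y \<otimes> (inv y \<otimes> x)"
    using assms xc by (auto simp: support_def simp flip: m_assoc)
  then show "x \<in> (\<lambda>(y,w). y \<otimes> w) ` (support f \<times> support h)" by force
qed

lemma (in group) ring_integral_group_ring: "ring (integral_group_ring G)"
proof (rule ringI)
  let ?R = "integral_group_ring G"
  have carr: "f \<in> carrier ?R \<longleftrightarrow> finite (support f) \<and> support f \<subseteq> carrier G" for f
    by (simp add: integral_group_ring_def)
  have sa: "support (\<lambda>x. f x + h x) \<subseteq> support f \<union> support h" for f h by (auto simp: support_def)
  have addc: "f \<oplus>\<^bsub>?R\<^esub> h \<in> carrier ?R" if "f \<in> carrier ?R" "h \<in> carrier ?R" for f h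
    using that finite_subset[OF sa] sa[of f h] by (simp add: carr) (auto simp: integral_group_ring_def)
  show "abelian_group ?R"
  proof (rule abelian_groupI)
    fix f assume "f \<in> carrier ?R"
    then have "(\<lambda>x. - f x) \<in> carrier ?R" by (simp add: carr support_def)
    moreover have "(\<lambda>x. - f x) \<oplus>\<^bsub>?R\<^esub> f = \<zero>\<^bsub>?R\<^esub>" by (simp add: integral_group_ring_def)
    ultimately show "\<exists>y\<in>carrier ?R. y \<oplus>\<^bsub>?R\<^esub> f = \<zero>\<^bsub>?R\<^esub>" by blast
  next
    show "f \<oplus>\<^bsub>?R\<^esub> h \<in> carrier ?R" if "f \<in> carrier ?R" "h \<in> carrier ?R" for f h using addc that .
  qed (auto simp: integral_group_ring_def support_def add_ac)
  have mc: "gr_mult f h \<in> carrier ?R" if "f \<in> carrier ?R" "h \<in> carrier ?R" for f h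
  proof -
    have "(\<lambda>(y,w). y \<otimes> w) ` (support f \<times> support h) \<subseteq> carrier G" using that by (auto simp: carr)
    moreover have "finite ((\<lambda>(y,w). y \<otimes> w) ` (support f \<times> support h))" using that by (simp add: carr)
    ultimately show ?thesis unfolding carr using that gr_mult_support[of f h] by (meson carr finite_subset subset_trans)
  qed
  show "monoid ?R"
  proof (rule monoidI)
    show "gr_mult f h \<in> carrier ?R" if "f \<in> carrier ?R" "h \<in> carrier ?R" for f h using mc that .
    have s1: "support (\<one>\<^bsub>?R\<^esub>) = {\<one>}" by (auto simp: support_def integral_group_ring_def)
    then show "\<one>\<^bsub>?R\<^esub> \<in> carrier ?R" by (simp add: carr)
    show "gr_mult \<one>\<^bsub>?R\<^esub> f = f" if "f \<in> carrier ?R" for f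
    proof
      fix x show "gr_mult \<one>\<^bsub>?R\<^esub> f x = f x"
      proof (cases "x \<in> carrier G")
        case True
        then show ?thesis using gr_mult_eq[of "{\<one>}" "\<one>\<^bsub>?R\<^esub>" x f] s1 by (simp add: integral_group_ring_def)
      next
        case False
        then show ?thesis using that by (auto simp: integral_group_ring_def support_def)
      qed
    qed
    show "gr_mult f \<one>\<^bsub>?R\<^esub> = f" if f: "f \<in> carrier ?R" for f
    proof
      fix x show "gr_mult f \<one>\<^bsub>?R\<^esub> x = f x"
      proof (cases "x \<in> carrier G")
        case True
        have "gr_mult f \<one>\<^bsub>?R\<^esub> x = (\<Sum>y\<in>insert x (support f). f y * \<one>\<^bsub>?R\<^esub> (inv y \<otimes> x))"
          using f True by (intro gr_mult_eq) (auto simp: carr)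
        also have "\<dots> = (\<Sum>y\<in>insert x (support f). if y = x then f x else 0)"
        proof (rule sum.cong)
          fix y assume "y \<in> insert x (support f)"
          then have "y \<in> carrier G" using f True by (auto simp: carr)
          then show "f y * \<one>\<^bsub>?R\<^esub> (inv y \<otimes> x) = (if y = x then f x else 0)"
            using True by (auto simp: integral_group_ring_def) (metis inv_equality inv_inv inv_closed)
        qed simp
        also have "\<dots> = f x" using f by (simp add: carr)
        finally show ?thesis .
      next
        case False
        then show ?thesis using that by (auto simp: integral_group_ring_def support_def)
      qed
    qed
    fix f g h assume f: "f \<in> carrier ?R" and g: "g \<in> carrier ?R" and h: "h \<in> carrier ?R"
    show "gr_mult (gr_mult f g) h = gr_mult f (gr_mult g h)"
    proof
      fix x
      show "gr_mult (gr_mult f g) h x = gr_mult f (gr_mult g h) x"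
      proof (cases "x \<in> carrier G")
        case True
        define S where "S = (\<lambda>(y,w). y \<otimes> w) ` (support f \<times> support g)"
        have S: "finite S" "S \<subseteq> carrier G" "support (gr_mult f g) \<subseteq> S"
          using f g gr_mult_support[of f g] by (auto simp: S_def carr)
        have "gr_mult (gr_mult f g) h x = (\<Sum>z\<in>S. gr_mult f g z * h (inv z \<otimes> x))"
          using S True by (intro gr_mult_eq)
        also have "\<dots> = (\<Sum>z\<in>S. \<Sum>y\<in>support f. f y * (g (inv y \<otimes> z) * h (inv z \<otimes> x)))"
          using S(2) f by (intro sum.cong refl)
             (simp add: gr_mult_eq[of "support f" f] carr sum_distrib_right mult.assoc subset_iff)
        also have "\<dots> = (\<Sum>y\<in>support f. f y * (\<Sum>z\<in>S. g (inv y \<otimes> z) * h (inv z \<otimes> x)))"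
          by (subst sum.swap) (simp add: sum_distrib_left)
        also have "\<dots> = (\<Sum>y\<in>support f. f y * gr_mult g h (inv y \<otimes> x))"
        proof (intro sum.cong refl arg_cong2[of _ _ _ _ "(*)"])
          fix y assume y: "y \<in> support f"
          then have yc: "y \<in> carrier G" using f by (auto simp: carr)
          have "(\<Sum>z\<in>S. g (inv y \<otimes> z) * h (inv z \<otimes> x)) = (\<Sum>w\<in>support g. g w * h (inv (y \<otimes> w) \<otimes> x))"
            using y yc g S by (intro sum_translate) (auto simp: carr S_def)
          also have "\<dots> = (\<Sum>w\<in>support g. g w * h (inv w \<otimes> (inv y \<otimes> x)))"
            using yc g True by (intro sum.cong refl) (auto simp: carr inv_mult_group m_assoc subset_iff)
          also have "\<dots> = gr_mult g h (inv y \<otimes> x)"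
            using g True yc by (subst gr_mult_eq[of "support g" g]) (auto simp: carr)
          finally show "(\<Sum>z\<in>S. g (inv y \<otimes> z) * h (inv z \<otimes> x)) = gr_mult g h (inv y \<otimes> x)" .
        qed
        also have "\<dots> = gr_mult f (gr_mult g h) x"
          using f True by (subst gr_mult_eq[of "support f" f]) (auto simp: carr)
        finally show ?thesis .
      qed (simp add: integral_group_ring_def)
    qed
  qed
  fix f g h assume f: "f \<in> carrier ?R" and g: "g \<in> carrier ?R" and h: "h \<in> carrier ?R"
  have ad: "(f \<oplus>\<^bsub>?R\<^esub> g) x = f x + g x" for f g x by (simp add: integral_group_ring_def)
  show "gr_mult (f \<oplus>\<^bsub>?R\<^esub> g) h = gr_mult f h \<oplus>\<^bsub>?R\<^esub> gr_mult g h"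
  proof
    fix x show "gr_mult (f \<oplus>\<^bsub>?R\<^esub> g) h x = (gr_mult f h \<oplus>\<^bsub>?R\<^esub> gr_mult g h) x"
    proof (cases "x \<in> carrier G")
      case True
      have "support (f \<oplus>\<^bsub>?R\<^esub> g) \<subseteq> support f \<union> support g" by (auto simp: support_def ad)
      then show ?thesis using True f g
        by (simp add: ad gr_mult_eq[of "support f \<union> support g"] carr sum.distrib distrib_right)
    qed (simp add: integral_group_ring_def)
  qed
  show "gr_mult h (f \<oplus>\<^bsub>?R\<^esub> g) = gr_mult h f \<oplus>\<^bsub>?R\<^esub> gr_mult h g"
    by (simp add: integral_group_ring_def sum.distrib distrib_left fun_eq_iff)
qed


subsection \<open>Algebraic actions\<close>

locale compact_metrizable_abelian_group = comm_group X
  for X :: "('x, 'm) monoid_scheme" (structure) and T :: "'x topology" +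
  assumes topspace_eq: "topspace T = carrier X"
    and continuous_mult: "continuous_map (prod_topology T T) T (\<lambda>(x, y). x \<otimes>\<^bsub>X\<^esub> y)"
    and continuous_inv: "continuous_map T T (\<lambda>x. inv\<^bsub>X\<^esub> x)"
    and compact: "compact_space T"
    and metrizable: "metrizable_space T"

text \<open>The library locale \<open>group_action\<close> says that \<open>\<alpha>\<close> is a homomorphism from \<open>\<Gamma>\<close>
  into the bijections of the set \<open>carrier X\<close>; the inverse of \<open>\<alpha> g\<close> is
  \<open>\<alpha> (inv g)\<close>, so every \<open>\<alpha> g\<close> is a homeomorphic group automorphism.\<close>

locale algebraic_action =
  compact_metrizable_abelian_group X T + group_action \<Gamma> "carrier X" \<alpha>
  for \<Gamma> :: "('g, 'n) monoid_scheme" and X :: "('x, 'm) monoid_scheme"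
    and T :: "'x topology" and \<alpha> :: "'g \<Rightarrow> 'x \<Rightarrow> 'x" +
  assumes countable_acting_group: "countable (carrier \<Gamma>)"
    and action_hom: "g \<in> carrier \<Gamma> \<Longrightarrow> \<alpha> g \<in> hom X X"
    and action_continuous: "g \<in> carrier \<Gamma> \<Longrightarrow> continuous_map T T (\<alpha> g)"

definition periodic_points ::
    "('g, 'n) monoid_scheme \<Rightarrow> ('x, 'm) monoid_scheme \<Rightarrow> ('g \<Rightarrow> 'x \<Rightarrow> 'x) \<Rightarrow> 'x set" where
  "periodic_points \<Gamma> X \<alpha> = {x \<in> carrier X. finite (orbit \<Gamma> \<alpha> x)}"


subsection \<open>The dual module\<close>

definition circle_group :: "complex monoid" where
  "circle_group = \<lparr>carrier = sphere 0 1, mult = (*), one = 1\<rparr>"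

text \<open>Characters are represented by extensional functions, so that equality of characters is
  equality on \<open>carrier X\<close>. Since \<open>X\<close> is compact, its dual is discrete and carries no further
  topological data.\<close>

definition pontryagin_dual :: "('x, 'm) monoid_scheme \<Rightarrow> 'x topology \<Rightarrow> ('x \<Rightarrow> complex) monoid"
  where
  "pontryagin_dual X T =
     \<lparr>carrier = {\<xi> \<in> extensional (carrier X). \<xi> \<in> hom X circle_group \<and> continuous_map T euclidean \<xi>},
      mult = (\<lambda>\<xi> \<eta>. \<lambda>x\<in>carrier X. \<xi> x * \<eta> x),
      one = (\<lambda>x\<in>carrier X. 1)\<rparr>"

text \<open>The dual group, written multiplicatively in terms of complex values, as a module over the
  integral group ring. A group element \<open>g\<close> acts by
  \<open>(g \<odot> \<xi>) x = \<xi> (\<alpha> (inv g) x)\<close>, which is a left action; the scalar action of the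
  ring is its additive extension. The ring multiplication fields of the record are unused.\<close>

definition dual_module ::
    "('g, 'n) monoid_scheme \<Rightarrow> ('x, 'm) monoid_scheme \<Rightarrow> 'x topology \<Rightarrow> ('g \<Rightarrow> 'x \<Rightarrow> 'x)
     \<Rightarrow> ('g \<Rightarrow> int, 'x \<Rightarrow> complex) module" where
  "dual_module \<Gamma> X T \<alpha> =
     \<lparr>carrier = carrier (pontryagin_dual X T),
      mult = undefined,
      one = undefined,
      zero = \<one>\<^bsub>pontryagin_dual X T\<^esub>,
      add = (\<lambda>\<xi> \<eta>. \<xi> \<otimes>\<^bsub>pontryagin_dual X T\<^esub> \<eta>),
      smult = (\<lambda>f \<xi>. \<lambda>x\<in>carrier X. \<Prod>g \<in> support f. \<xi> (\<alpha> (inv\<^bsub>\<Gamma>\<^esub> g) x) powi f g)\<rparr>"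

lemma continuous_map_complex_mult:
  "continuous_map T euclidean f \<Longrightarrow> continuous_map T euclidean g
   \<Longrightarrow> continuous_map T euclidean (\<lambda>x. f x * g x :: complex)"
  by (auto simp: continuous_map_atin intro: tendsto_mult)

lemma continuous_map_complex_prod:
  "finite I \<Longrightarrow> (\<And>i. i \<in> I \<Longrightarrow> continuous_map T euclidean (f i))
   \<Longrightarrow> continuous_map T euclidean (\<lambda>x. \<Prod>i\<in>I. f i x :: complex)"
  by (induction I rule: finite_induct) (auto intro: continuous_map_complex_mult)

lemma (in algebraic_action) dual_left_module:
  "left_module (integral_group_ring \<Gamma>) (dual_module \<Gamma> X T \<alpha>)"
proof -
  let ?R = "integral_group_ring \<Gamma>" and ?M = "dual_module \<Gamma> X T \<alpha>"
  interpret G: group \<Gamma> using group_hom by (simp add: group_hom_def)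
  have carr: "f \<in> carrier ?R \<longleftrightarrow> finite (support f) \<and> support f \<subseteq> carrier \<Gamma>" for f
    by (simp add: integral_group_ring_def)
  have mcarr: "u \<in> carrier ?M \<longleftrightarrow> u \<in> extensional (carrier X) \<and> (\<forall>x\<in>carrier X. norm (u x) = 1)
     \<and> (\<forall>x\<in>carrier X. \<forall>y\<in>carrier X. u (x \<otimes>\<^bsub>X\<^esub> y) = u x * u y) \<and> continuous_map T euclidean u" for u
    by (auto simp: dual_module_def pontryagin_dual_def circle_group_def hom_def Pi_iff)
  have ac: "\<alpha> g x \<in> carrier X" if "g \<in> carrier \<Gamma>" "x \<in> carrier X" for g x
    using element_image that by blast
  have ah: "\<alpha> g (x \<otimes>\<^bsub>X\<^esub> y) = \<alpha> g x \<otimes>\<^bsub>X\<^esub> \<alpha> g y"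
    if "g \<in> carrier \<Gamma>" "x \<in> carrier X" "y \<in> carrier X" for g x y
    using action_hom that by (auto simp: hom_def)
  have am: "\<alpha> (g \<otimes>\<^bsub>\<Gamma>\<^esub> h) x = \<alpha> g (\<alpha> h x)" if "g \<in> carrier \<Gamma>" "h \<in> carrier \<Gamma>" "x \<in> carrier X" for g h x
    using composition_rule that by simp
  have add: "u \<oplus>\<^bsub>?M\<^esub> v = (\<lambda>x\<in>carrier X. u x * v x)" for u v
    by (simp add: dual_module_def pontryagin_dual_def)
  have sm: "f \<odot>\<^bsub>?M\<^esub> u = (\<lambda>x\<in>carrier X. \<Prod>g \<in> support f. u (\<alpha> (inv\<^bsub>\<Gamma>\<^esub> g) x) powi f g)" for f u
    by (simp add: dual_module_def)
  have restr: "continuous_map T euclidean (restrict k (carrier X))" if "continuous_map T euclidean k" for k :: "'x \<Rightarrow> complex"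
    using that by (rule continuous_map_eq) (simp add: topspace_eq)
  have zc: "\<zero>\<^bsub>?M\<^esub> = (\<lambda>x\<in>carrier X. 1)" by (simp add: dual_module_def pontryagin_dual_def)
  have nz: "u x \<noteq> 0" if "u \<in> carrier ?M" "x \<in> carrier X" for u x using that by (auto simp: mcarr)
  have addc: "u \<oplus>\<^bsub>?M\<^esub> v \<in> carrier ?M" if "u \<in> carrier ?M" "v \<in> carrier ?M" for u v
    using that by (simp add: mcarr add norm_mult restr continuous_map_complex_mult)
  show ?thesis
  proof (intro left_module.intro left_module_axioms.intro)
    show "ring ?R" by (rule G.ring_integral_group_ring)
    show "abelian_group ?M"
    proof (rule abelian_groupI)
      show "\<zero>\<^bsub>?M\<^esub> \<in> carrier ?M" by (simp add: mcarr zc restr)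
      fix u assume u: "u \<in> carrier ?M"
      show "\<zero>\<^bsub>?M\<^esub> \<oplus>\<^bsub>?M\<^esub> u = u" using u by (auto simp: mcarr zc add extensional_def)
      have "continuous_map T euclidean (\<lambda>x. cnj (u x))"
        using u continuous_map_compose[of T euclidean u euclidean cnj] by (simp add: mcarr o_def continuous_on_cnj)
      then have "(\<lambda>x\<in>carrier X. cnj (u x)) \<in> carrier ?M"
        using u by (simp add: mcarr restr)
      moreover have "(\<lambda>x\<in>carrier X. cnj (u x)) \<oplus>\<^bsub>?M\<^esub> u = \<zero>\<^bsub>?M\<^esub>"
        using u by (auto simp: mcarr zc add intro!: restrict_ext) (metis complex_norm_square mult.commute of_real_1 one_power2)
      ultimately show "\<exists>y\<in>carrier ?M. y \<oplus>\<^bsub>?M\<^esub> u = \<zero>\<^bsub>?M\<^esub>" by blast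
    next
      fix u v w assume "u \<in> carrier ?M" "v \<in> carrier ?M" "w \<in> carrier ?M"
      then show "u \<oplus>\<^bsub>?M\<^esub> v \<oplus>\<^bsub>?M\<^esub> w = u \<oplus>\<^bsub>?M\<^esub> (v \<oplus>\<^bsub>?M\<^esub> w)" by (auto simp: add intro!: restrict_ext)
    next
      fix u v assume "u \<in> carrier ?M" "v \<in> carrier ?M"
      then show "u \<oplus>\<^bsub>?M\<^esub> v = v \<oplus>\<^bsub>?M\<^esub> u" by (simp add: add mult.commute)
    qed (rule addc)
    show smc: "f \<odot>\<^bsub>?M\<^esub> u \<in> carrier ?M" if f: "f \<in> carrier ?R" and u: "u \<in> carrier ?M" for f u
    proof -
      have gc: "g \<in> carrier \<Gamma>" if "g \<in> support f" for g using f that by (auto simp: carr)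
      have c1: "continuous_map T euclidean (\<lambda>x. u (\<alpha> (inv\<^bsub>\<Gamma>\<^esub> g) x) powi f g)" if "g \<in> support f" for g
      proof -
        have "continuous_map T (top_of_set (sphere 0 1)) (\<lambda>x. u (\<alpha> (inv\<^bsub>\<Gamma>\<^esub> g) x))"
          using u gc[OF that] continuous_map_compose[OF action_continuous, of "inv\<^bsub>\<Gamma>\<^esub> g" euclidean u]
          by (auto simp: continuous_map_in_subtopology mcarr o_def topspace_eq ac)
        moreover have "continuous_map (top_of_set (sphere 0 1)) euclidean (\<lambda>z::complex. z powi f g)"
          by (auto intro!: continuous_intros)
        ultimately show ?thesis using continuous_map_compose[unfolded o_def] by blast
      qed
      have "continuous_map T euclidean (\<lambda>x. \<Prod>g \<in> support f. u (\<alpha> (inv\<^bsub>\<Gamma>\<^esub> g) x) powi f g)"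
        using f c1 by (intro continuous_map_complex_prod) (auto simp: carr)
      moreover have "norm (\<Prod>g \<in> support f. u (\<alpha> (inv\<^bsub>\<Gamma>\<^esub> g) x) powi f g) = 1" if "x \<in> carrier X" for x
        using u gc ac that by (auto simp: mcarr norm_power_int simp flip: prod_norm intro!: prod.neutral)
      moreover have "(f \<odot>\<^bsub>?M\<^esub> u) (x \<otimes>\<^bsub>X\<^esub> y) = (f \<odot>\<^bsub>?M\<^esub> u) x * (f \<odot>\<^bsub>?M\<^esub> u) y" if x: "x \<in> carrier X" "y \<in> carrier X" for x y
      proof -
        have "u (\<alpha> (inv\<^bsub>\<Gamma>\<^esub> g) (x \<otimes>\<^bsub>X\<^esub> y)) = u (\<alpha> (inv\<^bsub>\<Gamma>\<^esub> g) x) * u (\<alpha> (inv\<^bsub>\<Gamma>\<^esub> g) y)" if "g \<in> support f" for g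
          using u ac gc[OF that] x by (simp add: ah mcarr)
        then show ?thesis using x unfolding sm by (simp add: power_int_mult_distrib flip: prod.distrib)
      qed
      ultimately show ?thesis by (simp add: mcarr restr sm)
    qed
    show "(a \<oplus>\<^bsub>?R\<^esub> b) \<odot>\<^bsub>?M\<^esub> u = a \<odot>\<^bsub>?M\<^esub> u \<oplus>\<^bsub>?M\<^esub> b \<odot>\<^bsub>?M\<^esub> u"
      if a: "a \<in> carrier ?R" and b: "b \<in> carrier ?R" and u: "u \<in> carrier ?M" for a b u
    proof -
      have ad: "(a \<oplus>\<^bsub>?R\<^esub> b) x = a x + b x" for x by (simp add: integral_group_ring_def)
      define S where "S = support a \<union> support b"
      have S: "finite S" "S \<subseteq> carrier \<Gamma>" "support a \<subseteq> S" "support b \<subseteq> S" "support (a \<oplus>\<^bsub>?R\<^esub> b) \<subseteq> S"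
        using a b by (auto simp: S_def carr) (auto simp: support_def ad)
      show ?thesis
        unfolding sm add
      proof (rule restrict_ext)
        fix x assume x: "x \<in> carrier X"
        have "u (\<alpha> (inv\<^bsub>\<Gamma>\<^esub> z) x) \<noteq> 0" if "z \<in> S" for z using that S(2) x ac nz[OF u] by blast
        then show "(\<Prod>g\<in>support (a \<oplus>\<^bsub>?R\<^esub> b). u (\<alpha> (inv\<^bsub>\<Gamma>\<^esub> g) x) powi (a \<oplus>\<^bsub>?R\<^esub> b) g) =
          (\<lambda>x\<in>carrier X. \<Prod>g\<in>support a. u (\<alpha> (inv\<^bsub>\<Gamma>\<^esub> g) x) powi a g) x * (\<lambda>x\<in>carrier X. \<Prod>g\<in>support b. u (\<alpha> (inv\<^bsub>\<Gamma>\<^esub> g) x) powi b g) x"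
          unfolding prod_support[OF S(1,3)] prod_support[OF S(1,4)] prod_support[OF S(1,5)]
          using x by (simp add: ad power_int_add flip: prod.distrib)
      qed
    qed
    show "a \<odot>\<^bsub>?M\<^esub> (u \<oplus>\<^bsub>?M\<^esub> v) = a \<odot>\<^bsub>?M\<^esub> u \<oplus>\<^bsub>?M\<^esub> a \<odot>\<^bsub>?M\<^esub> v"
      if "a \<in> carrier ?R" "u \<in> carrier ?M" "v \<in> carrier ?M" for a u v
      unfolding sm add
    proof (rule restrict_ext)
      fix x assume x: "x \<in> carrier X"
      have "\<alpha> (inv\<^bsub>\<Gamma>\<^esub> g) x \<in> carrier X" if "g \<in> support a" for g
        using that \<open>a \<in> carrier ?R\<close> x ac by (auto simp: carr)
      then show "(\<Prod>g\<in>support a. (\<lambda>x\<in>carrier X. u x * v x) (\<alpha> (inv\<^bsub>\<Gamma>\<^esub> g) x) powi a g) =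
         (\<lambda>x\<in>carrier X. \<Prod>g\<in>support a. u (\<alpha> (inv\<^bsub>\<Gamma>\<^esub> g) x) powi a g) x *
         (\<lambda>x\<in>carrier X. \<Prod>g\<in>support a. v (\<alpha> (inv\<^bsub>\<Gamma>\<^esub> g) x) powi a g) x"
        using x by (simp add: power_int_mult_distrib flip: prod.distrib)
    qed
    show "\<one>\<^bsub>?R\<^esub> \<odot>\<^bsub>?M\<^esub> u = u" if "u \<in> carrier ?M" for u
    proof -
      have "support (\<one>\<^bsub>?R\<^esub>) = {\<one>\<^bsub>\<Gamma>\<^esub>}" by (auto simp: support_def integral_group_ring_def)
      moreover have "\<alpha> \<one>\<^bsub>\<Gamma>\<^esub> x = x" if "x \<in> carrier X" for x using that id_eq_one by (metis restrict_apply')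
      ultimately show ?thesis using that unfolding sm
        by (auto simp: integral_group_ring_def mcarr extensional_def fun_eq_iff)
    qed
    fix f g u assume f: "f \<in> carrier ?R" and g: "g \<in> carrier ?R" and u: "u \<in> carrier ?M"
    show "(f \<otimes>\<^bsub>?R\<^esub> g) \<odot>\<^bsub>?M\<^esub> u = f \<odot>\<^bsub>?M\<^esub> (g \<odot>\<^bsub>?M\<^esub> u)"
      unfolding sm
    proof (rule restrict_ext)
      fix x assume x: "x \<in> carrier X"
      define S where "S = (\<lambda>(y,w). y \<otimes>\<^bsub>\<Gamma>\<^esub> w) ` (support f \<times> support g)"
      have S: "finite S" "S \<subseteq> carrier \<Gamma>" "support (f \<otimes>\<^bsub>?R\<^esub> g) \<subseteq> S"
        using f g G.gr_mult_support[of f g] by (auto simp: S_def carr)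
      have pis: "(u a) powi (\<Sum>y\<in>A. k y) = (\<Prod>y\<in>A. u a powi k y)" if "finite A" "a \<in> carrier X" for a A and k :: "'a \<Rightarrow> int"
        using that(1) by (induction A) (auto simp: power_int_add nz[OF u that(2)])
      have pip: "(\<Prod>y\<in>A. k y) powi n = (\<Prod>y\<in>A. k y powi n)" if "finite A" for A and k :: "'a \<Rightarrow> complex" and n
        using that by (induction A) (auto simp: power_int_mult_distrib)
      have "(\<Prod>z\<in>support (f \<otimes>\<^bsub>?R\<^esub> g). u (\<alpha> (inv\<^bsub>\<Gamma>\<^esub> z) x) powi (f \<otimes>\<^bsub>?R\<^esub> g) z)
          = (\<Prod>z\<in>S. u (\<alpha> (inv\<^bsub>\<Gamma>\<^esub> z) x) powi (f \<otimes>\<^bsub>?R\<^esub> g) z)"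
        by (rule prod_support[OF S(1,3)])
      also have "\<dots> = (\<Prod>z\<in>S. \<Prod>y\<in>support f. (u (\<alpha> (inv\<^bsub>\<Gamma>\<^esub> z) x) powi g (inv\<^bsub>\<Gamma>\<^esub> y \<otimes>\<^bsub>\<Gamma>\<^esub> z)) powi f y)"
      proof (intro prod.cong refl)
        fix z assume "z \<in> S"
        then have z: "z \<in> carrier \<Gamma>" using S by auto
        then have zx: "\<alpha> (inv\<^bsub>\<Gamma>\<^esub> z) x \<in> carrier X" using ac x by simp
        have "(f \<otimes>\<^bsub>?R\<^esub> g) z = (\<Sum>y\<in>support f. g (inv\<^bsub>\<Gamma>\<^esub> y \<otimes>\<^bsub>\<Gamma>\<^esub> z) * f y)"
          using f z by (subst G.gr_mult_eq[of "support f" f]) (auto simp: carr mult.commute)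
        then show "u (\<alpha> (inv\<^bsub>\<Gamma>\<^esub> z) x) powi (f \<otimes>\<^bsub>?R\<^esub> g) z =
          (\<Prod>y\<in>support f. (u (\<alpha> (inv\<^bsub>\<Gamma>\<^esub> z) x) powi g (inv\<^bsub>\<Gamma>\<^esub> y \<otimes>\<^bsub>\<Gamma>\<^esub> z)) powi f y)"
          using f zx by (simp add: pis carr power_int_mult)
      qed
      also have "\<dots> = (\<Prod>y\<in>support f. (\<Prod>z\<in>S. u (\<alpha> (inv\<^bsub>\<Gamma>\<^esub> z) x) powi g (inv\<^bsub>\<Gamma>\<^esub> y \<otimes>\<^bsub>\<Gamma>\<^esub> z)) powi f y)"
        by (subst prod.swap) (simp add: pip S)
      also have "\<dots> = (\<Prod>y\<in>support f. (\<lambda>x\<in>carrier X. \<Prod>w\<in>support g. u (\<alpha> (inv\<^bsub>\<Gamma>\<^esub> w) x) powi g w) (\<alpha> (inv\<^bsub>\<Gamma>\<^esub> y) x) powi f y)"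
      proof (intro prod.cong refl arg_cong2[of _ _ _ _ "(powi)"])
        fix y assume y: "y \<in> support f"
        then have yc: "y \<in> carrier \<Gamma>" using f by (auto simp: carr)
        have "(\<Prod>z\<in>S. u (\<alpha> (inv\<^bsub>\<Gamma>\<^esub> z) x) powi g (inv\<^bsub>\<Gamma>\<^esub> y \<otimes>\<^bsub>\<Gamma>\<^esub> z))
           = (\<Prod>w\<in>support g. u (\<alpha> (inv\<^bsub>\<Gamma>\<^esub> (y \<otimes>\<^bsub>\<Gamma>\<^esub> w)) x) powi g w)"
          using y yc g S by (intro G.prod_translate) (auto simp: carr S_def)
        also have "\<dots> = (\<Prod>w\<in>support g. u (\<alpha> (inv\<^bsub>\<Gamma>\<^esub> w) (\<alpha> (inv\<^bsub>\<Gamma>\<^esub> y) x)) powi g w)"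
          using yc g x by (intro prod.cong refl) (auto simp: carr G.inv_mult_group am subset_iff)
        finally show "(\<Prod>z\<in>S. u (\<alpha> (inv\<^bsub>\<Gamma>\<^esub> z) x) powi g (inv\<^bsub>\<Gamma>\<^esub> y \<otimes>\<^bsub>\<Gamma>\<^esub> z))
          = (\<lambda>x\<in>carrier X. \<Prod>w\<in>support g. u (\<alpha> (inv\<^bsub>\<Gamma>\<^esub> w) x) powi g w) (\<alpha> (inv\<^bsub>\<Gamma>\<^esub> y) x)"
          using yc x ac by simp
      qed
      finally show "(\<Prod>z\<in>support (f \<otimes>\<^bsub>?R\<^esub> g). u (\<alpha> (inv\<^bsub>\<Gamma>\<^esub> z) x) powi (f \<otimes>\<^bsub>?R\<^esub> g) z)
        = (\<Prod>y\<in>support f. (\<lambda>x\<in>carrier X. \<Prod>w\<in>support g. u (\<alpha> (inv\<^bsub>\<Gamma>\<^esub> w) x) powi g w) (\<alpha> (inv\<^bsub>\<Gamma>\<^esub> y) x) powi f y)" .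
    qed
  qed
qed

definition noetherian_action ::
    "('g, 'n) monoid_scheme \<Rightarrow> ('x, 'm) monoid_scheme \<Rightarrow> 'x topology \<Rightarrow> ('g \<Rightarrow> 'x \<Rightarrow> 'x) \<Rightarrow> bool"
  where
  "noetherian_action \<Gamma> X T \<alpha> \<longleftrightarrow>
     algebraic_action \<Gamma> X T \<alpha> \<and>
     noetherian_left_module (integral_group_ring \<Gamma>) (dual_module \<Gamma> X T \<alpha>)"

end

theory Submission
  imports Defs "HOL-Computational_Algebra.Computational_Algebra" "HOL-Complex_Analysis.Great_Picard"
    "HOL-Library.Function_Algebras"
begin

text \<open>By Pontryagin duality, if the periodic points were not dense, some nontrivial character of \<open>X\<close>
  would be trivial on all of them. The dual of \<open>X\<close> is finitely generated over the integral group ring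
  of a finitely generated nilpotent subgroup of finite index, and by a theorem of P. Hall such a
  module is residually finite. So that character survives in a finite quotient module, and a
  character of this quotient that is nontrivial at it is evaluation at a point of \<open>X\<close> with finite
  orbit, a contradiction.

  Noetherianity is Hall's form of the basis theorem, by induction along a central chain of the
  nilpotent group. Residual finiteness reduces to modules with a unique minimal submodule
  (the monolith), which are finite. On the analytic side Haar integration is replaced by the mean
  value obtained from finite averages of translates; characters arise as extreme positive definite
  eigenfunctions of convolution operators.\<close>

subsection \<open>Group representations and Noetherian chains\<close>

text \<open>Finiteness of a monolithic module rests on excluding divisibility. If a scalar a does
  not kill \<open>w\<close> modulo \<open>B\<close>, then every submodule U containing
  \<open>w\<close> has \<open>w\<close> in \<open>B + a U\<close>, because this contains
  \<open>a w\<close>. With scalars in Z this bounds the additive order of \<open>w\<close>; with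
  polynomials over F_p in a central element it bounds the order of that element on \<open>w\<close>.
  The obstacle is that U is much larger than the cyclic module L of \<open>w\<close>, so the
  quotient of \<open>w\<close> by a may lie far from L. The basis theorem is therefore carried along
  with a torsion bound: one scalar s such that no admissible scalar 1 + u s kills anything of U
  modulo L. Taking a of this form pulls the division back into L, where a would have to be a unit.

  Quotient modules are never formed: a pair of subgroups \<open>B\<close> and \<open>W\<close>
  stands for \<open>W / B\<close>, and operators have to commute with the group modulo
  \<open>B\<close> only.

  To separate a point x0 from a subgroup, the convolution kernel is chosen so that its Fourier
  coefficient at a character \<xi> has the factor 2 - \<xi>(x0) - 1/\<xi>(x0); whichever character
  the spectral argument finds is then nontrivial at x0.\<close>

definition add_subgroup :: "'a::ab_group_add set \<Rightarrow> bool" where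
  "add_subgroup N \<longleftrightarrow> 0 \<in> N \<and> (\<forall>x\<in>N. \<forall>y\<in>N. x - y \<in> N)"

lemma add_subgroup_zero: "add_subgroup N \<Longrightarrow> 0 \<in> N"
  and add_subgroup_diff: "add_subgroup N \<Longrightarrow> x \<in> N \<Longrightarrow> y \<in> N \<Longrightarrow> x - y \<in> N"
  by (auto simp: add_subgroup_def)

lemma add_subgroup_minus: "add_subgroup N \<Longrightarrow> x \<in> N \<Longrightarrow> - x \<in> N"
  using add_subgroup_diff[of N 0 x] add_subgroup_zero by auto

lemma add_subgroup_add: "add_subgroup N \<Longrightarrow> x \<in> N \<Longrightarrow> y \<in> N \<Longrightarrow> x + y \<in> N"
  using add_subgroup_diff[of N x "- y"] add_subgroup_minus by auto

lemma add_subgroup_cancel: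
  assumes "add_subgroup N" "y \<in> N"
  shows "x + y \<in> N \<longleftrightarrow> x \<in> N" "y + x \<in> N \<longleftrightarrow> x \<in> N" "x - y \<in> N \<longleftrightarrow> x \<in> N" "y - x \<in> N \<longleftrightarrow> x \<in> N"
proof -
  show 1: "x + y \<in> N \<longleftrightarrow> x \<in> N" "x - y \<in> N \<longleftrightarrow> x \<in> N"
    using add_subgroup_add[OF assms(1) _ assms(2), of x] add_subgroup_diff[OF assms(1) _ assms(2), of "x + y"]
      add_subgroup_diff[OF assms(1) _ assms(2), of x] add_subgroup_add[OF assms(1) _ assms(2), of "x - y"]
    unfolding add_diff_cancel_right' diff_add_cancel by metis+
  show "y + x \<in> N \<longleftrightarrow> x \<in> N" using 1 by (simp add: add.commute)
  show "y - x \<in> N \<longleftrightarrow> x \<in> N"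
    using add_subgroup_minus[OF assms(1), of "x - y"] add_subgroup_minus[OF assms(1), of "y - x"] 1 by auto
qed

lemma add_subgroup_congruent:
  assumes "add_subgroup N" "x - y \<in> N"
  shows "x \<in> N \<longleftrightarrow> y \<in> N"
  using add_subgroup_cancel(1)[OF assms, of y] by simp

lemma add_subgroup_UN:
  assumes "\<And>n::nat. add_subgroup (A n)" "\<And>n. A n \<subseteq> A (Suc n)"
  shows "add_subgroup (\<Union>n. A n)"
  unfolding add_subgroup_def
proof (intro conjI ballI)
  show "0 \<in> (\<Union>n. A n)" using assms(1) by (auto simp: add_subgroup_def)
  fix x y assume "x \<in> (\<Union>n. A n)" "y \<in> (\<Union>n. A n)"
  then obtain m n where "x \<in> A m" "y \<in> A n" by auto
  moreover have "A m \<subseteq> A (max m n)" "A n \<subseteq> A (max m n)"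
    using lift_Suc_mono_le[of A] assms(2) by auto
  ultimately show "x - y \<in> (\<Union>n. A n)" using assms(1)[of "max m n"] add_subgroup_diff by blast
qed

locale group_rep = group G for G :: "('g, 'm) monoid_scheme" (structure) +
  fixes \<rho> :: "'g \<Rightarrow> 'a::ab_group_add \<Rightarrow> 'a"
  assumes rep_add: "g \<in> carrier G \<Longrightarrow> \<rho> g (x + y) = \<rho> g x + \<rho> g y"
    and rep_mult: "g \<in> carrier G \<Longrightarrow> h \<in> carrier G \<Longrightarrow> \<rho> (g \<otimes> h) x = \<rho> g (\<rho> h x)"
    and rep_one: "\<rho> \<one> x = x"
begin

lemma rep_zero: "g \<in> carrier G \<Longrightarrow> \<rho> g 0 = 0"
  using rep_add[of g 0 0] by simp

lemma rep_minus: "g \<in> carrier G \<Longrightarrow> \<rho> g (- x) = - \<rho> g x"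
  using rep_add[of g x "- x"] by (simp add: rep_zero eq_neg_iff_add_eq_0 add.commute)

lemma rep_diff: "g \<in> carrier G \<Longrightarrow> \<rho> g (x - y) = \<rho> g x - \<rho> g y"
  using rep_add[of g x "- y"] by (simp add: rep_minus)

lemma rep_inv: "g \<in> carrier G \<Longrightarrow> \<rho> (inv g) (\<rho> g x) = x" "g \<in> carrier G \<Longrightarrow> \<rho> g (\<rho> (inv g) x) = x"
  by (simp_all flip: rep_mult add: rep_one)

definition invariant_subgroup :: "'g set \<Rightarrow> 'a set \<Rightarrow> bool" where
  "invariant_subgroup K N \<longleftrightarrow> add_subgroup N \<and> (\<forall>k\<in>K. \<forall>x\<in>N. \<rho> k x \<in> N)"

lemma invariant_add_subgroup: "invariant_subgroup K N \<Longrightarrow> add_subgroup N"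
  and invariant_rep: "invariant_subgroup K N \<Longrightarrow> k \<in> K \<Longrightarrow> x \<in> N \<Longrightarrow> \<rho> k x \<in> N"
  by (auto simp: invariant_subgroup_def)

lemma invariant_mono: "invariant_subgroup K N \<Longrightarrow> K' \<subseteq> K \<Longrightarrow> invariant_subgroup K' N"
  by (auto simp: invariant_subgroup_def)

lemma invariant_Int:
  "invariant_subgroup K A \<Longrightarrow> invariant_subgroup K B \<Longrightarrow> invariant_subgroup K (A \<inter> B)"
  by (auto simp: invariant_subgroup_def add_subgroup_def)

text \<open>Inverses are treated in a separate hypothesis because \<open>\<rho> k\<close> may map an
  invariant subgroup properly into itself.\<close>

lemma invariant_generate:
  assumes "K \<subseteq> carrier G" "invariant_subgroup K N" "\<And>k x. k \<in> K \<Longrightarrow> x \<in> N \<Longrightarrow> \<rho> (inv k) x \<in> N"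
  shows "invariant_subgroup (generate G K) N"
  unfolding invariant_subgroup_def
proof (intro conjI ballI)
  show "add_subgroup N" using assms by (auto simp: invariant_subgroup_def)
  fix k x assume "k \<in> generate G K" "x \<in> N"
  then show "\<rho> k x \<in> N"
  proof (induction arbitrary: x)
    case (eng h1 h2)
    then have "h1 \<in> carrier G" "h2 \<in> carrier G" using generate_in_carrier[OF assms(1)] by auto
    then show ?case using eng by (simp add: rep_mult)
  qed (use assms rep_one in \<open>auto simp: invariant_subgroup_def\<close>)
qed

text \<open>The module \<open>A\<close> modulo \<open>B\<close> is Noetherian over \<open>K\<close>,
  expressed through the interval of invariant subgroups between them.\<close>

definition noetherian_between :: "'g set \<Rightarrow> 'a set \<Rightarrow> 'a set \<Rightarrow> bool" where
  "noetherian_between K B A \<longleftrightarrow>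
     (\<forall>N::nat \<Rightarrow> 'a set. (\<forall>n. invariant_subgroup K (N n) \<and> B \<subseteq> N n \<and> N n \<subseteq> A) \<and> (\<forall>n. N n \<subseteq> N (Suc n))
        \<longrightarrow> (\<exists>n. \<forall>m\<ge>n. N m = N n))"

lemma noetherian_between_stable:
  assumes "noetherian_between K B A" "\<And>n::nat. invariant_subgroup K (N n)" "\<And>n. B \<subseteq> N n"
    "\<And>n. N n \<subseteq> A" "\<And>n. N n \<subseteq> N (Suc n)"
  shows "\<exists>n. \<forall>m\<ge>n. N m = N n"
  using assms unfolding noetherian_between_def by blast

lemma noetherian_between_mono:
  assumes "noetherian_between K B A" "K \<subseteq> K'" "B \<subseteq> B'" "A' \<subseteq> A"
  shows "noetherian_between K' B' A'"
  unfolding noetherian_between_def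
proof (intro allI impI)
  fix N :: "nat \<Rightarrow> 'a set"
  assume N: "(\<forall>n. invariant_subgroup K' (N n) \<and> B' \<subseteq> N n \<and> N n \<subseteq> A') \<and> (\<forall>n. N n \<subseteq> N (Suc n))"
  show "\<exists>n. \<forall>m\<ge>n. N m = N n"
  proof (rule noetherian_between_stable[OF assms(1)])
    show "invariant_subgroup K (N n)" for n using N invariant_mono[OF _ assms(2)] by blast
    show "B \<subseteq> N n" "N n \<subseteq> A" "N n \<subseteq> N (Suc n)" for n using N assms(3,4) by (meson order_trans)+
  qed
qed

lemma noetherian_between_maximal:
  assumes "noetherian_between K B A" "\<F> \<noteq> {}"
    "\<And>N. N \<in> \<F> \<Longrightarrow> invariant_subgroup K N \<and> B \<subseteq> N \<and> N \<subseteq> A"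
  obtains N where "N \<in> \<F>" "\<And>N'. N' \<in> \<F> \<Longrightarrow> N \<subseteq> N' \<Longrightarrow> N' = N"
proof -
  have False if H: "\<forall>N\<in>\<F>. \<exists>N'\<in>\<F>. N \<subset> N'"
  proof -
    from H obtain nx where nx: "\<And>N. N \<in> \<F> \<Longrightarrow> nx N \<in> \<F> \<and> N \<subset> nx N" by metis
    obtain N0 where N0: "N0 \<in> \<F>" using assms(2) by blast
    define f where "f n = (nx ^^ n) N0" for n
    have f1: "f n \<in> \<F>" for n by (induction n) (use N0 nx in \<open>auto simp: f_def\<close>)
    then have f: "f n \<in> \<F>" "f n \<subset> f (Suc n)" for n using nx[of "f n"] by (auto simp: f_def)
    have "\<exists>n. \<forall>m\<ge>n. f m = f n"
    proof (rule noetherian_between_stable[OF assms(1)])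
      show "invariant_subgroup K (f n)" "B \<subseteq> f n" "f n \<subseteq> A" "f n \<subseteq> f (Suc n)" for n
        using assms(3)[OF f(1)[of n]] f(2)[of n] by blast+
    qed
    then obtain n where n: "\<And>m. m \<ge> n \<Longrightarrow> f m = f n" by blast
    have "f (Suc n) = f n" by (rule n) simp
    with f(2)[of n] show False by blast
  qed
  then show ?thesis using that by blast
qed

text \<open>The sum \<open>A + \<rho> t L + ... + \<rho> (t^j) L\<close>, that is, the elements of
  degree at most \<open>j\<close> in \<open>t\<close>. Exponents start at 1 because in the
  applications \<open>A\<close> already contains \<open>L\<close>, the part of degree 0.\<close>

primrec tower :: "'g \<Rightarrow> 'a set \<Rightarrow> 'a set \<Rightarrow> nat \<Rightarrow> 'a set" where
  "tower t L A 0 = A"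
| "tower t L A (Suc j) = {x + \<rho> (t [^] Suc j) l | x l. x \<in> tower t L A j \<and> l \<in> L}"

text \<open>The subgroups \<open>{l \<in> L. sc s l \<in> D}\<close> for \<open>s \<in> S\<close>
  are directed, since \<open>r\<close> and \<open>s\<close> both divide \<open>r * s\<close>. A
  maximal one therefore contains all the others.\<close>

lemma torsion_bounded:
  fixes sc :: "'r::comm_ring_1 \<Rightarrow> 'a \<Rightarrow> 'a"
  assumes noeth: "noetherian_between K B L" and L: "invariant_subgroup K L"
    and D: "invariant_subgroup K D" "B \<subseteq> D"
    and sc: "Modules.module sc" and S: "1 \<in> S" "\<And>r s. r \<in> S \<Longrightarrow> s \<in> S \<Longrightarrow> r * s \<in> S"
    and sc_closed: "\<And>N r x. invariant_subgroup K N \<Longrightarrow> x \<in> N \<Longrightarrow> sc r x \<in> N"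
    and comm: "\<And>r k l. k \<in> K \<Longrightarrow> l \<in> L \<Longrightarrow> sc r (\<rho> k l) - \<rho> k (sc r l) \<in> B"
    and B: "B \<subseteq> L" "add_subgroup B"
  obtains s where "s \<in> S" "\<And>l r. l \<in> L \<Longrightarrow> r \<in> S \<Longrightarrow> sc r l \<in> D \<Longrightarrow> sc s l \<in> D"
proof -
  interpret sc: Modules.module sc by (rule sc)
  define T where "T s = {l \<in> L. sc s l \<in> D}" for s
  note asL = invariant_add_subgroup[OF L] and asD = invariant_add_subgroup[OF D(1)]
  have T: "invariant_subgroup K (T s) \<and> B \<subseteq> T s \<and> T s \<subseteq> L" for s
  proof (intro conjI)
    show "T s \<subseteq> L" by (auto simp: T_def)
    show "B \<subseteq> T s" using sc_closed[OF D(1)] D(2) B by (auto simp: T_def)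
    show "invariant_subgroup K (T s)"
      unfolding invariant_subgroup_def add_subgroup_def
    proof (intro conjI ballI)
      show "0 \<in> T s" using add_subgroup_zero[OF asL] add_subgroup_zero[OF asD] by (simp add: T_def)
      fix x assume x: "x \<in> T s"
      show "x - y \<in> T s" if "y \<in> T s" for y
        using x that add_subgroup_diff[OF asL] add_subgroup_diff[OF asD] by (simp add: T_def sc.scale_right_diff_distrib)
      fix k assume k: "k \<in> K"
      have "\<rho> k (sc s x) \<in> D" using x invariant_rep[OF D(1) k] by (simp add: T_def)
      moreover have "sc s (\<rho> k x) - \<rho> k (sc s x) \<in> D" using comm[OF k, of x s] x D(2) by (auto simp: T_def)
      ultimately show "\<rho> k x \<in> T s"
        using add_subgroup_congruent[OF asD] invariant_rep[OF L k] x by (auto simp: T_def)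
    qed
  qed
  obtain N where N: "N \<in> T ` S" "\<And>N'. N' \<in> T ` S \<Longrightarrow> N \<subseteq> N' \<Longrightarrow> N' = N"
    by (rule noetherian_between_maximal[OF noeth, of "T ` S"]) (use S(1) T in blast)+
  then obtain s where s: "s \<in> S" "N = T s" by auto
  have "sc s l \<in> D" if l: "l \<in> L" "r \<in> S" "sc r l \<in> D" for l r
  proof -
    have "T s \<subseteq> T (r * s)" using sc_closed[OF D(1)] by (auto simp: T_def simp flip: sc.scale_scale)
    then have "T (r * s) = T s" using N(2)[of "T (r * s)"] s S(2)[OF l(2) s(1)] by auto
    moreover have "l \<in> T (r * s)"
      using l sc_closed[OF D(1), of "sc r l" s] by (simp add: T_def mult.commute[of r])
    ultimately show ?thesis by (auto simp: T_def)
  qed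
  then show ?thesis using that s(1) by blast
qed

end

section \<open>Adjoining one normalizing element: Hilbert's basis argument for towers\<close>

locale rep_tower = group_rep G \<rho> for G :: "('g, 'm) monoid_scheme" (structure) and \<rho> :: "'g \<Rightarrow> 'a::ab_group_add \<Rightarrow> 'a" +
  fixes K :: "'g set" and t :: 'g and L A B :: "'a set"
  assumes K_carrier: "K \<subseteq> carrier G" and t_carrier: "t \<in> carrier G"
    and t_normalizes: "k \<in> K \<Longrightarrow> inv t \<otimes> k \<otimes> t \<in> K" "k \<in> K \<Longrightarrow> t \<otimes> k \<otimes> inv t \<in> K"
    and inv_L: "invariant_subgroup K L" and inv_A: "invariant_subgroup K A"
    and rep_t_A: "x \<in> A \<Longrightarrow> \<exists>y\<in>A. \<exists>l\<in>L. \<rho> t x = y + \<rho> t l"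
    and inv_B: "invariant_subgroup K B" and rep_t_B: "x \<in> B \<Longrightarrow> \<rho> t x \<in> B"
    and B_L: "B \<subseteq> L" and B_A: "B \<subseteq> A"
begin

abbreviation "tow \<equiv> tower t L A"

text \<open>The shift by one makes \<open>\<tau> j\<close> the leading monomial in the step from
  \<open>tow j\<close> to \<open>tow (Suc j)\<close>.\<close>

definition \<tau> :: "nat \<Rightarrow> 'g" where "\<tau> j = t [^] Suc j"

declare tower.simps(2) [simp del]

lemma tow_Suc_eq [simp]: "tow (Suc j) = {x + \<rho> (\<tau> j) l | x l. x \<in> tow j \<and> l \<in> L}"
  by (simp add: tower.simps(2) \<tau>_def)

lemma tau_0: "\<tau> 0 = t"
  and tau_carrier: "\<tau> j \<in> carrier G"
  and tau_Suc_right: "\<tau> (Suc j) = \<tau> j \<otimes> t"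
  and tau_Suc_left: "\<tau> (Suc j) = t \<otimes> \<tau> j"
  using t_carrier nat_pow_Suc2[of t "Suc j"] by (simp_all add: \<tau>_def)

lemma tau_Suc: "\<rho> (\<tau> (Suc j)) x = \<rho> t (\<rho> (\<tau> j) x)"
  using t_carrier tau_carrier by (simp add: rep_mult tau_Suc_left)

lemma tau_normalizes: "k \<in> K \<Longrightarrow> inv (\<tau> j) \<otimes> k \<otimes> \<tau> j \<in> K"
proof (induction j)
  case 0 then show ?case using t_normalizes(1)[OF 0] t_carrier by (simp add: tau_0)
next
  case (Suc j)
  have "inv (\<tau> (Suc j)) \<otimes> k \<otimes> \<tau> (Suc j) = inv t \<otimes> (inv (\<tau> j) \<otimes> k \<otimes> \<tau> j) \<otimes> t"
  proof -
    have "k \<in> carrier G" using Suc K_carrier by auto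
    then show ?thesis using t_carrier tau_carrier[of j] by (simp add: tau_Suc_right inv_mult_group m_assoc)
  qed
  then show ?case using t_normalizes(1)[OF Suc.IH[OF Suc.prems]] by metis
qed

lemma tau_normalizes': "k \<in> K \<Longrightarrow> \<tau> j \<otimes> k \<otimes> inv (\<tau> j) \<in> K"
proof (induction j)
  case 0 then show ?case using t_normalizes(2)[OF 0] t_carrier by (simp add: tau_0)
next
  case (Suc j)
  have "\<tau> (Suc j) \<otimes> k \<otimes> inv (\<tau> (Suc j)) = t \<otimes> (\<tau> j \<otimes> k \<otimes> inv (\<tau> j)) \<otimes> inv t"
  proof -
    have "k \<in> carrier G" using Suc K_carrier by auto
    then show ?thesis using t_carrier tau_carrier[of j] by (simp add: tau_Suc_left inv_mult_group m_assoc)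
  qed
  then show ?case using t_normalizes(2)[OF Suc.IH[OF Suc.prems]] by metis
qed

lemma rep_tau': "k \<in> K \<Longrightarrow> \<rho> (\<tau> j) (\<rho> k l) = \<rho> (\<tau> j \<otimes> k \<otimes> inv (\<tau> j)) (\<rho> (\<tau> j) l)"
proof -
  assume "k \<in> K"
  then have k: "k \<in> carrier G" using K_carrier by auto
  have "\<tau> j \<otimes> k = (\<tau> j \<otimes> k \<otimes> inv (\<tau> j)) \<otimes> \<tau> j"
    using k tau_carrier[of j] by (simp add: m_assoc)
  then have "\<rho> (\<tau> j \<otimes> k) l = \<rho> ((\<tau> j \<otimes> k \<otimes> inv (\<tau> j)) \<otimes> \<tau> j) l" by (rule arg_cong)
  then show ?thesis using k tau_carrier[of j] by (simp only: rep_mult m_closed inv_closed)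
qed

lemma rep_tau: "k \<in> K \<Longrightarrow> \<rho> k (\<rho> (\<tau> j) l) = \<rho> (\<tau> j) (\<rho> (inv (\<tau> j) \<otimes> k \<otimes> \<tau> j) l)"
proof -
  assume "k \<in> K"
  then have k: "k \<in> carrier G" using K_carrier by auto
  have "k \<otimes> \<tau> j = \<tau> j \<otimes> (inv (\<tau> j) \<otimes> k \<otimes> \<tau> j)"
    using k tau_carrier[of j] by (simp add: m_assoc[symmetric])
  then have "\<rho> (k \<otimes> \<tau> j) l = \<rho> (\<tau> j \<otimes> (inv (\<tau> j) \<otimes> k \<otimes> \<tau> j)) l" by (rule arg_cong)
  then show ?thesis using k tau_carrier[of j] by (simp only: rep_mult m_closed inv_closed)
qed

lemma tow_invariant: "invariant_subgroup K (tow j)"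
proof (induction j)
  case 0 then show ?case using inv_A by simp
next
  case (Suc j)
  note asj = invariant_add_subgroup[OF Suc] and asL = invariant_add_subgroup[OF inv_L]
  show ?case
    unfolding invariant_subgroup_def add_subgroup_def
  proof (intro conjI ballI)
    show "0 \<in> tow (Suc j)"
      using add_subgroup_zero[OF asj] add_subgroup_zero[OF asL] rep_zero[OF tau_carrier] by force
    fix x assume "x \<in> tow (Suc j)"
    then obtain y l where x: "x = y + \<rho> (\<tau> j) l" "y \<in> tow j" "l \<in> L" by auto
    show "x - x' \<in> tow (Suc j)" if x'_in: "x' \<in> tow (Suc j)" for x'
    proof -
      obtain y' l' where x': "x' = y' + \<rho> (\<tau> j) l'" "y' \<in> tow j" "l' \<in> L" using x'_in by auto
      have "x - x' = (y - y') + \<rho> (\<tau> j) (l - l')" using x x' rep_diff[OF tau_carrier] by simp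
      moreover have "y - y' \<in> tow j" "l - l' \<in> L" using x x' add_subgroup_diff[OF asj] add_subgroup_diff[OF asL] by auto
      ultimately show ?thesis by auto
    qed
    fix k assume k: "k \<in> K"
    then have "\<rho> k x = \<rho> k y + \<rho> (\<tau> j) (\<rho> (inv (\<tau> j) \<otimes> k \<otimes> \<tau> j) l)"
      using K_carrier x(1) rep_tau[OF k] by (auto simp: rep_add)
    moreover have "\<rho> k y \<in> tow j" using invariant_rep[OF Suc k] x by auto
    moreover have "\<rho> (inv (\<tau> j) \<otimes> k \<otimes> \<tau> j) l \<in> L" using tau_normalizes[OF k] x invariant_rep[OF inv_L] by auto
    ultimately show "\<rho> k x \<in> tow (Suc j)" by auto
  qed
qed

lemmas tow_add_subgroup = invariant_add_subgroup[OF tow_invariant]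

lemma tow_Suc: "tow j \<subseteq> tow (Suc j)"
proof
  fix x assume "x \<in> tow j"
  then have "x = x + \<rho> (\<tau> j) 0 \<and> x \<in> tow j \<and> 0 \<in> L"
    using rep_zero[OF tau_carrier, of j] add_subgroup_zero[OF invariant_add_subgroup[OF inv_L]] by simp
  then show "x \<in> tow (Suc j)" by (simp only: tow_Suc_eq mem_Collect_eq) blast
qed

lemma tow_A: "A \<subseteq> tow j"
proof (induction j)
  case (Suc j) then show ?case using tow_Suc by blast
qed simp

lemma tow_tau: "l \<in> L \<Longrightarrow> \<rho> (\<tau> j) l \<in> tow (Suc j)"
  using add_subgroup_zero[OF tow_add_subgroup[of j]] by (simp only: tow_Suc_eq mem_Collect_eq) force

text \<open>The base case is the assumption \<open>rep_t_A\<close>. It allows a summand in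
  \<open>A\<close> in view of the second of two successive towers, where the new element maps the
  union of the first tower into itself plus a translate of \<open>L\<close> only.\<close>

lemma rep_t_tow: "x \<in> tow j \<Longrightarrow> \<rho> t x \<in> tow (Suc j)"
proof (induction j arbitrary: x)
  case 0 then show ?case using rep_t_A by (fastforce simp: tau_0)
next
  case (Suc j)
  then obtain y l where x: "x = y + \<rho> (\<tau> j) l" "y \<in> tow j" "l \<in> L" by auto
  then have "\<rho> t x = \<rho> t y + \<rho> (\<tau> (Suc j)) l" using t_carrier by (simp only: tau_Suc rep_add)
  moreover have "\<rho> t y \<in> tow (Suc j)" using Suc x by auto
  ultimately show ?case using x(3) by (simp only: tow_Suc_eq[of "Suc j"] mem_Collect_eq) blast
qed

lemma UN_tow_invariant: "invariant_subgroup (insert t K) (\<Union>j. tow j)"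
proof -
  have "add_subgroup (\<Union>j. tow j)" by (intro add_subgroup_UN tow_add_subgroup tow_Suc)
  moreover have "\<rho> t x \<in> (\<Union>j. tow j)" if "x \<in> tow j" for x j using rep_t_tow[OF that] by blast
  moreover have "\<rho> k x \<in> (\<Union>j. tow j)" if "x \<in> tow j" "k \<in> K" for x j k
    using invariant_rep[OF tow_invariant] that by blast
  ultimately show ?thesis by (auto simp: invariant_subgroup_def)
qed

text \<open>Applying \<open>inv t\<close> lowers the exponent of \<open>\<rho> (\<tau> j) l\<close>
  by one; for \<open>j = 0\<close> it returns \<open>l\<close> itself, which lies in
  \<open>A\<close>.\<close>

lemma UN_tow_inv:
  assumes "L \<subseteq> A" "\<And>x. x \<in> A \<Longrightarrow> \<rho> (inv t) x \<in> A" "x \<in> (\<Union>j. tow j)"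
  shows "\<rho> (inv t) x \<in> (\<Union>j. tow j)"
proof -
  have "\<rho> (inv t) x \<in> (\<Union>j. tow j)" if "x \<in> tow j" for x j
    using that
  proof (induction j arbitrary: x)
    case 0 then show ?case using assms(2) by (metis UN_I UNIV_I tower.simps(1))
  next
    case (Suc j)
    then obtain y l where x: "x = y + \<rho> (\<tau> j) l" "y \<in> tow j" "l \<in> L" by auto
    have "\<rho> (inv t) (\<rho> (\<tau> j) l) \<in> (\<Union>j. tow j)"
    proof (cases j)
      case 0
      then have "\<rho> (inv t) (\<rho> (\<tau> j) l) = l" using t_carrier by (simp add: rep_inv tau_0)
      then show ?thesis using x(3) assms(1) tow_A by auto
    next
      case (Suc i)
      then have "\<rho> (inv t) (\<rho> (\<tau> j) l) = \<rho> (\<tau> i) l" unfolding Suc tau_Suc using t_carrier by (simp add: rep_inv)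
      then show ?thesis using tow_tau[OF x(3), of i] by (metis UN_I UNIV_I)
    qed
    moreover have "\<rho> (inv t) y \<in> (\<Union>j. tow j)" using Suc x by blast
    ultimately show ?case unfolding x(1) using t_carrier
      by (simp only: rep_add inv_closed) (rule add_subgroup_add[OF invariant_add_subgroup[OF UN_tow_invariant]])
  qed
  then show ?thesis using assms(3) by blast
qed

text \<open>The counterpart of the ideal of leading coefficients in Hilbert's basis theorem, in
  degree \<open>j + 1\<close>.\<close>

definition lead :: "'a set \<Rightarrow> nat \<Rightarrow> 'a set" where
  "lead N j = {l \<in> L. \<exists>y\<in>tow j. \<rho> (\<tau> j) l + y \<in> N}"

lemma rep_tau_B: "x \<in> B \<Longrightarrow> \<rho> (\<tau> j) x \<in> B"
proof (induction j)
  case 0 then show ?case using rep_t_B by (simp add: tau_0)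
next
  case (Suc j) then show ?case using rep_t_B by (simp only: tau_Suc)
qed

lemma lead_between:
  assumes "invariant_subgroup K N" "B \<subseteq> N"
  shows "invariant_subgroup K (lead N j)" "B \<subseteq> lead N j" "lead N j \<subseteq> L"
proof -
  note asN = invariant_add_subgroup[OF assms(1)] and asj = tow_add_subgroup[of j] and asL = invariant_add_subgroup[OF inv_L]
  show "lead N j \<subseteq> L" by (auto simp: lead_def)
  show "B \<subseteq> lead N j"
  proof
    fix x assume x: "x \<in> B"
    then have "\<rho> (\<tau> j) x + 0 \<in> N" using rep_tau_B assms(2) by auto
    then show "x \<in> lead N j" unfolding lead_def using x B_L add_subgroup_zero[OF asj] by blast
  qed
  show "invariant_subgroup K (lead N j)"
    unfolding invariant_subgroup_def add_subgroup_def
  proof (intro conjI ballI)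
    show "0 \<in> lead N j" using \<open>B \<subseteq> lead N j\<close> add_subgroup_zero[OF invariant_add_subgroup[OF inv_B]] by blast
    fix l assume "l \<in> lead N j"
    then obtain y where l: "l \<in> L" "y \<in> tow j" "\<rho> (\<tau> j) l + y \<in> N" by (auto simp: lead_def)
    show "l - l' \<in> lead N j" if l': "l' \<in> lead N j" for l'
    proof -
      obtain y' where l': "l' \<in> L" "y' \<in> tow j" "\<rho> (\<tau> j) l' + y' \<in> N" using l' by (auto simp: lead_def)
      have "\<rho> (\<tau> j) (l - l') + (y - y') = (\<rho> (\<tau> j) l + y) - (\<rho> (\<tau> j) l' + y')"
        by (simp only: rep_diff[OF tau_carrier]) simp
      then have "\<rho> (\<tau> j) (l - l') + (y - y') \<in> N" using add_subgroup_diff[OF asN l(3) l'(3)] by (simp only:)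
      then show ?thesis
        using add_subgroup_diff[OF asj l(2) l'(2)] add_subgroup_diff[OF asL l(1) l'(1)] unfolding lead_def by blast
    qed
    fix k assume k: "k \<in> K"
    \<comment> \<open>Moving \<open>k\<close> past \<open>\<tau> j\<close> conjugates it, and the
      conjugate stays in \<open>K\<close> because \<open>t\<close> normalizes
      \<open>K\<close>.\<close>
    define k' where "k' = \<tau> j \<otimes> k \<otimes> inv (\<tau> j)"
    have k': "k' \<in> K" using tau_normalizes'[OF k] by (simp only: k'_def)
    have "\<rho> k' (\<rho> (\<tau> j) l + y) = \<rho> (\<tau> j) (\<rho> k l) + \<rho> k' y"
      unfolding rep_tau'[OF k] k'_def[symmetric] using k' K_carrier by (intro rep_add) blast
    moreover have "\<rho> k' (\<rho> (\<tau> j) l + y) \<in> N" using invariant_rep[OF assms(1) k' l(3)] .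
    moreover have "\<rho> k' y \<in> tow j" using invariant_rep[OF tow_invariant k' l(2)] .
    moreover have "\<rho> k l \<in> L" using invariant_rep[OF inv_L k l(1)] .
    ultimately show "\<rho> k l \<in> lead N j" unfolding lead_def by auto
  qed
qed

lemma lead_Suc:
  assumes "\<And>x. x \<in> N \<Longrightarrow> \<rho> t x \<in> N"
  shows "lead N j \<subseteq> lead N (Suc j)"
proof
  fix l assume "l \<in> lead N j"
  then obtain y where l: "l \<in> L" "y \<in> tow j" "\<rho> (\<tau> j) l + y \<in> N" by (auto simp: lead_def)
  have "\<rho> (\<tau> (Suc j)) l + \<rho> t y \<in> N"
    using assms[OF l(3)] t_carrier by (simp only: rep_add tau_Suc)
  then show "l \<in> lead N (Suc j)" unfolding lead_def using rep_t_tow[OF l(2)] l(1) by blast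
qed

text \<open>Induction on the degree: from an element of \<open>N'\<close> subtract an element of
  \<open>N\<close> with the same leading coefficient.\<close>

lemma subset_of_lead:
  assumes "add_subgroup N" "add_subgroup N'" "N \<subseteq> N'" "N' \<subseteq> (\<Union>j. tow j)" "N' \<inter> A \<subseteq> N" "\<And>j. lead N' j \<subseteq> lead N j"
  shows "N' \<subseteq> N"
proof -
  have "x \<in> N" if "x \<in> N'" "x \<in> tow j" for x j
    using that
  proof (induction j arbitrary: x)
    case 0 then show ?case using assms(5) by auto
  next
    case (Suc j)
    then obtain y l where x: "x = y + \<rho> (\<tau> j) l" "y \<in> tow j" "l \<in> L" by auto
    then have "l \<in> lead N' j" unfolding lead_def using Suc(2) by (auto simp: add.commute)
    then obtain y' where y': "y' \<in> tow j" "\<rho> (\<tau> j) l + y' \<in> N" using assms(6) by (auto simp: lead_def)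
    have "x - (\<rho> (\<tau> j) l + y') = y - y'" unfolding x(1) by simp
    moreover have "x - (\<rho> (\<tau> j) l + y') \<in> N'" using y' assms(3) Suc(2) add_subgroup_diff[OF assms(2)] by blast
    moreover have "y - y' \<in> tow j" using add_subgroup_diff[OF tow_add_subgroup] x y' by auto
    ultimately have "x - (\<rho> (\<tau> j) l + y') \<in> N" using Suc(1) by metis
    then show ?case using add_subgroup_cancel(3)[OF assms(1) y'(2)] by blast
  qed
  then show ?thesis using assms(4) by blast
qed

text \<open>Leading coefficients grow with the degree and along the chain, so stabilization of the
  diagonal \<open>lead (N n) n\<close> settles all large degrees at once. The finitely many small
  degrees and the part inside \<open>A\<close> are stabilized one by one.\<close>

lemma tower_noetherian:
  assumes "noetherian_between K B L" "noetherian_between Q B A" "K \<subseteq> Q" "invariant_subgroup Q A"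
  shows "noetherian_between (insert t Q) B (\<Union>j. tow j)"
  unfolding noetherian_between_def
proof (intro allI impI)
  fix N :: "nat \<Rightarrow> 'a set"
  assume "(\<forall>n. invariant_subgroup (insert t Q) (N n) \<and> B \<subseteq> N n \<and> N n \<subseteq> (\<Union>j. tow j)) \<and> (\<forall>n. N n \<subseteq> N (Suc n))"
  then have N: "invariant_subgroup (insert t Q) (N n)" "B \<subseteq> N n" "N n \<subseteq> (\<Union>j. tow j)" "N n \<subseteq> N (Suc n)" for n by auto
  have NQ: "invariant_subgroup Q (N n)" for n by (rule invariant_mono[OF N(1)]) auto
  have NK: "invariant_subgroup K (N n)" for n using NQ assms(3) invariant_mono by blast
  have Nmono: "m \<le> n \<Longrightarrow> N m \<subseteq> N n" for m n using lift_Suc_mono_le[of N] N(4) by blast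
  have lead_n: "m \<le> n \<Longrightarrow> lead (N m) j \<subseteq> lead (N n) j" for m n j using Nmono[of m n] by (auto simp: lead_def)
  have lead_j: "i \<le> j \<Longrightarrow> lead (N n) i \<subseteq> lead (N n) j" for i j n
    using lift_Suc_mono_le[of "lead (N n)" i j, OF lead_Suc[of "N n"]] invariant_rep[OF N(1)[of n], of t] by simp
  have "\<exists>n. \<forall>m\<ge>n. N m \<inter> A = N n \<inter> A"
  proof (rule noetherian_between_stable[OF assms(2)])
    show "invariant_subgroup Q (N n \<inter> A)" for n using invariant_Int[OF NQ assms(4)] .
    show "B \<subseteq> N n \<inter> A" "N n \<inter> A \<subseteq> A" "N n \<inter> A \<subseteq> N (Suc n) \<inter> A" for n using N(2,4)[of n] B_A by auto
  qed
  then obtain n1 where n1: "\<And>m. m \<ge> n1 \<Longrightarrow> N m \<inter> A = N n1 \<inter> A" by blast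
  have "\<exists>n. \<forall>m\<ge>n. lead (N m) m = lead (N n) n"
  proof (rule noetherian_between_stable[OF assms(1), of "\<lambda>n. lead (N n) n", OF lead_between[OF NK N(2)]])
    show "lead (N n) n \<subseteq> lead (N (Suc n)) (Suc n)" for n
      using lead_n[of n "Suc n" n] lead_j[of n "Suc n" "Suc n"] by auto
  qed
  then obtain n2 where n2: "\<And>m. m \<ge> n2 \<Longrightarrow> lead (N m) m = lead (N n2) n2" by blast
  have "\<exists>n. \<forall>m\<ge>n. lead (N m) j = lead (N n) j" for j
    by (rule noetherian_between_stable[OF assms(1), of "\<lambda>n. lead (N n) j", OF lead_between[OF NK N(2)] lead_n[OF le_SucI[OF order_refl]]])
  then obtain f where f: "\<And>j m. m \<ge> f j \<Longrightarrow> lead (N m) j = lead (N (f j)) j" by metis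
  define n where "n = n1 + n2 + (\<Sum>j\<le>n2. f j)"
  have n: "n1 \<le> n" "n2 \<le> n" "\<And>j. j \<le> n2 \<Longrightarrow> f j \<le> n"
    using member_le_sum[of _ "{..n2}" f] by (auto simp: n_def trans_le_add2)
  have "N m = N n" if m: "m \<ge> n" for m
  proof (rule antisym)
    show "N n \<subseteq> N m" using Nmono m by auto
    have ld: "lead (N m) j \<subseteq> lead (N n) j" for j
    proof (cases "j \<le> n2")
      case True
      then have "lead (N m) j = lead (N (f j)) j" "lead (N n) j = lead (N (f j)) j"
        using f[of j m] f[of j n] n(3)[of j] m by (metis order_trans)+
      then show ?thesis by blast
    next
      case False
      have "lead (N m) j \<subseteq> lead (N (max m j)) (max m j)"
        using lead_n[of m "max m j" j] lead_j[of j "max m j" "max m j"] by auto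
      also have "\<dots> = lead (N n2) n2" using False by (intro n2) auto
      also have "\<dots> \<subseteq> lead (N n) j" using lead_n[of n2 n n2] lead_j[of n2 j n] n(2) False by auto
      finally show ?thesis .
    qed
    have "N m \<inter> A \<subseteq> N n" using n1[of m] n1[of n] m n(1) by (metis Int_lower1 order_trans)
    then show "N m \<subseteq> N n"
      using subset_of_lead[of "N n" "N m"] invariant_add_subgroup[OF N(1)] ld N(3)[of m] Nmono[OF m] by blast
  qed
  then show "\<exists>n. \<forall>m\<ge>n. N m = N n" by blast
qed

text \<open>The quotient of \<open>tow (Suc j)\<close> by \<open>tow j\<close> is a twisted copy of
  \<open>L\<close> modulo \<open>lead B j\<close>. The subgroups \<open>lead B j\<close> become
  stationary, so one \<open>s\<close> kills the \<open>S\<close>-torsion of all these quotients. If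
  \<open>a = 1 + u * s\<close> is in \<open>S\<close> and kills \<open>l\<close>, then
  \<open>s\<close> kills \<open>l\<close> too, and so does \<open>a - u * s = 1\<close>.\<close>

lemma tower_torsion_free:
  fixes sc :: "'r::comm_ring_1 \<Rightarrow> 'a \<Rightarrow> 'a"
  assumes noeth: "noetherian_between K B L"
    and sc: "Modules.module sc" and S: "1 \<in> S" "\<And>r s. r \<in> S \<Longrightarrow> s \<in> S \<Longrightarrow> r * s \<in> S"
    and sc_closed: "\<And>N r x. invariant_subgroup K N \<Longrightarrow> x \<in> N \<Longrightarrow> sc r x \<in> N"
    and comm: "\<And>r g l. g \<in> carrier G \<Longrightarrow> l \<in> L \<Longrightarrow> sc r (\<rho> g l) - \<rho> g (sc r l) \<in> B"
  obtains s where "s \<in> S"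
    "\<And>u x. 1 + u * s \<in> S \<Longrightarrow> x \<in> (\<Union>j. tow j) \<Longrightarrow> sc (1 + u * s) x \<in> A \<Longrightarrow> x \<in> A"
proof -
  interpret sc: Modules.module sc by (rule sc)
  note asB = invariant_add_subgroup[OF inv_B] 
  note lB = lead_between[OF inv_B order_refl]
  have mono: "i \<le> j \<Longrightarrow> lead B i \<subseteq> lead B j" for i j
    using lift_Suc_mono_le[of "lead B" i j, OF lead_Suc[of B]] rep_t_B by simp
  have "\<exists>n. \<forall>m\<ge>n. lead B m = lead B n"
    by (rule noetherian_between_stable[OF noeth, of "lead B", OF lB mono[OF le_SucI[OF order_refl]]])
  then obtain n where n: "\<And>m. m \<ge> n \<Longrightarrow> lead B m = lead B n" by blast
  have "\<exists>s\<in>S. \<forall>l\<in>L. \<forall>r\<in>S. sc r l \<in> lead B j \<longrightarrow> sc s l \<in> lead B j" for j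
  proof -
    have comm': "sc r (\<rho> k l) - \<rho> k (sc r l) \<in> B" if "k \<in> K" "l \<in> L" for r k l
      using comm[of k l r] that K_carrier by blast
    obtain s where "s \<in> S" "\<And>l r. l \<in> L \<Longrightarrow> r \<in> S \<Longrightarrow> sc r l \<in> lead B j \<Longrightarrow> sc s l \<in> lead B j"
      by (rule torsion_bounded[OF noeth inv_L lB(1,2) sc S sc_closed comm' B_L asB, of j]) blast+
    then show ?thesis by blast
  qed
  then obtain f where f: "\<And>j. f j \<in> S"
    "\<And>j l r. l \<in> L \<Longrightarrow> r \<in> S \<Longrightarrow> sc r l \<in> lead B j \<Longrightarrow> sc (f j) l \<in> lead B j" by metis
  define s where "s = (\<Prod>j\<le>n. f j)"
  have "prod f J \<in> S" if "finite J" for J using that by (induction J) (auto simp: S f)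
  then have sS: "s \<in> S" by (simp add: s_def)
  have tors: "sc s l \<in> lead B j" if l: "l \<in> L" "r \<in> S" "sc r l \<in> lead B j" for l r j
  proof -
    define i where "i = min j n"
    have i: "lead B j = lead B i" "i \<le> n" using n[of j] unfolding i_def min_def by (metis linear, simp)
    then have "s = prod f ({..n} - {i}) * f i" by (simp add: s_def prod.remove[of "{..n}" i] mult.commute)
    moreover have "sc (f i) l \<in> lead B i" using f(2)[of l r i] l i by simp
    ultimately show ?thesis using sc_closed[OF lB(1)] i by (simp flip: sc.scale_scale)
  qed
  have "x \<in> A" if a: "1 + u * s \<in> S" "x \<in> tow j" "sc (1 + u * s) x \<in> A" for u x j
    using a(2,3)
  proof (induction j arbitrary: x)
    case 0 then show ?case by simp
  next
    case (Suc j)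
    note asj = tow_add_subgroup[of j]
    define a where "a = 1 + u * s"
    obtain y l where x: "x = y + \<rho> (\<tau> j) l" "y \<in> tow j" "l \<in> L" using Suc(2) by auto
    have "sc a x \<in> tow j" using Suc(3) tow_A[of j] by (auto simp: a_def)
    then have "sc a y + sc a (\<rho> (\<tau> j) l) \<in> tow j" by (simp only: x(1) sc.scale_right_distrib)
    moreover have "sc a y \<in> tow j" using sc_closed[OF tow_invariant x(2)] .
    ultimately have "sc a (\<rho> (\<tau> j) l) \<in> tow j" using add_subgroup_cancel(2)[OF asj] by blast
    moreover have "sc a (\<rho> (\<tau> j) l) - \<rho> (\<tau> j) (sc a l) \<in> tow j"
      using comm[OF tau_carrier x(3)] B_A tow_A by blast
    ultimately have "\<rho> (\<tau> j) (sc a l) \<in> tow j" using add_subgroup_congruent[OF asj] by blast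
    moreover have "sc a l \<in> L" using sc_closed[OF inv_L x(3)] .
    moreover have lead_iff: "l' \<in> lead B j \<longleftrightarrow> \<rho> (\<tau> j) l' \<in> tow j" if "l' \<in> L" for l'
    proof
      assume "l' \<in> lead B j"
      then obtain y where "y \<in> tow j" "\<rho> (\<tau> j) l' + y \<in> tow j" using B_A tow_A by (auto simp: lead_def)
      then show "\<rho> (\<tau> j) l' \<in> tow j" using add_subgroup_cancel(1)[OF asj] by blast
    next
      assume *: "\<rho> (\<tau> j) l' \<in> tow j"
      have "\<rho> (\<tau> j) l' + - \<rho> (\<tau> j) l' \<in> B" using add_subgroup_zero[OF asB] by simp
      then show "l' \<in> lead B j" unfolding lead_def using add_subgroup_minus[OF asj *] that by blast
    qed
    ultimately have al: "sc a l \<in> lead B j" by blast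
    have "sc s l \<in> lead B j" using tors[OF x(3)] al a(1) by (simp add: a_def)
    then have "sc a l - sc u (sc s l) \<in> lead B j"
      using add_subgroup_diff[OF invariant_add_subgroup[OF lB(1)] al] sc_closed[OF lB(1)] by blast
    then have "l \<in> lead B j" by (simp add: a_def sc.scale_left_distrib)
    then have "\<rho> (\<tau> j) l \<in> tow j" using lead_iff[OF x(3)] by blast
    then have "x \<in> tow j" unfolding x(1) using add_subgroup_add[OF asj x(2)] by blast
    then show ?case using Suc by blast
  qed
  then show ?thesis using that[OF sS] by blast
qed

end

lemma (in rep_tower) UN_tow_subset:
  assumes "add_subgroup W" "\<And>x. x \<in> W \<Longrightarrow> \<rho> t x \<in> W" "A \<subseteq> W" "L \<subseteq> W"
  shows "(\<Union>j. tow j) \<subseteq> W"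
proof -
  have \<tau>W: "x \<in> W \<Longrightarrow> \<rho> (\<tau> j) x \<in> W" for x j
    by (induction j) (auto simp: tau_0 tau_Suc assms)
  have "tow j \<subseteq> W" for j
    by (induction j) (use assms add_subgroup_add[OF assms(1)] \<tau>W in \<open>auto 0 3\<close>)
  then show ?thesis by blast
qed

section \<open>Central chains with cyclic factors\<close>

context group begin

text \<open>Generators leading from \<open>K\<close> up to the whole group, each central modulo the
  subgroup reached so far. A list of elements supports induction without factor groups.\<close>

primrec central_chain :: "'a set \<Rightarrow> 'a list \<Rightarrow> bool" where
  "central_chain K [] \<longleftrightarrow> K = carrier G"
| "central_chain K (g # gs) \<longleftrightarrow> g \<in> carrier G \<and> (\<forall>h\<in>carrier G. h \<otimes> g \<otimes> inv h \<otimes> inv g \<in> K)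
     \<and> central_chain (generate G (insert g K)) gs"

lemma normal_generate_insert:
  assumes "K \<lhd> G" "g \<in> carrier G" "\<And>h. h \<in> carrier G \<Longrightarrow> h \<otimes> g \<otimes> inv h \<otimes> inv g \<in> K"
  shows "generate G (insert g K) \<lhd> G"
proof (rule normal_invI)
  have Kc: "insert g K \<subseteq> carrier G" using assms normal_imp_subgroup subgroup.subset by blast
  then show "subgroup (generate G (insert g K)) G" by (rule generate_is_subgroup)
  have gen: "h \<otimes> x \<otimes> inv h \<in> generate G (insert g K)" if "x \<in> insert g K" "h \<in> carrier G" for x h
  proof (cases "x = g")
    case True
    have "h \<otimes> g \<otimes> inv h = (h \<otimes> g \<otimes> inv h \<otimes> inv g) \<otimes> g" using that assms by (simp add: m_assoc)
    also have "\<dots> \<in> generate G (insert g K)" using assms that by (intro generate.eng generate.incl) auto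
    finally show ?thesis using True by simp
  next
    case False
    then show ?thesis using that normal.inv_op_closed2[OF assms(1)] by (intro generate.incl) auto
  qed
  fix h x assume "x \<in> generate G (insert g K)" "h \<in> carrier G"
  then show "h \<otimes> x \<otimes> inv h \<in> generate G (insert g K)"
  proof (induction rule: generate.induct)
    case one then show ?case by (simp add: generate.one)
  next
    case (incl x) then show ?case using gen by blast
  next
    case (inv x)
    have "h \<otimes> inv x \<otimes> inv h = inv (h \<otimes> x \<otimes> inv h)" using inv Kc by (auto simp: inv_mult_group m_assoc)
    then show ?case using generate_m_inv_closed[OF Kc gen[OF inv(1,2)]] by simp
  next
    case (eng x y)
    have xy: "x \<in> carrier G" "y \<in> carrier G" using eng generate_in_carrier[OF Kc] by auto
    have "h \<otimes> (x \<otimes> y) \<otimes> inv h = (h \<otimes> x \<otimes> inv h) \<otimes> (h \<otimes> y \<otimes> inv h)"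
      using xy eng by (simp add: m_assoc inv_solve_left)
    then show ?case using eng by (simp add: generate.eng)
  qed
qed

lemma central_chain_mono:
  assumes "central_chain K gs" "K \<subseteq> K'" "K' \<subseteq> carrier G" 
  shows "central_chain K' gs"
  using assms
proof (induction gs arbitrary: K K')
  case (Cons g gs)
  have "generate G (insert g K) \<subseteq> generate G (insert g K')" by (rule mono_generate) (use Cons in auto)
  moreover have "generate G (insert g K') \<subseteq> carrier G" using Cons by (intro generate_incl) auto
  ultimately have "central_chain (generate G (insert g K')) gs" using Cons by auto
  then show ?case using Cons by auto
qed auto

end

text \<open>The scalars will be integers, to bound the additive order of an element, and integer
  polynomials in the operator of a group element, to bound the order of that operator. They commute
  with the group only modulo \<open>B\<close>, since that group element is central only up to
  elements acting trivially on \<open>W\<close> modulo \<open>B\<close>.\<close>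

locale scaled_group_rep = group_rep G \<rho> for G :: "('g, 'm) monoid_scheme" (structure)
    and \<rho> :: "'g \<Rightarrow> 'a::ab_group_add \<Rightarrow> 'a" +
  fixes sc :: "'r::comm_ring_1 \<Rightarrow> 'a \<Rightarrow> 'a" and S :: "'r set" and B W :: "'a set"
  assumes sc: "Modules.module sc" and S: "1 \<in> S" "\<And>r s. r \<in> S \<Longrightarrow> s \<in> S \<Longrightarrow> r * s \<in> S"
    and inv_B: "invariant_subgroup (carrier G) B" and inv_W: "invariant_subgroup (carrier G) W"
    and comm: "\<And>r g l. g \<in> carrier G \<Longrightarrow> l \<in> W \<Longrightarrow> sc r (\<rho> g l) - \<rho> g (sc r l) \<in> B"
begin

text \<open>Integer scalars satisfy this for every \<open>K\<close>; polynomials in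
  \<open>\<rho> z\<close> satisfy it as soon as \<open>z \<in> K\<close>.\<close>

definition sc_stable :: "'g set \<Rightarrow> bool" where
  "sc_stable K \<longleftrightarrow> (\<forall>N r x. invariant_subgroup K N \<longrightarrow> x \<in> N \<longrightarrow> sc r x \<in> N)"

lemma sc_stable_mono: "sc_stable K \<Longrightarrow> K \<subseteq> K' \<Longrightarrow> sc_stable K'"
  unfolding sc_stable_def using invariant_mono[of K'] by metis

text \<open>Only scalars congruent to 1 modulo \<open>s\<close> are tested. In this form the
  property passes through a chain of extensions when the scalars \<open>s\<close> are
  multiplied.\<close>

definition torsion_free_over :: "'r \<Rightarrow> 'a set \<Rightarrow> 'a set \<Rightarrow> bool" where
  "torsion_free_over s L U \<longleftrightarrow> (\<forall>u x. 1 + u * s \<in> S \<longrightarrow> x \<in> U \<longrightarrow> sc (1 + u * s) x \<in> L \<longrightarrow> x \<in> L)"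

text \<open>Two towers, in the positive and in the negative powers of \<open>t\<close>, because
  invariance under the generated group includes \<open>inv t\<close>. The second tower starts from
  the union \<open>A\<close> of the first.\<close>

lemma generate_insert_step:
  assumes K: "K \<lhd> G" and t: "t \<in> carrier G" and L: "invariant_subgroup K L" "B \<subseteq> L" "L \<subseteq> W"
    and noeth: "noetherian_between K B L" and stable: "sc_stable K"
  obtains U s where "L \<subseteq> U" "U \<subseteq> W" "invariant_subgroup (generate G (insert t K)) U"
    "noetherian_between (generate G (insert t K)) B U" "s \<in> S" "torsion_free_over s L U"
proof -
  have Ksub: "subgroup K G" using K by (rule normal_imp_subgroup)
  have Kc: "K \<subseteq> carrier G" using subgroup.subset[OF Ksub] .
  have sc_closed: "sc r x \<in> N" if "invariant_subgroup K N" "x \<in> N" for N r x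
    using stable that by (auto simp: sc_stable_def)
  note comm' = comm[OF _ subsetD[OF L(3)]]
  have tconj: "inv t \<otimes> k \<otimes> t \<in> K" "t \<otimes> k \<otimes> inv t \<in> K" if "k \<in> K" for k
    using normal.inv_op_closed1[OF K t that] normal.inv_op_closed2[OF K t that] by auto
  have B: "invariant_subgroup K B" using inv_B Kc invariant_mono by blast
  interpret T1: rep_tower G \<rho> K t L L B
  proof
    show "\<exists>y\<in>L. \<exists>l\<in>L. \<rho> t x = y + \<rho> t l" if "x \<in> L" for x
      using that add_subgroup_zero[OF invariant_add_subgroup[OF L(1)]] by (intro bexI[of _ 0] bexI[of _ x]) auto
    show "\<rho> t x \<in> B" if "x \<in> B" for x using invariant_rep[OF inv_B t that] .
  qed (use Kc t tconj L B in auto)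
  define A where "A = (\<Union>j. T1.tow j)"
  have LA: "L \<subseteq> A" using T1.tow_A by (auto simp: A_def)
  have A: "invariant_subgroup (insert t K) A" unfolding A_def by (rule T1.UN_tow_invariant)
  have asA: "add_subgroup A" using A by (rule invariant_add_subgroup)
  \<comment> \<open>Under \<open>inv t\<close> only the summand of degree 0 can leave
    \<open>A\<close>.\<close>
  have invtA: "\<exists>y\<in>A. \<exists>l\<in>L. \<rho> (inv t) x = y + \<rho> (inv t) l" if "x \<in> T1.tow j" for x j
    using that
  proof (induction j arbitrary: x)
    case 0
    then show ?case using add_subgroup_zero[OF asA] by (intro bexI[of _ 0] bexI[of _ x]) auto
  next
    case (Suc j)
    then obtain y l where x: "x = y + \<rho> (T1.\<tau> j) l" "y \<in> T1.tow j" "l \<in> L" by auto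
    from Suc.IH[OF x(2)] obtain y' l' where y': "y' \<in> A" "l' \<in> L" "\<rho> (inv t) y = y' + \<rho> (inv t) l'" by blast
    have "\<rho> (inv t) (\<rho> (T1.\<tau> j) l) \<in> A"
    proof (cases j)
      case 0 then show ?thesis using t x(3) LA by (auto simp: T1.tau_0 rep_inv)
    next
      case (Suc i)
      then have "\<rho> (inv t) (\<rho> (T1.\<tau> j) l) = \<rho> (T1.\<tau> i) l" using t by (simp add: T1.tau_Suc rep_inv)
      then show ?thesis using T1.tow_tau[OF x(3), of i] unfolding A_def by (metis UN_I UNIV_I)
    qed
    moreover have "\<rho> (inv t) x = (y' + \<rho> (inv t) (\<rho> (T1.\<tau> j) l)) + \<rho> (inv t) l'"
      using t y'(3) by (simp add: x(1) rep_add algebra_simps)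
    ultimately show ?case using y' add_subgroup_add[OF asA] by blast
  qed
  interpret T2: rep_tower G \<rho> K "inv t" L A B
  proof
    show "\<exists>y\<in>A. \<exists>l\<in>L. \<rho> (inv t) x = y + \<rho> (inv t) l" if "x \<in> A" for x
      using that invtA unfolding A_def by blast
    show "\<rho> (inv t) x \<in> B" if "x \<in> B" for x using invariant_rep[OF inv_B _ that] t by simp
    show "invariant_subgroup K A" using A by (rule invariant_mono) auto
  qed (use Kc t tconj L B LA in auto)
  define U where "U = (\<Union>j. T2.tow j)"
  have AU: "A \<subseteq> U" using T2.tow_A by (auto simp: U_def)
  have asW: "add_subgroup W" using inv_W by (rule invariant_add_subgroup)
  have "A \<subseteq> W" unfolding A_def using L t by (intro T1.UN_tow_subset asW invariant_rep[OF inv_W]) auto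
  then have UW: "U \<subseteq> W" unfolding U_def using L t by (intro T2.UN_tow_subset asW invariant_rep[OF inv_W]) auto
  have gc: "insert t K \<subseteq> carrier G" using t Kc by auto
  have U_t: "\<rho> t x \<in> U" if "x \<in> U" for x
    using T2.UN_tow_inv[of x] that LA invariant_rep[OF A, of t] t by (simp add: U_def)
  have U_K: "invariant_subgroup (insert (inv t) K) U" unfolding U_def by (rule T2.UN_tow_invariant)
  have inv_U: "invariant_subgroup (generate G (insert t K)) U"
  proof (rule invariant_generate[OF gc])
    show "invariant_subgroup (insert t K) U" using U_K U_t by (auto simp: invariant_subgroup_def)
    show "\<rho> (inv k) x \<in> U" if "k \<in> insert t K" "x \<in> U" for k x
      using that invariant_rep[OF U_K, of "inv k"] subgroup.m_inv_closed[OF Ksub] by auto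
  qed
  have noethA: "noetherian_between (insert t K) B A"
    unfolding A_def by (rule T1.tower_noetherian[OF noeth noeth order_refl L(1)])
  have "noetherian_between (insert (inv t) (insert t K)) B U"
    unfolding U_def by (rule T2.tower_noetherian[OF noeth noethA _ A]) auto
  then have noethU: "noetherian_between (generate G (insert t K)) B U"
    by (rule noetherian_between_mono) (auto intro: generate.incl generate.inv)
  obtain s1 where s1: "s1 \<in> S" "\<And>u x. 1 + u * s1 \<in> S \<Longrightarrow> x \<in> A \<Longrightarrow> sc (1 + u * s1) x \<in> L \<Longrightarrow> x \<in> L"
    unfolding A_def by (rule T1.tower_torsion_free[OF noeth sc S sc_closed comm']) blast+
  obtain s2 where s2: "s2 \<in> S" "\<And>u x. 1 + u * s2 \<in> S \<Longrightarrow> x \<in> U \<Longrightarrow> sc (1 + u * s2) x \<in> A \<Longrightarrow> x \<in> A"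
    unfolding U_def by (rule T2.tower_torsion_free[OF noeth sc S sc_closed comm']) blast+
  have "torsion_free_over (s1 * s2) L U"
    unfolding torsion_free_over_def
  proof (intro allI impI)
    fix u x assume a: "1 + u * (s1 * s2) \<in> S" "x \<in> U" "sc (1 + u * (s1 * s2)) x \<in> L"
    \<comment> \<open>One and the same scalar is congruent to 1 modulo \<open>s2\<close>, for the
      outer tower, and modulo \<open>s1\<close>, for the inner one.\<close>
    have eq: "1 + u * (s1 * s2) = 1 + (u * s1) * s2" "1 + u * (s1 * s2) = 1 + (u * s2) * s1" by (simp_all add: ac_simps)
    have "x \<in> A" using s2(2)[of "u * s1" x] a LA unfolding eq(1) by blast
    then show "x \<in> L" using s1(2)[of "u * s2" x] a unfolding eq(2) by blast
  qed
  then show ?thesis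
    using that[OF _ UW inv_U noethU S(2)[OF s1(1) s2(1)]] LA AU by blast
qed

text \<open>The bounds \<open>s\<close> of the single steps multiply. As \<open>L\<close> is
  Noetherian over the small group \<open>K\<close> at the start, it may be the piece spanned by a
  single element, while \<open>U\<close> is Noetherian over the whole group and its torsion over
  \<open>L\<close> stays controlled.\<close>

theorem central_chain_noetherian:
  assumes "K \<lhd> G" "central_chain K gs" "invariant_subgroup K L" "B \<subseteq> L" "L \<subseteq> W"
    "noetherian_between K B L" "sc_stable K"
  obtains U s where "L \<subseteq> U" "U \<subseteq> W" "invariant_subgroup (carrier G) U"
    "noetherian_between (carrier G) B U" "s \<in> S" "torsion_free_over s L U"
  using assms
proof (induction gs arbitrary: K L thesis)
  case Nil
  have "torsion_free_over 1 L L" by (auto simp: torsion_free_over_def)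
  then show ?case using Nil S(1) by auto
next
  case (Cons t gs)
  let ?K = "generate G (insert t K)"
  obtain U s where U: "L \<subseteq> U" "U \<subseteq> W" "invariant_subgroup ?K U" "noetherian_between ?K B U" "s \<in> S" "torsion_free_over s L U"
    by (rule generate_insert_step[of K t L]) (use Cons in auto)
  have K': "?K \<lhd> G" by (rule normal_generate_insert) (use Cons in auto)
  have "K \<subseteq> ?K" by (auto intro: generate.incl)
  then have st: "sc_stable ?K" by (rule sc_stable_mono[OF Cons.prems(8)])
  have "central_chain ?K gs" "B \<subseteq> U" using Cons.prems(3,5) U(1) by auto
  then obtain V s' where V: "U \<subseteq> V" "V \<subseteq> W" "invariant_subgroup (carrier G) V"
    "noetherian_between (carrier G) B V" "s' \<in> S" "torsion_free_over s' U V"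
    by (rule Cons.IH[OF _ K' _ U(3) _ U(2) U(4) st, rotated]) 
  have "torsion_free_over (s * s') L V"
    unfolding torsion_free_over_def
  proof (intro allI impI)
    fix u x assume a: "1 + u * (s * s') \<in> S" "x \<in> V" "sc (1 + u * (s * s')) x \<in> L"
    have eq: "1 + u * (s * s') = 1 + (u * s) * s'" "1 + u * (s * s') = 1 + (u * s') * s" by (simp_all add: ac_simps)
    have "x \<in> U" using V(6) a U(1) unfolding eq(1) torsion_free_over_def by blast
    then show "x \<in> L" using U(6) a unfolding eq(2) torsion_free_over_def by blast
  qed
  then show ?case using Cons.prems(1)[of V "s * s'"] U V S by blast
qed

end

subsection \<open>Finitely generated modules over groups with a central chain\<close>

definition zmul :: "int \<Rightarrow> 'a::ab_group_add \<Rightarrow> 'a" where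
  "zmul k x = (\<Sum>i<nat k. x) - (\<Sum>i<nat (- k). x)"

text \<open>The value at a difference of two naturals is the difference of the two repeated sums.
  Writing both scalars as such differences reduces the module laws to repeated sums.\<close>

lemma zmul_module: "Modules.module (zmul :: int \<Rightarrow> 'a::ab_group_add \<Rightarrow> 'a)"
proof -
  define c where "c n x = (\<Sum>i<n. x)" for n :: nat and x :: 'a
  have c_simps: "c 0 x = 0" "c (Suc n) x = x + c n x" for x n by (simp_all add: c_def add.commute)
  have c_add: "c (m + n) x = c m x + c n x" for m n x by (induction m) (simp_all add: c_simps add.assoc)
  have c_diff: "c n (x - y) = c n x - c n y" for n x y by (simp add: c_def sum_subtractf)
  have c_plus: "c n (x + y) = c n x + c n y" for n x y by (simp add: c_def sum.distrib)
  have c_mult: "c m (c n x) = c (m * n) x" for m n x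
    by (induction m) (simp_all add: c_simps c_add)
  have zc: "zmul (int m - int n) x = c m x - c n x" for m n x
  proof (cases "n \<le> m")
    case True
    then obtain d where "m = n + d" using le_Suc_ex by blast
    then show ?thesis by (simp add: zmul_def c_add flip: c_def)
  next
    case False
    then obtain d where "n = m + d" using le_Suc_ex nat_le_linear by blast
    then show ?thesis by (simp add: zmul_def c_add flip: c_def)
  qed
  show ?thesis
  proof
    fix a b :: int and x y :: 'a
    obtain m n where a: "a = int m - int n" by (rule int_diff_cases)
    obtain p q where b: "b = int p - int q" by (rule int_diff_cases)
    show "zmul a (x + y) = zmul a x + zmul a y" by (simp add: a zc c_plus)
    have "a + b = int (m + p) - int (n + q)" by (simp add: a b)
    then have "zmul (a + b) x = c (m + p) x - c (n + q) x" by (simp only: zc)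
    then show "zmul (a + b) x = zmul a x + zmul b x" by (simp add: a b zc c_add)
    have "a * b = int (m * p + n * q) - int (m * q + n * p)" by (simp add: a b algebra_simps)
    then have "zmul (a * b) x = c (m * p + n * q) x - c (m * q + n * p) x" by (simp only: zc)
    then show "zmul a (zmul b x) = zmul (a * b) x" by (simp add: a b zc c_add c_diff c_mult)
    show "zmul 1 x = x" using zc[of 1 0 x] by (simp add: c_simps)
  qed
qed

interpretation zmul: Modules.module "zmul :: int \<Rightarrow> 'a::ab_group_add \<Rightarrow> 'a"
  by (rule zmul_module)

lemma zmul_of_nat_Suc: "zmul (int (Suc n)) x = x + zmul (int n) x"
  by (simp add: zmul.scale_left_distrib)

lemma additive_zmul:
  assumes "\<And>x y. f (x + y) = f x + (f y :: 'b::ab_group_add)"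
  shows "f (zmul k x) = zmul k (f (x :: 'a::ab_group_add))"
proof -
  have f0: "f 0 = 0" using assms[of 0 0] by simp
  have fm: "f (- y) = - f y" for y using assms[of y "- y"] by (simp add: f0 eq_neg_iff_add_eq_0 add.commute)
  have n: "f (zmul (int n) y) = zmul (int n) (f y)" for n y
    by (induction n) (simp_all only: of_nat_0 zmul.scale_zero_left f0 zmul_of_nat_Suc assms)
  show ?thesis
  proof (cases k rule: int_cases2)
    case (nonneg n) then show ?thesis using n by simp
  next
    case (nonpos n) then show ?thesis using n fm by simp
  qed
qed

lemma add_subgroup_zmul:
  assumes "add_subgroup N" "x \<in> N"
  shows "zmul k x \<in> N"
proof -
  have n: "zmul (int n) x \<in> N" for n
    by (induction n) (simp_all only: of_nat_0 zmul.scale_zero_left add_subgroup_zero assms zmul_of_nat_Suc add_subgroup_add)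
  show ?thesis
  proof (cases k rule: int_cases2)
    case (nonneg n) then show ?thesis using n by simp
  next
    case (nonpos n) then show ?thesis using n add_subgroup_minus[OF assms(1)] by simp
  qed
qed

lemma int_subgroup_cyclic:
  assumes "add_subgroup (I :: int set)"
  obtains d where "d \<ge> 0" "I = {k. d dvd k}"
proof (cases "\<exists>k\<in>I. k > 0")
  case False
  have "k = 0" if "k \<in> I" for k
    using False that add_subgroup_minus[OF assms that] by (metis neg_0_less_iff_less linorder_neqE)
  then have "I = {k. 0 dvd k}" using add_subgroup_zero[OF assms] by auto
  then show ?thesis using that[of 0] by simp
next
  case True
  define n where "n = (LEAST n. n > 0 \<and> int n \<in> I)"
  have ex: "\<exists>n::nat. n > 0 \<and> int n \<in> I" using True by (metis pos_int_cases)
  have n: "n > 0" "int n \<in> I" using LeastI_ex[OF ex] by (auto simp: n_def)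
  have n_le: "m > 0 \<and> int m \<in> I \<Longrightarrow> n \<le> m" for m unfolding n_def by (rule Least_le)
  have mult: "int n * k \<in> I" for k
  proof -
    have "zmul k (int n) = k * int n" for k :: int
    proof (cases k rule: int_cases2)
      case (nonneg m) then show ?thesis by (simp add: zmul_def)
    next
      case (nonpos m) then show ?thesis by (simp add: zmul_def)
    qed
    then show ?thesis using add_subgroup_zmul[OF assms n(2), of k] by (simp add: mult.commute)
  qed
  have "int n dvd k" if k: "k \<in> I" for k
  proof (rule ccontr)
    assume "\<not> int n dvd k"
    then have "k mod int n \<noteq> 0" by (metis mod_0_imp_dvd)
    moreover have "k mod int n \<ge> 0" by (rule pos_mod_sign) (use n(1) in simp)
    ultimately have "k mod int n > 0" by linarith
    moreover have "k mod int n \<in> I"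
      using add_subgroup_diff[OF assms k mult[of "k div int n"]] by (simp add: minus_mult_div_eq_mod)
    ultimately have "nat (k mod int n) > 0 \<and> int (nat (k mod int n)) \<in> I" by simp
    then have "n \<le> nat (k mod int n)" by (rule n_le)
    then have "int n \<le> k mod int n" using n(1) by simp
    moreover have "k mod int n < int n" by (rule pos_mod_bound) (use n(1) in simp)
    ultimately show False by (rule leD[THEN notE])
  qed
  then have "I = {k. int n dvd k}" using mult by (auto elim: dvdE)
  then show ?thesis using that[of "int n"] by simp
qed

definition sumset :: "'a::ab_group_add set \<Rightarrow> 'a set \<Rightarrow> 'a set" where
  "sumset A C = {a + c | a c. a \<in> A \<and> c \<in> C}"

lemma sumset_add_subgroup:
  assumes "add_subgroup A" "add_subgroup C"
  shows "add_subgroup (sumset A C)" "A \<subseteq> sumset A C" "C \<subseteq> sumset A C"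
proof -
  note z = add_subgroup_zero[OF assms(1)] add_subgroup_zero[OF assms(2)]
  show "A \<subseteq> sumset A C" "C \<subseteq> sumset A C" using z by (force simp: sumset_def)+
  have "x - y \<in> sumset A C" if xy: "x \<in> sumset A C" "y \<in> sumset A C" for x y
  proof -
    obtain a c a' c' where "x = a + c" "y = a' + c'" "a \<in> A" "c \<in> C" "a' \<in> A" "c' \<in> C"
      using xy by (auto simp: sumset_def)
    then have "x - y = (a - a') + (c - c')" "a - a' \<in> A" "c - c' \<in> C" using assms by (auto simp: add_subgroup_diff)
    then show ?thesis unfolding sumset_def by blast
  qed
  then show "add_subgroup (sumset A C)" using z \<open>A \<subseteq> sumset A C\<close> by (auto simp: add_subgroup_def)
qed

lemma sumset_subset:
  "add_subgroup N \<Longrightarrow> A \<subseteq> N \<Longrightarrow> C \<subseteq> N \<Longrightarrow> sumset A C \<subseteq> N"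
  using add_subgroup_add[of N] by (auto simp: sumset_def)

lemma add_subgroup_range_zmul: "add_subgroup (range (\<lambda>k. zmul k x))"
  unfolding add_subgroup_def
proof (intro conjI ballI)
  show "0 \<in> range (\<lambda>k. zmul k x)" using zmul.scale_zero_left[of x] by (metis rangeI)
  fix y z assume "y \<in> range (\<lambda>k. zmul k x)" "z \<in> range (\<lambda>k. zmul k x)"
  then show "y - z \<in> range (\<lambda>k. zmul k x)" by (auto simp flip: zmul.scale_left_diff_distrib)
qed

primrec span_over :: "'a::ab_group_add set \<Rightarrow> 'a list \<Rightarrow> 'a set" where
  "span_over B [] = B"
| "span_over B (x # xs) = sumset (span_over B xs) (range (\<lambda>k. zmul k x))"

lemma span_over_subgroup:
  assumes "add_subgroup B"
  shows "add_subgroup (span_over B xs)" "B \<subseteq> span_over B xs" "set xs \<subseteq> span_over B xs"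
proof (induction xs)
  case (Cons x xs)
  note s = sumset_add_subgroup[OF Cons(1) add_subgroup_range_zmul[of x]]
  { case 1 show ?case using s by simp }
  { case 2 show ?case using s Cons by auto }
  { case 3
    have "x \<in> range (\<lambda>k. zmul k x)" using zmul.scale_one[of x] by (metis rangeI)
    then show ?case using s Cons by auto }
qed (use assms in auto)

lemma span_over_subset:
  assumes "add_subgroup N" "B \<subseteq> N" "set xs \<subseteq> N"
  shows "span_over B xs \<subseteq> N"
  using assms
proof (induction xs)
  case (Cons x xs)
  then have "range (\<lambda>k. zmul k x) \<subseteq> N" using add_subgroup_zmul[OF Cons(2)] by auto
  then show ?case using Cons sumset_subset[OF Cons(2)] by simp
qed auto

text \<open>Finiteness of \<open>A\<close> modulo \<open>B\<close> through a finite set of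
  representatives, which may lie outside \<open>A\<close>.\<close>

definition finite_mod :: "'a::ab_group_add set \<Rightarrow> 'a set \<Rightarrow> bool" where
  "finite_mod B A \<longleftrightarrow> (\<exists>C. finite C \<and> (\<forall>x\<in>A. \<exists>c\<in>C. x - c \<in> B))"

lemma finite_mod_self: "add_subgroup B \<Longrightarrow> finite_mod B B"
  unfolding finite_mod_def by (intro exI[of _ "{0}"]) auto

lemma finite_mod_subset: "finite_mod B A \<Longrightarrow> A' \<subseteq> A \<Longrightarrow> finite_mod B A'"
  unfolding finite_mod_def by blast

lemma finite_mod_pigeonhole:
  assumes "add_subgroup B" "finite_mod B A" "\<And>n::nat. f n \<in> A"
  obtains m n where "m < n" "f n - f m \<in> B"
proof -
  obtain C where C: "finite C" "\<And>x. x \<in> A \<Longrightarrow> \<exists>c\<in>C. x - c \<in> B" using assms(2) by (auto simp: finite_mod_def)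
  have "\<forall>n. \<exists>c. c \<in> C \<and> f n - c \<in> B" using C(2)[OF assms(3)] by blast
  then obtain h where h: "\<And>n. h n \<in> C \<and> f n - h n \<in> B" by metis
  have "\<not> inj h" using C(1) h by (meson finite_subset finite_imageD image_subsetI infinite_UNIV_nat)
  then obtain m n where mn: "h m = h n" "m \<noteq> n" by (auto simp: inj_def)
  have d: "f n - f m \<in> B" if "h m = h n" for m n
    using add_subgroup_diff[OF assms(1), of "f n - h n" "f m - h m"] h[of n] h[of m] that by simp
  show ?thesis
    using that[of m n] that[of n m] d[OF mn(1)] d[OF mn(1)[symmetric]] mn(2) by (meson linorder_neqE_nat)
qed

lemma finite_mod_extend:
  assumes B: "add_subgroup B" and N: "finite_mod B N" and p: "p > 0" "zmul p x \<in> B"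
  shows "finite_mod B (sumset N (range (\<lambda>k. zmul k x)))"
proof -
  obtain C where C: "finite C" "\<And>y. y \<in> N \<Longrightarrow> \<exists>c\<in>C. y - c \<in> B" using N by (auto simp: finite_mod_def)
  have "\<exists>d\<in>(\<lambda>(c, i). c + zmul i x) ` (C \<times> {0..<p}). y - d \<in> B" if "y \<in> sumset N (range (\<lambda>k. zmul k x))" for y
  proof -
    obtain z k where y: "y = z + zmul k x" "z \<in> N" using \<open>y \<in> _\<close> by (auto simp: sumset_def)
    obtain c where c: "c \<in> C" "z - c \<in> B" using C y by blast
    have "zmul k x - zmul (k mod p) x = zmul (k - k mod p) x" by (simp add: zmul.scale_left_diff_distrib)
    also have "\<dots> = zmul (k div p) (zmul p x)" by (simp add: minus_mod_eq_mult_div mult.commute)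
    finally have "zmul k x - zmul (k mod p) x \<in> B" using add_subgroup_zmul[OF B p(2)] by simp
    then have "(z - c) + (zmul k x - zmul (k mod p) x) \<in> B" using add_subgroup_add[OF B c(2)] by blast
    then have "y - (c + zmul (k mod p) x) \<in> B" by (simp add: y algebra_simps)
    moreover have "(c, k mod p) \<in> C \<times> {0..<p}" using c p by simp
    ultimately show ?thesis by force
  qed
  then show ?thesis unfolding finite_mod_def using C(1) by (intro exI[of _ "(\<lambda>(c, i). c + zmul i x) ` (C \<times> {0..<p})"]) auto
qed

lemma finite_mod_span_over:
  assumes B: "add_subgroup B" and N: "add_subgroup N" "finite_mod B N" and p: "p > 0" "\<And>x. x \<in> set xs \<Longrightarrow> zmul p x \<in> B"
  shows "finite_mod B (span_over N xs)"
  using p(2)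
proof (induction xs)
  case (Cons x xs)
  then show ?case using finite_mod_extend[OF B _ p(1)] by auto
qed (use N in auto)

section \<open>Finitely generated modules are Noetherian\<close>

context group_rep begin

text \<open>The chains \<open>N n \<inter> A\<close> and \<open>N n + A\<close> both stabilize, and
  by the modular law they determine \<open>N n\<close>.\<close>

lemma noetherian_between_trans:
  assumes "noetherian_between K B A" "noetherian_between K A C" "invariant_subgroup K A" "B \<subseteq> A" "A \<subseteq> C"
    "add_subgroup C" "K \<subseteq> carrier G"
  shows "noetherian_between K B C"
  unfolding noetherian_between_def
proof (intro allI impI)
  fix N :: "nat \<Rightarrow> 'a set"
  assume "(\<forall>n. invariant_subgroup K (N n) \<and> B \<subseteq> N n \<and> N n \<subseteq> C) \<and> (\<forall>n. N n \<subseteq> N (Suc n))"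
  then have N: "invariant_subgroup K (N n)" "B \<subseteq> N n" "N n \<subseteq> C" "N n \<subseteq> N (Suc n)" for n by auto
  note asA = invariant_add_subgroup[OF assms(3)] and asN = invariant_add_subgroup[OF N(1)]
  have Nmono: "m \<le> n \<Longrightarrow> N m \<subseteq> N n" for m n using lift_Suc_mono_le[of N] N(4) by blast
  have "\<exists>n. \<forall>m\<ge>n. N m \<inter> A = N n \<inter> A"
    by (rule noetherian_between_stable[OF assms(1)]) (use invariant_Int[OF N(1) assms(3)] N(2,4) assms(4) in blast)+
  then obtain n1 where n1: "\<And>m. m \<ge> n1 \<Longrightarrow> N m \<inter> A = N n1 \<inter> A" by blast
  have "\<exists>n. \<forall>m\<ge>n. sumset (N m) A = sumset (N n) A"
  proof (rule noetherian_between_stable[OF assms(2)])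
    fix n
    show "A \<subseteq> sumset (N n) A" "sumset (N n) A \<subseteq> C" "sumset (N n) A \<subseteq> sumset (N (Suc n)) A"
      using sumset_add_subgroup[OF asN[of n] asA] sumset_subset[OF assms(6) N(3) assms(5)] N(4)[of n]
      by (simp_all add: sumset_def) blast
    show "invariant_subgroup K (sumset (N n) A)"
      unfolding invariant_subgroup_def
    proof (intro conjI ballI)
      show "add_subgroup (sumset (N n) A)" by (rule sumset_add_subgroup[OF asN asA])
      fix k x assume k: "k \<in> K" "x \<in> sumset (N n) A"
      then obtain y a where "x = y + a" "y \<in> N n" "a \<in> A" by (auto simp: sumset_def)
      then have "\<rho> k x = \<rho> k y + \<rho> k a" "\<rho> k y \<in> N n" "\<rho> k a \<in> A"
        using k(1) assms(7) rep_add invariant_rep[OF N(1) k(1)] invariant_rep[OF assms(3) k(1)] by auto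
      then show "\<rho> k x \<in> sumset (N n) A" unfolding sumset_def by blast
    qed
  qed
  then obtain n2 where n2: "\<And>m. m \<ge> n2 \<Longrightarrow> sumset (N m) A = sumset (N n2) A" by blast
  have "N m = N (max n1 n2)" if m: "m \<ge> max n1 n2" for m
  proof (rule antisym)
    show "N (max n1 n2) \<subseteq> N m" using Nmono m by blast
    show "N m \<subseteq> N (max n1 n2)"
    proof
      fix x assume x: "x \<in> N m"
      then have "x \<in> sumset (N m) A" using sumset_add_subgroup[OF asN asA] by blast
      then have "x \<in> sumset (N (max n1 n2)) A" using n2[of m] n2[of "max n1 n2"] m by simp
      then obtain y a where xy: "x = y + a" "y \<in> N (max n1 n2)" "a \<in> A" by (auto simp: sumset_def)
      then have "a \<in> N m" using add_subgroup_cancel(2)[OF asN] x Nmono[OF m] by blast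
      then have "a \<in> N (max n1 n2)" using n1[of m] n1[of "max n1 n2"] m xy(3) by auto
      then show "x \<in> N (max n1 n2)" using xy add_subgroup_add[OF asN] by blast
    qed
  qed
  then show "\<exists>n. \<forall>m\<ge>n. N m = N n" by blast
qed

text \<open>A subgroup between \<open>B\<close> and \<open>B + Z x\<close> is determined by the
  ideal of integers \<open>k\<close> for which it contains \<open>zmul k x\<close>.\<close>

lemma noetherian_between_cyclic:
  assumes B: "add_subgroup B"
  shows "noetherian_between K B (sumset B (range (\<lambda>k. zmul k x)))"
  unfolding noetherian_between_def
proof (intro allI impI)
  let ?C = "sumset B (range (\<lambda>k. zmul k x))"
  fix N :: "nat \<Rightarrow> 'a set"
  assume "(\<forall>n. invariant_subgroup K (N n) \<and> B \<subseteq> N n \<and> N n \<subseteq> ?C) \<and> (\<forall>n. N n \<subseteq> N (Suc n))"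
  then have N: "add_subgroup (N n)" "B \<subseteq> N n" "N n \<subseteq> ?C" "N n \<subseteq> N (Suc n)" for n by (auto simp: invariant_subgroup_def)
  have Nmono: "m \<le> n \<Longrightarrow> N m \<subseteq> N n" for m n using lift_Suc_mono_le[of N] N(4) by blast
  define I where "I n = {k. zmul k x \<in> N n}" for n
  have "add_subgroup (I n)" for n
    using N(1)[of n] by (simp add: add_subgroup_def I_def zmul.scale_left_diff_distrib)
  then have "\<exists>d\<ge>0. I n = {k. d dvd k}" for n by (metis int_subgroup_cyclic)
  then obtain d where d: "\<And>n. d n \<ge> 0" "\<And>n. I n = {k. d n dvd k}" by metis
  have Imono: "m \<le> n \<Longrightarrow> I m \<subseteq> I n" for m n using Nmono by (auto simp: I_def)
  have Ieq: "N m = N n" if "I m = I n" for m n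
  proof -
    have "N m \<subseteq> N n" if "I m = I n" for m n
    proof
      fix y assume y: "y \<in> N m"
      then obtain b k where yb: "y = b + zmul k x" "b \<in> B" using N(3)[of m] by (auto simp: sumset_def)
      then have "k \<in> I m" using y add_subgroup_cancel(2)[OF N(1), of b m] N(2) by (auto simp: I_def)
      then have "zmul k x \<in> N n" using that by (auto simp: I_def)
      then show "y \<in> N n" using yb N(2)[of n] add_subgroup_add[OF N(1)] by blast
    qed
    then show ?thesis using that by blast
  qed
  show "\<exists>n. \<forall>m\<ge>n. N m = N n"
  proof (cases "\<exists>n. d n \<noteq> 0")
    case False
    then have "I m = I 0" for m using d(2) by simp
    then show ?thesis using Ieq by blast
  next
    case True
    \<comment> \<open>A generator of least nonzero size; all later generators divide it and hence
      equal it.\<close>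
    define n where "n = arg_min (\<lambda>n. nat (d n)) (\<lambda>n. d n \<noteq> 0)"
    have n: "d n \<noteq> 0" "\<And>m. d m \<noteq> 0 \<Longrightarrow> nat (d n) \<le> nat (d m)"
      using True arg_min_natI[of "\<lambda>n. d n \<noteq> 0"] arg_min_nat_le[of "\<lambda>n. d n \<noteq> 0" _ "\<lambda>n. nat (d n)"]
      unfolding n_def by blast+
    have "I m = I n" if m: "m \<ge> n" for m
    proof -
      have dv: "d m dvd d n" using Imono[OF m] d(2)[of n] d(2)[of m] by auto
      then have "d m \<noteq> 0" using n(1) by auto
      moreover have "d m \<le> d n" using dv d(1)[of n] n(1) by (simp add: zdvd_imp_le)
      ultimately have "d m = d n" using n(2)[of m] d(1)[of m] d(1)[of n] by linarith
      then show ?thesis using d(2) by simp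
    qed
    then show ?thesis using Ieq by blast
  qed
qed

lemma noetherian_between_span_over:
  assumes B: "add_subgroup B"
  shows "noetherian_between {} B (span_over B xs)"
proof (induction xs)
  case Nil
  show ?case unfolding noetherian_between_def span_over.simps by (metis subset_antisym)
next
  case (Cons x xs)
  note s = span_over_subgroup[OF B, of xs] and s' = span_over_subgroup[OF B, of "x # xs"]
  show ?case
    by (rule noetherian_between_trans[OF Cons])
      (use s s' noetherian_between_cyclic[OF s(1)] sumset_add_subgroup(2)[OF s(1) add_subgroup_range_zmul] in \<open>auto simp: invariant_subgroup_def\<close>)
qed

definition generated :: "'a list \<Rightarrow> 'a set" where
  "generated xs = \<Inter>{N. invariant_subgroup (carrier G) N \<and> set xs \<subseteq> N}"

lemma generated_invariant: "invariant_subgroup (carrier G) (generated xs)"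
  and set_subset_generated: "set xs \<subseteq> generated xs"
  and generated_subset: "invariant_subgroup (carrier G) N \<Longrightarrow> set xs \<subseteq> N \<Longrightarrow> generated xs \<subseteq> N"
  by (auto simp: generated_def invariant_subgroup_def add_subgroup_def)

lemma zmul_scaled_group_rep:
  assumes "invariant_subgroup (carrier G) B" "invariant_subgroup (carrier G) W"
    "1 \<in> S" "\<And>r s. r \<in> S \<Longrightarrow> s \<in> S \<Longrightarrow> r * s \<in> S"
  shows "scaled_group_rep G \<rho> zmul S B W" "scaled_group_rep.sc_stable \<rho> zmul K"
proof -
  show *: "scaled_group_rep G \<rho> zmul S B W"
  proof
    show "zmul r (\<rho> g l) - \<rho> g (zmul r l) \<in> B" if "g \<in> carrier G" for r g l
      using additive_zmul[of "\<rho> g" r l] rep_add[OF that] add_subgroup_zero[OF invariant_add_subgroup[OF assms(1)]] by simp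
  qed (use assms in auto)
  then interpret scaled_group_rep G \<rho> zmul S B W .
  show "sc_stable K"
    unfolding sc_stable_def using invariant_add_subgroup add_subgroup_zmul by blast
qed

text \<open>With \<open>S = {1}\<close> the general theorem reduces to its Noetherian claim. The
  chain starts at the trivial subgroup, over which the integer span of the generators is already
  Noetherian.\<close>

theorem generated_noetherian:
  assumes "central_chain {\<one>} gs"
  shows "noetherian_between (carrier G) {0} (generated xs)"
proof -
  have B: "invariant_subgroup (carrier G) {0}" by (auto simp: invariant_subgroup_def add_subgroup_def rep_zero)
  interpret scaled_group_rep G \<rho> zmul "{1}" "{0}" "generated xs"
    by (rule zmul_scaled_group_rep(1)[OF B generated_invariant]) auto
  note asB = invariant_add_subgroup[OF B]
  have L: "span_over {0} xs \<subseteq> generated xs"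
    using span_over_subset[OF invariant_add_subgroup[OF generated_invariant]]
      add_subgroup_zero[OF invariant_add_subgroup[OF generated_invariant]] set_subset_generated by blast
  have "noetherian_between {\<one>} {0} (span_over {0} xs)"
    by (rule noetherian_between_mono[OF noetherian_between_span_over[OF asB]]) auto
  moreover have "invariant_subgroup {\<one>} (span_over {0} xs)"
    using span_over_subgroup(1)[OF asB] by (simp add: invariant_subgroup_def rep_one)
  moreover have "sc_stable {\<one>}" by (rule zmul_scaled_group_rep(2)[OF B generated_invariant]) auto
  ultimately obtain U s where U: "span_over {0} xs \<subseteq> U" "U \<subseteq> generated xs" "invariant_subgroup (carrier G) U"
    "noetherian_between (carrier G) {0} U"
    using central_chain_noetherian[OF one_is_normal assms, of "span_over {0} xs"] span_over_subgroup(2)[OF asB] L by metis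
  have "generated xs \<subseteq> U" using generated_subset[OF U(3)] span_over_subgroup(3)[OF asB] U(1) by blast
  then show ?thesis using U by (metis subset_antisym)
qed

end

section \<open>Integer polynomials in an additive map\<close>

definition poly_mul :: "('a::ab_group_add \<Rightarrow> 'a) \<Rightarrow> int poly \<Rightarrow> 'a \<Rightarrow> 'a" where
  "poly_mul T p = fold_coeffs (\<lambda>a f x. zmul a x + T (f x)) p (\<lambda>x. 0)"

locale additive_map =
  fixes T :: "'a::ab_group_add \<Rightarrow> 'a"
  assumes T_add: "T (x + y) = T x + T y"
begin

lemma T_zero: "T 0 = 0" using T_add[of 0 0] by simp

lemma T_minus: "T (- x) = - T x"
  using T_add[of x "- x"] by (simp add: T_zero eq_neg_iff_add_eq_0 add.commute)

lemma T_diff: "T (x - y) = T x - T y"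
  using T_add[of x "- y"] by (simp add: T_minus)

lemma T_zmul: "T (zmul k x) = zmul k (T x)"
  by (rule additive_zmul[OF T_add])

lemma funpow_add: "(T ^^ n) (x + y) = (T ^^ n) x + (T ^^ n) y"
  by (induction n) (simp_all add: T_add)

lemma funpow_diff: "(T ^^ n) (x - y) = (T ^^ n) x - (T ^^ n) y"
  by (induction n) (simp_all add: T_diff)

lemma poly_mul_0 [simp]: "poly_mul T 0 x = 0"
  by (simp add: poly_mul_def)

lemma poly_mul_pCons [simp]: "poly_mul T (pCons a p) x = zmul a x + T (poly_mul T p x)"
proof (cases "p = 0 \<and> a = 0")
  case True then show ?thesis by (simp add: T_zero)
next
  case False then show ?thesis by (auto simp: poly_mul_def)
qed

lemma poly_mul_add: "poly_mul T (p + q) x = poly_mul T p x + poly_mul T q x"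
proof (induction p arbitrary: q)
  case (pCons a p)
  obtain b q' where q: "q = pCons b q'" by (rule pCons_cases)
  show ?case by (simp add: q pCons zmul.scale_left_distrib T_add algebra_simps)
qed simp

lemma poly_mul_smult: "poly_mul T (Polynomial.smult a p) x = zmul a (poly_mul T p x)"
  by (induction p) (simp_all add: zmul.scale_right_distrib T_zmul)

lemma poly_mul_right_add: "poly_mul T p (x + y) = poly_mul T p x + poly_mul T p y"
  by (induction p) (simp_all add: zmul.scale_right_distrib T_add algebra_simps)

lemma poly_mul_module: "Modules.module (poly_mul T)"
proof
  fix p q x y
  show "poly_mul T p (x + y) = poly_mul T p x + poly_mul T p y" by (rule poly_mul_right_add)
  show "poly_mul T (p + q) x = poly_mul T p x + poly_mul T q x" by (rule poly_mul_add)
  show "poly_mul T p (poly_mul T q x) = poly_mul T (p * q) x"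
    by (induction p) (simp_all add: poly_mul_add poly_mul_smult)
  show "poly_mul T 1 x = x" by (simp add: one_pCons T_zero)
qed

lemma poly_mul_closed:
  assumes "add_subgroup N" "\<And>x. x \<in> N \<Longrightarrow> T x \<in> N" "x \<in> N"
  shows "poly_mul T p x \<in> N"
  by (induction p)
    (use assms(2) add_subgroup_zmul[OF assms(1,3)] add_subgroup_zero[OF assms(1)] add_subgroup_add[OF assms(1)] in auto)

lemma poly_mul_monom: "poly_mul T (monom 1 k) x = (T ^^ k) x"
  by (induction k) (simp_all add: monom_0 monom_Suc T_zero)

lemma poly_mul_commute:
  "poly_mul T p (T x) = T (poly_mul T p x)"
  by (induction p) (simp_all add: T_zero T_add T_zmul)

lemma poly_mul_funpow: "poly_mul T p ((T ^^ k) x) = (T ^^ k) (poly_mul T p x)"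
  by (induction k) (simp_all add: poly_mul_commute)

lemma poly_mul_eq_sum:
  assumes "degree p < n"
  shows "poly_mul T p x = (\<Sum>i<n. zmul (coeff p i) ((T ^^ i) x))"
  using assms
proof (induction p arbitrary: n)
  case (pCons a p)
  have Tsum: "T (sum f A) = (\<Sum>i\<in>A. T (f i))" if "finite A" for f and A :: "nat set"
    using that by (induction A) (auto simp: T_zero T_add)
  obtain m where n: "n = Suc m" using pCons.prems by (cases n) auto
  show ?case
  proof (cases "p = 0")
    case True
    have "(\<Sum>i<m. zmul (coeff (pCons a p) (Suc i)) ((T ^^ Suc i) x)) = 0" by (simp add: True)
    then show ?thesis unfolding n sum.lessThan_Suc_shift by (simp add: True T_zero)
  next
    case False
    then have "degree p < m" using pCons.prems n by simp
    then show ?thesis unfolding n sum.lessThan_Suc_shift using pCons.IH by (simp add: Tsum T_zmul)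
  qed
qed simp

text \<open>If \<open>q\<close> is not divisible by \<open>p\<close> and annihilates \<open>w\<close> modulo \<open>B\<close>, then the top coefficient
  prime to \<open>p\<close> puts the orbit of \<open>w\<close> under \<open>T\<close> into finitely many classes modulo \<open>B\<close>.\<close>

lemma finite_order_of_annihilator:
  assumes B: "add_subgroup B" "\<And>x. x \<in> B \<Longrightarrow> T x \<in> B"
    and p: "prime (p::int)" "zmul p w \<in> B" and q: "poly_mul T q w \<in> B" "\<not> p dvd coeff q i"
  obtains m n where "m < n" "(T ^^ n) w - (T ^^ m) w \<in> B"
proof -
  have ex: "\<exists>i. \<not> p dvd coeff q i" using q(2) by blast
  have bd: "\<forall>i. \<not> p dvd coeff q i \<longrightarrow> i \<le> degree q" by (metis coeff_eq_0 dvd_0_right not_le)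
  define d where "d = (GREATEST i. \<not> p dvd coeff q i)"
  have d: "\<not> p dvd coeff q d" unfolding d_def by (rule GreatestI_ex_nat[OF ex bd[rule_format]])
  have d_max: "p dvd coeff q j" if "j > d" for j
    using Greatest_le_nat[of "\<lambda>i. \<not> p dvd coeff q i" j "degree q"] bd that unfolding d_def by fastforce
  have TB: "(T ^^ j) x \<in> B" if "x \<in> B" for x j by (induction j) (use that B in auto)
  have pT: "zmul p ((T ^^ j) w) \<in> B" for j
    using TB[OF p(2), of j] additive_zmul[of "T ^^ j" p w] funpow_add by simp
  define V where "V = span_over B (map (\<lambda>j. (T ^^ j) w) [0..<d])"
  note V = span_over_subgroup[OF B(1), of "map (\<lambda>j. (T ^^ j) w) [0..<d]", folded V_def]
  have low: "(T ^^ j) w \<in> V" if "j < d" for j using V(3) that by force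
  have sumV: "sum f A \<in> V" if "\<And>j. j \<in> A \<Longrightarrow> f j \<in> V" for f and A :: "nat set"
    using that by (induction A rule: infinite_finite_induct) (use add_subgroup_zero[OF V(1)] add_subgroup_add[OF V(1)] in auto)
  have top: "(T ^^ d) w \<in> V"
  proof -
    have dq: "d \<le> degree q" using bd d by blast
    define f where "f j = zmul (coeff q j) ((T ^^ j) w)" for j
    have "poly_mul T q w = (\<Sum>j<Suc (degree q). f j)" unfolding f_def by (rule poly_mul_eq_sum) simp
    also have "\<dots> = f d + (\<Sum>j\<in>{..<Suc (degree q)} - {d}. f j)" using dq by (intro sum.remove) auto
    finally have "f d + (\<Sum>j\<in>{..<Suc (degree q)} - {d}. f j) \<in> V" using q(1) V(2) by auto
    moreover have "(\<Sum>j\<in>{..<Suc (degree q)} - {d}. f j) \<in> V"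
    proof (rule sumV)
      fix j assume j: "j \<in> {..<Suc (degree q)} - {d}"
      show "f j \<in> V"
      proof (cases "j < d")
        case True then show ?thesis unfolding f_def using low add_subgroup_zmul[OF V(1)] by blast
      next
        case False
        then obtain c where "coeff q j = p * c" using d_max[of j] j by (auto elim: dvdE)
        then have "f j = zmul c (zmul p ((T ^^ j) w))" by (simp add: f_def mult.commute)
        then show ?thesis using add_subgroup_zmul[OF B(1) pT] V(2) by auto
      qed
    qed
    ultimately have fd: "f d \<in> V" using add_subgroup_cancel(1)[OF V(1)] by blast
    \<comment> \<open>The coefficient at \<open>d\<close> is invertible modulo \<open>p\<close>, and
      \<open>p\<close> kills the orbit modulo \<open>B\<close>; so \<open>(T ^^ d) w\<close> itself,
      not only its multiple \<open>f d\<close>, lies in \<open>V\<close>.\<close>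
    have "coprime p (coeff q d)" using p(1) d by (simp add: prime_imp_coprime)
    then obtain u v where uv: "u * p + v * coeff q d = 1" using bezout_int[of p "coeff q d"] by auto
    then have "(T ^^ d) w = zmul (u * p + v * coeff q d) ((T ^^ d) w)" by simp
    also have "\<dots> = zmul u (zmul p ((T ^^ d) w)) + zmul v (f d)"
      by (simp only: zmul.scale_left_distrib f_def zmul.scale_scale)
    also have "\<dots> \<in> V"
      using V(2) pT[of d] by (intro add_subgroup_add[OF V(1)] add_subgroup_zmul[OF V(1) fd] add_subgroup_zmul[OF V(1), of "zmul p ((T ^^ d) w)"]) auto
    finally show ?thesis .
  qed
  have TV: "T y \<in> V" if "y \<in> V" for y
  proof -
    have "V \<subseteq> {y. T y \<in> V}"
      unfolding V_def
    proof (rule span_over_subset)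
      show "add_subgroup {y. T y \<in> span_over B (map (\<lambda>j. (T ^^ j) w) [0..<d])}"
        using V(1) unfolding V_def by (auto simp: add_subgroup_def T_zero T_diff)
      show "B \<subseteq> {y. T y \<in> span_over B (map (\<lambda>j. (T ^^ j) w) [0..<d])}" using B(2) V(2) unfolding V_def by auto
      have "T ((T ^^ j) w) \<in> V" if "j < d" for j
        using low[of "Suc j"] top that by (cases "Suc j = d") auto
      then show "set (map (\<lambda>j. (T ^^ j) w) [0..<d]) \<subseteq> {y. T y \<in> span_over B (map (\<lambda>j. (T ^^ j) w) [0..<d])}"
        by (auto simp: V_def)
    qed
    then show ?thesis using that by blast
  qed
  have "(T ^^ (n + d)) w \<in> V" for n by (induction n) (use top TV in auto)
  moreover have "finite_mod B V"
    unfolding V_def using pT prime_gt_0_int[OF p(1)]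
    by (intro finite_mod_span_over[OF B(1) B(1) finite_mod_self[OF B(1)]]) auto
  ultimately obtain m n where "m < n" "(T ^^ (n + d)) w - (T ^^ (m + d)) w \<in> B"
    using finite_mod_pigeonhole[OF B(1), of V "\<lambda>n. (T ^^ (n + d)) w"] by blast
  then show ?thesis using that[of "m + d" "n + d"] by simp
qed

end

text \<open>Over the field with \<open>p\<close> elements \<open>1 + x s\<close> has constant term 1
  and positive degree, so it divides no power of \<open>x\<close>. The proof compares the highest
  and the lowest nonzero terms of its product with \<open>b\<close>.\<close>

lemma not_unit_mod_prime:
  assumes p: "prime (p::int)" and s: "\<not> p dvd coeff s i"
  shows "\<exists>j. \<not> p dvd coeff (monom 1 k - pCons 1 s * b) j"
proof (rule ccontr)
  assume "\<not> ?thesis"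
  then have H: "p dvd coeff (monom 1 k) j - coeff (pCons 1 s * b) j" for j by (metis coeff_diff)
  define a where "a = pCons 1 s"
  have H1: "p dvd coeff (a * b) j \<longleftrightarrow> j \<noteq> k" for j
  proof -
    have "p dvd coeff (a * b) j \<longleftrightarrow> p dvd (coeff (monom 1 k) j :: int)"
      using H[of j] unfolding a_def by (metis dvd_diff_right_iff dvd_diff_left_iff)
    moreover have "\<not> p dvd 1" using p not_prime_unit by blast
    ultimately show ?thesis by auto
  qed
  have top: "\<exists>d. \<not> p dvd coeff f d \<and> (\<forall>j>d. p dvd coeff f j)" if "\<not> p dvd coeff f j0" for f :: "int poly" and j0
  proof -
    have bd: "\<And>i. \<not> p dvd coeff f i \<Longrightarrow> i \<le> degree f" by (metis coeff_eq_0 dvd_0_right not_le)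
    let ?d = "GREATEST i. \<not> p dvd coeff f i"
    have "\<not> p dvd coeff f ?d" using GreatestI_nat[of "\<lambda>i. \<not> p dvd coeff f i", OF that bd] by blast
    moreover have "p dvd coeff f j" if "j > ?d" for j
      using Greatest_le_nat[of "\<lambda>i. \<not> p dvd coeff f i" j "degree f"] bd that by fastforce
    ultimately show ?thesis by blast
  qed
  obtain d where d: "\<not> p dvd coeff a d" "\<And>j. j > d \<Longrightarrow> p dvd coeff a j"
    using top[of a "Suc i"] s by (auto simp: a_def)
  have d0: "d > 0" using d(2)[of "Suc i"] s by (cases d) (auto simp: a_def)
  obtain j0 where j0: "\<not> p dvd coeff b j0"
  proof (rule ccontr)
    assume "\<not> thesis"
    then have "p dvd coeff b j" for j using that by blast
    then have "p dvd coeff (a * b) k" by (auto simp: coeff_mult intro!: dvd_sum)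
    then show False using H1 by blast
  qed
  then obtain e where e: "\<not> p dvd coeff b e" "\<And>j. j > e \<Longrightarrow> p dvd coeff b j" using top by blast
  define m where "m = (LEAST j. \<not> p dvd coeff b j)"
  have m: "\<not> p dvd coeff b m" "\<And>j. j < m \<Longrightarrow> p dvd coeff b j"
    unfolding m_def using LeastI[of "\<lambda>j. \<not> p dvd coeff b j", OF j0] not_less_Least by blast+
  have "p dvd coeff (a * b) (d + e) - coeff a d * coeff b e"
  proof -
    have "coeff (a * b) (d + e) = (\<Sum>i\<le>d + e. coeff a i * coeff b (d + e - i))" by (rule coeff_mult)
    also have "\<dots> = coeff a d * coeff b e + (\<Sum>i\<in>{..d + e} - {d}. coeff a i * coeff b (d + e - i))"
      by (subst sum.remove[of _ d]) auto
    finally have "coeff (a * b) (d + e) - coeff a d * coeff b e = (\<Sum>i\<in>{..d + e} - {d}. coeff a i * coeff b (d + e - i))"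
      by simp
    also have "p dvd \<dots>"
    proof (rule dvd_sum)
      fix i assume "i \<in> {..d + e} - {d}"
      then have "i > d \<or> d + e - i > e" by auto
      then show "p dvd coeff a i * coeff b (d + e - i)" using d(2) e(2) by auto
    qed
    finally show ?thesis .
  qed
  moreover have "\<not> p dvd coeff a d * coeff b e" using d(1) e(1) p prime_dvd_mult_iff by blast
  ultimately have "\<not> p dvd coeff (a * b) (d + e)" by (metis dvd_diff_right_iff dvd_diff_left_iff)
  then have k1: "d + e = k" using H1 by blast
  have "p dvd coeff (a * b) m - coeff b m"
  proof -
    have "coeff (a * b) m = (\<Sum>i\<le>m. coeff a i * coeff b (m - i))" by (rule coeff_mult)
    also have "\<dots> = coeff b m + (\<Sum>i\<in>{..m} - {0}. coeff a i * coeff b (m - i))"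
      by (subst sum.remove[of _ 0]) (auto simp: a_def)
    finally have "coeff (a * b) m - coeff b m = (\<Sum>i\<in>{..m} - {0}. coeff a i * coeff b (m - i))" by simp
    also have "p dvd \<dots>" by (rule dvd_sum) (use m(2) in auto)
    finally show ?thesis .
  qed
  then have "\<not> p dvd coeff (a * b) m" using m(1) by (metis dvd_diff_right_iff dvd_diff_left_iff)
  then have "m = k" using H1 by blast
  moreover have "m \<le> e" unfolding m_def by (rule Least_le) (rule e(1))
  ultimately show False using k1 d0 by simp
qed

subsection \<open>Residual finiteness\<close>

text \<open>The monolith is represented by a single nonzero element \<open>w\<close> of it modulo
  \<open>B\<close>.\<close>

locale monolithic = group_rep G \<rho> for G :: "('g, 'm) monoid_scheme" (structure)
    and \<rho> :: "'g \<Rightarrow> 'a::ab_group_add \<Rightarrow> 'a" +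
  fixes B W :: "'a set" and w :: 'a
  assumes inv_B: "invariant_subgroup (carrier G) B" and inv_W: "invariant_subgroup (carrier G) W"
    and B_W: "B \<subseteq> W" and w_W: "w \<in> W" and w_B: "w \<notin> B"
    and essential: "invariant_subgroup (carrier G) N \<Longrightarrow> B \<subseteq> N \<Longrightarrow> N \<subseteq> W \<Longrightarrow> N \<noteq> B \<Longrightarrow> w \<in> N"
begin

lemmas asB = invariant_add_subgroup[OF inv_B] and asW = invariant_add_subgroup[OF inv_W]

text \<open>An endomorphism of \<open>W\<close> modulo \<open>B\<close> is given by an additive map
  \<open>c\<close> that commutes with the group up to \<open>B\<close>. This lemma supplies its
  kernel, and \<open>image_invariant\<close> its image, as submodules.\<close>

lemma preimage_invariant:
  assumes c: "additive_map c" "\<And>x. x \<in> B \<Longrightarrow> c x \<in> B" "\<And>g x. g \<in> carrier G \<Longrightarrow> x \<in> W \<Longrightarrow> c (\<rho> g x) - \<rho> g (c x) \<in> B"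
    and N: "invariant_subgroup (carrier G) N" "B \<subseteq> N" "N \<subseteq> W"
  shows "invariant_subgroup (carrier G) {x \<in> W. c x \<in> N}" "B \<subseteq> {x \<in> W. c x \<in> N}"
proof -
  interpret c: additive_map c by (rule c(1))
  note asN = invariant_add_subgroup[OF N(1)]
  show "B \<subseteq> {x \<in> W. c x \<in> N}" using B_W c(2) N(2) by auto
  show "invariant_subgroup (carrier G) {x \<in> W. c x \<in> N}"
    unfolding invariant_subgroup_def add_subgroup_def
  proof (intro conjI ballI)
    show "0 \<in> {x \<in> W. c x \<in> N}" using add_subgroup_zero[OF asW] add_subgroup_zero[OF asN] by (simp add: c.T_zero)
    fix x assume x: "x \<in> {x \<in> W. c x \<in> N}"
    show "x - y \<in> {x \<in> W. c x \<in> N}" if "y \<in> {x \<in> W. c x \<in> N}" for y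
      using x that add_subgroup_diff[OF asW] add_subgroup_diff[OF asN] by (simp add: c.T_diff)
    fix g assume g: "g \<in> carrier G"
    have "\<rho> g (c x) \<in> N" using x invariant_rep[OF N(1) g] by simp
    moreover have "c (\<rho> g x) - \<rho> g (c x) \<in> N" using c(3)[OF g] x N(2) by blast
    ultimately have "c (\<rho> g x) \<in> N" using add_subgroup_congruent[OF asN] by blast
    then show "\<rho> g x \<in> {x \<in> W. c x \<in> N}" using x invariant_rep[OF inv_W g] by simp
  qed
qed

lemma image_invariant:
  assumes c: "additive_map c" "\<And>g x. g \<in> carrier G \<Longrightarrow> x \<in> W \<Longrightarrow> c (\<rho> g x) - \<rho> g (c x) \<in> B"
    "\<And>x. x \<in> W \<Longrightarrow> c x \<in> W" and U: "invariant_subgroup (carrier G) U" "U \<subseteq> W"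
  shows "invariant_subgroup (carrier G) (sumset B (c ` U))" "sumset B (c ` U) \<subseteq> W" "B \<subseteq> sumset B (c ` U)"
proof -
  interpret c: additive_map c by (rule c(1))
  note asU = invariant_add_subgroup[OF U(1)]
  have ascU: "add_subgroup (c ` U)"
    unfolding add_subgroup_def using add_subgroup_zero[OF asU] add_subgroup_diff[OF asU]
    by (auto simp flip: c.T_diff) (metis c.T_zero image_eqI)
  note s = sumset_add_subgroup[OF asB ascU]
  show "B \<subseteq> sumset B (c ` U)" by (rule s)
  show "sumset B (c ` U) \<subseteq> W" using c(3) U(2) B_W by (intro sumset_subset[OF asW]) auto
  show "invariant_subgroup (carrier G) (sumset B (c ` U))"
    unfolding invariant_subgroup_def
  proof (intro conjI ballI)
    fix g y assume g: "g \<in> carrier G" and "y \<in> sumset B (c ` U)"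
    then obtain b x where y: "y = b + c x" "b \<in> B" "x \<in> U" by (auto simp: sumset_def)
    have "\<rho> g y = (\<rho> g b - (c (\<rho> g x) - \<rho> g (c x))) + c (\<rho> g x)" using g by (simp add: y rep_add)
    moreover have "\<rho> g b - (c (\<rho> g x) - \<rho> g (c x)) \<in> B"
      by (rule add_subgroup_diff[OF asB invariant_rep[OF inv_B g y(2)] c(2)[OF g subsetD[OF U(2) y(3)]]])
    moreover have "\<rho> g x \<in> U" using invariant_rep[OF U(1) g y(3)] .
    ultimately show "\<rho> g y \<in> sumset B (c ` U)" unfolding sumset_def by blast
  qed (rule s)
qed

text \<open>The kernel of \<open>c\<close> modulo \<open>B\<close> is a submodule that misses
  \<open>w\<close>, hence it is zero.\<close>

lemma injective_mod:
  assumes c: "additive_map c" "\<And>x. x \<in> B \<Longrightarrow> c x \<in> B" "\<And>g x. g \<in> carrier G \<Longrightarrow> x \<in> W \<Longrightarrow> c (\<rho> g x) - \<rho> g (c x) \<in> B"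
    and "c w \<notin> B" "x \<in> W" "c x \<in> B"
  shows "x \<in> B"
proof -
  have "w \<notin> {x \<in> W. c x \<in> B}" using assms(4) by simp
  then have "{x \<in> W. c x \<in> B} = B"
    using essential[OF preimage_invariant[OF c inv_B order_refl B_W]] by blast
  then show ?thesis using assms by blast
qed

text \<open>The kernels of the powers of \<open>c\<close> stabilize, so the image of a high power
  meets the kernel of \<open>c\<close> in zero. That kernel contains \<open>w\<close>, hence the
  image is zero and \<open>c\<close> is nilpotent modulo \<open>B\<close>. Finiteness then climbs
  from the kernel of \<open>c\<close> to the kernels of its powers.\<close>

lemma fitting:
  assumes c: "additive_map c" "\<And>x. x \<in> B \<Longrightarrow> c x \<in> B" "\<And>g x. g \<in> carrier G \<Longrightarrow> x \<in> W \<Longrightarrow> c (\<rho> g x) - \<rho> g (c x) \<in> B"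
    "\<And>x. x \<in> W \<Longrightarrow> c x \<in> W" "c w \<in> B"
    and noeth: "noetherian_between (carrier G) B W"
    and fin: "finite_mod B {x \<in> W. c x \<in> B}"
  shows "finite_mod B W"
proof -
  interpret c: additive_map c by (rule c(1))
  define K where "K j = {x \<in> W. (c ^^ j) x \<in> B}" for j
  have cW: "(c ^^ j) x \<in> W" if "x \<in> W" for j x by (induction j) (use that c(4) in auto)
  have cB: "(c ^^ j) x \<in> B" if "x \<in> B" for j x by (induction j) (use that c(2) in auto)
  have ccomm: "(c ^^ j) (\<rho> g x) - \<rho> g ((c ^^ j) x) \<in> B" if g: "g \<in> carrier G" and x: "x \<in> W" for j g x
  proof (induction j)
    case 0 then show ?case using add_subgroup_zero[OF asB] by simp
  next
    case (Suc j)
    have "c ((c ^^ j) (\<rho> g x) - \<rho> g ((c ^^ j) x)) + (c (\<rho> g ((c ^^ j) x)) - \<rho> g (c ((c ^^ j) x))) \<in> B"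
      using Suc c(2) c(3)[OF g cW[OF x]] by (intro add_subgroup_add[OF asB]) auto
    then show ?case by (simp add: c.T_diff)
  qed
  have ca: "additive_map (c ^^ j)" for j by unfold_locales (rule c.funpow_add)
  note K = preimage_invariant[OF ca cB ccomm inv_B order_refl B_W, folded K_def]
  have Kmono: "K j \<subseteq> K (Suc j)" for j using c(2) by (auto simp: K_def)
  have "\<exists>n. \<forall>m\<ge>n. K m = K n"
    by (rule noetherian_between_stable[OF noeth, of K]) (use K Kmono in \<open>auto simp: K_def\<close>)
  then obtain n where n: "\<And>m. m \<ge> n \<Longrightarrow> K m = K n" by blast
  note I = image_invariant[OF ca ccomm cW inv_W order_refl, of n]
  have "sumset B ((c ^^ n) ` W) = B"
  proof (rule ccontr)
    assume "sumset B ((c ^^ n) ` W) \<noteq> B"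
    then have "w \<in> sumset B ((c ^^ n) ` W)" using essential I by blast
    then obtain b x where x: "w = b + (c ^^ n) x" "b \<in> B" "x \<in> W" by (auto simp: sumset_def)
    have "c w = c b + (c ^^ Suc n) x" by (simp add: x(1) c.T_add)
    then have "(c ^^ Suc n) x \<in> B" using c(5) c(2)[OF x(2)] add_subgroup_cancel(2)[OF asB] by metis
    then have "x \<in> K (Suc n)" using x(3) by (simp only: K_def mem_Collect_eq)
    then have "x \<in> K n" using n[of "Suc n"] by auto
    then have "w \<in> B" using x add_subgroup_add[OF asB] by (simp add: K_def)
    then show False using w_B by blast
  qed
  moreover have "0 + (c ^^ n) x \<in> sumset B ((c ^^ n) ` W)" if "x \<in> W" for x
    using that add_subgroup_zero[OF asB] unfolding sumset_def by blast
  ultimately have Wn: "W \<subseteq> K n" by (auto simp: K_def)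
  have finK: "finite_mod B (K j)" for j
  proof (induction j)
    case 0
    show ?case by (rule finite_mod_subset[OF finite_mod_self[OF asB]]) (auto simp: K_def)
  next
    case (Suc j)
    obtain C where C: "finite C" "\<And>x. x \<in> K j \<Longrightarrow> \<exists>y\<in>C. x - y \<in> B" using Suc by (auto simp: finite_mod_def)
    obtain D where D: "finite D" "\<And>x. x \<in> {x \<in> W. c x \<in> B} \<Longrightarrow> \<exists>y\<in>D. x - y \<in> B" using fin by (auto simp: finite_mod_def)
    define pre where "pre y = (SOME x. x \<in> W \<and> c x - y \<in> B)" for y
    have "\<exists>z\<in>(\<lambda>(y, d). pre y + d) ` (C \<times> D). x - z \<in> B" if x: "x \<in> K (Suc j)" for x
    proof -
      have "c x \<in> K j" using x c(4) by (simp add: K_def flip: funpow_swap1)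
      then obtain y where y: "y \<in> C" "c x - y \<in> B" using C by blast
      have xW: "x \<in> W" using x by (simp add: K_def)
      have pre: "pre y \<in> W \<and> c (pre y) - y \<in> B"
        unfolding pre_def by (rule someI[of _ x]) (use xW y in blast)
      have "c (x - pre y) = (c x - y) - (c (pre y) - y)" by (simp add: c.T_diff)
      then have "c (x - pre y) \<in> B" using y(2) pre add_subgroup_diff[OF asB] by metis
      moreover have "x - pre y \<in> W" using xW pre add_subgroup_diff[OF asW] by blast
      ultimately obtain d where "d \<in> D" "x - pre y - d \<in> B" using D by blast
      then show ?thesis using y(1) by (intro bexI[of _ "pre y + d"]) (auto simp: algebra_simps)
    qed
    then show ?case unfolding finite_mod_def using C(1) D(1)
      by (intro exI[of _ "(\<lambda>(y, d). pre y + d) ` (C \<times> D)"]) auto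
  qed
  show ?thesis by (rule finite_mod_subset[OF finK Wn])
qed

lemma zmul_additive_map: "additive_map (zmul k)"
  by unfold_locales (rule zmul.scale_right_distrib)

lemma zmul_mod:
  "x \<in> B \<Longrightarrow> zmul k x \<in> B" "x \<in> W \<Longrightarrow> zmul k x \<in> W"
  "g \<in> carrier G \<Longrightarrow> zmul k (\<rho> g x) - \<rho> g (zmul k x) \<in> B"
  using add_subgroup_zmul[OF asB] add_subgroup_zmul[OF asW] additive_zmul[of "\<rho> g" k x] rep_add
    add_subgroup_zero[OF asB] by auto

text \<open>If \<open>w\<close> had infinite order modulo \<open>B\<close>, then for every integer
  \<open>a > 1\<close> the submodule \<open>B + a U\<close> would contain \<open>a w\<close>, hence
  \<open>w\<close>. With \<open>a\<close> congruent to 1 modulo the torsion bound, the quotient of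
  \<open>w\<close> by \<open>a\<close> lies in \<open>B + Z w\<close>, so \<open>a\<close> divides
  1.\<close>

lemma prime_annihilates:
  assumes "central_chain {\<one>} gs"
  obtains p where "prime (p::int)" "zmul p w \<in> B"
proof -
  have "\<exists>n. n \<noteq> 0 \<and> zmul n w \<in> B"
  proof (rule ccontr)
    assume "\<not> ?thesis"
    then have nz: "\<And>n. n \<noteq> 0 \<Longrightarrow> zmul n w \<notin> B" by blast
    interpret scaled_group_rep G \<rho> zmul "{n. n \<noteq> 0}" B W
      by (rule zmul_scaled_group_rep(1)[OF inv_B inv_W]) auto
    define L where "L = span_over B [w]"
    note L = span_over_subgroup[OF asB, of "[w]", folded L_def]
    have LW: "L \<subseteq> W" unfolding L_def by (rule span_over_subset[OF asW B_W]) (simp add: w_W)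
    have "noetherian_between {\<one>} B L"
      unfolding L_def by (rule noetherian_between_mono[OF noetherian_between_span_over[OF asB] _ order_refl order_refl]) simp
    moreover have "invariant_subgroup {\<one>} L" using L(1) by (simp add: invariant_subgroup_def rep_one)
    moreover have "sc_stable {\<one>}" by (rule zmul_scaled_group_rep(2)[OF inv_B inv_W]) auto
    ultimately obtain U s where U: "L \<subseteq> U" "U \<subseteq> W" "invariant_subgroup (carrier G) U"
      "s \<in> {n. n \<noteq> 0}" "torsion_free_over s L U"
      using central_chain_noetherian[OF one_is_normal assms, of L] L(2) LW by metis
    \<comment> \<open>The choice \<open>u = 2 * s\<close> makes the scalar larger than 1 whatever
      the sign of \<open>s\<close>.\<close>
    define a where "a = 1 + (2 * s) * s"
    have "s * s > 0" using U(4) by (auto simp: zero_less_mult_iff)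
    then have a: "a > 1" by (simp add: a_def)
    note I = image_invariant[OF zmul_additive_map zmul_mod(3) zmul_mod(2) U(3,2), of a]
    have "zmul a w \<in> sumset B (zmul a ` U)" using L(3) U(1) add_subgroup_zero[OF asB] by (force simp: sumset_def)
    moreover have "zmul a w \<notin> B" using nz a by simp
    ultimately have "w \<in> sumset B (zmul a ` U)" using essential[OF I(1,3,2)] by blast
    then obtain b x where x: "w = b + zmul a x" "b \<in> B" "x \<in> U" by (auto simp: sumset_def)
    then have "zmul a x \<in> L" using L add_subgroup_cancel(2)[OF L(1), of b "zmul a x"] by auto
    moreover have "1 + (2 * s) * s \<in> {n. n \<noteq> 0}" using a by (simp add: a_def)
    ultimately have "x \<in> L" using U(5)[unfolded torsion_free_over_def] x(3) unfolding a_def by blast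
    then obtain b' k where x': "x = b' + zmul k w" "b' \<in> B" by (auto simp: L_def sumset_def)
    have "zmul (1 - a * k) w = b + zmul a b'"
    proof -
      have "zmul (1 - a * k) w = w - zmul a (zmul k w)" by (simp add: zmul.scale_left_diff_distrib)
      also have "\<dots> = b + zmul a x - zmul a (zmul k w)" using x(1) by simp
      finally show ?thesis by (simp add: x'(1) zmul.scale_right_distrib)
    qed
    then have "zmul (1 - a * k) w \<in> B" using x(2) x'(2) zmul_mod(1) add_subgroup_add[OF asB] by simp
    then have "1 - a * k = 0" using nz by blast
    then have "a dvd 1" by (metis dvd_triv_left eq_iff_diff_eq_0)
    then show False using a by simp
  qed
  then obtain n :: int where n: "n \<noteq> 0" "zmul n w \<in> B" by blast
  have ex: "\<exists>m::nat. m > 0 \<and> zmul (int m) w \<in> B"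
  proof (intro exI[of _ "nat \<bar>n\<bar>"] conjI)
    show "zmul (int (nat \<bar>n\<bar>)) w \<in> B" using n add_subgroup_minus[OF asB n(2)] by (auto simp: abs_if)
  qed (use n in simp)
  define m where "m = (LEAST m::nat. m > 0 \<and> zmul (int m) w \<in> B)"
  have m: "m > 0" "zmul (int m) w \<in> B" using LeastI_ex[OF ex] by (auto simp: m_def)
  have m_le: "k > 0 \<Longrightarrow> zmul (int k) w \<in> B \<Longrightarrow> m \<le> k" for k unfolding m_def by (rule Least_le) simp
  have "m \<noteq> 1" using m(2) w_B by auto
  then obtain p where p: "prime p" "p dvd m" using prime_factor_nat by blast
  then obtain k where k: "m = p * k" by (auto elim: dvdE)
  have "k > 0" "k < m" using m(1) k prime_gt_1_nat[OF p(1)] by auto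
  then have kB: "zmul (int k) w \<notin> B" using m_le[of k] by auto
  have pk: "zmul (int p) (zmul (int k) w) \<in> B" using m(2) k by simp
  \<comment> \<open>By minimality of \<open>m\<close> the element \<open>zmul (int k) w\<close> is
    nonzero modulo \<open>B\<close>, and \<open>p\<close> kills it. So \<open>p\<close> is not
    injective modulo \<open>B\<close> and must kill \<open>w\<close>.\<close>
  have "zmul (int p) w \<in> B"
    using injective_mod[OF zmul_additive_map zmul_mod(1,3) _ zmul_mod(2)[OF w_W] pk] kB by blast
  then show ?thesis using that[of "int p"] p(1) by simp
qed

end

section \<open>Elements that are central in the action have finite order on the monolith\<close>

context group begin

lemma inv_mult_cancel:
  assumes "x \<in> carrier G" "y \<in> carrier G"
  shows "inv x \<otimes> (x \<otimes> y) = y" "x \<otimes> (inv x \<otimes> y) = y"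
  using assms by (simp_all flip: m_assoc)

lemma normal_centralizer_mod:
  assumes K: "K \<lhd> G"
  shows "subgroup {x \<in> carrier G. \<forall>h\<in>carrier G. h \<otimes> x \<otimes> inv h \<otimes> inv x \<in> K} G"
proof (rule subgroupI)
  have Ks: "subgroup K G" using K by (rule normal_imp_subgroup)
  let ?Z = "{x \<in> carrier G. \<forall>h\<in>carrier G. h \<otimes> x \<otimes> inv h \<otimes> inv x \<in> K}"
  show "?Z \<subseteq> carrier G" by auto
  have "\<one> \<in> ?Z" using subgroup.one_closed[OF Ks] by simp
  then show "?Z \<noteq> {}" by blast
  fix x assume x: "x \<in> ?Z"
  then have xc: "x \<in> carrier G" by simp
  show "inv x \<in> ?Z"
  proof safe
    fix h assume h: "h \<in> carrier G"
    have "h \<otimes> inv x \<otimes> inv h \<otimes> inv (inv x) = inv x \<otimes> inv (h \<otimes> x \<otimes> inv h \<otimes> inv x) \<otimes> x"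
      using xc h by (simp add: inv_mult_group m_assoc[symmetric])
    also have "\<dots> \<in> K" using x h by (intro normal.inv_op_closed1[OF K xc] subgroup.m_inv_closed[OF Ks]) auto
    finally show "h \<otimes> inv x \<otimes> inv h \<otimes> inv (inv x) \<in> K" .
  qed (use xc in simp)
  fix y assume y: "y \<in> ?Z"
  then have yc: "y \<in> carrier G" by simp
  show "x \<otimes> y \<in> ?Z"
  proof safe
    fix h assume h: "h \<in> carrier G"
    have "h \<otimes> (x \<otimes> y) \<otimes> inv h \<otimes> inv (x \<otimes> y) = (h \<otimes> x \<otimes> inv h \<otimes> inv x) \<otimes> (x \<otimes> (h \<otimes> y \<otimes> inv h \<otimes> inv y) \<otimes> inv x)"
      using xc yc h by (simp add: inv_mult_group m_assoc inv_mult_cancel)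
    also have "\<dots> \<in> K"
      by (rule subgroup.m_closed[OF Ks _ normal.inv_op_closed2[OF K xc]]) (use x y h in auto)
    finally show "h \<otimes> (x \<otimes> y) \<otimes> inv h \<otimes> inv (x \<otimes> y) \<in> K" .
  qed (use xc yc in simp)
qed

end

context monolithic begin

definition act_eq :: "'g \<Rightarrow> 'g \<Rightarrow> bool" (infix "\<simeq>" 50) where
  "u \<simeq> v \<longleftrightarrow> (\<forall>x\<in>W. \<rho> u x - \<rho> v x \<in> B)"

lemma act_eq_refl [simp]: "u \<simeq> u"
  by (simp add: act_eq_def add_subgroup_zero[OF asB])

lemma act_eq_sym: "u \<simeq> v \<Longrightarrow> v \<simeq> u"
  unfolding act_eq_def using add_subgroup_minus[OF asB] by fastforce

lemma act_eq_trans [trans]: "u \<simeq> v \<Longrightarrow> v \<simeq> y \<Longrightarrow> u \<simeq> y"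
  unfolding act_eq_def using add_subgroup_add[OF asB] by fastforce

lemma act_eq_left: "u \<simeq> v \<Longrightarrow> a \<in> carrier G \<Longrightarrow> u \<in> carrier G \<Longrightarrow> v \<in> carrier G \<Longrightarrow> a \<otimes> u \<simeq> a \<otimes> v"
  unfolding act_eq_def using invariant_rep[OF inv_B] by (simp add: rep_mult flip: rep_diff)

lemma act_eq_right: "u \<simeq> v \<Longrightarrow> a \<in> carrier G \<Longrightarrow> u \<in> carrier G \<Longrightarrow> v \<in> carrier G \<Longrightarrow> u \<otimes> a \<simeq> v \<otimes> a"
  unfolding act_eq_def using invariant_rep[OF inv_W] by (simp add: rep_mult)

lemma act_eq_mult:
  "u \<simeq> v \<Longrightarrow> u' \<simeq> v' \<Longrightarrow> u \<in> carrier G \<Longrightarrow> v \<in> carrier G \<Longrightarrow> u' \<in> carrier G \<Longrightarrow> v' \<in> carrier G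
   \<Longrightarrow> u \<otimes> u' \<simeq> v \<otimes> v'"
  by (rule act_eq_trans[OF act_eq_right[of u v u'] act_eq_left[of u' v' v]])

definition act_kernel :: "'g set" where
  "act_kernel = {g \<in> carrier G. g \<simeq> \<one>}"

lemma act_kernelD: "g \<in> act_kernel \<Longrightarrow> x \<in> W \<Longrightarrow> \<rho> g x - x \<in> B"
  by (auto simp: act_kernel_def act_eq_def rep_one)

lemma act_kernel_normal: "act_kernel \<lhd> G"
proof (rule normal_invI)
  show "subgroup act_kernel G"
  proof (rule subgroupI)
    show "act_kernel \<subseteq> carrier G" by (auto simp: act_kernel_def)
    show "act_kernel \<noteq> {}" by (auto simp: act_kernel_def)
    fix a assume a: "a \<in> act_kernel"
    then have "inv a \<otimes> a \<simeq> inv a \<otimes> \<one>" by (intro act_eq_left) (auto simp: act_kernel_def)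
    then show "inv a \<in> act_kernel" using a act_eq_sym by (simp add: act_kernel_def)
    fix b assume b: "b \<in> act_kernel"
    have "a \<otimes> b \<simeq> \<one> \<otimes> \<one>" using a b by (intro act_eq_mult) (auto simp: act_kernel_def)
    then show "a \<otimes> b \<in> act_kernel" using a b by (simp add: act_kernel_def)
  qed
  fix x h assume "x \<in> carrier G" "h \<in> act_kernel"
  then have "x \<otimes> h \<otimes> inv x \<simeq> x \<otimes> \<one> \<otimes> inv x" "x \<in> carrier G" "h \<in> carrier G"
    by (auto simp only: act_kernel_def mem_Collect_eq intro!: act_eq_mult act_eq_refl one_closed m_closed inv_closed)
  then show "x \<otimes> h \<otimes> inv x \<in> act_kernel" by (simp add: act_kernel_def)
qed

lemma commutator_in_kernel:
  assumes "h \<in> carrier G" "g \<in> carrier G"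
  shows "h \<otimes> g \<otimes> inv h \<otimes> inv g \<in> act_kernel \<longleftrightarrow> h \<otimes> g \<simeq> g \<otimes> h"
proof
  assume "h \<otimes> g \<otimes> inv h \<otimes> inv g \<in> act_kernel"
  then have "(h \<otimes> g \<otimes> inv h \<otimes> inv g) \<otimes> (g \<otimes> h) \<simeq> \<one> \<otimes> (g \<otimes> h)"
    using assms by (intro act_eq_right) (auto simp: act_kernel_def)
  moreover have "(h \<otimes> g \<otimes> inv h \<otimes> inv g) \<otimes> (g \<otimes> h) = h \<otimes> g"
    using assms by (simp add: m_assoc inv_mult_cancel)
  ultimately show "h \<otimes> g \<simeq> g \<otimes> h" using assms by simp
next
  assume "h \<otimes> g \<simeq> g \<otimes> h"
  then have "(h \<otimes> g) \<otimes> inv (g \<otimes> h) \<simeq> (g \<otimes> h) \<otimes> inv (g \<otimes> h)" using assms by (intro act_eq_right) auto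
  then have "h \<otimes> g \<otimes> inv h \<otimes> inv g \<simeq> \<one>" using assms by (simp add: inv_mult_group m_assoc inv_mult_cancel)
  then show "h \<otimes> g \<otimes> inv h \<otimes> inv g \<in> act_kernel" using assms by (simp add: act_kernel_def)
qed

text \<open>The argument of \<open>prime_annihilates\<close> with polynomials in
  \<open>T = \<rho> z\<close> as scalars. If no positive power of \<open>z\<close> fixed
  \<open>w\<close> modulo \<open>B\<close>, a polynomial could kill \<open>w\<close> only when
  \<open>p\<close> divides all its coefficients. Then \<open>w\<close> would generate a free module
  over F_p[x, 1/x] and yet be divisible in it by the non-unit \<open>1 + x s\<close>.\<close>

lemma finite_order_mod:
  assumes gs: "central_chain {\<one>} gs" and z: "z \<in> carrier G"
    and zc: "\<And>h. h \<in> carrier G \<Longrightarrow> h \<otimes> z \<otimes> inv h \<otimes> inv z \<in> act_kernel"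
    and p: "prime (p::int)" "zmul p w \<in> B"
  obtains n :: nat where "n > 0" "\<rho> (z [^] n) w - w \<in> B"
proof -
  define T where "T = \<rho> z"
  interpret T: additive_map T by unfold_locales (simp add: T_def rep_add z)
  have Tpow: "(T ^^ n) x = \<rho> (z [^] n) x" for n x
  proof (induction n)
    case 0 then show ?case by (simp add: rep_one)
  next
    case (Suc n)
    have "z [^] Suc n = z \<otimes> z [^] n" using z by (rule nat_pow_Suc2)
    then have "\<rho> (z [^] Suc n) x = \<rho> z (\<rho> (z [^] n) x)" using z by (simp only: rep_mult nat_pow_closed)
    then show ?case using Suc by (simp add: T_def del: nat_pow_Suc)
  qed
  have TB: "T x \<in> B" if "x \<in> B" for x using invariant_rep[OF inv_B z that] by (simp add: T_def)
  have TW: "T x \<in> W" if "x \<in> W" for x using invariant_rep[OF inv_W z that] by (simp add: T_def)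
  have Tcomm: "T (\<rho> g x) - \<rho> g (T x) \<in> B" if "g \<in> carrier G" "x \<in> W" for g x
  proof -
    have "z \<otimes> g \<simeq> g \<otimes> z" using zc[OF that(1)] commutator_in_kernel[OF that(1) z] by (blast intro: act_eq_sym)
    then show ?thesis using that z by (simp add: act_eq_def T_def rep_mult)
  qed
  have TnB: "(T ^^ n) x \<in> B" if "x \<in> B" for n x by (induction n) (use that TB in auto)
  have TnW: "(T ^^ n) x \<in> W" if "x \<in> W" for n x by (induction n) (use that TW in auto)
  have TnB_inv: "x \<in> B" if "(T ^^ n) x \<in> B" for n x
  proof -
    have "x = \<rho> (inv (z [^] n)) ((T ^^ n) x)" using z by (simp add: Tpow rep_inv)
    then show ?thesis using invariant_rep[OF inv_B _ that, of "inv (z [^] n)"] z by simp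
  qed
  let ?\<sigma> = "poly_mul T"
  have s_add: "additive_map (?\<sigma> q)" for q by unfold_locales (rule T.poly_mul_right_add)
  have sB: "?\<sigma> q x \<in> B" if "x \<in> B" for q x by (rule T.poly_mul_closed[OF asB TB that])
  have sW: "?\<sigma> q x \<in> W" if "x \<in> W" for q x by (rule T.poly_mul_closed[OF asW TW that])
  have scomm: "?\<sigma> q (\<rho> g x) - \<rho> g (?\<sigma> q x) \<in> B" if g: "g \<in> carrier G" and x: "x \<in> W" for q g x
  proof (induction q)
    case 0 then show ?case using g by (simp add: rep_zero add_subgroup_zero[OF asB])
  next
    case (pCons a q)
    have "?\<sigma> (pCons a q) (\<rho> g x) - \<rho> g (?\<sigma> (pCons a q) x)
      = T (?\<sigma> q (\<rho> g x) - \<rho> g (?\<sigma> q x)) + (T (\<rho> g (?\<sigma> q x)) - \<rho> g (T (?\<sigma> q x)))"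
      using g additive_zmul[of "\<rho> g" a x] by (simp add: rep_add T.T_diff)
    then show ?case using TB[OF pCons(2)] Tcomm[OF g sW[OF x]] add_subgroup_add[OF asB] by metis
  qed
  note result = that
  show ?thesis
  proof (rule ccontr)
    assume contra: "\<not> thesis"
    have none: False if "n > 0" "\<rho> (z [^] n) w - w \<in> B" for n :: nat using contra result[OF that] by blast
    have inford: False if "m < n" "(T ^^ n) w - (T ^^ m) w \<in> B" for m n
    proof -
      have "(T ^^ m) ((T ^^ (n - m)) w) = (T ^^ n) w"
        using that(1) funpow_add[of m "n - m" T] by (simp add: fun_eq_iff)
      then have "(T ^^ m) ((T ^^ (n - m)) w - w) \<in> B" using that by (simp add: T.funpow_diff)
      then have "\<rho> (z [^] (n - m)) w - w \<in> B" using TnB_inv by (simp add: Tpow[symmetric])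
      then show False using none[of "n - m"] that(1) by simp
    qed
    have ann: "p dvd coeff q i" if "?\<sigma> q w \<in> B" for q i
      using T.finite_order_of_annihilator[OF asB TB p that, of i] inford by blast
    \<comment> \<open>The polynomials that do not kill \<open>w\<close>. Each is injective modulo
      \<open>B\<close>, so \<open>S\<close> is closed under products.\<close>
    define S where "S = {q. ?\<sigma> q w \<notin> B}"
    have S_mult: "q * r \<in> S" if "q \<in> S" "r \<in> S" for q r
    proof -
      interpret \<sigma>: Modules.module ?\<sigma> by (rule T.poly_mul_module)
      have "?\<sigma> q (?\<sigma> r w) \<notin> B"
        using injective_mod[OF s_add sB scomm _ sW[OF w_W], of q r] that by (auto simp: S_def)
      then show ?thesis by (simp add: S_def)
    qed
    have S_one: "1 \<in> S" using w_B Modules.module.scale_one[OF T.poly_mul_module] by (simp add: S_def)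
    interpret scaled_group_rep G \<rho> ?\<sigma> S B W
      by (rule scaled_group_rep.intro[OF group_rep_axioms scaled_group_rep_axioms.intro[OF T.poly_mul_module S_one S_mult inv_B inv_W scomm]])
    \<comment> \<open>Adding the kernel of the action makes the subgroup generated by
      \<open>z\<close> normal, since \<open>z\<close> is central modulo this kernel.\<close>
    define K where "K = generate G (insert z act_kernel)"
    have kc: "act_kernel \<subseteq> carrier G" by (auto simp: act_kernel_def)
    have ikc: "insert z act_kernel \<subseteq> carrier G" using kc z by auto
    have K: "K \<lhd> G" unfolding K_def by (rule normal_generate_insert[OF act_kernel_normal z zc])
    have K_chain: "central_chain K gs"
      by (rule central_chain_mono[OF gs]) (use subgroup.one_closed[OF normal_imp_subgroup[OF K]] subgroup.subset[OF normal_imp_subgroup[OF K]] in auto)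
    have z_K: "z \<in> K" by (auto simp: K_def intro: generate.incl)
    have stable: "sc_stable K"
      unfolding sc_stable_def
    proof (intro allI impI)
      fix N q x assume N: "invariant_subgroup K N" "x \<in> N"
      show "?\<sigma> q x \<in> N"
        by (rule T.poly_mul_closed[OF invariant_add_subgroup[OF N(1)] _ N(2)])
          (use invariant_rep[OF N(1) z_K] in \<open>simp add: T_def\<close>)
    qed
    \<comment> \<open>This is \<open>B\<close> plus the span of \<open>w\<close> over Z[x, 1/x]: a
      power of \<open>T\<close> clears the denominators.\<close>
    define L where "L = {x \<in> W. \<exists>k q. (T ^^ k) x - ?\<sigma> q w \<in> B}"
    have L_add: "add_subgroup L"
      unfolding add_subgroup_def
    proof (intro conjI ballI)
      show "0 \<in> L" using add_subgroup_zero[OF asW] add_subgroup_zero[OF asB]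
        by (auto simp: L_def intro!: exI[of _ 0])
      fix x y assume "x \<in> L" "y \<in> L"
      then obtain k q l r where xy: "x \<in> W" "y \<in> W" "(T ^^ k) x - ?\<sigma> q w \<in> B" "(T ^^ l) y - ?\<sigma> r w \<in> B"
        by (auto simp: L_def)
      have "(T ^^ l) ((T ^^ k) x - ?\<sigma> q w) - (T ^^ k) ((T ^^ l) y - ?\<sigma> r w) \<in> B"
        using TnB xy add_subgroup_diff[OF asB] by blast
      moreover have "(T ^^ l) ((T ^^ k) x - ?\<sigma> q w) - (T ^^ k) ((T ^^ l) y - ?\<sigma> r w)
        = (T ^^ (k + l)) (x - y) - ?\<sigma> (monom 1 l * q - monom 1 k * r) w"
      proof -
        interpret \<sigma>: Modules.module ?\<sigma> by (rule T.poly_mul_module)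
        have "?\<sigma> (monom 1 l * q - monom 1 k * r) w = (T ^^ l) (?\<sigma> q w) - (T ^^ k) (?\<sigma> r w)"
          by (simp add: \<sigma>.scale_left_diff_distrib T.poly_mul_monom flip: \<sigma>.scale_scale)
        moreover have "(T ^^ l) ((T ^^ k) x) = (T ^^ (k + l)) x" by (metis add.commute comp_apply funpow_add)
        moreover have "(T ^^ k) ((T ^^ l) y) = (T ^^ (k + l)) y" by (simp add: funpow_add)
        ultimately show ?thesis by (simp add: T.funpow_diff)
      qed
      ultimately show "x - y \<in> L" using add_subgroup_diff[OF asW xy(1,2)] by (auto simp: L_def)
    qed
    have L_K: "invariant_subgroup K L"
      unfolding K_def
    proof (rule invariant_generate[OF ikc])
      have ker: "\<rho> g x \<in> L" if g: "g \<in> act_kernel" and x: "x \<in> L" for g x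
      proof -
        obtain k q where kq: "x \<in> W" "(T ^^ k) x - ?\<sigma> q w \<in> B" using x by (auto simp: L_def)
        have "(T ^^ k) (\<rho> g x - x) + ((T ^^ k) x - ?\<sigma> q w) \<in> B"
          using TnB[OF act_kernelD[OF g kq(1)]] kq(2) add_subgroup_add[OF asB] by blast
        then have "(T ^^ k) (\<rho> g x) - ?\<sigma> q w \<in> B" by (simp add: T.funpow_diff)
        then show ?thesis using invariant_rep[OF inv_W _ kq(1), of g] g kc by (auto simp: L_def)
      qed
      have Lz: "\<rho> z x \<in> L" if x: "x \<in> L" for x
      proof -
        obtain k q where kq: "x \<in> W" "(T ^^ k) x - ?\<sigma> q w \<in> B" using x by (auto simp: L_def)
        have "T ((T ^^ k) x - ?\<sigma> q w) = (T ^^ k) (T x) - ?\<sigma> (pCons 0 q) w"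
          by (simp add: T.T_diff funpow_swap1)
        then have "(T ^^ k) (T x) - ?\<sigma> (pCons 0 q) w \<in> B" using TB[OF kq(2)] by metis
        then show ?thesis using TW[OF kq(1)] unfolding L_def T_def[symmetric] by blast
      qed
      have Lz': "\<rho> (inv z) x \<in> L" if x: "x \<in> L" for x
      proof -
        obtain k q where kq: "x \<in> W" "(T ^^ k) x - ?\<sigma> q w \<in> B" using x by (auto simp: L_def)
        have "(T ^^ Suc k) (\<rho> (inv z) x) = (T ^^ k) x" using z by (simp add: funpow_Suc_right T_def rep_inv del: funpow.simps)
        then have "(T ^^ Suc k) (\<rho> (inv z) x) - ?\<sigma> q w \<in> B" using kq(2) by (simp only:)
        then show ?thesis using invariant_rep[OF inv_W _ kq(1), of "inv z"] z unfolding L_def by blast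
      qed
      show "invariant_subgroup (insert z act_kernel) L"
        using L_add ker Lz by (auto simp: invariant_subgroup_def)
      show "\<rho> (inv k) x \<in> L" if "k \<in> insert z act_kernel" "x \<in> L" for k x
        using that Lz' ker subgroup.m_inv_closed[OF normal_imp_subgroup[OF act_kernel_normal]] by auto
    qed
    have BL: "B \<subseteq> L" using B_W by (auto simp: L_def intro!: exI[of _ 0])
    have LW: "L \<subseteq> W" by (auto simp: L_def)
    have "(T ^^ 0) w - ?\<sigma> 1 w \<in> B"
      using add_subgroup_zero[OF asB] Modules.module.scale_one[OF T.poly_mul_module] by simp
    then have wL: "w \<in> L" using w_W unfolding L_def by blast
    \<comment> \<open>One step of the basis theorem leads from \<open>B + Z w\<close>, which
      \<open>act_kernel\<close> preserves because it acts trivially, to a Noetherian module over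
      \<open>K\<close> containing \<open>L\<close>.\<close>
    have noethL: "noetherian_between K B L"
    proof -
      define L0 where "L0 = span_over B [w]"
      note L0 = span_over_subgroup[OF asB, of "[w]", folded L0_def]
      have L0W: "L0 \<subseteq> W" unfolding L0_def by (rule span_over_subset[OF asW B_W]) (simp add: w_W)
      have i0: "invariant_subgroup act_kernel L0"
        unfolding invariant_subgroup_def
      proof (intro conjI ballI)
        fix g x assume g: "g \<in> act_kernel" "x \<in> L0"
        have "\<rho> g x - x \<in> L0" using act_kernelD[OF g(1)] L0W L0(2) g(2) by blast
        then show "\<rho> g x \<in> L0" using add_subgroup_cancel(3)[OF L0(1) g(2)] by blast
      qed (rule L0)
      interpret Z: scaled_group_rep G \<rho> zmul "{1}" B W
        by (rule zmul_scaled_group_rep(1)[OF inv_B inv_W]) auto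
      have n0: "noetherian_between act_kernel B L0"
        unfolding L0_def by (rule noetherian_between_mono[OF noetherian_between_span_over[OF asB] _ order_refl order_refl]) simp
      have st0: "Z.sc_stable act_kernel" by (rule zmul_scaled_group_rep(2)[OF inv_B inv_W]) auto
      obtain U where U: "L0 \<subseteq> U" "invariant_subgroup K U" "noetherian_between K B U"
        by (rule Z.generate_insert_step[OF act_kernel_normal z i0 L0(2) L0W n0 st0, folded K_def]) blast
      have "L \<subseteq> U"
      proof
        fix x assume "x \<in> L"
        then obtain k q where kq: "x \<in> W" "(T ^^ k) x - ?\<sigma> q w \<in> B" by (auto simp: L_def)
        note asU = invariant_add_subgroup[OF U(2)]
        have "w \<in> U" using L0(3) U(1) by auto
        then have "?\<sigma> q w \<in> U" using stable U(2) unfolding sc_stable_def by blast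
        then have "(T ^^ k) x \<in> U" using kq(2) L0(2) U(1) add_subgroup_congruent[OF asU] by blast
        moreover have "inv (z [^] k) \<in> K"
        proof -
          have Ks: "subgroup K G" using K by (rule normal_imp_subgroup)
          have "z [^] k \<in> K" by (induction k) (use z_K subgroup.one_closed[OF Ks] subgroup.m_closed[OF Ks] in auto)
          then show ?thesis by (rule subgroup.m_inv_closed[OF Ks])
        qed
        ultimately have "\<rho> (inv (z [^] k)) ((T ^^ k) x) \<in> U" using invariant_rep[OF U(2)] by blast
        then show "x \<in> U" using z by (simp add: Tpow rep_inv)
      qed
      then show ?thesis using noetherian_between_mono[OF U(3)] by blast
    qed
    obtain U s where U: "L \<subseteq> U" "U \<subseteq> W" "invariant_subgroup (carrier G) U" "s \<in> S" "torsion_free_over s L U"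
      using central_chain_noetherian[OF K K_chain L_K BL LW noethL stable] by metis
    have "\<exists>i. \<not> p dvd coeff s i"
    proof (rule ccontr)
      assume "\<not> ?thesis"
      then have "[:p:] dvd s" by (simp add: const_poly_dvd_iff)
      then obtain t where "s = t * [:p:]" by (auto elim: dvdE simp: mult.commute)
      then have "?\<sigma> s w = ?\<sigma> t (zmul p w)"
        by (simp add: T.poly_mul_smult additive_zmul[where f = "?\<sigma> t", OF T.poly_mul_right_add])
      then show False using sB[OF p(2)] U(4) by (simp add: S_def)
    qed
    then obtain i where i: "\<not> p dvd coeff s i" by blast
    \<comment> \<open>Here \<open>u = x\<close>, and the constant coefficient 1 guarantees through
      \<open>ann\<close> that \<open>a\<close> does not kill \<open>w\<close>.\<close>
    define a where "a = 1 + [:0, 1:] * s"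
    have a_eq: "a = pCons 1 s" by (simp add: a_def one_pCons)
    have aS: "a \<in> S"
    proof -
      have "\<not> p dvd coeff a 0" using p(1) not_prime_unit by (auto simp: a_eq)
      then show ?thesis using ann[of a 0] by (auto simp: S_def)
    qed
    note I = image_invariant[OF s_add scomm sW U(3,2), of a]
    have "?\<sigma> a w \<in> sumset B (?\<sigma> a ` U)" using wL U(1) add_subgroup_zero[OF asB] by (force simp: sumset_def)
    then have "w \<in> sumset B (?\<sigma> a ` U)" using essential[OF I(1,3,2)] aS by (auto simp: S_def)
    then obtain b x where x: "w = b + ?\<sigma> a x" "b \<in> B" "x \<in> U" by (auto simp: sumset_def)
    then have "?\<sigma> a x \<in> L" using BL wL add_subgroup_cancel(2)[OF L_add, of b "?\<sigma> a x"] by auto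
    then have "x \<in> L" using U(5)[unfolded torsion_free_over_def] x(3) aS unfolding a_def by blast
    then obtain k q where kq: "(T ^^ k) x - ?\<sigma> q w \<in> B" by (auto simp: L_def)
    interpret \<sigma>: Modules.module ?\<sigma> by (rule T.poly_mul_module)
    have "?\<sigma> (monom 1 k - pCons 1 s * q) w = (T ^^ k) w - ?\<sigma> a (?\<sigma> q w)"
      by (simp add: a_eq[symmetric] \<sigma>.scale_left_diff_distrib T.poly_mul_monom)
    also have "\<dots> = (T ^^ k) b + ?\<sigma> a ((T ^^ k) x - ?\<sigma> q w)"
      by (subst x(1)) (simp add: T.funpow_add \<sigma>.scale_right_diff_distrib T.poly_mul_funpow)
    also have "\<dots> \<in> B" using TnB[OF x(2)] sB[OF kq] add_subgroup_add[OF asB] by blast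
    finally have "\<And>j. p dvd coeff (monom 1 k - pCons 1 s * q) j" by (rule ann)
    then show False using not_unit_mod_prime[OF p(1) i] by blast
  qed
qed

end

section \<open>Groups acting through finitely many operators\<close>

definition (in group_rep) finite_image :: "'a set \<Rightarrow> 'a set \<Rightarrow> 'g set \<Rightarrow> bool" where
  "finite_image B W K \<longleftrightarrow>
     (\<exists>F. finite F \<and> F \<subseteq> carrier G \<and> (\<forall>k\<in>K. \<exists>f\<in>F. \<forall>x\<in>W. \<rho> k x - \<rho> f x \<in> B))"

lemma (in group_rep) finite_image_mono: "finite_image B W K \<Longrightarrow> W' \<subseteq> W \<Longrightarrow> finite_image B W' K"
  unfolding finite_image_def by (metis subsetD)

context monolithic begin

lemma finite_image_iff:
  "finite_image B W K \<longleftrightarrow> (\<exists>F. finite F \<and> F \<subseteq> carrier G \<and> (\<forall>k\<in>K. \<exists>f\<in>F. k \<simeq> f))"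
  by (simp add: finite_image_def act_eq_def)

lemma act_eq_commute_pow:
  assumes "h \<otimes> x \<simeq> x \<otimes> h" "h \<in> carrier G" "x \<in> carrier G"
  shows "h \<otimes> x [^] (k::nat) \<simeq> x [^] k \<otimes> h"
proof (induction k)
  case 0 then show ?case using assms by simp
next
  case (Suc k)
  have "h \<otimes> x [^] k \<otimes> x \<simeq> x [^] k \<otimes> h \<otimes> x" by (rule act_eq_right[OF Suc]) (use assms in auto)
  moreover have "x [^] k \<otimes> (h \<otimes> x) \<simeq> x [^] k \<otimes> (x \<otimes> h)" by (rule act_eq_left[OF assms(1)]) (use assms in auto)
  ultimately have "h \<otimes> x [^] k \<otimes> x \<simeq> x [^] k \<otimes> (x \<otimes> h)" using assms by (simp add: m_assoc) (rule act_eq_trans)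
  then show ?case using assms by (simp add: m_assoc)
qed

text \<open>For fixed \<open>h\<close> the commutators of \<open>h\<close> with powers of
  \<open>g\<close> lie in \<open>K\<close>, so they act in at most \<open>card F\<close> ways. Two
  coinciding ones among the exponents \<open>0..card F\<close> yield a positive
  \<open>d \<le> card F\<close> for which \<open>g [^] d\<close> commutes with \<open>h\<close> in
  the action. The factorial is a multiple of all such \<open>d\<close> and thus independent of
  \<open>h\<close>.\<close>

lemma power_in_center:
  assumes K: "K \<lhd> G" and g: "g \<in> carrier G" "\<And>h. h \<in> carrier G \<Longrightarrow> h \<otimes> g \<otimes> inv h \<otimes> inv g \<in> K"
    and fin: "finite_image B W K"
  shows "\<exists>m::nat. m > 0 \<and> (\<forall>h\<in>carrier G. h \<otimes> g [^] m \<otimes> inv h \<otimes> inv (g [^] m) \<in> act_kernel)"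
proof -
  obtain F where F: "finite F" "F \<subseteq> carrier G" "\<And>k. k \<in> K \<Longrightarrow> \<exists>f\<in>F. k \<simeq> f" using fin by (auto simp: finite_image_iff)
  define m :: nat where "m = fact (card F)"
  have comm: "h \<otimes> g [^] m \<simeq> g [^] m \<otimes> h" if h: "h \<in> carrier G" for h
  proof -
    have gj: "g [^] j \<in> {x \<in> carrier G. \<forall>h\<in>carrier G. h \<otimes> x \<otimes> inv h \<otimes> inv x \<in> K}" for j :: nat
    proof (induction j)
      case 0 then show ?case using subgroup.one_closed[OF normal_centralizer_mod[OF K]] by simp
    next
      case (Suc j) then show ?case using subgroup.m_closed[OF normal_centralizer_mod[OF K] Suc, of g] g by simp
    qed
    define \<phi> where "\<phi> j = h \<otimes> g [^] j \<otimes> inv h \<otimes> inv (g [^] j)" for j :: nat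
    have "\<exists>f\<in>F. \<phi> j \<simeq> f" for j using gj[of j] h F(3) by (auto simp: \<phi>_def)
    then obtain f where f: "\<And>j. f j \<in> F \<and> \<phi> j \<simeq> f j" by metis
    have "\<not> inj_on f {0..card F}"
    proof
      assume "inj_on f {0..card F}"
      then have "card {0..card F} \<le> card F" by (rule card_inj_on_le) (use f F(1) in auto)
      then show False by simp
    qed
    then obtain i j where ij: "i < j" "j \<le> card F" "f i = f j"
      unfolding inj_on_def by (metis atLeastAtMost_iff linorder_neqE_nat)
    define d where "d = j - i"
    have d: "d > 0" "d \<le> card F" "j = i + d" using ij by (auto simp: d_def)
    have c: "\<phi> i \<in> carrier G" "\<phi> j \<in> carrier G" using h g by (auto simp: \<phi>_def)
    let ?x = "g [^] i" and ?y = "g [^] d"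
    have xy: "?x \<in> carrier G" "?y \<in> carrier G" using g by auto
    have gij: "g [^] j = ?x \<otimes> ?y" using g d(3) by (simp add: nat_pow_mult)
    have "\<phi> i \<simeq> \<phi> j" using f[of i] f[of j] ij(3) by (metis act_eq_sym act_eq_trans)
    \<comment> \<open>Removing the factor \<open>h\<close> and conjugating by \<open>g [^] i\<close>
      turns the coincidence of the two commutators into commutation with
      \<open>g [^] d\<close>.\<close>
    then have "inv ?x \<otimes> (inv h \<otimes> \<phi> i) \<otimes> ?x \<simeq> inv ?x \<otimes> (inv h \<otimes> \<phi> j) \<otimes> ?x"
      by (intro act_eq_right act_eq_left) (use h g c in auto)
    moreover have "inv ?x \<otimes> (inv h \<otimes> \<phi> i) \<otimes> ?x = inv h"
      using h xy by (simp add: \<phi>_def m_assoc inv_mult_cancel)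
    moreover have "inv ?x \<otimes> (inv h \<otimes> \<phi> j) \<otimes> ?x = ?y \<otimes> inv h \<otimes> inv ?y"
      using h xy unfolding \<phi>_def gij by (simp add: m_assoc inv_mult_cancel inv_mult_group)
    ultimately have "inv h \<simeq> ?y \<otimes> inv h \<otimes> inv ?y" by simp
    then have "h \<otimes> inv h \<otimes> (?y \<otimes> h) \<simeq> h \<otimes> (?y \<otimes> inv h \<otimes> inv ?y) \<otimes> (?y \<otimes> h)"
      by (intro act_eq_right act_eq_left) (use h xy in auto)
    then have "?y \<otimes> h \<simeq> h \<otimes> ?y" using h xy by (simp add: m_assoc inv_mult_cancel)
    then have yh: "h \<otimes> ?y \<simeq> ?y \<otimes> h" by (rule act_eq_sym)
    have "d dvd m" unfolding m_def using d by (intro dvd_fact) auto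
    then obtain q where "m = d * q" by (auto elim: dvdE)
    then have "g [^] m = ?y [^] q" using g by (simp add: nat_pow_pow)
    then show ?thesis using act_eq_commute_pow[OF yh h xy(2)] by simp
  qed
  have "h \<otimes> g [^] m \<otimes> inv h \<otimes> inv (g [^] m) \<in> act_kernel" if "h \<in> carrier G" for h
    using commutator_in_kernel[OF that, of "g [^] m"] comm[OF that] g by simp
  then show ?thesis by (intro exI[of _ m]) (simp add: m_def)
qed

text \<open>Normality of \<open>K\<close> brings every element to the form
  \<open>k \<otimes> g [^] j\<close> up to the action, and \<open>j\<close> matters only modulo
  \<open>N\<close>.\<close>

lemma finite_image_generate:
  assumes K: "K \<lhd> G" and g: "g \<in> carrier G" and N: "N > 0" "g [^] (N::nat) \<simeq> \<one>"
    and fin: "finite_image B W K"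
  shows "finite_image B W (generate G (insert g K))"
proof -
  have Ks: "subgroup K G" using K by (rule normal_imp_subgroup)
  have Kc: "K \<subseteq> carrier G" using subgroup.subset[OF Ks] .
  have gc: "insert g K \<subseteq> carrier G" using g Kc by auto
  have rep: "u \<in> carrier G \<and> (\<exists>k\<in>K. \<exists>j::nat. u \<simeq> k \<otimes> g [^] j)" if "u \<in> generate G (insert g K)" for u
    using that
  proof (induction rule: generate.induct)
    case one
    have "\<one> \<simeq> \<one> \<otimes> g [^] (0::nat)" by simp
    then show ?case using subgroup.one_closed[OF Ks] by blast
  next
    case (incl h)
    show ?case
    proof (cases "h = g")
      case True
      then have "h \<simeq> \<one> \<otimes> g [^] (1::nat)" using g by simp
      then show ?thesis using subgroup.one_closed[OF Ks] True g by blast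
    next
      case False
      then have "h \<in> K" using incl by simp
      moreover have "h \<simeq> h \<otimes> g [^] (0::nat)" using \<open>h \<in> K\<close> Kc by auto
      ultimately show ?thesis using Kc by blast
    qed
  next
    case (inv h)
    show ?case
    proof (cases "h = g")
      case True
      \<comment> \<open>In the action \<open>inv g\<close> equals \<open>g [^] (N - 1)\<close>, so
        natural exponents suffice.\<close>
      obtain M where M: "N = Suc M" using N(1) by (cases N) auto
      have "g [^] N \<otimes> inv g \<simeq> \<one> \<otimes> inv g" by (rule act_eq_right[OF N(2)]) (use g in auto)
      moreover have "g [^] N \<otimes> inv g = \<one> \<otimes> g [^] M" using g by (simp add: M m_assoc)
      ultimately have "inv h \<simeq> \<one> \<otimes> g [^] M" using g True act_eq_sym by simp
      then show ?thesis using subgroup.one_closed[OF Ks] True g by blast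
    next
      case False
      then have "inv h \<in> K" using inv subgroup.m_inv_closed[OF Ks] by simp
      moreover have "inv h \<simeq> inv h \<otimes> g [^] (0::nat)" using \<open>inv h \<in> K\<close> Kc by auto
      ultimately show ?thesis using Kc by blast
    qed
  next
    case (eng u v)
    then obtain k j k' i where uv: "k \<in> K" "u \<simeq> k \<otimes> g [^] (j::nat)" "k' \<in> K" "v \<simeq> k' \<otimes> g [^] (i::nat)" "u \<in> carrier G" "v \<in> carrier G"
      by blast
    have kc: "k \<in> carrier G" "k' \<in> carrier G" using uv Kc by auto
    have "u \<otimes> v \<simeq> (k \<otimes> g [^] j) \<otimes> (k' \<otimes> g [^] i)"
      by (rule act_eq_mult) (use uv kc g in auto)
    moreover have "(k \<otimes> g [^] j) \<otimes> (k' \<otimes> g [^] i) = (k \<otimes> (g [^] j \<otimes> k' \<otimes> inv (g [^] j))) \<otimes> g [^] (j + i)"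
      using kc g by (simp add: m_assoc inv_mult_cancel flip: nat_pow_mult)
    moreover have "k \<otimes> (g [^] j \<otimes> k' \<otimes> inv (g [^] j)) \<in> K"
      by (rule subgroup.m_closed[OF Ks uv(1) normal.inv_op_closed2[OF K _ uv(3)]]) (use g in simp)
    ultimately show ?case using m_closed[OF uv(5,6)] by (simp only:) blast
  qed
  obtain F where F: "finite F" "F \<subseteq> carrier G" "\<And>k. k \<in> K \<Longrightarrow> \<exists>f\<in>F. k \<simeq> f" using fin by (auto simp: finite_image_iff)
  define F' where "F' = (\<lambda>(f, r). f \<otimes> g [^] (r::nat)) ` (F \<times> {..<N})"
  have gmod: "g [^] j \<simeq> g [^] (j mod N)" for j :: nat
  proof -
    have gN: "(g [^] N) [^] q \<simeq> \<one>" for q :: nat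
    proof (induction q)
      case (Suc q)
      have "(g [^] N) [^] q \<otimes> g [^] N \<simeq> \<one> \<otimes> \<one>" by (rule act_eq_mult[OF Suc N(2)]) (use g in auto)
      then show ?case by simp
    qed simp
    have "g [^] j = (g [^] N) [^] (j div N) \<otimes> g [^] (j mod N)"
      using g by (simp add: nat_pow_pow nat_pow_mult)
    moreover have "(g [^] N) [^] (j div N) \<otimes> g [^] (j mod N) \<simeq> \<one> \<otimes> g [^] (j mod N)"
      by (rule act_eq_right[OF gN]) (use g in auto)
    ultimately show ?thesis using g by simp
  qed
  have "\<exists>f\<in>F'. u \<simeq> f" if u: "u \<in> generate G (insert g K)" for u
  proof -
    obtain k j where kj: "u \<in> carrier G" "k \<in> K" "u \<simeq> k \<otimes> g [^] (j::nat)" using rep[OF u] by blast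
    obtain f where f: "f \<in> F" "k \<simeq> f" using F(3) kj by blast
    have "k \<otimes> g [^] j \<simeq> f \<otimes> g [^] (j mod N)"
      by (rule act_eq_mult[OF f(2) gmod]) (use f kj Kc F g in auto)
    then have "u \<simeq> f \<otimes> g [^] (j mod N)" using kj(3) act_eq_trans by blast
    moreover have "f \<otimes> g [^] (j mod N) \<in> F'" using f N unfolding F'_def by force
    ultimately show ?thesis by blast
  qed
  moreover have "finite F'" "F' \<subseteq> carrier G" using F g by (auto simp: F'_def)
  ultimately show ?thesis unfolding finite_image_iff by blast
qed

text \<open>In the \<open>p\<close>-torsion a maximal submodule finite modulo \<open>B\<close> is
  everything: finitely many translates of any further \<open>x\<close> span an invariant extension
  that is still finite. From the \<open>p\<close>-torsion to \<open>W\<close> leads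
  \<open>fitting\<close>, applied to multiplication by \<open>p\<close>.\<close>

lemma finite_mod_of_finite_image:
  assumes gs: "central_chain {\<one>} gs" and noeth: "noetherian_between (carrier G) B W"
    and fin: "finite_image B W (carrier G)"
  shows "finite_mod B W"
proof -
  obtain p where p: "prime (p::int)" "zmul p w \<in> B" by (rule prime_annihilates[OF gs])
  obtain F where F: "finite F" "F \<subseteq> carrier G" "\<And>k. k \<in> carrier G \<Longrightarrow> \<exists>f\<in>F. k \<simeq> f"
    using fin by (auto simp: finite_image_iff)
  obtain fs where fs: "set fs = F" using finite_list[OF F(1)] by blast
  define W1 where "W1 = {x \<in> W. zmul p x \<in> B}"
  have W1: "invariant_subgroup (carrier G) W1" "B \<subseteq> W1"
    using preimage_invariant[OF zmul_additive_map zmul_mod(1,3) inv_B order_refl B_W] by (auto simp: W1_def)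
  have W1W: "W1 \<subseteq> W" by (auto simp: W1_def)
  have noeth1: "noetherian_between (carrier G) B W1"
    by (rule noetherian_between_mono[OF noeth order_refl order_refl W1W])
  define \<F> where "\<F> = {N. invariant_subgroup (carrier G) N \<and> B \<subseteq> N \<and> N \<subseteq> W1 \<and> finite_mod B N}"
  have "B \<in> \<F>" using inv_B W1(2) finite_mod_self[OF asB] by (simp add: \<F>_def)
  then have ne: "\<F> \<noteq> {}" by blast
  obtain N where N: "N \<in> \<F>" and Nmax: "\<And>N'. N' \<in> \<F> \<Longrightarrow> N \<subseteq> N' \<Longrightarrow> N' = N"
    by (rule noetherian_between_maximal[OF noeth1 ne]) (auto simp: \<F>_def)
  have N': "invariant_subgroup (carrier G) N" "B \<subseteq> N" "N \<subseteq> W1" "finite_mod B N" using N by (auto simp: \<F>_def)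
  note asN = invariant_add_subgroup[OF N'(1)]
  have "x \<in> N" if x: "x \<in> W1" for x
  proof -
    let ?xs = "map (\<lambda>f. \<rho> f x) fs"
    define V where "V = span_over N ?xs"
    note V = span_over_subgroup[OF asN, of ?xs, folded V_def]
    have xW: "x \<in> W" "zmul p x \<in> B" using x by (auto simp: W1_def)
    have "zmul p (\<rho> f x) \<in> B" if "f \<in> F" for f
      using that F(2) additive_zmul[of "\<rho> f" p x] rep_add invariant_rep[OF inv_B _ xW(2), of f] by auto
    then have Vfin: "finite_mod B V"
      unfolding V_def using fs prime_gt_0_int[OF p(1)] by (intro finite_mod_span_over[OF asB asN N'(4)]) auto
    have VW: "V \<subseteq> W1"
      unfolding V_def using fs F(2) invariant_rep[OF W1(1) _ x]
      by (intro span_over_subset[OF invariant_add_subgroup[OF W1(1)] N'(3)]) auto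
    have near: "\<rho> g x \<in> V" if g: "g \<in> carrier G" for g
    proof -
      obtain f where f: "f \<in> F" "g \<simeq> f" using F(3)[OF g] by blast
      have "\<rho> f x \<in> V" using f(1) V(3) fs by auto
      moreover have "\<rho> g x - \<rho> f x \<in> V" using f(2) xW(1) N'(2) V(2) by (auto simp: act_eq_def)
      ultimately show ?thesis using add_subgroup_congruent[OF V(1)] by blast
    qed
    have "\<rho> g y \<in> V" if g: "g \<in> carrier G" and y: "y \<in> V" for g y
    proof -
      have "V \<subseteq> {y. \<rho> g y \<in> V}"
        unfolding V_def
      proof (rule span_over_subset, unfold V_def[symmetric])
        show "add_subgroup {y. \<rho> g y \<in> V}"
          using V(1) g by (auto simp: add_subgroup_def rep_zero rep_diff)
        show "N \<subseteq> {y. \<rho> g y \<in> V}" using invariant_rep[OF N'(1) g] V(2) by auto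
        show "set ?xs \<subseteq> {y. \<rho> g y \<in> V}"
          using fs F(2) g near by (auto simp flip: rep_mult)
      qed
      then show ?thesis using y by blast
    qed
    then have "invariant_subgroup (carrier G) V" using V(1) by (simp add: invariant_subgroup_def)
    then have "V = N" using Nmax[of V] V(2) N'(2) VW Vfin by (auto simp: \<F>_def)
    then show "x \<in> N" using near[of \<one>] rep_one by simp
  qed
  then have "finite_mod B W1" using finite_mod_subset[OF N'(4)] by blast
  then have fin_ker: "finite_mod B {x \<in> W. zmul p x \<in> B}" by (simp only: W1_def)
  show ?thesis by (rule fitting[OF zmul_additive_map _ _ _ p(2) noeth fin_ker]; rule zmul_mod; assumption)
qed

end

context group_rep begin

text \<open>A power \<open>y\<close> of the next generator is central in the action and fixes
  \<open>w\<close>, so \<open>\<rho> y - 1\<close> is an endomorphism that kills \<open>w\<close>.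
  On its kernel the generator has finite order, the induction hypothesis makes the kernel finite,
  and \<open>fitting\<close> returns to \<open>W\<close>. Hence the induction varies
  \<open>W\<close> and keeps \<open>B\<close> and \<open>w\<close>.\<close>

lemma monolithic_finite:
  assumes gs0: "central_chain {\<one>} gs0"
    and "monolithic G \<rho> B W w" "noetherian_between (carrier G) B W"
    and "K \<lhd> G" "central_chain K gs" "finite_image B W K"
  shows "finite_mod B W"
  using assms(2-)
proof (induction gs arbitrary: K W)
  case Nil
  then interpret monolithic G \<rho> B W w by simp
  show ?case using finite_mod_of_finite_image[OF gs0] Nil by simp
next
  case (Cons g gs)
  interpret monolithic G \<rho> B W w by fact
  have g: "g \<in> carrier G" "\<And>h. h \<in> carrier G \<Longrightarrow> h \<otimes> g \<otimes> inv h \<otimes> inv g \<in> K"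
    and gs: "central_chain (generate G (insert g K)) gs" using Cons.prems(4) by auto
  obtain m where m: "m > 0" "\<And>h. h \<in> carrier G \<Longrightarrow> h \<otimes> g [^] (m::nat) \<otimes> inv h \<otimes> inv (g [^] m) \<in> act_kernel"
    using power_in_center[OF Cons.prems(3) g(1) _ Cons.prems(5)] g(2) by blast
  have gm: "g [^] m \<in> carrier G" using g by simp
  obtain p where p: "prime (p::int)" "zmul p w \<in> B" by (rule prime_annihilates[OF gs0])
  obtain n where n: "n > 0" "\<rho> ((g [^] m) [^] (n::nat)) w - w \<in> B"
    by (rule finite_order_mod[OF gs0 gm m(2) p])
  define y where "y = (g [^] m) [^] n"
  have y: "y \<in> carrier G" "y = g [^] (m * n)" using g by (simp_all add: y_def nat_pow_pow)
  have yc: "act_eq (h \<otimes> y) (y \<otimes> h)" if "h \<in> carrier G" for h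
    unfolding y_def using act_eq_commute_pow[OF _ that gm] m(2)[OF that] commutator_in_kernel[OF that gm] by blast
  define c where "c x = \<rho> y x - x" for x
  have c_add: "additive_map c" by unfold_locales (simp add: c_def rep_add y(1))
  have cB: "c x \<in> B" if "x \<in> B" for x
    unfolding c_def using invariant_rep[OF inv_B y(1) that] that by (rule add_subgroup_diff[OF asB])
  have cW: "c x \<in> W" if "x \<in> W" for x
    unfolding c_def using invariant_rep[OF inv_W y(1) that] that by (rule add_subgroup_diff[OF asW])
  have cc: "c (\<rho> h x) - \<rho> h (c x) \<in> B" if h: "h \<in> carrier G" and x: "x \<in> W" for h x
  proof -
    have "c (\<rho> h x) - \<rho> h (c x) = \<rho> (y \<otimes> h) x - \<rho> (h \<otimes> y) x"
      using h y(1) by (simp add: c_def rep_diff rep_mult)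
    then show ?thesis using act_eq_sym[OF yc[OF h]] x by (simp add: act_eq_def)
  qed
  define W1 where "W1 = {x \<in> W. c x \<in> B}"
  note W1 = preimage_invariant[OF c_add cB cc inv_B order_refl B_W, folded W1_def]
  have W1W: "W1 \<subseteq> W" by (auto simp: W1_def)
  have cw: "c w \<in> B" using n(2) by (simp add: c_def y_def)
  interpret M1: monolithic G \<rho> B W1 w
  proof
    show "w \<in> N" if "invariant_subgroup (carrier G) N" "B \<subseteq> N" "N \<subseteq> W1" "N \<noteq> B" for N
      using essential[OF that(1,2) order_trans[OF that(3) W1W] that(4)] .
    show "w \<in> W1" using w_W cw by (simp add: W1_def)
  qed (use W1 inv_B w_B in auto)
  have noeth1: "noetherian_between (carrier G) B W1"
    by (rule noetherian_between_mono[OF Cons.prems(2) order_refl order_refl W1W])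
  have fin1: "finite_image B W1 K" by (rule finite_image_mono[OF Cons.prems(5) W1W])
  have "M1.act_eq (g [^] (m * n)) \<one>"
    unfolding M1.act_eq_def y(2)[symmetric] by (auto simp: W1_def c_def rep_one)
  then have fin': "finite_image B W1 (generate G (insert g K))"
    using m(1) n(1) by (intro M1.finite_image_generate[OF Cons.prems(3) g(1) _ _ fin1]) auto
  have "finite_mod B W1"
    by (rule Cons.IH[OF M1.monolithic_axioms noeth1 normal_generate_insert[OF Cons.prems(3) g] gs fin'])
  then have fin_ker: "finite_mod B {x \<in> W. c x \<in> B}" by (simp only: W1_def)
  show ?case by (rule fitting[OF c_add _ _ _ cw Cons.prems(2) fin_ker]; rule cB cc cW; assumption)
qed

text \<open>P. Hall's theorem. A submodule maximal among those missing \<open>w\<close> has a monolithic quotient.\<close>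

theorem residually_finite:
  assumes gs: "central_chain {\<one>} gs" and K0: "invariant_subgroup (carrier G) K0" "K0 \<subseteq> W"
    and W: "invariant_subgroup (carrier G) W" "noetherian_between (carrier G) {0} W"
    and w: "w \<in> W" "w \<notin> K0"
  obtains B where "invariant_subgroup (carrier G) B" "K0 \<subseteq> B" "B \<subseteq> W" "w \<notin> B" "finite_mod B W"
proof -
  define \<F> where "\<F> = {N. invariant_subgroup (carrier G) N \<and> K0 \<subseteq> N \<and> N \<subseteq> W \<and> w \<notin> N}"
  have "K0 \<in> \<F>" using K0 w by (simp add: \<F>_def)
  then have ne: "\<F> \<noteq> {}" by blast
  obtain B where B: "B \<in> \<F>" and Bmax: "\<And>N'. N' \<in> \<F> \<Longrightarrow> B \<subseteq> N' \<Longrightarrow> N' = B"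
    by (rule noetherian_between_maximal[OF W(2) ne])
      (use add_subgroup_zero[OF invariant_add_subgroup[OF K0(1)]] in \<open>auto simp: \<F>_def\<close>)
  have B': "invariant_subgroup (carrier G) B" "K0 \<subseteq> B" "B \<subseteq> W" "w \<notin> B" using B by (auto simp: \<F>_def)
  interpret monolithic G \<rho> B W w
  proof
    show "w \<in> N" if "invariant_subgroup (carrier G) N" "B \<subseteq> N" "N \<subseteq> W" "N \<noteq> B" for N
      using Bmax[of N] that B' by (auto simp: \<F>_def)
  qed (use B' W w in auto)
  have "noetherian_between (carrier G) B W"
    using B' add_subgroup_zero[OF asB] by (intro noetherian_between_mono[OF W(2)]) auto
  moreover have "finite_image B W {\<one>}"
    unfolding finite_image_iff by (intro exI[of _ "{\<one>}"]) auto
  ultimately have "finite_mod B W"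
    using monolithic_finite[OF gs monolithic_axioms _ one_is_normal gs] by blast
  then show ?thesis using that B' by blast
qed

end

subsection \<open>Finitely generated nilpotent groups\<close>

declare lower_central_series.simps(2) [simp del]

context group begin

lemma commutator_inverse:
  assumes "x \<in> carrier G" "y \<in> carrier G"
  shows "inv (x \<otimes> y \<otimes> inv x \<otimes> inv y) = y \<otimes> x \<otimes> inv y \<otimes> inv x"
  using assms by (simp add: inv_mult_group m_assoc)

lemma lower_central_series_normal: "lower_central_series G n \<lhd> G"
proof (induction n)
  case 0
  show ?case by (rule normal_invI) (auto simp: subgroup_self)
next
  case (Suc n)
  note sub = subgroup.subset[OF normal_imp_subgroup[OF Suc]]
  show ?case
    unfolding lower_central_series.simps(2)
  proof (rule normal_generateI)
    show "(\<Union>x\<in>lower_central_series G n. \<Union>y\<in>carrier G. {x \<otimes> y \<otimes> inv x \<otimes> inv y}) \<subseteq> carrier G"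
      using sub by auto
    fix c h assume "c \<in> (\<Union>x\<in>lower_central_series G n. \<Union>y\<in>carrier G. {x \<otimes> y \<otimes> inv x \<otimes> inv y})" and h: "h \<in> carrier G"
    then obtain x y where c: "x \<in> lower_central_series G n" "y \<in> carrier G" "c = x \<otimes> y \<otimes> inv x \<otimes> inv y" by auto
    have xc: "x \<in> carrier G" using c sub by auto
    have "h \<otimes> c \<otimes> inv h = (h \<otimes> x \<otimes> inv h) \<otimes> (h \<otimes> y \<otimes> inv h) \<otimes> inv (h \<otimes> x \<otimes> inv h) \<otimes> inv (h \<otimes> y \<otimes> inv h)"
      using xc c(2) h unfolding c(3) by (simp add: inv_mult_group m_assoc inv_mult_cancel)
    moreover have "h \<otimes> x \<otimes> inv h \<in> lower_central_series G n" by (rule normal.inv_op_closed2[OF Suc h c(1)])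
    moreover have "h \<otimes> y \<otimes> inv h \<in> carrier G" using h c by simp
    ultimately show "h \<otimes> c \<otimes> inv h \<in> (\<Union>x\<in>lower_central_series G n. \<Union>y\<in>carrier G. {x \<otimes> y \<otimes> inv x \<otimes> inv y})"
      by blast
  qed
qed

lemmas lower_central_series_subgroup = normal_imp_subgroup[OF lower_central_series_normal]
lemmas lower_central_series_subset = subgroup.subset[OF lower_central_series_subgroup]

lemma commutator_in_lower_central_series:
  assumes "x \<in> lower_central_series G n" "h \<in> carrier G"
  shows "x \<otimes> h \<otimes> inv x \<otimes> inv h \<in> lower_central_series G (Suc n)"
    "h \<otimes> x \<otimes> inv h \<otimes> inv x \<in> lower_central_series G (Suc n)"
proof -
  show 1: "x \<otimes> h \<otimes> inv x \<otimes> inv h \<in> lower_central_series G (Suc n)"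
    unfolding lower_central_series.simps(2) by (rule generate.incl) (use assms in blast)
  have "x \<in> carrier G" using assms lower_central_series_subset by blast
  then show "h \<otimes> x \<otimes> inv h \<otimes> inv x \<in> lower_central_series G (Suc n)"
    using subgroup.m_inv_closed[OF lower_central_series_subgroup 1] commutator_inverse[of x h] assms by simp
qed

lemma lower_central_series_Suc_subset: "lower_central_series G (Suc n) \<subseteq> lower_central_series G n"
  unfolding lower_central_series.simps(2)
proof (rule generate_subgroup_incl[OF _ lower_central_series_subgroup], safe)
  fix x y assume x: "x \<in> lower_central_series G n" "y \<in> carrier G"
  note sub = lower_central_series_subgroup[of n]
  have xc: "x \<in> carrier G" using x lower_central_series_subset by blast
  have "x \<otimes> (y \<otimes> inv x \<otimes> inv y) \<in> lower_central_series G n"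
    using subgroup.m_closed[OF sub x(1) normal.inv_op_closed2[OF lower_central_series_normal x(2) subgroup.m_inv_closed[OF sub x(1)]]] .
  then show "x \<otimes> y \<otimes> inv x \<otimes> inv y \<in> lower_central_series G n" using xc x by (simp add: m_assoc)
qed

text \<open>Commutators of generators suffice: with \<open>Q\<close> generated by them and the term
  \<open>Suc (Suc n)\<close>, the elements central modulo \<open>Q\<close> form a subgroup. It
  contains \<open>F\<close> and the term \<open>Suc n\<close>, hence the whole term
  \<open>n\<close>, and so \<open>Q\<close> contains all commutators that define the term
  \<open>Suc n\<close>.\<close>

lemma lower_central_series_generators:
  assumes S: "finite S" "S \<subseteq> carrier G" "generate G S = carrier G"
  shows "\<exists>F. finite F \<and> F \<subseteq> lower_central_series G n \<and>
    generate G (F \<union> lower_central_series G (Suc n)) = lower_central_series G n"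
proof (induction n)
  case 0
  have "generate G (S \<union> lower_central_series G (Suc 0)) = carrier G"
  proof
    have "S \<union> lower_central_series G (Suc 0) \<subseteq> carrier G" using S lower_central_series_subset by blast
    then show "generate G (S \<union> lower_central_series G (Suc 0)) \<subseteq> carrier G" by (rule generate_incl)
    show "carrier G \<subseteq> generate G (S \<union> lower_central_series G (Suc 0))"
      using mono_generate[of S "S \<union> lower_central_series G (Suc 0)"] S by auto
  qed
  then show ?case using S by (intro exI[of _ S]) simp
next
  case (Suc n)
  let ?g = "lower_central_series G"
  obtain F where F: "finite F" "F \<subseteq> ?g n" "generate G (F \<union> ?g (Suc n)) = ?g n" using Suc by blast
  have Fc: "F \<subseteq> carrier G" using F lower_central_series_subset by blast
  define F' where "F' = (\<lambda>(x, s). x \<otimes> s \<otimes> inv x \<otimes> inv s) ` (F \<times> S)"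
  have F': "F' \<subseteq> ?g (Suc n)"
  proof
    fix c assume "c \<in> F'"
    then obtain x s where c: "x \<in> F" "s \<in> S" "c = x \<otimes> s \<otimes> inv x \<otimes> inv s" by (auto simp: F'_def)
    show "c \<in> ?g (Suc n)"
      unfolding c(3) by (rule commutator_in_lower_central_series(1)[OF subsetD[OF F(2) c(1)] subsetD[OF S(2) c(2)]])
  qed
  define Q where "Q = generate G (F' \<union> ?g (Suc (Suc n)))"
  have gen_sub: "F' \<union> ?g (Suc (Suc n)) \<subseteq> ?g (Suc n)" using F' lower_central_series_Suc_subset[of "Suc n"] by blast
  have gen_c: "F' \<union> ?g (Suc (Suc n)) \<subseteq> carrier G" using gen_sub lower_central_series_subset by blast
  have Qs: "subgroup Q G" unfolding Q_def by (rule generate_is_subgroup[OF gen_c])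
  have Qsub: "Q \<subseteq> ?g (Suc n)" unfolding Q_def by (rule generate_subgroup_incl[OF gen_sub lower_central_series_subgroup])
  have Qsup: "?g (Suc (Suc n)) \<subseteq> Q" "F' \<subseteq> Q" unfolding Q_def by (auto intro: generate.incl)
  \<comment> \<open>\<open>Q\<close> lies between two consecutive terms of the series; conjugation
    changes its elements only by factors in the lower term.\<close>
  have Q: "Q \<lhd> G"
  proof (rule normal_invI[OF Qs])
    fix h q assume h: "h \<in> carrier G" and q: "q \<in> Q"
    have qc: "q \<in> carrier G" using q subgroup.subset[OF Qs] by blast
    have "h \<otimes> q \<otimes> inv h \<otimes> inv q \<in> Q"
      by (rule subsetD[OF Qsup(1) commutator_in_lower_central_series(2)[OF subsetD[OF Qsub q] h]])
    then have "(h \<otimes> q \<otimes> inv h \<otimes> inv q) \<otimes> q \<in> Q" using subgroup.m_closed[OF Qs] q by blast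
    then show "h \<otimes> q \<otimes> inv h \<in> Q" using h qc by (simp add: m_assoc)
  qed
  define Z where "Z = {x \<in> carrier G. \<forall>h\<in>carrier G. h \<otimes> x \<otimes> inv h \<otimes> inv x \<in> Q}"
  have Zs: "subgroup Z G" unfolding Z_def by (rule normal_centralizer_mod[OF Q])
  have "x \<in> Z" if x: "x \<in> F" for x
  proof -
    have xc: "x \<in> carrier G" using x Fc by blast
    \<comment> \<open>The elements commuting with \<open>x\<close> modulo \<open>Q\<close> form a
      subgroup, so it is enough that the generators in \<open>S\<close> do.\<close>
    define C where "C = {h \<in> carrier G. h \<otimes> x \<otimes> inv h \<otimes> inv x \<in> Q}"
    have "subgroup C G"
    proof (rule subgroupI)
      show "C \<subseteq> carrier G" by (auto simp: C_def)
      have "\<one> \<in> C" using subgroup.one_closed[OF Qs] xc by (simp add: C_def)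
      then show "C \<noteq> {}" by blast
      fix h assume h: "h \<in> C"
      then have hc: "h \<in> carrier G" by (simp add: C_def)
      have "inv h \<otimes> x \<otimes> inv (inv h) \<otimes> inv x = inv h \<otimes> inv (h \<otimes> x \<otimes> inv h \<otimes> inv x) \<otimes> h"
        using hc xc by (simp add: inv_mult_group m_assoc inv_mult_cancel)
      also have "\<dots> \<in> Q"
        using h by (intro normal.inv_op_closed1[OF Q hc] subgroup.m_inv_closed[OF Qs]) (simp add: C_def)
      finally show "inv h \<in> C" using hc by (simp add: C_def)
      fix h' assume h': "h' \<in> C"
      then have hc': "h' \<in> carrier G" by (simp add: C_def)
      have "h \<otimes> h' \<otimes> x \<otimes> inv (h \<otimes> h') \<otimes> inv x
        = (h \<otimes> (h' \<otimes> x \<otimes> inv h' \<otimes> inv x) \<otimes> inv h) \<otimes> (h \<otimes> x \<otimes> inv h \<otimes> inv x)"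
        using hc hc' xc by (simp add: inv_mult_group m_assoc inv_mult_cancel)
      also have "\<dots> \<in> Q"
        by (rule subgroup.m_closed[OF Qs normal.inv_op_closed2[OF Q hc]]) (use h h' in \<open>simp_all add: C_def\<close>)
      finally show "h \<otimes> h' \<in> C" using hc hc' by (simp add: C_def)
    qed
    moreover have "S \<subseteq> C"
    proof
      fix s assume s: "s \<in> S"
      then have "x \<otimes> s \<otimes> inv x \<otimes> inv s \<in> Q" using x Qsup(2) by (force simp: F'_def)
      then have "s \<otimes> x \<otimes> inv s \<otimes> inv x \<in> Q"
        using subgroup.m_inv_closed[OF Qs] commutator_inverse[of x s] xc s S(2) by fastforce
      then show "s \<in> C" using s S(2) by (auto simp: C_def)
    qed
    ultimately have "carrier G \<subseteq> C" using generate_subgroup_incl[of S C] S(3) by simp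
    then show ?thesis using xc by (auto simp: Z_def C_def)
  qed
  moreover have "?g (Suc n) \<subseteq> Z"
  proof
    fix x assume x: "x \<in> ?g (Suc n)"
    then have "h \<otimes> x \<otimes> inv h \<otimes> inv x \<in> Q" if "h \<in> carrier G" for h
      by (rule subsetD[OF Qsup(1) commutator_in_lower_central_series(2)[OF _ that]])
    then show "x \<in> Z" using x lower_central_series_subset[of "Suc n"] by (auto simp: Z_def)
  qed
  ultimately have gZ: "?g n \<subseteq> Z" using generate_subgroup_incl[of "F \<union> ?g (Suc n)" Z] Zs F(3) by blast
  have "?g (Suc n) \<subseteq> Q"
    unfolding lower_central_series.simps(2)[of G n]
  proof (rule generate_subgroup_incl[OF _ Qs], safe)
    fix x y assume x: "x \<in> ?g n" "y \<in> carrier G"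
    then have xc: "x \<in> carrier G" and "y \<otimes> x \<otimes> inv y \<otimes> inv x \<in> Q" using gZ by (auto simp: Z_def)
    then show "x \<otimes> y \<otimes> inv x \<otimes> inv y \<in> Q"
      using subgroup.m_inv_closed[OF Qs] commutator_inverse[of y x] x by fastforce
  qed
  then have "Q = ?g (Suc n)" using Qsub by blast
  moreover have "finite F'" using F(1) S(1) by (simp add: F'_def)
  ultimately show ?case using F' unfolding Q_def by blast
qed

lemma central_chain_append:
  assumes "subgroup K G" "\<And>f h. f \<in> set fs \<Longrightarrow> h \<in> carrier G \<Longrightarrow> h \<otimes> f \<otimes> inv h \<otimes> inv f \<in> K"
    "set fs \<subseteq> carrier G" "central_chain (generate G (set fs \<union> K)) gs"
  shows "central_chain K (fs @ gs)"
  using assms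
proof (induction fs arbitrary: K)
  case Nil
  have "generate G K = K"
    using generate_subgroup_incl[OF order_refl Nil(1)] generate.incl[of _ K G] by blast
  then show ?case using Nil by simp
next
  case (Cons f fs)
  note Kc = subgroup.subset[OF Cons.prems(1)]
  let ?K = "generate G (insert f K)"
  have fK: "insert f K \<subseteq> carrier G" using Cons.prems(3) Kc by auto
  have Ks: "subgroup ?K G" by (rule generate_is_subgroup[OF fK])
  have c1: "set fs \<union> ?K \<subseteq> carrier G" using Cons.prems(3) subgroup.subset[OF Ks] by auto
  have c2: "set (f # fs) \<union> K \<subseteq> carrier G" using Cons.prems(3) Kc by auto
  have "generate G (set fs \<union> ?K) = generate G (set (f # fs) \<union> K)"
  proof
    have "?K \<subseteq> generate G (set (f # fs) \<union> K)" by (rule mono_generate) auto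
    moreover have "set fs \<subseteq> generate G (set (f # fs) \<union> K)" by (auto intro: generate.incl)
    ultimately show "generate G (set fs \<union> ?K) \<subseteq> generate G (set (f # fs) \<union> K)"
      by (intro generate_subgroup_incl generate_is_subgroup[OF c2]) auto
    have "set (f # fs) \<union> K \<subseteq> set fs \<union> ?K" by (auto intro: generate.incl)
    then show "generate G (set (f # fs) \<union> K) \<subseteq> generate G (set fs \<union> ?K)" by (rule mono_generate)
  qed
  moreover have "h \<otimes> f' \<otimes> inv h \<otimes> inv f' \<in> ?K" if "f' \<in> set fs" "h \<in> carrier G" for f' h
    using Cons.prems(2)[of f' h] that by (auto intro: generate.incl)
  ultimately have "central_chain ?K (fs @ gs)" using Cons.IH[OF Ks] Cons.prems by auto
  then show ?case using Cons.prems by auto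
qed

text \<open>Finitely many generators for each factor of the lower central series, listed one after
  the other, refine the series to one with cyclic factors.\<close>

theorem nilpotent_central_chain:
  assumes S: "finite S" "S \<subseteq> carrier G" "generate G S = carrier G"
    and nil: "lower_central_series G n = {\<one>}"
  obtains gs where "central_chain {\<one>} gs"
proof -
  have "\<exists>gs. central_chain (lower_central_series G i) gs" for i
  proof (induction i)
    case 0 then show ?case by (intro exI[of _ "[]"]) simp
  next
    case (Suc i)
    then obtain gs where gs: "central_chain (lower_central_series G i) gs" by blast
    obtain F where F: "finite F" "F \<subseteq> lower_central_series G i"
      "generate G (F \<union> lower_central_series G (Suc i)) = lower_central_series G i"
      using lower_central_series_generators[OF S] by blast
    obtain fs where fs: "set fs = F" using finite_list[OF F(1)] by blast
    have "central_chain (lower_central_series G (Suc i)) (fs @ gs)"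
      by (rule central_chain_append[OF lower_central_series_subgroup])
        (use F fs gs lower_central_series_subset[of i] commutator_in_lower_central_series(2) in auto)
    then show ?case by blast
  qed
  then show ?thesis using that nil by metis
qed

section \<open>Subgroups of finite index\<close>

lemma right_transversal:
  assumes H: "subgroup H G" "finite (rcosets H)"
  obtains T where "finite T" "T \<subseteq> carrier G" "\<And>x. x \<in> carrier G \<Longrightarrow> \<exists>h\<in>H. \<exists>t\<in>T. x = h \<otimes> t"
proof -
  note Hc = subgroup.subset[OF H(1)]
  define r where "r c = (SOME t. t \<in> c)" for c :: "'a set"
  have r: "r (H #> x) \<in> H #> x" if "x \<in> carrier G" for x
    unfolding r_def by (rule someI[of _ x]) (use rcos_self[OF that H(1)] in simp)
  have "\<exists>h\<in>H. \<exists>t\<in>r ` (rcosets H). x = h \<otimes> t" if x: "x \<in> carrier G" for x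
  proof -
    obtain h where h: "h \<in> H" "r (H #> x) = h \<otimes> x" using r[OF x] by (auto simp: r_coset_def)
    then have "x = inv h \<otimes> r (H #> x)" using x Hc by (auto simp: inv_mult_cancel)
    moreover have "inv h \<in> H" using subgroup.m_inv_closed[OF H(1) h(1)] .
    moreover have "H #> x \<in> rcosets H" using x by (auto simp: RCOSETS_def)
    ultimately show ?thesis by blast
  qed
  moreover have "r ` (rcosets H) \<subseteq> carrier G"
  proof safe
    fix c assume "c \<in> rcosets H"
    then obtain x where x: "x \<in> carrier G" "c = H #> x" by (auto simp: RCOSETS_def)
    then show "r c \<in> carrier G" using r[of x] r_coset_subset_G[OF Hc x(1)] by auto
  qed
  ultimately show ?thesis using that[of "r ` (rcosets H)"] H(2) by blast
qed

text \<open>Schreier's argument: if \<open>?K\<close> is generated by the elements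
  \<open>t s (t')^-1\<close> that lie in \<open>H\<close>, then the product set of \<open>?K\<close>
  and \<open>T\<close> is stable under right multiplication by the generators of the group, so it is
  the whole group.\<close>

theorem finite_index_subgroup_finitely_generated:
  assumes S: "finite S" "S \<subseteq> carrier G" "generate G S = carrier G"
    and H: "subgroup H G" "finite (rcosets H)"
  obtains A where "finite A" "A \<subseteq> H" "generate G A = H"
proof -
  note Hc = subgroup.subset[OF H(1)]
  obtain T0 where T0: "finite T0" "T0 \<subseteq> carrier G" "\<And>x. x \<in> carrier G \<Longrightarrow> \<exists>h\<in>H. \<exists>t\<in>T0. x = h \<otimes> t"
    by (rule right_transversal[OF H]) blast
  define T where "T = insert \<one> T0"
  have T: "finite T" "T \<subseteq> carrier G" "\<one> \<in> T" "\<And>x. x \<in> carrier G \<Longrightarrow> \<exists>h\<in>H. \<exists>t\<in>T. x = h \<otimes> t"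
    using T0(1,2) T0(3) unfolding T_def by (auto, blast)
  define S' where "S' = S \<union> m_inv G ` S"
  have S': "finite S'" "S' \<subseteq> carrier G" using S by (auto simp: S'_def)
  \<comment> \<open>\<open>T\<close> is included because it may contain two elements of
    \<open>H\<close>, the inserted \<open>\<one>\<close> and the chosen representative of the coset
    \<open>H\<close>.\<close>
  define A where "A = H \<inter> ((\<lambda>(t, s, t'). t \<otimes> s \<otimes> inv t') ` (T \<times> S' \<times> T) \<union> T)"
  have A: "finite A" "A \<subseteq> H" using T S' by (auto simp: A_def)
  have Ac: "A \<subseteq> carrier G" using A Hc by auto
  let ?K = "generate G A"
  have Ks: "subgroup ?K G" by (rule generate_is_subgroup[OF Ac])
  note Kc = subgroup.subset[OF Ks]
  define P where "P = {k \<otimes> t | k t. k \<in> ?K \<and> t \<in> T}"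
  have step: "y \<otimes> s \<in> P" if y: "y \<in> P" and s: "s \<in> S'" for y s
  proof -
    obtain k t where kt: "k \<in> ?K" "t \<in> T" "y = k \<otimes> t" using y by (auto simp: P_def)
    have c: "k \<in> carrier G" "t \<in> carrier G" "s \<in> carrier G" using kt Kc T S' s by auto
    obtain h t' where ht: "h \<in> H" "t' \<in> T" "t \<otimes> s = h \<otimes> t'" using T(4)[of "t \<otimes> s"] c by auto
    have c': "h \<in> carrier G" "t' \<in> carrier G" using ht Hc T by auto
    have "h = t \<otimes> s \<otimes> inv t'" using ht(3) c c' by (simp add: m_assoc)
    then have "h \<in> A" using ht kt s unfolding A_def by force
    then have "k \<otimes> h \<in> ?K" by (rule generate.eng[OF kt(1) generate.incl])
    moreover have "y \<otimes> s = (k \<otimes> h) \<otimes> t'" using kt(3) ht(3) c c' by (simp add: m_assoc)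
    ultimately show ?thesis using ht(2) by (auto simp: P_def)
  qed
  have "y \<otimes> x \<in> P" if "x \<in> generate G S" "y \<in> P" for x y
    using that
  proof (induction arbitrary: y rule: generate.induct)
    case one
    then have "y \<in> carrier G" using Kc T(2) by (auto simp: P_def)
    then show ?case using one by simp
  next
    case (eng a b)
    have "a \<in> carrier G" "b \<in> carrier G" using eng generate_in_carrier[OF S(2)] by auto
    moreover have "y \<in> carrier G" using eng(5) Kc T by (auto simp: P_def)
    ultimately have "y \<otimes> (a \<otimes> b) = y \<otimes> a \<otimes> b" by (simp add: m_assoc)
    then show ?case using eng by simp
  qed (auto intro!: step simp: S'_def)
  moreover have "\<one> \<otimes> \<one> \<in> P" using T(3) generate.one unfolding P_def by blast
  ultimately have carr: "\<one> \<otimes> x \<in> P" if "x \<in> carrier G" for x using that S(3) by (metis l_one one_closed)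
  have "H \<subseteq> ?K"
  proof
    fix h assume h: "h \<in> H"
    then have "h \<in> P" using carr[of h] Hc by auto
    then obtain k t where kt: "k \<in> ?K" "t \<in> T" "h = k \<otimes> t" by (auto simp: P_def)
    have KH: "?K \<subseteq> H" by (rule generate_subgroup_incl[OF A(2) H(1)])
    have "k \<in> carrier G" "t \<in> carrier G" using kt Kc T(2) by auto
    then have "t = inv k \<otimes> h" unfolding kt(3) by (rule inv_mult_cancel(1)[symmetric])
    then have "t \<in> H" using KH kt(1) h subgroup.m_closed[OF H(1) subgroup.m_inv_closed[OF H(1)]] by blast
    then have "t \<in> A" using kt(2) by (auto simp: A_def)
    then show "h \<in> ?K" unfolding kt(3) by (rule generate.eng[OF kt(1) generate.incl])
  qed
  then have "?K = H" using generate_subgroup_incl[OF A(2) H(1)] by blast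
  then show ?thesis using that A by blast
qed

end

subsection \<open>The invariant mean\<close>

lemma continuous_map_complex_iff:
  fixes f :: "'a \<Rightarrow> complex"
  shows "continuous_map T euclidean f \<longleftrightarrow>
    (\<forall>x\<in>topspace T. \<forall>e>0. \<exists>U. openin T U \<and> x \<in> U \<and> (\<forall>y\<in>U. norm (f y - f x) < e))"
  using Met_TC.continuous_map_to_metric[of T f] by (simp add: mtopology_is_euclidean dist_norm norm_minus_commute)

lemma continuous_map_complex_minus:
  "continuous_map T euclidean f \<Longrightarrow> continuous_map T euclidean (\<lambda>x. - f x :: complex)"
  by (auto simp: continuous_map_atin intro: tendsto_minus)

lemma continuous_map_complex_cnj:
  "continuous_map T euclidean f \<Longrightarrow> continuous_map T euclidean (\<lambda>x. cnj (f x))"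
  by (auto simp: continuous_map_atin intro: tendsto_cnj)

lemma continuous_map_complex_of_real:
  "continuous_map T euclidean f \<Longrightarrow> continuous_map T euclidean (\<lambda>x. complex_of_real (f x))"
  by (auto simp: continuous_map_atin intro: tendsto_of_real)

lemma continuous_map_complex_const: "continuous_map T euclidean (\<lambda>x. c :: complex)"
  by simp

lemmas continuous_map_complex_intros = continuous_map_complex_mult continuous_map_complex_minus
  continuous_map_complex_cnj continuous_map_complex_of_real continuous_map_add continuous_map_diff
  continuous_map_complex_const continuous_map_sum

section \<open>Uniform continuity and averages over translates\<close>

context compact_metrizable_abelian_group
begin

abbreviation cont :: "('x \<Rightarrow> complex) \<Rightarrow> bool" where
  "cont f \<equiv> continuous_map T euclidean f"

abbreviation cont2 :: "('x \<Rightarrow> 'x \<Rightarrow> complex) \<Rightarrow> bool" where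
  "cont2 F \<equiv> continuous_map (prod_topology T T) euclidean (\<lambda>(x, y). F x y)"

lemma continuous_map_mult_gen:
  assumes "continuous_map S T f" "continuous_map S T g"
  shows "continuous_map S T (\<lambda>x. f x \<otimes> g x)"
  using continuous_map_compose[OF continuous_map_pairedI[OF assms] continuous_mult] by (simp add: o_def)

lemma continuous_map_inv_gen:
  assumes "continuous_map S T f"
  shows "continuous_map S T (\<lambda>x. inv (f x))"
  using continuous_map_compose[OF assms continuous_inv] by (simp add: o_def)

lemma continuous_map_translate: "a \<in> carrier X \<Longrightarrow> continuous_map T T (\<lambda>x. x \<otimes> a)"
  by (intro continuous_map_mult_gen) (auto simp: topspace_eq)

lemma cont_comp: "cont f \<Longrightarrow> continuous_map S T g \<Longrightarrow> continuous_map S euclidean (\<lambda>x. f (g x))"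
  using continuous_map_compose[of S T g euclidean f] by (simp add: o_def)

lemma cont_translate: "cont f \<Longrightarrow> a \<in> carrier X \<Longrightarrow> cont (\<lambda>x. f (x \<otimes> a))"
  by (rule cont_comp[OF _ continuous_map_translate])

lemma cont2_slice:
  assumes "cont2 F"
  shows "x \<in> carrier X \<Longrightarrow> cont (F x)" "y \<in> carrier X \<Longrightarrow> cont (\<lambda>x. F x y)"
proof -
  show "cont (F x)" if "x \<in> carrier X"
    using continuous_map_compose[OF continuous_map_pairedI[of T T "\<lambda>_. x" T "\<lambda>y. y"] assms] that
    by (simp add: o_def topspace_eq)
  show "cont (\<lambda>x. F x y)" if "y \<in> carrier X"
    using continuous_map_compose[OF continuous_map_pairedI[of T T "\<lambda>x. x" T "\<lambda>_. y"] assms] that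
    by (simp add: o_def topspace_eq)
qed

lemma translate_open:
  assumes "openin T U" "\<one> \<in> U" "x \<in> carrier X"
  shows "openin T ((\<lambda>u. x \<otimes> u) ` U)" "x \<in> (\<lambda>u. x \<otimes> u) ` U"
proof -
  have U: "U \<subseteq> carrier X" using openin_subset[OF assms(1)] by (simp add: topspace_eq)
  have "(\<lambda>u. x \<otimes> u) ` U = {y \<in> topspace T. y \<otimes> inv x \<in> U}"
  proof (intro equalityI subsetI)
    fix y assume "y \<in> {y \<in> topspace T. y \<otimes> inv x \<in> U}"
    then have "y = x \<otimes> (y \<otimes> inv x)" "y \<otimes> inv x \<in> U"
      using assms(3) by (auto simp: topspace_eq m_assoc[symmetric] m_comm[of x] m_assoc)
    then show "y \<in> (\<lambda>u. x \<otimes> u) ` U" by blast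
  next
    fix y assume "y \<in> (\<lambda>u. x \<otimes> u) ` U"
    then obtain u where u: "u \<in> U" "y = x \<otimes> u" by blast
    then have "u \<in> carrier X" using U by blast
    then have "y \<otimes> inv x = u" using u(2) assms(3) by (simp add: m_comm[of x] m_assoc)
    then show "y \<in> {y \<in> topspace T. y \<otimes> inv x \<in> U}" using u \<open>u \<in> carrier X\<close> assms(3) by (simp add: topspace_eq)
  qed
  then show "openin T ((\<lambda>u. x \<otimes> u) ` U)"
    using openin_continuous_map_preimage[OF continuous_map_translate[of "inv x"] assms(1)] assms(3) by simp
  show "x \<in> (\<lambda>u. x \<otimes> u) ` U" using assms(2,3) by force
qed

lemma finite_translate_cover:
  assumes "openin T U" "\<one> \<in> U"
  obtains I where "finite I" "I \<subseteq> carrier X" "I \<noteq> {}" "\<And>x. x \<in> carrier X \<Longrightarrow> \<exists>a\<in>I. \<exists>u\<in>U. x = a \<otimes> u"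
proof -
  have "\<forall>V\<in>(\<lambda>x. (\<lambda>u. x \<otimes> u) ` U) ` carrier X. openin T V" using translate_open[OF assms] by auto
  moreover have "topspace T \<subseteq> \<Union>((\<lambda>x. (\<lambda>u. x \<otimes> u) ` U) ` carrier X)"
    using translate_open(2)[OF assms] by (auto simp: topspace_eq)
  ultimately obtain \<F> where \<F>: "finite \<F>" "\<F> \<subseteq> (\<lambda>x. (\<lambda>u. x \<otimes> u) ` U) ` carrier X" "topspace T \<subseteq> \<Union>\<F>"
    using compact unfolding compact_space_alt by metis
  then obtain I where I: "I \<subseteq> carrier X" "finite I" "\<F> = (\<lambda>x. (\<lambda>u. x \<otimes> u) ` U) ` I"
    by (meson finite_subset_image)
  have cov: "\<exists>a\<in>I. \<exists>u\<in>U. x = a \<otimes> u" if "x \<in> carrier X" for x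
    using \<F>(3) that unfolding I(3) topspace_eq by blast
  then have "I \<noteq> {}" using one_closed by blast
  then show ?thesis using that I cov by blast
qed

text \<open>The tube lemma along \<open>\<one>\<close>, for the open set of all
  \<open>(x, y)\<close> and \<open>u\<close> where translating \<open>x\<close> by \<open>u\<close>
  changes \<open>F\<close> by less than \<open>e\<close>.\<close>

lemma uniform_continuity2:
  assumes F: "continuous_map (prod_topology T Y) euclidean (\<lambda>(x, y). F x y :: complex)" and Y: "compact_space Y" and e: "e > 0"
  obtains U where "openin T U" "\<one> \<in> U"
    "\<And>x y u. x \<in> carrier X \<Longrightarrow> y \<in> topspace Y \<Longrightarrow> u \<in> U \<Longrightarrow> norm (F (x \<otimes> u) y - F x y) < e"
proof -
  let ?Z = "prod_topology T Y"
  let ?D = "\<lambda>(z, u). norm (F (fst z \<otimes> u) (snd z) - F (fst z) (snd z))"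
  have cm_ff: "continuous_map (prod_topology ?Z T) T (\<lambda>p. fst (fst p))"
    using continuous_map_compose[OF continuous_map_fst continuous_map_fst] by (simp add: o_def)
  have cm_sf: "continuous_map (prod_topology ?Z T) Y (\<lambda>p. snd (fst p))"
    using continuous_map_compose[OF continuous_map_fst continuous_map_snd] by (simp add: o_def)
  have c1: "continuous_map (prod_topology ?Z T) ?Z (\<lambda>p. (fst (fst p) \<otimes> snd p, snd (fst p)))"
    by (intro continuous_map_pairedI continuous_map_mult_gen cm_ff cm_sf continuous_map_snd)
  have c2: "continuous_map (prod_topology ?Z T) euclidean (\<lambda>p. F (fst (fst p) \<otimes> snd p) (snd (fst p)))"
    using continuous_map_compose[OF c1 F] by (simp add: o_def)
  have c3: "continuous_map (prod_topology ?Z T) euclidean (\<lambda>p. F (fst (fst p)) (snd (fst p)))"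
    using continuous_map_compose[OF continuous_map_fst F] by (simp add: o_def case_prod_unfold)
  have "continuous_map (prod_topology ?Z T) euclidean ?D"
    using continuous_map_norm[OF continuous_map_diff[OF c2 c3]] by (simp add: case_prod_unfold)
  then have op: "openin (prod_topology ?Z T) {p \<in> topspace (prod_topology ?Z T). ?D p \<in> {..<e}}"
    by (rule openin_continuous_map_preimage) simp
  let ?W = "{p \<in> topspace (prod_topology ?Z T). ?D p \<in> {..<e}}"
  have comp: "compactin ?Z (topspace ?Z)"
    using compact Y by (metis compact_space_def compact_space_prod_topology)
  have sub: "topspace ?Z \<times> {\<one>} \<subseteq> ?W" using e by (auto simp: topspace_eq)
  have one: "\<one> \<in> topspace T" by (simp add: topspace_eq)
  obtain V U where VU: "openin ?Z V" "openin T U" "topspace ?Z \<subseteq> V" "{\<one>} \<subseteq> U" "V \<times> U \<subseteq> ?W"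
    using tube_lemma_left[OF op comp one sub] by auto
  show ?thesis
  proof (rule that[of U])
    show "openin T U" "\<one> \<in> U" using VU by auto
    fix x y u assume "x \<in> carrier X" "y \<in> topspace Y" "u \<in> U"
    then have "((x, y), u) \<in> V \<times> U" using VU by (auto simp: topspace_eq)
    then have "((x, y), u) \<in> ?W" using VU(5) by blast
    then show "norm (F (x \<otimes> u) y - F x y) < e" by simp
  qed
qed

lemma uniform_continuity:
  assumes "cont f" "e > 0"
  obtains U where "openin T U" "\<one> \<in> U"
    "\<And>x u. x \<in> carrier X \<Longrightarrow> u \<in> U \<Longrightarrow> norm (f (x \<otimes> u) - f x) < e"
proof -
  have c: "continuous_map (prod_topology T T) euclidean (\<lambda>(x, y). f x)"
    using cont_comp[OF assms(1) continuous_map_fst] by (simp add: case_prod_unfold)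
  show ?thesis
    by (rule uniform_continuity2[OF c compact assms(2)]) (use that one_closed in \<open>metis topspace_eq\<close>)
qed

lemma cont_if_uniform:
  assumes "\<And>e. e > 0 \<Longrightarrow> \<exists>U. openin T U \<and> \<one> \<in> U \<and> (\<forall>x\<in>carrier X. \<forall>u\<in>U. norm (f (x \<otimes> u) - f x :: complex) < e)"
  shows "cont f"
  unfolding continuous_map_complex_iff
proof (intro ballI allI impI)
  fix x and e :: real assume x: "x \<in> topspace T" and e: "e > 0"
  then have xc: "x \<in> carrier X" by (simp add: topspace_eq)
  obtain U where U: "openin T U" "\<one> \<in> U" "\<forall>x\<in>carrier X. \<forall>u\<in>U. norm (f (x \<otimes> u) - f x) < e" using assms[OF e] by blast
  show "\<exists>U. openin T U \<and> x \<in> U \<and> (\<forall>y\<in>U. norm (f y - f x) < e)"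
    by (rule exI[of _ "(\<lambda>u. x \<otimes> u) ` U"]) (use translate_open[OF U(1,2) xc] U(3) xc in auto)
qed

lemma cont_bounded:
  assumes "cont f"
  obtains C where "C > 0" "\<And>x. x \<in> carrier X \<Longrightarrow> norm (f x) \<le> C"
proof -
  have "compactin euclidean (f ` topspace T)"
    using image_compactin[OF _ assms] compact by (simp add: compact_space_def)
  then have "bounded (f ` carrier X)" by (simp add: compact_imp_bounded topspace_eq)
  then show ?thesis using that unfolding bounded_pos by blast
qed

text \<open>Composites are included so that several approximations can be improved by one operator;
  all these operators commute.\<close>

inductive averaging :: "(('x \<Rightarrow> complex) \<Rightarrow> 'x \<Rightarrow> complex) \<Rightarrow> bool" where
  average: "finite I \<Longrightarrow> I \<noteq> {} \<Longrightarrow> I \<subseteq> carrier X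
    \<Longrightarrow> averaging (\<lambda>f x. (\<Sum>a\<in>I. f (x \<otimes> a)) / of_nat (card I))"
| comp: "averaging A \<Longrightarrow> averaging B \<Longrightarrow> averaging (\<lambda>f. A (B f))"

lemma averaging_cong:
  assumes "averaging A" "x \<in> carrier X" "\<And>x. x \<in> carrier X \<Longrightarrow> f x = g x"
  shows "A f x = A g x"
  using assms
proof (induction arbitrary: f g x)
  case (average I)
  then show ?case by (intro arg_cong2[of _ _ _ _ "(/)"] sum.cong) auto
next
  case (comp A B)
  show ?case by (rule comp(3)[OF comp(5)]) (use comp in blast)
qed

lemma averaging_add: "averaging A \<Longrightarrow> A (\<lambda>x. f x + g x) = (\<lambda>x. A f x + A g x)"
proof (induction arbitrary: f g rule: averaging.induct)
  case (average I) show ?case by (simp add: sum.distrib add_divide_distrib)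
next
  case (comp A B) then show ?case by simp
qed

lemma averaging_scale: "averaging A \<Longrightarrow> A (\<lambda>x. c * f x) = (\<lambda>x. c * A f x)"
proof (induction arbitrary: f rule: averaging.induct)
  case (average I) show ?case by (simp add: sum_distrib_left sum_divide_distrib)
next
  case (comp A B) then show ?case by simp
qed

lemma averaging_diff: "averaging A \<Longrightarrow> A (\<lambda>x. f x - g x) = (\<lambda>x. A f x - A g x)"
  using averaging_add[of A f "\<lambda>x. (- 1) * g x"] averaging_scale[of A "- 1" g] by simp

lemma averaging_const: "averaging A \<Longrightarrow> A (\<lambda>x. c) = (\<lambda>x. c)"
proof (induction rule: averaging.induct)
  case (comp A B)
  show ?case by (simp only: comp.IH)
qed (auto simp: card_gt_0_iff)

lemma averaging_cnj: "averaging A \<Longrightarrow> A (\<lambda>x. cnj (f x)) = (\<lambda>x. cnj (A f x))"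
proof (induction arbitrary: f rule: averaging.induct)
  case (average I) show ?case by simp
next
  case (comp A B) then show ?case by simp
qed

lemma averaging_Re_le:
  assumes "averaging A" "x \<in> carrier X" "\<And>x. x \<in> carrier X \<Longrightarrow> Re (f x) \<le> M"
  shows "Re (A f x) \<le> M"
  using assms
proof (induction arbitrary: f x)
  case (average I)
  have "(\<Sum>a\<in>I. Re (f (x \<otimes> a))) \<le> (\<Sum>a\<in>I. M)" using average by (intro sum_mono) auto
  then show ?case using average by (simp add: Re_divide_of_nat divide_le_eq card_gt_0_iff mult.commute)
next
  case (comp A B)
  show ?case by (rule comp(3)[OF comp(5)]) (use comp in blast)
qed

lemma averaging_norm_le:
  assumes "averaging A" "x \<in> carrier X" "\<And>x. x \<in> carrier X \<Longrightarrow> norm (f x) \<le> M"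
  shows "norm (A f x) \<le> M"
  using assms
proof (induction arbitrary: f x)
  case (average I)
  have "norm (\<Sum>a\<in>I. f (x \<otimes> a)) \<le> (\<Sum>a\<in>I. M)" using average by (intro sum_norm_le) auto
  then show ?case using average by (simp add: norm_divide divide_le_eq card_gt_0_iff mult.commute)
next
  case (comp A B)
  show ?case by (rule comp(3)[OF comp(5)]) (use comp in blast)
qed

lemma averaging_translate:
  assumes "averaging A" "x \<in> carrier X" "b \<in> carrier X"
  shows "A (\<lambda>x. f (x \<otimes> b)) x = A f (x \<otimes> b)"
  using assms
proof (induction arbitrary: f x)
  case (average I)
  then show ?case by (intro arg_cong2[of _ _ _ _ "(/)"] sum.cong refl arg_cong[of _ _ f])
      (auto simp: m_assoc m_comm[of b] subset_iff)
next
  case (comp A B)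
  have "A (B (\<lambda>x. f (x \<otimes> b))) x = A (\<lambda>x. B f (x \<otimes> b)) x"
    by (rule averaging_cong[OF comp(1,5)]) (use comp in blast)
  then show ?case using comp by simp
qed

lemma averaging_commute:
  assumes "averaging A" "averaging B" "x \<in> carrier X"
  shows "A (B f) x = B (A f) x"
  using assms(1,3)
proof (induction arbitrary: f x)
  case (average I)
  have "B (\<lambda>x. \<Sum>a\<in>J. f (x \<otimes> a)) x = (\<Sum>a\<in>J. B f (x \<otimes> a))" if "finite J" "J \<subseteq> carrier X" for J
    using that
  proof (induction J)
    case empty
    then show ?case using averaging_const[OF assms(2), of 0] by simp
  next
    case (insert a J)
    then have "B (\<lambda>x. \<Sum>a\<in>insert a J. f (x \<otimes> a)) = (\<lambda>x. B (\<lambda>x. f (x \<otimes> a)) x + B (\<lambda>x. \<Sum>a\<in>J. f (x \<otimes> a)) x)"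
      by (simp add: averaging_add[OF assms(2)])
    then show ?case using insert average by (simp add: averaging_translate[OF assms(2)])
  qed
  then show ?case using average averaging_scale[OF assms(2), of "1 / of_nat (card I)"] by simp
next
  case (comp A' B')
  have "A' (B' (B f)) x = A' (B (B' f)) x"
    by (rule averaging_cong[OF comp(1,5)]) (use comp in blast)
  then show ?case using comp by simp
qed

lemma averaging_cont: "averaging A \<Longrightarrow> cont f \<Longrightarrow> cont (A f)"
proof (induction arbitrary: f rule: averaging.induct)
  case (average I)
  have "cont (\<lambda>x. (1 / of_nat (card I)) * (\<Sum>a\<in>I. f (x \<otimes> a)))"
    using average by (intro continuous_map_complex_intros cont_translate) auto
  then show ?case by simp
qed auto

lemma averaging_reflect:
  assumes "averaging A"
  shows "\<exists>A'. averaging A' \<and> (\<forall>f. \<forall>x\<in>carrier X. A' (\<lambda>x. f (inv x)) x = A f (inv x))"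
  using assms
proof induction
  case (average I)
  have I': "m_inv X ` I \<subseteq> carrier X" "finite (m_inv X ` I)" "m_inv X ` I \<noteq> {}" using average by auto
  have inj: "inj_on (m_inv X) I" 
  proof (rule inj_onI)
    fix a b assume ab: "a \<in> I" "b \<in> I" "inv a = inv b"
    then have "inv (inv a) = inv (inv b)" by simp
    then show "a = b" using ab(1,2) average(3) by auto
  qed
  show ?case
  proof (intro exI conjI allI ballI)
    show "averaging (\<lambda>f x. (\<Sum>a\<in>m_inv X ` I. f (x \<otimes> a)) / of_nat (card (m_inv X ` I)))"
      by (rule averaging.average[OF I'(2,3,1)])
    fix f :: "'x \<Rightarrow> complex" and x assume x: "x \<in> carrier X"
    have "(\<Sum>a\<in>I. f (inv (x \<otimes> inv a))) = (\<Sum>a\<in>I. f (inv x \<otimes> a))"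
      using x average(3) by (intro sum.cong refl arg_cong[of _ _ f]) (auto simp: inv_mult subset_iff)
    then show "(\<Sum>a\<in>m_inv X ` I. f (inv (x \<otimes> a))) / of_nat (card (m_inv X ` I)) = (\<Sum>a\<in>I. f (inv x \<otimes> a)) / of_nat (card I)"
      using inj by (simp add: sum.reindex card_image)
  qed
next
  case (comp A B)
  then obtain A' B' where A': "averaging A'" "\<And>f x. x \<in> carrier X \<Longrightarrow> A' (\<lambda>x. f (inv x)) x = A f (inv x)"
    and B': "averaging B'" "\<And>f x. x \<in> carrier X \<Longrightarrow> B' (\<lambda>x. f (inv x)) x = B f (inv x)" by blast
  have "A' (B' (\<lambda>x. f (inv x))) x = A (B f) (inv x)" if x: "x \<in> carrier X" for f x
  proof -
    have "A' (B' (\<lambda>x. f (inv x))) x = A' (\<lambda>x. B f (inv x)) x" by (rule averaging_cong[OF A'(1) x B'(2)])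
    then show ?thesis using A'(2)[OF x] by simp
  qed
  then show ?case using averaging.comp[OF A'(1) B'(1)] by blast
qed

text \<open>\<open>m\<close> is the infimum, over all averages, of the supremum of the real part. If
  a nearly optimal average dipped below \<open>m - e\<close> at a point, it would be low on a whole
  translate of \<open>U\<close>, and averaging it over finitely many translates would push the
  supremum below \<open>m\<close>.\<close>

lemma Re_average_near_const:
  assumes f: "cont f"
  shows "\<exists>m. \<forall>e>0. \<exists>A. averaging A \<and> (\<forall>x\<in>carrier X. \<bar>Re (A f x) - m\<bar> \<le> e)"
proof -
  define S where "S = {M. \<exists>A. averaging A \<and> (\<forall>x\<in>carrier X. Re (A f x) \<le> M)}"
  obtain C where C: "\<And>x. x \<in> carrier X \<Longrightarrow> norm (f x) \<le> C" using cont_bounded[OF f] by blast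
  let ?A1 = "\<lambda>f x. (\<Sum>a\<in>{\<one>}. f (x \<otimes> a)) / of_nat (card {\<one>})"
  have avg1: "averaging ?A1" by (rule averaging.average) auto
  have C': "\<bar>Re (A f x)\<bar> \<le> C" if "averaging A" "x \<in> carrier X" for A x
    by (rule order_trans[OF abs_Re_le_cmod averaging_norm_le[OF that C]])
  have "Re (?A1 f x) \<le> C" if "x \<in> carrier X" for x using C'[OF avg1 that] by (rule abs_le_D1)
  then have "C \<in> S" unfolding S_def using avg1 by blast
  then have Sne: "S \<noteq> {}" by blast
  have low: "- C \<le> M" if "M \<in> S" for M
  proof -
    obtain A where A: "averaging A" "Re (A f \<one>) \<le> M" using \<open>M \<in> S\<close> by (auto simp: S_def)
    then show ?thesis using C'[OF A(1) one_closed] by linarith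
  qed
  then have bdd: "bdd_below S" by (auto simp: bdd_below_def)
  define m where "m = Inf S"
  have m_le: "m \<le> M" if "M \<in> S" for M unfolding m_def by (rule cInf_lower[OF that bdd])
  have "\<exists>A. averaging A \<and> (\<forall>x\<in>carrier X. \<bar>Re (A f x) - m\<bar> \<le> e)" if e: "e > 0" for e
  proof -
    obtain U where U: "openin T U" "\<one> \<in> U" "\<And>x u. x \<in> carrier X \<Longrightarrow> u \<in> U \<Longrightarrow> norm (f (x \<otimes> u) - f x) < e / 2"
      by (rule uniform_continuity[OF f, of "e / 2"]) (use e in auto)
    have Uc: "U \<subseteq> carrier X" using openin_subset[OF U(1)] by (simp add: topspace_eq)
    obtain I where I: "finite I" "I \<subseteq> carrier X" "I \<noteq> {}" "\<And>x. x \<in> carrier X \<Longrightarrow> \<exists>a\<in>I. \<exists>u\<in>U. x = a \<otimes> u"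
      by (rule finite_translate_cover[OF U(1,2)]) blast
    define J where "J = m_inv X ` I"
    have J: "finite J" "J \<noteq> {}" "J \<subseteq> carrier X" using I by (auto simp: J_def)
    define N where "N = real (card J)"
    have N: "N \<ge> 1" using J by (simp add: N_def Suc_le_eq card_gt_0_iff)
    \<comment> \<open>Of the \<open>N\<close> averaged values one is at most
      \<open>m - e / 2\<close> and the others are at most \<open>m + \<eta>\<close>. With this
      \<open>\<eta>\<close> the total excess \<open>(N - 1) * \<eta> - e / 2\<close> over
      \<open>m\<close> equals \<open>- \<eta>\<close>.\<close>
    define \<eta> where "\<eta> = e / (2 * N)"
    have \<eta>: "\<eta> > 0" "\<eta> \<le> e" using e N by (auto simp: \<eta>_def field_simps)
    obtain M where "M \<in> S" "M < m + \<eta>" using cInf_lessD[OF Sne, of "m + \<eta>"] \<eta> by (auto simp: m_def)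
    then obtain A where A: "averaging A" "\<And>x. x \<in> carrier X \<Longrightarrow> Re (A f x) \<le> m + \<eta>" by (force simp: S_def)
    have "m - e \<le> Re (A f x0)" if x0: "x0 \<in> carrier X" for x0
    proof (rule ccontr)
      assume "\<not> m - e \<le> Re (A f x0)"
      then have x0_low: "Re (A f x0) < m - e" by simp
      have near: "Re (A f (x0 \<otimes> u)) \<le> m - e / 2" if u: "u \<in> U" for u
      proof -
        have uc: "u \<in> carrier X" using u Uc by blast
        have "norm (A (\<lambda>x. f (x \<otimes> u) - f x) x0) \<le> e / 2"
          by (rule averaging_norm_le[OF A(1) x0]) (use U(3) u less_imp_le in blast)
        moreover have "A (\<lambda>x. f (x \<otimes> u) - f x) x0 = A f (x0 \<otimes> u) - A f x0"
          using averaging_diff[OF A(1)] averaging_translate[OF A(1) x0 uc] by simp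
        ultimately have "Re (A f (x0 \<otimes> u)) - Re (A f x0) \<le> e / 2"
          using complex_Re_le_cmod[of "A f (x0 \<otimes> u) - A f x0"] by simp
        then show ?thesis using x0_low by simp
      qed
      let ?B = "\<lambda>f x. (\<Sum>a\<in>J. f (x \<otimes> a)) / of_nat (card J)"
      have "averaging ?B" by (rule averaging.average[OF J])
      then have BA: "averaging (\<lambda>f. ?B (A f))" by (rule averaging.comp[OF _ A(1)])
      define M' where "M' = m + ((N - 1) * \<eta> - e / 2) / N"
      have "Re (?B (A f) x) \<le> M'" if x: "x \<in> carrier X" for x
      proof -
        obtain a u where au: "a \<in> I" "u \<in> U" "inv x0 \<otimes> x = a \<otimes> u" using I(4)[of "inv x0 \<otimes> x"] x x0 by auto
        have c: "a \<in> carrier X" "u \<in> carrier X" using au I Uc by auto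
        have "x = x0 \<otimes> (inv x0 \<otimes> x)" using x x0 by (simp flip: m_assoc)
        then have "x \<otimes> inv a = x0 \<otimes> (a \<otimes> u) \<otimes> inv a" using au(3) by simp
        also have "\<dots> = x0 \<otimes> u" using c x0 by (simp add: m_assoc m_comm[of a])
        finally have xa: "x \<otimes> inv a = x0 \<otimes> u" .
        have aJ: "inv a \<in> J" using au by (auto simp: J_def)
        have "(\<Sum>b\<in>J. Re (A f (x \<otimes> b))) = Re (A f (x \<otimes> inv a)) + (\<Sum>b\<in>J - {inv a}. Re (A f (x \<otimes> b)))"
          by (rule sum.remove[OF J(1) aJ])
        also have "\<dots> \<le> (m - e / 2) + (\<Sum>b\<in>J - {inv a}. m + \<eta>)"
          using near[OF au(2)] xa A(2) x J(3) by (intro add_mono sum_mono) auto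
        also have "\<dots> = (m - e / 2) + (N - 1) * (m + \<eta>)"
          using J aJ by (simp add: N_def card_Diff_singleton Suc_le_eq card_gt_0_iff of_nat_diff)
        also have "\<dots> = N * M'" using N by (simp add: M'_def field_simps)
        finally show ?thesis using N by (simp add: Re_divide_of_nat N_def[symmetric] divide_le_eq mult.commute)
      qed
      then have "M' \<in> S" unfolding S_def using BA by blast
      then have "m \<le> M'" by (rule m_le)
      then have "(N - 1) * \<eta> - e / 2 \<ge> 0" using N by (simp add: M'_def zero_le_divide_iff)
      moreover have "(N - 1) * \<eta> - e / 2 = - \<eta>" using N by (simp add: \<eta>_def field_simps)
      ultimately show False using \<eta> by simp
    qed
    then have "\<bar>Re (A f x) - m\<bar> \<le> e" if "x \<in> carrier X" for x
      using A(2)[OF that] \<eta> that by (smt (verit))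
    then show ?thesis using A(1) by blast
  qed
  then show ?thesis by blast
qed

definition is_mean :: "('x \<Rightarrow> complex) \<Rightarrow> complex \<Rightarrow> bool" where
  "is_mean f c \<longleftrightarrow> (\<forall>e>0. \<exists>A. averaging A \<and> (\<forall>x\<in>carrier X. norm (A f x - c) \<le> e))"

lemma averaging_near:
  assumes "averaging B" "\<And>x. x \<in> carrier X \<Longrightarrow> norm (f x - c) \<le> e" "x \<in> carrier X"
  shows "norm (B f x - c) \<le> e"
  using averaging_norm_le[OF assms(1,3), of "\<lambda>x. f x - c" e] assms(2)
    averaging_diff[OF assms(1), of f "\<lambda>_. c"] averaging_const[OF assms(1), of c] by simp

text \<open>Averages commute, so one composite approximates both constants.\<close>

lemma is_mean_unique:
  assumes "is_mean f c" "is_mean f d"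
  shows "c = d"
proof (rule ccontr)
  assume "c \<noteq> d"
  define e where "e = norm (c - d) / 3"
  have e: "e > 0" using \<open>c \<noteq> d\<close> by (simp add: e_def)
  obtain A where A: "averaging A" "\<And>x. x \<in> carrier X \<Longrightarrow> norm (A f x - c) \<le> e" using assms(1) e unfolding is_mean_def by blast
  obtain B where B: "averaging B" "\<And>x. x \<in> carrier X \<Longrightarrow> norm (B f x - d) \<le> e" using assms(2) e unfolding is_mean_def by blast
  have "norm (B (A f) \<one> - c) \<le> e" by (rule averaging_near[OF B(1) A(2) one_closed])
  moreover have "norm (A (B f) \<one> - d) \<le> e" by (rule averaging_near[OF A(1) B(2) one_closed])
  moreover have "A (B f) \<one> = B (A f) \<one>" by (rule averaging_commute[OF A(1) B(1) one_closed])
  ultimately have "norm (c - d) \<le> 2 * e"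
    using norm_triangle_le_diff[of "B (A f) \<one> - d" "B (A f) \<one> - c" "2 * e"] by simp
  then show False using e by (simp add: e_def)
qed

lemma is_mean_exists:
  assumes f: "cont f"
  shows "\<exists>c. is_mean f c"
proof -
  obtain a where a: "\<And>e. e > 0 \<Longrightarrow> \<exists>A. averaging A \<and> (\<forall>x\<in>carrier X. \<bar>Re (A f x) - a\<bar> \<le> e)"
    using Re_average_near_const[OF f] by blast
  \<comment> \<open>The factor \<open>- \<i>\<close> makes the imaginary part of \<open>f\<close> a
    real part.\<close>
  have "cont (\<lambda>x. (- \<i>) * f x)" by (intro continuous_map_complex_intros f)
  then obtain b where b: "\<And>e. e > 0 \<Longrightarrow> \<exists>A. averaging A \<and> (\<forall>x\<in>carrier X. \<bar>Re (A (\<lambda>x. (- \<i>) * f x) x) - b\<bar> \<le> e)"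
    using Re_average_near_const by metis
  have "\<exists>C. averaging C \<and> (\<forall>x\<in>carrier X. norm (C f x - Complex a b) \<le> e)" if e: "e > 0" for e
  proof -
    have e2: "e / 2 > 0" using e by simp
    obtain A where A: "averaging A" "\<And>x. x \<in> carrier X \<Longrightarrow> \<bar>Re (A f x) - a\<bar> \<le> e / 2" using a[OF e2] by blast
    obtain B where B: "averaging B" "\<And>x. x \<in> carrier X \<Longrightarrow> \<bar>Re (B (\<lambda>x. (- \<i>) * f x) x) - b\<bar> \<le> e / 2" using b[OF e2] by blast
    have B': "\<bar>Im (B f x) - b\<bar> \<le> e / 2" if "x \<in> carrier X" for x
      using B(2)[OF that] averaging_scale[OF B(1), of "- \<i>" f] by simp
    have "norm (A (B f) x - Complex a b) \<le> e" if x: "x \<in> carrier X" for x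
    proof -
      have 1: "\<bar>Re (B (A f) x) - a\<bar> \<le> e / 2"
      proof -
        have "Re (B (A f) x) \<le> a + e / 2" by (rule averaging_Re_le[OF B(1) x]) (use A(2) in \<open>smt (verit)\<close>)
        moreover have "Re (B (\<lambda>x. (- 1) * A f x) x) \<le> - a + e / 2"
          by (rule averaging_Re_le[OF B(1) x]) (use A(2) in \<open>simp, smt (verit)\<close>)
        ultimately have "Re (B (A f) x) \<le> a + e / 2 \<and> a - e / 2 \<le> Re (B (A f) x)"
          using averaging_scale[OF B(1), of "- 1" "A f"] by simp
        then show ?thesis unfolding abs_le_iff by linarith
      qed
      have 2: "\<bar>Im (A (B f) x) - b\<bar> \<le> e / 2"
      proof -
        have "Re (A (\<lambda>x. (- \<i>) * B f x) x) \<le> b + e / 2" by (rule averaging_Re_le[OF A(1) x]) (use B' in \<open>simp, smt (verit)\<close>)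
        moreover have "Re (A (\<lambda>x. \<i> * B f x) x) \<le> - b + e / 2"
          by (rule averaging_Re_le[OF A(1) x]) (use B' in \<open>simp, smt (verit)\<close>)
        ultimately have "Im (A (B f) x) \<le> b + e / 2 \<and> b - e / 2 \<le> Im (A (B f) x)"
          using averaging_scale[OF A(1), of "- \<i>" "B f"] averaging_scale[OF A(1), of "\<i>" "B f"] by simp
        then show ?thesis unfolding abs_le_iff by linarith
      qed
      have "A (B f) x = B (A f) x" by (rule averaging_commute[OF A(1) B(1) x])
      then show ?thesis using 1 2 cmod_le[of "A (B f) x - Complex a b"] by simp
    qed
    then show ?thesis using averaging.comp[OF A(1) B(1)] by blast
  qed
  then show ?thesis unfolding is_mean_def by blast
qed

definition mean :: "('x \<Rightarrow> complex) \<Rightarrow> complex" where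
  "mean f = (THE c. is_mean f c)"

lemma is_mean_mean: "cont f \<Longrightarrow> is_mean f (mean f)"
  unfolding mean_def using is_mean_exists is_mean_unique by (metis the_equality)

lemma mean_eqI: "is_mean f c \<Longrightarrow> mean f = c"
  unfolding mean_def using is_mean_unique by blast

end

section \<open>Linearity, positivity and interchange of means\<close>

context compact_metrizable_abelian_group
begin

lemma is_mean_simultaneous:
  assumes "finite I" "\<And>i. i \<in> I \<Longrightarrow> is_mean (f i) (c i)" "e > 0"
  shows "\<exists>A. averaging A \<and> (\<forall>i\<in>I. \<forall>x\<in>carrier X. norm (A (f i) x - c i) \<le> e)"
  using assms(1,2)
proof (induction I)
  case empty
  have "averaging (\<lambda>f x. (\<Sum>a\<in>{\<one>}. f (x \<otimes> a)) / of_nat (card {\<one>}))" by (rule averaging.average) auto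
  then show ?case by blast
next
  case (insert i I)
  then obtain A where A: "averaging A" "\<And>j x. j \<in> I \<Longrightarrow> x \<in> carrier X \<Longrightarrow> norm (A (f j) x - c j) \<le> e" by blast
  obtain B where B: "averaging B" "\<And>x. x \<in> carrier X \<Longrightarrow> norm (B (f i) x - c i) \<le> e"
    using insert(4)[of i] assms(3) by (auto simp: is_mean_def)
  have "norm (A (B (f j)) x - c j) \<le> e" if "j \<in> insert i I" "x \<in> carrier X" for j x
  proof (cases "j = i")
    case True
    show ?thesis unfolding True by (rule averaging_near[OF A(1) B(2) that(2)])
  next
    case False
    then have "j \<in> I" using that by simp
    have "norm (B (A (f j)) x - c j) \<le> e" by (rule averaging_near[OF B(1) A(2)[OF \<open>j \<in> I\<close>] that(2)])
    then show ?thesis using averaging_commute[OF A(1) B(1) that(2)] by simp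
  qed
  then show ?case using averaging.comp[OF A(1) B(1)] by blast
qed

lemma mean_simultaneous:
  assumes "finite I" "\<And>i. i \<in> I \<Longrightarrow> cont (f i)" "e > 0"
  obtains A where "averaging A" "\<And>i x. i \<in> I \<Longrightarrow> x \<in> carrier X \<Longrightarrow> norm (A (f i) x - mean (f i)) \<le> e"
proof -
  have "\<exists>A. averaging A \<and> (\<forall>i\<in>I. \<forall>x\<in>carrier X. norm (A (f i) x - mean (f i)) \<le> e)"
    by (rule is_mean_simultaneous[OF assms(1) _ assms(3)]) (rule is_mean_mean[OF assms(2)])
  then show ?thesis using that by blast
qed

lemma mean_cong:
  assumes "\<And>x. x \<in> carrier X \<Longrightarrow> f x = g x"
  shows "mean f = mean g"
proof -
  have eq: "A f x = A g x" if "averaging A" "x \<in> carrier X" for A x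
    by (rule averaging_cong[OF that]) (rule assms)
  have "is_mean f c \<longleftrightarrow> is_mean g c" for c
    unfolding is_mean_def by (intro all_cong1 imp_cong ex_cong1 conj_cong ball_cong refl) (simp add: eq)
  then have "is_mean f = is_mean g" by blast
  then show ?thesis by (simp add: mean_def)
qed

lemma mean_add:
  assumes "cont f" "cont g"
  shows "mean (\<lambda>x. f x + g x) = mean f + mean g"
proof (rule mean_eqI, unfold is_mean_def, intro allI impI)
  fix e :: real assume e: "e > 0"
  obtain A where A: "averaging A" "\<And>h x. h \<in> {f, g} \<Longrightarrow> x \<in> carrier X \<Longrightarrow> norm (A h x - mean h) \<le> e / 2"
    by (rule mean_simultaneous[of "{f, g}" "\<lambda>h. h" "e / 2"]) (use assms e in auto)
  have "norm (A (\<lambda>x. f x + g x) x - (mean f + mean g)) \<le> e" if "x \<in> carrier X" for x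
    using norm_triangle_mono[OF A(2)[of f x] A(2)[of g x]] that averaging_add[OF A(1), of f g] by (simp add: algebra_simps)
  then show "\<exists>A. averaging A \<and> (\<forall>x\<in>carrier X. norm (A (\<lambda>x. f x + g x) x - (mean f + mean g)) \<le> e)" using A(1) by blast
qed

lemma mean_const: "mean (\<lambda>x. c) = c"
proof (rule mean_eqI, unfold is_mean_def, intro allI impI)
  fix e :: real assume e: "e > 0"
  have a: "averaging (\<lambda>f x. (\<Sum>a\<in>{\<one>}. f (x \<otimes> a)) / of_nat (card {\<one>}))" by (rule averaging.average) auto
  show "\<exists>A. averaging A \<and> (\<forall>x\<in>carrier X. norm (A (\<lambda>x. c) x - c) \<le> e)"
    by (rule exI, rule conjI, rule a) (use e in simp)
qed

lemma mean_scale: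
  assumes "cont f"
  shows "mean (\<lambda>x. c * f x) = c * mean f"
proof (rule mean_eqI, unfold is_mean_def, intro allI impI)
  fix e :: real assume e: "e > 0"
  have e': "e / (norm c + 1) > 0" using e by (simp add: add_nonneg_pos)
  obtain A where A: "averaging A" "\<And>x. x \<in> carrier X \<Longrightarrow> norm (A f x - mean f) \<le> e / (norm c + 1)"
    using is_mean_mean[OF assms] e' unfolding is_mean_def by blast
  have "norm (A (\<lambda>x. c * f x) x - c * mean f) \<le> e" if x: "x \<in> carrier X" for x
  proof -
    have "norm (A (\<lambda>x. c * f x) x - c * mean f) = norm c * norm (A f x - mean f)"
      using averaging_scale[OF A(1), of c f] by (simp add: norm_mult flip: right_diff_distrib)
    also have "\<dots> \<le> (norm c + 1) * (e / (norm c + 1))" by (intro mult_mono A(2) x) auto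
    also have "\<dots> = e" using e' e by (auto simp: zero_less_divide_iff)
    finally show ?thesis .
  qed
  then show "\<exists>A. averaging A \<and> (\<forall>x\<in>carrier X. norm (A (\<lambda>x. c * f x) x - c * mean f) \<le> e)" using A(1) by blast
qed

lemma mean_minus: "cont f \<Longrightarrow> mean (\<lambda>x. - f x) = - mean f"
  using mean_scale[of f "- 1"] by simp

lemma mean_diff: "cont f \<Longrightarrow> cont g \<Longrightarrow> mean (\<lambda>x. f x - g x) = mean f - mean g"
  using mean_add[of f "\<lambda>x. - g x"] mean_minus[of g] by (simp add: continuous_map_complex_minus)

lemma mean_sum:
  "finite I \<Longrightarrow> (\<And>i. i \<in> I \<Longrightarrow> cont (f i)) \<Longrightarrow> mean (\<lambda>x. \<Sum>i\<in>I. f i x) = (\<Sum>i\<in>I. mean (f i))"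
  by (induction I rule: finite_induct) (simp_all add: mean_const mean_add continuous_map_sum)

lemma mean_cnj:
  assumes "cont f"
  shows "mean (\<lambda>x. cnj (f x)) = cnj (mean f)"
proof (rule mean_eqI, unfold is_mean_def, intro allI impI)
  fix e :: real assume e: "e > 0"
  obtain A where A: "averaging A" "\<And>x. x \<in> carrier X \<Longrightarrow> norm (A f x - mean f) \<le> e"
    using is_mean_mean[OF assms] e unfolding is_mean_def by blast
  have "norm (A (\<lambda>x. cnj (f x)) x - cnj (mean f)) \<le> e" if x: "x \<in> carrier X" for x
    using A(2)[OF x] averaging_cnj[OF A(1), of f] complex_mod_cnj[of "A f x - mean f"] by simp
  then show "\<exists>A. averaging A \<and> (\<forall>x\<in>carrier X. norm (A (\<lambda>x. cnj (f x)) x - cnj (mean f)) \<le> e)" using A(1) by blast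
qed

lemma mean_norm_le:
  assumes "cont f" "\<And>x. x \<in> carrier X \<Longrightarrow> norm (f x) \<le> M"
  shows "norm (mean f) \<le> M"
proof (rule field_le_epsilon)
  fix e :: real assume e: "e > 0"
  obtain A where A: "averaging A" "\<And>x. x \<in> carrier X \<Longrightarrow> norm (A f x - mean f) \<le> e"
    using is_mean_mean[OF assms(1)] e unfolding is_mean_def by blast
  have "norm (A f \<one>) \<le> M" by (rule averaging_norm_le[OF A(1) one_closed assms(2)])
  then show "norm (mean f) \<le> M + e"
    using A(2)[OF one_closed] norm_triangle_ineq2[of "mean f" "A f \<one>"] norm_minus_commute[of "mean f" "A f \<one>"] by linarith
qed

lemma Re_mean_le:
  assumes "cont f" "\<And>x. x \<in> carrier X \<Longrightarrow> Re (f x) \<le> M"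
  shows "Re (mean f) \<le> M"
proof (rule field_le_epsilon)
  fix e :: real assume e: "e > 0"
  obtain A where A: "averaging A" "\<And>x. x \<in> carrier X \<Longrightarrow> norm (A f x - mean f) \<le> e"
    using is_mean_mean[OF assms(1)] e unfolding is_mean_def by blast
  have "Re (A f \<one>) \<le> M" by (rule averaging_Re_le[OF A(1) one_closed assms(2)])
  then show "Re (mean f) \<le> M + e"
    using A(2)[OF one_closed] abs_Re_le_cmod[of "A f \<one> - mean f"] by simp
qed

lemma Re_mean_ge:
  assumes "cont f" "\<And>x. x \<in> carrier X \<Longrightarrow> M \<le> Re (f x)"
  shows "M \<le> Re (mean f)"
  using Re_mean_le[of "\<lambda>x. - f x" "- M"] assms mean_minus[of f] by (simp add: continuous_map_complex_minus)

lemma mean_averaging: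
  assumes "averaging B" "cont f"
  shows "mean (B f) = mean f"
proof (rule mean_eqI, unfold is_mean_def, intro allI impI)
  fix e :: real assume e: "e > 0"
  obtain A where A: "averaging A" "\<And>x. x \<in> carrier X \<Longrightarrow> norm (A f x - mean f) \<le> e"
    using is_mean_mean[OF assms(2)] e unfolding is_mean_def by blast
  have "norm (A (B f) x - mean f) \<le> e" if x: "x \<in> carrier X" for x
    using averaging_near[OF assms(1) A(2) x] averaging_commute[OF A(1) assms(1) x] by simp
  then show "\<exists>A. averaging A \<and> (\<forall>x\<in>carrier X. norm (A (B f) x - mean f) \<le> e)" using A(1) by blast
qed

lemma mean_translate:
  assumes "cont f" "a \<in> carrier X"
  shows "mean (\<lambda>x. f (x \<otimes> a)) = mean f"
proof -
  have "averaging (\<lambda>f x. (\<Sum>a\<in>{a}. f (x \<otimes> a)) / of_nat (card {a}))" by (rule averaging.average) (use assms in auto)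
  from mean_averaging[OF this assms(1)] show ?thesis by simp
qed

lemma cont_inv: "cont f \<Longrightarrow> cont (\<lambda>x. f (inv x))"
  by (rule cont_comp[OF _ continuous_inv])

lemma mean_inv:
  assumes "cont f"
  shows "mean (\<lambda>x. f (inv x)) = mean f"
proof (rule mean_eqI, unfold is_mean_def, intro allI impI)
  fix e :: real assume e: "e > 0"
  obtain A where A: "averaging A" "\<And>x. x \<in> carrier X \<Longrightarrow> norm (A f x - mean f) \<le> e"
    using is_mean_mean[OF assms] e unfolding is_mean_def by blast
  obtain A' where A': "averaging A'" "\<And>f x. x \<in> carrier X \<Longrightarrow> A' (\<lambda>x. f (inv x)) x = A f (inv x)"
    using averaging_reflect[OF A(1)] by blast
  have "norm (A' (\<lambda>x. f (inv x)) x - mean f) \<le> e" if x: "x \<in> carrier X" for x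
    using A(2)[of "inv x"] A'(2)[OF x, of f] x by simp
  then show "\<exists>A. averaging A \<and> (\<forall>x\<in>carrier X. norm (A (\<lambda>x. f (inv x)) x - mean f) \<le> e)" using A'(1) by blast
qed

text \<open>\<open>k\<close> is the reciprocal of the size of a finite cover by translates of
  \<open>U\<close> and stands in for the Haar measure of \<open>U\<close>. That it is independent of
  \<open>f\<close> allows it to serve all powers of one function at once.\<close>

lemma mean_lower_bound:
  assumes U: "openin T U" "\<one> \<in> U"
  obtains k where "k > 0"
    "\<And>f x0 d. cont f \<Longrightarrow> (\<And>x. x \<in> carrier X \<Longrightarrow> 0 \<le> Re (f x)) \<Longrightarrow> x0 \<in> carrier X
      \<Longrightarrow> (\<And>u. u \<in> U \<Longrightarrow> d \<le> Re (f (x0 \<otimes> u))) \<Longrightarrow> k * d \<le> Re (mean f)"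
proof -
  have Uc: "U \<subseteq> carrier X" using openin_subset[OF U(1)] by (simp add: topspace_eq)
  obtain I where I: "finite I" "I \<subseteq> carrier X" "I \<noteq> {}" "\<And>x. x \<in> carrier X \<Longrightarrow> \<exists>a\<in>I. \<exists>u\<in>U. x = a \<otimes> u"
    by (rule finite_translate_cover[OF U]) blast
  define J where "J = m_inv X ` I"
  have J: "finite J" "J \<noteq> {}" "J \<subseteq> carrier X" using I by (auto simp: J_def)
  let ?B = "\<lambda>f x. (\<Sum>a\<in>J. f (x \<otimes> a)) / of_nat (card J)"
  have B: "averaging ?B" by (rule averaging.average[OF J])
  have cJ: "real (card J) > 0" using J by (simp add: card_gt_0_iff)
  have "1 / real (card J) * d \<le> Re (mean f)"
    if f: "cont f" "\<And>x. x \<in> carrier X \<Longrightarrow> 0 \<le> Re (f x)" and x0: "x0 \<in> carrier X" and d: "\<And>u. u \<in> U \<Longrightarrow> d \<le> Re (f (x0 \<otimes> u))" for f x0 d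
  proof -
    have "d / real (card J) \<le> Re (?B f x)" if x: "x \<in> carrier X" for x
    proof -
      obtain a u where au: "a \<in> I" "u \<in> U" "inv x0 \<otimes> x = a \<otimes> u" using I(4)[of "inv x0 \<otimes> x"] x x0 by auto
      have c: "a \<in> carrier X" "u \<in> carrier X" using au I Uc by auto
      have "x = x0 \<otimes> (inv x0 \<otimes> x)" using x x0 by (simp flip: m_assoc)
      then have "x \<otimes> inv a = x0 \<otimes> (a \<otimes> u) \<otimes> inv a" using au(3) by simp
      also have "\<dots> = x0 \<otimes> u" using c x0 by (simp add: m_assoc m_comm[of a])
      finally have xa: "x \<otimes> inv a = x0 \<otimes> u" .
      have aJ: "inv a \<in> J" using au by (auto simp: J_def)
      have "(\<Sum>b\<in>J. Re (f (x \<otimes> b))) = Re (f (x \<otimes> inv a)) + (\<Sum>b\<in>J - {inv a}. Re (f (x \<otimes> b)))"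
        by (rule sum.remove[OF J(1) aJ])
      also have "\<dots> \<ge> d + 0"
        using d[OF au(2)] xa f(2) x J(3) by (intro add_mono sum_nonneg) auto
      finally show ?thesis using cJ by (simp add: Re_divide_of_nat divide_le_cancel)
    qed
    then have "d / real (card J) \<le> Re (mean (?B f))" by (rule Re_mean_ge[OF averaging_cont[OF B f(1)]])
    then show ?thesis using mean_averaging[OF B f(1)] by simp
  qed
  then show ?thesis using that[of "1 / real (card J)"] cJ by simp
qed

lemma mean_pos:
  assumes f: "cont f" "\<And>x. x \<in> carrier X \<Longrightarrow> 0 \<le> Re (f x)" and x0: "x0 \<in> carrier X" "Re (f x0) > 0"
  shows "Re (mean f) > 0"
proof -
  obtain U where U: "openin T U" "\<one> \<in> U" "\<And>x u. x \<in> carrier X \<Longrightarrow> u \<in> U \<Longrightarrow> norm (f (x \<otimes> u) - f x) < Re (f x0) / 2"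
    by (rule uniform_continuity[OF f(1), of "Re (f x0) / 2"]) (use x0 in auto)
  obtain k where k: "k > 0" "\<And>f x0 d. cont f \<Longrightarrow> (\<And>x. x \<in> carrier X \<Longrightarrow> 0 \<le> Re (f x)) \<Longrightarrow> x0 \<in> carrier X
      \<Longrightarrow> (\<And>u. u \<in> U \<Longrightarrow> d \<le> Re (f (x0 \<otimes> u))) \<Longrightarrow> k * d \<le> Re (mean f)"
    by (rule mean_lower_bound[OF U(1,2)]) blast
  have "Re (f x0) / 2 \<le> Re (f (x0 \<otimes> u))" if "u \<in> U" for u
    using U(3)[OF x0(1) that] abs_Re_le_cmod[of "f (x0 \<otimes> u) - f x0"] by simp
  then have "k * (Re (f x0) / 2) \<le> Re (mean f)" by (intro k(2)[OF f(1) _ x0(1)] f(2))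
  moreover have "k * (Re (f x0) / 2) > 0" using k(1) x0(2) by simp
  ultimately show ?thesis by linarith
qed

lemma cont2_compose:
  assumes "cont2 F" "continuous_map S T f" "continuous_map S T g"
  shows "continuous_map S euclidean (\<lambda>x. F (f x) (g x))"
  using continuous_map_compose[OF continuous_map_pairedI[OF assms(2,3)] assms(1)] by (simp add: o_def)

lemma cont2_swap: "cont2 F \<Longrightarrow> cont2 (\<lambda>x y. F y x)"
  using cont2_compose[OF _ continuous_map_snd continuous_map_fst] by (simp add: case_prod_unfold)

lemma cont2_I1: "cont f \<Longrightarrow> cont2 (\<lambda>x y. f x)"
  using cont_comp[of f "prod_topology T T" fst] by (simp add: case_prod_unfold continuous_map_fst)

lemma cont2_I2: "cont f \<Longrightarrow> cont2 (\<lambda>x y. f y)"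
  using cont_comp[of f "prod_topology T T" snd] by (simp add: case_prod_unfold continuous_map_snd)

lemma cont2_mult: "cont2 F \<Longrightarrow> cont2 H \<Longrightarrow> cont2 (\<lambda>x y. F x y * H x y)"
  using continuous_map_complex_mult[of "prod_topology T T" "\<lambda>(x, y). F x y" "\<lambda>(x, y). H x y"] by (simp add: case_prod_unfold)

lemma cont2_group_mult: "cont f \<Longrightarrow> cont2 (\<lambda>x y. f (x \<otimes> y))"
  using cont_comp[of f, OF _ continuous_map_mult_gen[OF continuous_map_fst continuous_map_snd]] by (simp add: case_prod_unfold)

lemma cont2_group_div: "cont f \<Longrightarrow> cont2 (\<lambda>x y. f (x \<otimes> inv y))"
  using cont_comp[of f, OF _ continuous_map_mult_gen[OF continuous_map_fst continuous_map_inv_gen[OF continuous_map_snd]]]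
  by (simp add: case_prod_unfold)

lemma cont2_translate:
  assumes "cont2 F" "a \<in> carrier X"
  shows "cont2 (\<lambda>x y. F (x \<otimes> a) y)"
proof -
  have "continuous_map (prod_topology T T) T (\<lambda>p. fst p \<otimes> a)"
    using continuous_map_compose[OF continuous_map_fst continuous_map_translate[OF assms(2)]] by (simp add: o_def)
  from cont2_compose[OF assms(1) this continuous_map_snd] show ?thesis by (simp add: case_prod_unfold)
qed

lemma cont_mean:
  assumes F: "cont2 F"
  shows "cont (\<lambda>x. mean (F x))"
proof (rule cont_if_uniform)
  fix e :: real assume e: "e > 0"
  obtain U where U: "openin T U" "\<one> \<in> U"
    "\<And>x y u. x \<in> carrier X \<Longrightarrow> y \<in> topspace T \<Longrightarrow> u \<in> U \<Longrightarrow> norm (F (x \<otimes> u) y - F x y) < e / 2"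
    by (rule uniform_continuity2[OF F compact, of "e / 2"]) (use e in auto)
  have Uc: "U \<subseteq> carrier X" using openin_subset[OF U(1)] by (simp add: topspace_eq)
  have "norm (mean (F (x \<otimes> u)) - mean (F x)) < e" if x: "x \<in> carrier X" and u: "u \<in> U" for x u
  proof -
    have c: "cont (F (x \<otimes> u))" "cont (F x)" using cont2_slice(1)[OF F] x u Uc by auto
    have "norm (mean (\<lambda>y. F (x \<otimes> u) y - F x y)) \<le> e / 2"
      using U(3)[OF x _ u] by (intro mean_norm_le continuous_map_diff c) (auto simp: topspace_eq less_imp_le)
    then show ?thesis using mean_diff[OF c] e by simp
  qed
  then show "\<exists>U. openin T U \<and> \<one> \<in> U \<and> (\<forall>x\<in>carrier X. \<forall>u\<in>U. norm (mean (F (x \<otimes> u)) - mean (F x)) < e)"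
    using U by blast
qed

text \<open>An average is a finite sum, and the mean passes through it; this is the finite half of
  Fubini's theorem.\<close>

lemma averaging_mean:
  assumes "averaging A" "cont2 F"
  shows "cont2 (\<lambda>x y. A (\<lambda>x. F x y) x) \<and> (\<forall>x\<in>carrier X. A (\<lambda>x. mean (F x)) x = mean (\<lambda>y. A (\<lambda>x. F x y) x))"
  using assms
proof (induction arbitrary: F)
  case (average I)
  have c2: "cont2 (\<lambda>x y. F (x \<otimes> a) y)" if "a \<in> I" for a using cont2_translate[OF average(4)] that average(3) by blast
  have "cont2 (\<lambda>x y. (1 / of_nat (card I)) * (\<Sum>a\<in>I. F (x \<otimes> a) y))"
    using c2 average(1) by (intro cont2_mult) (auto simp: case_prod_unfold intro!: continuous_map_sum)
  moreover have "(\<Sum>a\<in>I. mean (F (x \<otimes> a))) / of_nat (card I) = mean (\<lambda>y. (\<Sum>a\<in>I. F (x \<otimes> a) y) / of_nat (card I))"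
    if x: "x \<in> carrier X" for x
  proof -
    have c: "cont (F (x \<otimes> a))" if "a \<in> I" for a using cont2_slice(1)[OF average(4)] x that average(3) by auto
    then have "cont (\<lambda>y. \<Sum>a\<in>I. F (x \<otimes> a) y)" by (intro continuous_map_sum average(1))
    then show ?thesis using mean_sum[OF average(1) c] mean_scale[of "\<lambda>y. \<Sum>a\<in>I. F (x \<otimes> a) y" "1 / of_nat (card I)"] by simp
  qed
  ultimately show ?case by simp
next
  case (comp A B)
  define F' where "F' = (\<lambda>x y. B (\<lambda>x. F x y) x)"
  have F': "cont2 F'" "\<And>x. x \<in> carrier X \<Longrightarrow> B (\<lambda>x. mean (F x)) x = mean (F' x)"
    using comp.IH(2)[OF comp.prems] by (auto simp: F'_def)
  have A: "cont2 (\<lambda>x y. A (\<lambda>x. F' x y) x)" "\<And>x. x \<in> carrier X \<Longrightarrow> A (\<lambda>x. mean (F' x)) x = mean (\<lambda>y. A (\<lambda>x. F' x y) x)"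
    using comp.IH(1)[OF F'(1)] by auto
  have "A (B (\<lambda>x. mean (F x))) x = mean (\<lambda>y. A (B (\<lambda>x. F x y)) x)" if x: "x \<in> carrier X" for x
    using averaging_cong[OF comp.hyps(1) x F'(2)] A(2)[OF x] by (simp add: F'_def)
  then show ?case using A(1) by (simp add: F'_def)
qed

text \<open>One average in \<open>x\<close> approximates the mean at finitely many values of
  \<open>y\<close> and the mean of \<open>M\<close>. Uniform continuity extends the approximation to
  all \<open>y\<close>, and \<open>averaging_mean\<close> moves this average inside the mean over
  \<open>y\<close>.\<close>

lemma mean_swap:
  assumes F: "cont2 F"
  shows "mean (\<lambda>x. mean (\<lambda>y. F x y)) = mean (\<lambda>y. mean (\<lambda>x. F x y))"
proof -
  define H where "H y = mean (\<lambda>x. F x y)" for y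
  define M where "M x = mean (F x)" for x
  have H: "cont H" unfolding H_def by (rule cont_mean[OF cont2_swap[OF F]])
  have M: "cont M" unfolding M_def by (rule cont_mean[OF F])
  have "norm (mean M - mean H) \<le> 0 + e" if e: "e > 0" for e
  proof -
    \<comment> \<open>Three errors \<open>d\<close> separate \<open>K\<close> from \<open>H\<close>
      at each point, and a fourth separates the means of \<open>K\<close> and
      \<open>M\<close>.\<close>
    define d where "d = e / 4"
    have d: "d > 0" using e by (simp add: d_def)
    obtain U where U: "openin T U" "\<one> \<in> U"
      "\<And>x y u. x \<in> carrier X \<Longrightarrow> y \<in> topspace T \<Longrightarrow> u \<in> U \<Longrightarrow> norm (F y (x \<otimes> u) - F y x) < d"
      by (rule uniform_continuity2[OF cont2_swap[OF F] compact d]) blast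
    have Uc: "U \<subseteq> carrier X" using openin_subset[OF U(1)] by (simp add: topspace_eq)
    obtain I where I: "finite I" "I \<subseteq> carrier X" "\<And>x. x \<in> carrier X \<Longrightarrow> \<exists>a\<in>I. \<exists>u\<in>U. x = a \<otimes> u"
      by (rule finite_translate_cover[OF U(1,2)]) blast
    have cF: "cont (\<lambda>x. F x y)" if "y \<in> carrier X" for y using cont2_slice(2)[OF F that] .
    obtain A where A: "averaging A" "\<And>f x. f \<in> insert M ((\<lambda>a x. F x a) ` I) \<Longrightarrow> x \<in> carrier X \<Longrightarrow> norm (A f x - mean f) \<le> d"
      by (rule mean_simultaneous[of "insert M ((\<lambda>a x. F x a) ` I)" "\<lambda>f. f" d]) (use I M cF d in auto)
    define K where "K y = A (\<lambda>x. F x y) \<one>" for y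
    have AM: "A M \<one> = mean K" "cont K"
      using averaging_mean[OF A(1) F] cont2_slice(1)[of "\<lambda>x y. A (\<lambda>x. F x y) x" \<one>] by (auto simp: M_def[abs_def] K_def[abs_def])
    have close: "norm (K y - H y) \<le> 3 * d" if y: "y \<in> carrier X" for y
    proof -
      obtain a u where au: "a \<in> I" "u \<in> U" "y = a \<otimes> u" using I(3)[OF y] by blast
      have ac: "a \<in> carrier X" using au I by blast
      have near: "norm (F x y - F x a) \<le> d" if "x \<in> carrier X" for x
        using U(3)[OF ac _ au(2), of x] that by (simp add: au(3) topspace_eq less_imp_le)
      have "norm (A (\<lambda>x. F x y - F x a) \<one>) \<le> d" by (rule averaging_norm_le[OF A(1) one_closed near])
      then have 1: "norm (K y - K a) \<le> d" using averaging_diff[OF A(1)] by (simp add: K_def)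
      have 2: "norm (K a - H a) \<le> d" using A(2)[of "\<lambda>x. F x a" \<one>] au(1) by (simp add: K_def H_def)
      have "norm (mean (\<lambda>x. F x y - F x a)) \<le> d" by (intro mean_norm_le continuous_map_diff cF y ac near)
      then have 3: "norm (H y - H a) \<le> d" using mean_diff[OF cF[OF y] cF[OF ac]] by (simp add: H_def)
      have "norm (K y - H y) = norm ((K y - K a) + (K a - H a) - (H y - H a))" by simp
      then show ?thesis
        using 1 2 3 norm_triangle_ineq[of "K y - K a" "K a - H a"] norm_triangle_ineq4[of "(K y - K a) + (K a - H a)" "H y - H a"]
        by linarith
    qed
    have "norm (mean (\<lambda>y. K y - H y)) \<le> 3 * d" by (intro mean_norm_le continuous_map_diff AM H close)
    then have 1: "norm (mean K - mean H) \<le> 3 * d" using mean_diff[OF AM(2) H] by simp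
    have 2: "norm (mean K - mean M) \<le> d" using A(2)[of M \<one>] AM(1) by simp
    have "norm (mean M - mean H) = norm ((mean K - mean H) - (mean K - mean M))" by simp
    then show ?thesis using 1 2 norm_triangle_ineq4[of "mean K - mean H" "mean K - mean M"] by (simp add: d_def)
  qed
  then have "norm (mean M - mean H) \<le> 0" by (rule field_le_epsilon)
  then show ?thesis by (simp add: M_def[abs_def] H_def[abs_def])
qed

section \<open>The mean-square norm and compactness\<close>

definition sq_norm :: "('x \<Rightarrow> complex) \<Rightarrow> real" where
  "sq_norm f = Re (mean (\<lambda>x. f x * cnj (f x)))"

lemma mean_mult_cnj:
  assumes "cont f"
  shows "mean (\<lambda>x. f x * cnj (f x)) = of_real (sq_norm f)"
proof -
  have "cont (\<lambda>x. f x * cnj (f x))" by (intro continuous_map_complex_intros assms)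
  from mean_cnj[OF this] have "cnj (mean (\<lambda>x. f x * cnj (f x))) = mean (\<lambda>x. f x * cnj (f x))" by (simp add: mult.commute)
  then have "Im (mean (\<lambda>x. f x * cnj (f x))) = 0" using complex_eq_iff by force
  then show ?thesis by (simp add: sq_norm_def complex_eq_iff)
qed

lemma sq_norm_nonneg: "cont f \<Longrightarrow> 0 \<le> sq_norm f"
  unfolding sq_norm_def by (intro Re_mean_ge continuous_map_complex_intros) (auto simp: complex_mult_cnj)

lemma sq_norm_eq_0:
  assumes "cont f" "sq_norm f \<le> 0" "x \<in> carrier X"
  shows "f x = 0"
proof (rule ccontr)
  assume "f x \<noteq> 0"
  then have "Re (f x * cnj (f x)) > 0" by (simp add: complex_mult_cnj complex_neq_0)
  then have "sq_norm f > 0" unfolding sq_norm_def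
    by (intro mean_pos[OF _ _ assms(3)] continuous_map_complex_intros assms(1)) (auto simp: complex_mult_cnj)
  then show False using assms(2) by simp
qed

lemma sq_norm_scale: "cont f \<Longrightarrow> sq_norm (\<lambda>x. c * f x) = (norm c)\<^sup>2 * sq_norm f"
proof -
  assume f: "cont f"
  have "mean (\<lambda>x. (c * cnj c) * (f x * cnj (f x))) = (c * cnj c) * mean (\<lambda>x. f x * cnj (f x))"
    by (intro mean_scale continuous_map_complex_intros f)
  then have "mean (\<lambda>x. (c * f x) * cnj (c * f x)) = of_real ((norm c)\<^sup>2) * of_real (sq_norm f)"
    unfolding complex_norm_square by (simp add: mult_ac mean_mult_cnj[OF f])
  then show ?thesis by (simp add: sq_norm_def)
qed

lemma sq_norm_diff_scale:
  assumes f: "cont f" and g: "cont g"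
  shows "sq_norm (\<lambda>x. f x - t * g x) = sq_norm f - 2 * Re (cnj t * mean (\<lambda>x. f x * cnj (g x))) + (norm t)\<^sup>2 * sq_norm g"
proof -
  have "mean (\<lambda>x. (f x - t * g x) * cnj (f x - t * g x))
    = mean (\<lambda>x. (f x * cnj (f x) - cnj t * (f x * cnj (g x))) - (t * (cnj (f x * cnj (g x))) - (t * cnj t) * (g x * cnj (g x))))"
    by (rule mean_cong) (simp add: algebra_simps)
  also have "\<dots> = (mean (\<lambda>x. f x * cnj (f x)) - cnj t * mean (\<lambda>x. f x * cnj (g x)))
      - (t * cnj (mean (\<lambda>x. f x * cnj (g x))) - (t * cnj t) * mean (\<lambda>x. g x * cnj (g x)))"
    by (simp only: mean_diff mean_scale mean_cnj continuous_map_complex_intros f g)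
  finally have E: "mean (\<lambda>x. (f x - t * g x) * cnj (f x - t * g x)) = \<dots>" .
  have "sq_norm (\<lambda>x. f x - t * g x) = Re ((of_real (sq_norm f) - cnj t * mean (\<lambda>x. f x * cnj (g x)))
      - (t * cnj (mean (\<lambda>x. f x * cnj (g x))) - (t * cnj t) * of_real (sq_norm g)))"
    unfolding sq_norm_def[of "\<lambda>x. f x - t * g x"] E mean_mult_cnj[OF f] mean_mult_cnj[OF g] ..
  also have "\<dots> = sq_norm f - 2 * Re (cnj t * mean (\<lambda>x. f x * cnj (g x))) + (norm t)\<^sup>2 * sq_norm g"
    unfolding complex_norm_square[symmetric] by simp
  finally show ?thesis .
qed

lemma Cauchy_Schwarz_mean:
  assumes f: "cont f" and g: "cont g"
  shows "(norm (mean (\<lambda>x. f x * cnj (g x))))\<^sup>2 \<le> sq_norm f * sq_norm g"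
proof -
  define c where "c = mean (\<lambda>x. f x * cnj (g x))"
  have pos: "0 \<le> sq_norm f - 2 * Re (cnj t * c) + (norm t)\<^sup>2 * sq_norm g" for t
    unfolding c_def sq_norm_diff_scale[OF f g, symmetric]
    by (intro sq_norm_nonneg continuous_map_complex_intros f g)
  define n where "n = (norm c)\<^sup>2"
  have "Re (cnj c * c) = n" unfolding n_def cmod_power2 by (simp add: power2_eq_square)
  then have rc: "Re (cnj (of_real s * c) * c) = s * n" for s
    by (simp add: distrib_left[symmetric] mult.assoc)
  have nc: "(norm (of_real s * c))\<^sup>2 = s\<^sup>2 * n" for s
    by (simp add: n_def norm_mult power_mult_distrib)
  have posr: "0 \<le> sq_norm f - 2 * (s * n) + s\<^sup>2 * n * sq_norm g" for s
    using pos[of "of_real s * c"] unfolding rc nc .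
  have "n \<le> sq_norm f * sq_norm g"
  proof (cases "sq_norm g = 0")
    case True
    \<comment> \<open>When \<open>g\<close> has norm 0, the expression in \<open>posr\<close> is
      affine in \<open>s\<close>, and a large \<open>s\<close> makes it negative unless
      \<open>n\<close> vanishes.\<close>
    have "n \<le> 0"
    proof (rule ccontr)
      assume "\<not> n \<le> 0"
      then have "2 * ((sq_norm f + 1) / n * n) \<le> sq_norm f"
        using posr[of "(sq_norm f + 1) / n"] True by simp
      then have "2 * (sq_norm f + 1) \<le> sq_norm f" using \<open>\<not> n \<le> 0\<close> by simp
      then show False using sq_norm_nonneg[OF f] by simp
    qed
    then show ?thesis using True by simp
  next
    case False
    then have b: "sq_norm g > 0" using sq_norm_nonneg[OF g] by simp
    have "sq_norm f - 2 * (1 / sq_norm g * n) + (1 / sq_norm g)\<^sup>2 * n * sq_norm g = sq_norm f - n / sq_norm g"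
      using b by (simp add: field_simps power2_eq_square)
    then have "0 \<le> sq_norm f - n / sq_norm g" using posr[of "1 / sq_norm g"] by simp
    then show ?thesis using b by (simp add: field_simps)
  qed
  then show ?thesis by (simp add: n_def c_def)
qed

text \<open>The theorem of Arzela and Ascoli: a diagonal subsequence converges on the countable set
  of centres of all the covers, and equicontinuity makes the convergence uniform.\<close>

lemma equicontinuous_subsequence:
  assumes bdd: "\<And>n x. x \<in> carrier X \<Longrightarrow> norm (f n x :: complex) \<le> C"
    and equi: "\<And>e. e > 0 \<Longrightarrow> \<exists>U. openin T U \<and> \<one> \<in> U \<and> (\<forall>n::nat. \<forall>x\<in>carrier X. \<forall>u\<in>U. norm (f n (x \<otimes> u) - f n x) \<le> e)"
  obtains r :: "nat \<Rightarrow> nat" and g where "strict_mono r" "cont g"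
    "\<And>e. e > 0 \<Longrightarrow> \<exists>N. \<forall>n\<ge>N. \<forall>x\<in>carrier X. norm (f (r n) x - g x) \<le> e"
proof -
  have "\<exists>I U. finite I \<and> I \<subseteq> carrier X \<and> U \<subseteq> carrier X \<and> (\<forall>x\<in>carrier X. \<exists>a\<in>I. \<exists>u\<in>U. x = a \<otimes> u)
      \<and> (\<forall>n. \<forall>x\<in>carrier X. \<forall>u\<in>U. norm (f n (x \<otimes> u) - f n x) \<le> inverse (Suc k))" for k
  proof -
    obtain U where U: "openin T U" "\<one> \<in> U" "\<forall>n. \<forall>x\<in>carrier X. \<forall>u\<in>U. norm (f n (x \<otimes> u) - f n x) \<le> inverse (Suc k)"
      using equi[of "inverse (Suc k)"] by auto
    obtain I where "finite I" "I \<subseteq> carrier X" "\<And>x. x \<in> carrier X \<Longrightarrow> \<exists>a\<in>I. \<exists>u\<in>U. x = a \<otimes> u"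
      by (rule finite_translate_cover[OF U(1,2)]) blast
    then show ?thesis using U openin_subset[OF U(1)] by (metis topspace_eq)
  qed
  then obtain I U where I: "\<And>k. finite (I k)" "\<And>k. I k \<subseteq> carrier X" "\<And>k x. x \<in> carrier X \<Longrightarrow> \<exists>a\<in>I k. \<exists>u\<in>U k. x = a \<otimes> u"
    and U: "\<And>k. U k \<subseteq> carrier X" "\<And>k n x u. x \<in> carrier X \<Longrightarrow> u \<in> U k \<Longrightarrow> norm (f n (x \<otimes> u) - f n x) \<le> inverse (Suc k)"
    by metis
  define S where "S = (\<Union>k. I k)"
  have "countable S" unfolding S_def using I(1) by (intro countable_UN) (auto simp: countable_finite)
  then obtain r where r: "strict_mono r" "\<And>x. x \<in> S \<Longrightarrow> \<exists>l. (\<lambda>n. f (r n) x) \<longlonglongrightarrow> l"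
    by (rule function_convergent_subsequence[of S f C]) (auto simp: S_def intro!: bdd dest: subsetD[OF I(2)])
  have Cauchy: "\<exists>N. \<forall>m\<ge>N. \<forall>n\<ge>N. \<forall>x\<in>carrier X. norm (f (r m) x - f (r n) x) \<le> e" if e: "e > 0" for e
  proof -
    obtain k where k: "inverse (real (Suc k)) < e / 3" using reals_Archimedean[of "e / 3"] e by auto
    have "\<exists>N. \<forall>m\<ge>N. \<forall>n\<ge>N. norm (f (r m) a - f (r n) a) < e / 3" if "a \<in> I k" for a
    proof -
      have C: "Cauchy (\<lambda>n. f (r n) a)" using r(2)[of a] that by (auto simp: S_def intro: LIMSEQ_imp_Cauchy)
      have "e / 3 > 0" using e by simp
      then show ?thesis using C[unfolded Cauchy_def dist_norm] by blast
    qed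
    then obtain N where N: "\<And>a m n. a \<in> I k \<Longrightarrow> m \<ge> N a \<Longrightarrow> n \<ge> N a \<Longrightarrow> norm (f (r m) a - f (r n) a) < e / 3" by metis
    have "norm (f (r m) x - f (r n) x) \<le> e"
      if m: "m \<ge> sum N (I k)" and n: "n \<ge> sum N (I k)" and x: "x \<in> carrier X" for m n x
    proof -
      obtain a u where au: "a \<in> I k" "u \<in> U k" "x = a \<otimes> u" using I(3)[OF x] by blast
      have ac: "a \<in> carrier X" using au I(2) by blast
      have "N a \<le> sum N (I k)" using member_le_sum[OF au(1), of N] I(1) by simp
      then have 1: "norm (f (r m) a - f (r n) a) < e / 3" using N[OF au(1)] m n by simp
      have 2: "norm (f (r m) x - f (r m) a) < e / 3" "norm (f (r n) x - f (r n) a) < e / 3"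
        using U(2)[OF ac au(2), of "r m"] U(2)[OF ac au(2), of "r n"] k by (simp_all add: au(3))
      have "norm (f (r m) x - f (r n) x) = norm ((f (r m) x - f (r m) a) + (f (r m) a - f (r n) a) - (f (r n) x - f (r n) a))" by simp
      then show ?thesis
        using 1 2 norm_triangle_ineq[of "f (r m) x - f (r m) a" "f (r m) a - f (r n) a"]
          norm_triangle_ineq4[of "(f (r m) x - f (r m) a) + (f (r m) a - f (r n) a)" "f (r n) x - f (r n) a"]
        by linarith
    qed
    then show ?thesis by blast
  qed
  define g where "g x = lim (\<lambda>n. f (r n) x)" for x
  have lim: "(\<lambda>n. f (r n) x) \<longlonglongrightarrow> g x" if x: "x \<in> carrier X" for x
  proof -
    have "Cauchy (\<lambda>n. f (r n) x)"
      unfolding Cauchy_def dist_norm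
    proof (intro allI impI)
      fix e :: real assume "e > 0"
      then have "e / 2 > 0" by simp
      then obtain N where N: "\<forall>m\<ge>N. \<forall>n\<ge>N. \<forall>x\<in>carrier X. norm (f (r m) x - f (r n) x) \<le> e / 2" using Cauchy by blast
      have "norm (f (r m) x - f (r n) x) < e" if "m \<ge> N" "n \<ge> N" for m n
      proof -
        have "norm (f (r m) x - f (r n) x) \<le> e / 2" using N that x by blast
        then show ?thesis using \<open>e > 0\<close> by linarith
      qed
      then show "\<exists>N. \<forall>m\<ge>N. \<forall>n\<ge>N. norm (f (r m) x - f (r n) x) < e" by blast
    qed
    then show ?thesis unfolding g_def by (simp add: Cauchy_convergent_iff convergent_LIMSEQ_iff)
  qed
  have unif: "\<exists>N. \<forall>n\<ge>N. \<forall>x\<in>carrier X. norm (f (r n) x - g x) \<le> e" if e: "e > 0" for e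
  proof -
    obtain N where N: "\<And>m n x. m \<ge> N \<Longrightarrow> n \<ge> N \<Longrightarrow> x \<in> carrier X \<Longrightarrow> norm (f (r m) x - f (r n) x) \<le> e" using Cauchy[OF e] by blast
    have "norm (f (r m) x - g x) \<le> e" if m: "m \<ge> N" and x: "x \<in> carrier X" for m x
    proof (rule LIMSEQ_le_const2)
      show "(\<lambda>n. norm (f (r m) x - f (r n) x)) \<longlonglongrightarrow> norm (f (r m) x - g x)" by (intro tendsto_intros lim x)
      show "\<exists>n0. \<forall>n\<ge>n0. norm (f (r m) x - f (r n) x) \<le> e" using N[OF m _ x] by blast
    qed
    then show ?thesis by blast
  qed
  have "cont g"
  proof (rule cont_if_uniform)
    fix e :: real assume e: "e > 0"
    then have "e / 2 > 0" by simp
    from equi[OF this] obtain V where V: "openin T V" "\<one> \<in> V" "\<And>n x u. x \<in> carrier X \<Longrightarrow> u \<in> V \<Longrightarrow> norm (f n (x \<otimes> u) - f n x) \<le> e / 2" by blast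
    have Vc: "V \<subseteq> carrier X" using openin_subset[OF V(1)] by (simp add: topspace_eq)
    have "norm (g (x \<otimes> u) - g x) < e" if x: "x \<in> carrier X" and u: "u \<in> V" for x u
    proof -
      have "norm (g (x \<otimes> u) - g x) \<le> e / 2"
      proof (rule LIMSEQ_le_const2)
        show "(\<lambda>n. norm (f (r n) (x \<otimes> u) - f (r n) x)) \<longlonglongrightarrow> norm (g (x \<otimes> u) - g x)"
          by (intro tendsto_intros lim) (use x u Vc in auto)
        show "\<exists>n0. \<forall>n\<ge>n0. norm (f (r n) (x \<otimes> u) - f (r n) x) \<le> e / 2" using V(3)[OF x u] by blast
      qed
      then show ?thesis using e by linarith
    qed
    then show "\<exists>U. openin T U \<and> \<one> \<in> U \<and> (\<forall>x\<in>carrier X. \<forall>u\<in>U. norm (g (x \<otimes> u) - g x) < e)" using V by blast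
  qed
  then show ?thesis by (rule that[OF r(1) _ unif])
qed

end

subsection \<open>Convolution operators and existence of characters\<close>

context compact_metrizable_abelian_group
begin

lemma sq_norm_le:
  assumes "cont f" "\<And>x. x \<in> carrier X \<Longrightarrow> norm (f x) \<le> M"
  shows "sq_norm f \<le> M\<^sup>2"
  unfolding sq_norm_def
proof (intro Re_mean_le continuous_map_complex_intros assms(1))
  fix x assume "x \<in> carrier X"
  then have "(norm (f x))\<^sup>2 \<le> M\<^sup>2" using assms(2) by (intro power_mono) auto
  then show "Re (f x * cnj (f x)) \<le> M\<^sup>2" unfolding complex_norm_square[symmetric] by simp
qed

lemma sq_norm_cong: "(\<And>x. x \<in> carrier X \<Longrightarrow> f x = g x) \<Longrightarrow> sq_norm f = sq_norm g"
  unfolding sq_norm_def by (intro arg_cong[of _ _ Re] mean_cong) simp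

lemma sq_norm_cnj: "sq_norm (\<lambda>x. cnj (f x)) = sq_norm f"
  unfolding sq_norm_def by (simp add: mult.commute)

end

text \<open>Hermitian symmetry makes convolution with \<open>k\<close> self-adjoint for the mean
  inner product. Completion to a Hilbert space is avoided: convolution turns mean-square bounds into
  equicontinuity, so limits are taken uniformly among continuous functions.\<close>

locale hermitian_kernel = compact_metrizable_abelian_group X T
  for X :: "('x, 'm) monoid_scheme" (structure) and T :: "'x topology" +
  fixes k :: "'x \<Rightarrow> complex"
  assumes cont_k: "continuous_map T euclidean k" and hermitian: "x \<in> carrier X \<Longrightarrow> k (inv x) = cnj (k x)"
    and nonzero: "\<exists>x\<in>carrier X. k x \<noteq> 0"
begin

definition convol :: "('x \<Rightarrow> complex) \<Rightarrow> 'x \<Rightarrow> complex" where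
  "convol f x = mean (\<lambda>y. k (x \<otimes> inv y) * f y)"

lemma cont2_convol: "cont f \<Longrightarrow> cont2 (\<lambda>x y. k (x \<otimes> inv y) * f y)"
  by (intro cont2_mult cont2_group_div cont2_I2 cont_k)

lemma cont_convol: "cont f \<Longrightarrow> cont (convol f)"
  unfolding convol_def[abs_def] by (rule cont_mean[OF cont2_convol])

lemma cont_slice: "x \<in> carrier X \<Longrightarrow> cont (\<lambda>y. k (x \<otimes> inv y))"
  by (rule cont2_slice(1)[OF cont2_group_div[OF cont_k]])

lemma mean_slice:
  assumes "cont h" "x \<in> carrier X"
  shows "mean (\<lambda>y. h (x \<otimes> inv y)) = mean h"
proof -
  have c: "cont (\<lambda>y. h (y \<otimes> x))" by (rule cont_translate[OF assms])
  have "mean (\<lambda>y. h (x \<otimes> inv y)) = mean (\<lambda>y. h (inv y \<otimes> x))" by (rule mean_cong) (simp add: assms m_comm)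
  also have "\<dots> = mean (\<lambda>y. h (y \<otimes> x))" by (rule mean_inv[OF c])
  also have "\<dots> = mean h" by (rule mean_translate[OF assms])
  finally show ?thesis .
qed

lemma sq_norm_slice: "x \<in> carrier X \<Longrightarrow> sq_norm (\<lambda>y. k (x \<otimes> inv y)) = sq_norm k"
  unfolding sq_norm_def using mean_slice[of "\<lambda>x. k x * cnj (k x)" x]
  by (simp add: cont_k continuous_map_complex_mult continuous_map_complex_cnj)

lemma convol_bound:
  assumes "cont f" "x \<in> carrier X"
  shows "(norm (convol f x))\<^sup>2 \<le> sq_norm k * sq_norm f"
  using Cauchy_Schwarz_mean[OF cont_slice[OF assms(2)] continuous_map_complex_cnj[OF assms(1)]]
  by (simp add: convol_def sq_norm_slice[OF assms(2)] sq_norm_cnj)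

lemma convol_diff_scale:
  assumes "cont f" "cont g" "x \<in> carrier X"
  shows "convol (\<lambda>x. f x - c * g x) x = convol f x - c * convol g x"
proof -
  note s = cont_slice[OF assms(3)]
  have "convol (\<lambda>x. f x - c * g x) x = mean (\<lambda>y. k (x \<otimes> inv y) * f y - c * (k (x \<otimes> inv y) * g y))"
    by (simp add: convol_def algebra_simps)
  also have "\<dots> = convol f x - c * convol g x"
    unfolding convol_def using assms(1,2) s by (simp only: mean_diff mean_scale continuous_map_complex_intros)
  finally show ?thesis .
qed

lemma convol_scale:
  assumes "cont f" "x \<in> carrier X"
  shows "convol (\<lambda>x. c * f x) x = c * convol f x"
proof -
  have "convol (\<lambda>x. c * f x) x = mean (\<lambda>y. c * (k (x \<otimes> inv y) * f y))" by (simp add: convol_def mult_ac)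
  also have "\<dots> = c * convol f x"
    unfolding convol_def by (rule mean_scale) (intro continuous_map_complex_intros cont_slice assms)
  finally show ?thesis .
qed

lemma convol_cong: "(\<And>x. x \<in> carrier X \<Longrightarrow> f x = g x) \<Longrightarrow> convol f x = convol g x"
  unfolding convol_def by (rule mean_cong) simp

lemma convol_translate:
  assumes "cont f" "x \<in> carrier X" "a \<in> carrier X"
  shows "convol (\<lambda>x. f (x \<otimes> a)) x = convol f (x \<otimes> a)"
proof -
  define h where "h y = k ((x \<otimes> a) \<otimes> inv y) * f y" for y
  have h: "cont h" unfolding h_def using assms by (intro continuous_map_complex_intros cont_slice) auto
  have "convol (\<lambda>x. f (x \<otimes> a)) x = mean (\<lambda>y. h (y \<otimes> a))"
    unfolding convol_def
  proof (rule mean_cong)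
    fix y assume y: "y \<in> carrier X"
    have "(x \<otimes> a) \<otimes> inv (y \<otimes> a) = (x \<otimes> inv y) \<otimes> (a \<otimes> inv a)"
      using assms y by (simp only: inv_mult m_ac m_closed inv_closed)
    also have "\<dots> = x \<otimes> inv y" using assms y by simp
    finally have "(x \<otimes> a) \<otimes> inv (y \<otimes> a) = x \<otimes> inv y" .
    then show "k (x \<otimes> inv y) * f (y \<otimes> a) = h (y \<otimes> a)" by (simp add: h_def)
  qed
  also have "\<dots> = mean h" by (rule mean_translate[OF h assms(3)])
  finally show ?thesis by (simp add: convol_def h_def[abs_def])
qed

lemma convol_equicontinuous:
  assumes e: "e > 0"
  obtains U where "openin T U" "\<one> \<in> U"
    "\<And>f x u. cont f \<Longrightarrow> x \<in> carrier X \<Longrightarrow> u \<in> U \<Longrightarrow> norm (convol f (x \<otimes> u) - convol f x) \<le> e * sqrt (sq_norm f)"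
proof -
  obtain U where U: "openin T U" "\<one> \<in> U" "\<And>x u. x \<in> carrier X \<Longrightarrow> u \<in> U \<Longrightarrow> norm (k (x \<otimes> u) - k x) < e"
    by (rule uniform_continuity[OF cont_k e]) blast
  have Uc: "U \<subseteq> carrier X" using openin_subset[OF U(1)] by (simp add: topspace_eq)
  have "norm (convol f (x \<otimes> u) - convol f x) \<le> e * sqrt (sq_norm f)"
    if f: "cont f" and x: "x \<in> carrier X" and u: "u \<in> U" for f x u
  proof -
    have uc: "u \<in> carrier X" using u Uc by blast
    define d where "d y = k ((x \<otimes> u) \<otimes> inv y) - k (x \<otimes> inv y)" for y
    have d: "cont d" unfolding d_def using x uc by (intro continuous_map_complex_intros cont_slice) auto
    have "norm (d y) \<le> e" if y: "y \<in> carrier X" for y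
    proof -
      have "(x \<otimes> u) \<otimes> inv y = (x \<otimes> inv y) \<otimes> u" using x uc y by (simp add: m_ac)
      then show ?thesis using U(3)[of "x \<otimes> inv y" u] x u y by (simp add: d_def less_imp_le)
    qed
    then have sd: "sq_norm d \<le> e\<^sup>2" by (rule sq_norm_le[OF d])
    have "convol f (x \<otimes> u) - convol f x = mean (\<lambda>y. k ((x \<otimes> u) \<otimes> inv y) * f y - k (x \<otimes> inv y) * f y)"
      unfolding convol_def using f x uc by (intro mean_diff[symmetric] continuous_map_complex_intros cont_slice) auto
    also have "\<dots> = mean (\<lambda>y. d y * cnj (cnj (f y)))" by (simp add: d_def algebra_simps)
    finally have "(norm (convol f (x \<otimes> u) - convol f x))\<^sup>2 \<le> sq_norm d * sq_norm f"
      using Cauchy_Schwarz_mean[OF d continuous_map_complex_cnj[OF f]] by (simp add: sq_norm_cnj)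
    also have "\<dots> \<le> e\<^sup>2 * sq_norm f" using sd sq_norm_nonneg[OF f] by (rule mult_right_mono)
    also have "\<dots> = (e * sqrt (sq_norm f))\<^sup>2" using sq_norm_nonneg[OF f] by (simp add: power_mult_distrib)
    finally show ?thesis by (rule power2_le_imp_le) (use e sq_norm_nonneg[OF f] in simp)
  qed
  then show ?thesis using that U by blast
qed

lemma convol_self_adjoint:
  assumes f: "cont f" and g: "cont g"
  shows "mean (\<lambda>x. convol f x * cnj (g x)) = mean (\<lambda>x. f x * cnj (convol g x))"
proof -
  define F where "F x y = k (x \<otimes> inv y) * f y * cnj (g x)" for x y
  have F: "cont2 F" unfolding F_def by (intro cont2_mult cont2_convol cont2_I1 continuous_map_complex_cnj f g)
  have "mean (\<lambda>x. convol f x * cnj (g x)) = mean (\<lambda>x. mean (F x))"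
  proof (rule mean_cong)
    fix x assume x: "x \<in> carrier X"
    have "mean (\<lambda>y. cnj (g x) * (k (x \<otimes> inv y) * f y)) = cnj (g x) * convol f x"
      unfolding convol_def by (rule mean_scale) (intro continuous_map_complex_intros cont_slice x f)
    then show "convol f x * cnj (g x) = mean (F x)" by (simp add: F_def[abs_def] mult.commute)
  qed
  also have "\<dots> = mean (\<lambda>y. mean (\<lambda>x. F x y))" by (rule mean_swap[OF F])
  also have "\<dots> = mean (\<lambda>y. f y * cnj (convol g y))"
  proof (rule mean_cong)
    fix y assume y: "y \<in> carrier X"
    have c: "cont (\<lambda>x. k (y \<otimes> inv x) * g x)" by (intro continuous_map_complex_intros cont_slice y g)
    have "cnj (convol g y) = mean (\<lambda>x. cnj (k (y \<otimes> inv x) * g x))"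
      unfolding convol_def by (rule mean_cnj[OF c, symmetric])
    then have "f y * cnj (convol g y) = mean (\<lambda>x. f y * cnj (k (y \<otimes> inv x) * g x))"
      using mean_scale[OF continuous_map_complex_cnj[OF c], of "f y"] by simp
    also have "\<dots> = mean (\<lambda>x. F x y)"
    proof (rule mean_cong)
      fix x assume x: "x \<in> carrier X"
      have "inv (y \<otimes> inv x) = x \<otimes> inv y" using x y by (simp add: inv_mult_group)
      then have "k (x \<otimes> inv y) = cnj (k (y \<otimes> inv x))" using hermitian[of "y \<otimes> inv x"] x y by simp
      then show "f y * cnj (k (y \<otimes> inv x) * g x) = F x y" by (simp add: F_def)
    qed
    finally show "mean (\<lambda>x. F x y) = f y * cnj (convol g y)" by simp
  qed
  finally show ?thesis .
qed

text \<open>The square of the operator norm of convolution and the largest eigenvalue of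
  \<open>convol2\<close>. Passing to the square removes the choice of sign for the extreme
  eigenvalue of convolution itself.\<close>

definition top_value :: real where
  "top_value = Sup {sq_norm (convol f) | f. cont f \<and> sq_norm f = 1}"

lemma sq_norm_convol_le: "cont f \<Longrightarrow> sq_norm (convol f) \<le> sq_norm k * sq_norm f"
  unfolding sq_norm_def[of "convol f"]
proof (intro Re_mean_le continuous_map_complex_intros cont_convol)
  fix x assume "cont f" "x \<in> carrier X"
  then show "Re (convol f x * cnj (convol f x)) \<le> sq_norm k * sq_norm f"
    using convol_bound unfolding complex_norm_square[symmetric] by simp
qed

lemma sq_norm_convol_top:
  assumes f: "cont f"
  shows "sq_norm (convol f) \<le> top_value * sq_norm f"
proof (cases "sq_norm f = 0")
  case True
  then show ?thesis using sq_norm_convol_le[OF f] by simp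
next
  case False
  then have pos: "sq_norm f > 0" using sq_norm_nonneg[OF f] by simp
  define c where "c = complex_of_real (1 / sqrt (sq_norm f))"
  have c: "(norm c)\<^sup>2 = 1 / sq_norm f" using pos by (simp add: c_def norm_divide power_divide)
  have cf: "cont (\<lambda>x. c * f x)" by (intro continuous_map_complex_intros f)
  have "sq_norm (\<lambda>x. c * f x) = 1" using pos by (simp add: sq_norm_scale[OF f] c)
  then have "sq_norm (convol (\<lambda>x. c * f x)) \<in> {sq_norm (convol f) | f. cont f \<and> sq_norm f = 1}" using cf by blast
  moreover have "bdd_above {sq_norm (convol f) | f. cont f \<and> sq_norm f = 1}"
    unfolding bdd_above_def using sq_norm_convol_le by (intro exI[of _ "sq_norm k"]) fastforce
  ultimately have "sq_norm (convol (\<lambda>x. c * f x)) \<le> top_value"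
    unfolding top_value_def by (rule cSup_upper)
  moreover have "sq_norm (convol (\<lambda>x. c * f x)) = sq_norm (\<lambda>x. c * convol f x)"
    by (rule sq_norm_cong) (rule convol_scale[OF f])
  ultimately have "sq_norm (convol f) / sq_norm f \<le> top_value"
    by (simp add: sq_norm_scale[OF cont_convol[OF f]] c)
  then show ?thesis using pos by (simp add: field_simps)
qed

lemma sq_norm_k_pos: "sq_norm k > 0"
  using nonzero sq_norm_eq_0[OF cont_k] by (meson not_le)

text \<open>By Hermitian symmetry the convolution of \<open>k\<close> with itself takes the value
  \<open>sq_norm k\<close> at \<open>\<one>\<close>.\<close>

lemma top_value_pos: "top_value > 0"
proof (rule ccontr)
  assume "\<not> top_value > 0"
  then have "top_value * sq_norm k \<le> 0" using sq_norm_k_pos by (simp add: mult_nonpos_nonneg)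
  then have "sq_norm (convol k) \<le> 0" using sq_norm_convol_top[OF cont_k] by simp
  then have "convol k \<one> = 0" using sq_norm_eq_0[OF cont_convol[OF cont_k]] by simp
  moreover have "convol k \<one> = mean (\<lambda>y. k y * cnj (k y))"
    unfolding convol_def by (rule mean_cong) (simp add: hermitian mult.commute)
  ultimately show False using sq_norm_k_pos by (simp add: sq_norm_def)
qed

abbreviation "convol2 f \<equiv> convol (convol f)"

lemma convol2_diff_scale:
  assumes "cont f" "cont g" "x \<in> carrier X"
  shows "convol2 (\<lambda>x. f x - c * g x) x = convol2 f x - c * convol2 g x"
proof -
  have "convol2 (\<lambda>x. f x - c * g x) x = convol (\<lambda>x. convol f x - c * convol g x) x"
    by (rule convol_cong) (rule convol_diff_scale[OF assms(1,2)])
  then show ?thesis using convol_diff_scale[OF cont_convol[OF assms(1)] cont_convol[OF assms(2)] assms(3)] by simp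
qed

lemma convol2_translate:
  assumes "cont f" "x \<in> carrier X" "a \<in> carrier X"
  shows "convol2 (\<lambda>x. f (x \<otimes> a)) x = convol2 f (x \<otimes> a)"
proof -
  have "convol2 (\<lambda>x. f (x \<otimes> a)) x = convol (\<lambda>x. convol f (x \<otimes> a)) x"
    by (rule convol_cong) (rule convol_translate[OF assms(1) _ assms(3)])
  then show ?thesis using convol_translate[OF cont_convol[OF assms(1)] assms(2,3)] by simp
qed

lemma convol2_bound:
  assumes f: "cont f" and x: "x \<in> carrier X"
  shows "(norm (convol2 f x))\<^sup>2 \<le> sq_norm k * top_value * sq_norm f"
proof -
  have "(norm (convol2 f x))\<^sup>2 \<le> sq_norm k * sq_norm (convol f)" by (rule convol_bound[OF cont_convol[OF f] x])
  also have "\<dots> \<le> sq_norm k * (top_value * sq_norm f)"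
    by (rule mult_left_mono[OF sq_norm_convol_top[OF f]]) (use sq_norm_k_pos in simp)
  finally show ?thesis by (simp add: mult.assoc)
qed

lemma convol2_equicontinuous:
  assumes e: "e > 0"
  shows "\<exists>U. openin T U \<and> \<one> \<in> U \<and> (\<forall>f. cont f \<and> sq_norm f \<le> 1 \<longrightarrow>
    (\<forall>x\<in>carrier X. \<forall>u\<in>U. norm (convol2 f (x \<otimes> u) - convol2 f x) \<le> e))"
proof -
  have e': "e / sqrt top_value > 0" using e top_value_pos by simp
  obtain U where U: "openin T U" "\<one> \<in> U"
    "\<And>f x u. cont f \<Longrightarrow> x \<in> carrier X \<Longrightarrow> u \<in> U \<Longrightarrow> norm (convol f (x \<otimes> u) - convol f x) \<le> e / sqrt top_value * sqrt (sq_norm f)"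
    by (rule convol_equicontinuous[OF e']) blast
  have "norm (convol2 f (x \<otimes> u) - convol2 f x) \<le> e"
    if f: "cont f" "sq_norm f \<le> 1" and x: "x \<in> carrier X" and u: "u \<in> U" for f x u
  proof -
    have "sq_norm (convol f) \<le> top_value * 1"
      using sq_norm_convol_top[OF f(1)] mult_left_mono[OF f(2), of top_value] top_value_pos by linarith
    then have "sqrt (sq_norm (convol f)) \<le> sqrt top_value" by simp
    then have "e / sqrt top_value * sqrt (sq_norm (convol f)) \<le> e / sqrt top_value * sqrt top_value"
      using e' by (intro mult_left_mono) auto
    also have "\<dots> = e" using top_value_pos by simp
    finally show ?thesis using U(3)[OF cont_convol[OF f(1)] x u] by linarith
  qed
  then show ?thesis using U by blast
qed

text \<open>Along a maximizing sequence the defect \<open>D n\<close> satisfies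
  \<open>sq_norm (D n) \<le> top_value * (top_value - s n)\<close> and so tends to 0. The functions
  \<open>convol2 (f n)\<close> are equicontinuous, and a uniform limit of them is an eigenfunction.
  It is nonzero because their inner products with the unit vectors \<open>f n\<close> tend to
  \<open>top_value\<close>.\<close>

theorem top_eigenfunction:
  obtains g where "cont g" "\<exists>x\<in>carrier X. g x \<noteq> 0"
    "\<And>x. x \<in> carrier X \<Longrightarrow> convol2 g x = of_real top_value * g x"
proof -
  let ?l = top_value and ?S = "{sq_norm (convol f) | f. cont f \<and> sq_norm f = 1}"
  have "\<exists>f. cont f \<and> sq_norm f = 1"
  proof -
    have "sq_norm (\<lambda>x. 1) = 1" by (simp add: sq_norm_def mean_const)
    then show ?thesis by (intro exI[of _ "\<lambda>x. 1"]) simp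
  qed
  then have ne: "?S \<noteq> {}" by blast
  have "\<exists>f. cont f \<and> sq_norm f = 1 \<and> ?l - inverse (real (Suc n)) < sq_norm (convol f)" for n
    using less_cSupD[OF ne, of "?l - inverse (real (Suc n))"] by (auto simp: top_value_def)
  then obtain f where f: "\<And>n. cont (f n)" "\<And>n. sq_norm (f n) = 1" "\<And>n. ?l - inverse (real (Suc n)) < sq_norm (convol (f n))"
    by metis
  define s where "s n = sq_norm (convol (f n))" for n
  define F where "F n = convol2 (f n)" for n
  have F: "cont (F n)" for n unfolding F_def by (intro cont_convol f)
  have s_le: "s n \<le> ?l" for n using sq_norm_convol_top[OF f(1)[of n]] f(2) by (simp add: s_def)
  have inner: "mean (\<lambda>x. F n x * cnj (f n x)) = of_real (s n)" for n
    unfolding F_def convol_self_adjoint[OF cont_convol[OF f(1)] f(1)] s_def by (rule mean_mult_cnj[OF cont_convol[OF f(1)]])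
  define D where "D n x = F n x - of_real ?l * f n x" for n x
  have D: "cont (D n)" for n unfolding D_def by (intro continuous_map_complex_intros F f)
  have D_small: "sq_norm (D n) \<le> ?l * inverse (real (Suc n))" for n
  proof -
    have "sq_norm (D n) = sq_norm (F n) - 2 * (?l * s n) + ?l\<^sup>2"
      unfolding D_def sq_norm_diff_scale[OF F f(1)] inner by (simp add: f(2))
    also have "sq_norm (F n) \<le> ?l * s n" unfolding F_def s_def by (rule sq_norm_convol_top[OF cont_convol[OF f(1)]])
    finally have "sq_norm (D n) \<le> ?l * (?l - s n)" by (simp add: power2_eq_square algebra_simps)
    also have "\<dots> \<le> ?l * inverse (real (Suc n))"
      using f(3)[of n] top_value_pos by (intro mult_left_mono) (auto simp: s_def)
    finally show ?thesis .
  qed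
  define C where "C = sqrt (sq_norm k * ?l)"
  have bdd: "norm (F n x) \<le> C" if "x \<in> carrier X" for n x
    unfolding C_def F_def using convol2_bound[OF f(1)[of n] that] f(2)[of n] by (intro real_le_rsqrt) simp
  have equi: "\<exists>U. openin T U \<and> \<one> \<in> U \<and> (\<forall>n. \<forall>x\<in>carrier X. \<forall>u\<in>U. norm (F n (x \<otimes> u) - F n x) \<le> e)" if "e > 0" for e
    using convol2_equicontinuous[OF that] f(1,2) unfolding F_def by (metis order_refl)
  obtain r g where r: "strict_mono (r :: nat \<Rightarrow> nat)" and g: "cont g"
    and lim: "\<And>e. e > 0 \<Longrightarrow> \<exists>N. \<forall>n\<ge>N. \<forall>x\<in>carrier X. norm (F (r n) x - g x) \<le> e"
    by (rule equicontinuous_subsequence[OF bdd equi]) blast+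
  have Fg: "(\<lambda>n. F (r n) x) \<longlonglongrightarrow> g x" if x: "x \<in> carrier X" for x
    unfolding LIMSEQ_def dist_norm
  proof (intro allI impI)
    fix e :: real assume e: "e > 0"
    then have "e / 2 > 0" by simp
    from lim[OF this] obtain N where N: "\<And>n x. n \<ge> N \<Longrightarrow> x \<in> carrier X \<Longrightarrow> norm (F (r n) x - g x) \<le> e / 2" by blast
    have "norm (F (r n) x - g x) < e" if "n \<ge> N" for n using N[OF that x] e by linarith
    then show "\<exists>N. \<forall>n\<ge>N. norm (F (r n) x - g x) < e" by blast
  qed
  have eig: "convol2 g x = of_real ?l * g x" if x: "x \<in> carrier X" for x
  proof -
    define M where "M = sq_norm k * ?l"
    have M: "M > 0" using sq_norm_k_pos top_value_pos by (simp add: M_def)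
    have 1: "(\<lambda>n. convol2 (D (r n)) x) \<longlonglongrightarrow> 0"
    proof -
      have "(norm (convol2 (D (r n)) x))\<^sup>2 \<le> M * ?l * inverse (real (Suc n))" for n
      proof -
        have "(norm (convol2 (D (r n)) x))\<^sup>2 \<le> M * sq_norm (D (r n))" using convol2_bound[OF D x] by (simp add: M_def)
        also have "\<dots> \<le> M * (?l * inverse (real (Suc (r n))))" using D_small M by (intro mult_left_mono) auto
        also have "\<dots> \<le> M * (?l * inverse (real (Suc n)))"
          using M top_value_pos seq_suble[OF r, of n] by (intro mult_left_mono le_imp_inverse_le) auto
        finally show ?thesis by (simp add: mult.assoc)
      qed
      then have "norm (convol2 (D (r n)) x) \<le> sqrt (M * ?l * inverse (real (Suc n)))" for n by (rule real_le_rsqrt)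
      moreover have "(\<lambda>n. sqrt (M * ?l * inverse (real (Suc n)))) \<longlonglongrightarrow> sqrt (M * ?l * 0)"
        by (intro tendsto_real_sqrt tendsto_mult tendsto_const LIMSEQ_inverse_real_of_nat)
      ultimately show ?thesis
        using Lim_null_comparison[of "\<lambda>n. convol2 (D (r n)) x" "\<lambda>n. sqrt (M * ?l * inverse (real (Suc n)))" sequentially] by simp
    qed
    have 2: "(\<lambda>n. convol2 (F (r n)) x) \<longlonglongrightarrow> convol2 g x"
      unfolding LIMSEQ_def dist_norm
    proof (intro allI impI)
      fix e :: real assume e: "e > 0"
      define d where "d = e / (2 * sqrt M)"
      have d: "d > 0" using e M by (simp add: d_def)
      obtain N where N: "\<And>n x. n \<ge> N \<Longrightarrow> x \<in> carrier X \<Longrightarrow> norm (F (r n) x - g x) \<le> d" using lim[OF d] by blast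
      have "norm (convol2 (F (r n)) x - convol2 g x) < e" if n: "n \<ge> N" for n
      proof -
        have c: "cont (\<lambda>x. F (r n) x - 1 * g x)" by (intro continuous_map_complex_intros F g)
        have "(norm (convol2 (F (r n)) x - convol2 g x))\<^sup>2 \<le> M * sq_norm (\<lambda>x. F (r n) x - 1 * g x)"
          using convol2_bound[OF c x] convol2_diff_scale[OF F g x, of "r n" 1] by (simp add: M_def)
        also have "\<dots> \<le> M * d\<^sup>2" using sq_norm_le[OF c, of d] N[OF n] M by (intro mult_left_mono) auto
        also have "\<dots> = (e / 2)\<^sup>2" using M by (simp add: d_def power_divide power_mult_distrib)
        finally have "norm (convol2 (F (r n)) x - convol2 g x) \<le> e / 2" by (rule power2_le_imp_le) (use e in simp)
        then show ?thesis using e by linarith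
      qed
      then show "\<exists>N. \<forall>n\<ge>N. norm (convol2 (F (r n)) x - convol2 g x) < e" by blast
    qed
    have "convol2 (D (r n)) x = convol2 (F (r n)) x - of_real ?l * F (r n) x" for n
      unfolding D_def using convol2_diff_scale[OF F f(1) x] by (simp add: F_def)
    then have "(\<lambda>n. convol2 (D (r n)) x) \<longlonglongrightarrow> convol2 g x - of_real ?l * g x"
      using 2 Fg[OF x] by (simp add: tendsto_intros)
    then show ?thesis using LIMSEQ_unique[OF 1] by fastforce
  qed
  have "\<exists>x\<in>carrier X. g x \<noteq> 0"
  proof (rule ccontr)
    assume "\<not> ?thesis"
    then have g0: "\<And>x. x \<in> carrier X \<Longrightarrow> g x = 0" by blast
    have h: "?l / 2 > 0" using top_value_pos by simp
    obtain N where N: "\<And>n x. n \<ge> N \<Longrightarrow> x \<in> carrier X \<Longrightarrow> norm (F (r n) x - g x) \<le> ?l / 2" using lim[OF h] by blast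
    obtain m where m: "inverse (real (Suc m)) < ?l / 2" using reals_Archimedean[OF h] by blast
    define n where "n = max N m"
    have "sq_norm (F (r n)) \<le> (?l / 2)\<^sup>2" using N[of n] g0 by (intro sq_norm_le F) (simp add: n_def)
    then have "(norm (mean (\<lambda>x. F (r n) x * cnj (f (r n) x))))\<^sup>2 \<le> (?l / 2)\<^sup>2"
      using Cauchy_Schwarz_mean[OF F f(1), of "r n" "r n"] by (simp add: f(2))
    then have "s (r n) \<le> ?l / 2" unfolding inner using h by (simp add: abs_le_square_iff[symmetric])
    moreover have "?l - inverse (real (Suc (r n))) < s (r n)" using f(3) by (simp add: s_def)
    moreover have "inverse (real (Suc (r n))) \<le> inverse (real (Suc m))"
      using seq_suble[OF r, of n] by (intro le_imp_inverse_le) (auto simp: n_def)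
    ultimately show False using m by linarith
  qed
  then show ?thesis using that g eig by blast
qed

end

section \<open>Positive definite functions\<close>

lemma sum_lessThan_double:
  fixes f :: "nat \<Rightarrow> 'a::comm_monoid_add"
  shows "(\<Sum>i<2 * n. f i) = (\<Sum>i<n. f (2 * i) + f (2 * i + 1))"
  by (induction n) (simp_all add: add.assoc)

lemma nonneg_Reals_iff: "z \<in> \<real>\<^sub>\<ge>\<^sub>0 \<longleftrightarrow> Im z = 0 \<and> 0 \<le> Re z"
  by (auto simp: complex_nonneg_Reals_iff)

context compact_metrizable_abelian_group
begin

text \<open>The points are an indexed list with repetitions allowed, so that lists can be doubled
  and translated freely.\<close>

definition pos_def :: "('x \<Rightarrow> complex) \<Rightarrow> bool" where
  "pos_def p \<longleftrightarrow> (\<forall>n (c :: nat \<Rightarrow> complex) (a :: nat \<Rightarrow> 'x). (\<forall>i<n. a i \<in> carrier X) \<longrightarrow>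
     (\<Sum>i<n. \<Sum>j<n. c i * cnj (c j) * p (a i \<otimes> inv (a j))) \<in> \<real>\<^sub>\<ge>\<^sub>0)"

lemma pos_defD:
  fixes n :: nat
  assumes p: "pos_def p" and a: "\<And>i. i < n \<Longrightarrow> a i \<in> carrier X"
  shows "(\<Sum>i<n. \<Sum>j<n. c i * cnj (c j) * p (a i \<otimes> inv (a j))) \<in> \<real>\<^sub>\<ge>\<^sub>0"
  using p[unfolded pos_def_def, THEN spec[of _ n], THEN spec[of _ c], THEN spec[of _ a]] by (simp add: a)

lemma pos_def_two_points:
  assumes p: "pos_def p" and x: "x \<in> carrier X"
  shows "c * cnj c * p \<one> + c * cnj d * p x + (d * cnj c * p (inv x) + d * cnj d * p \<one>) \<in> \<real>\<^sub>\<ge>\<^sub>0"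
proof -
  define a where "a i = (if i = 0 then x else \<one>)" for i :: nat
  define e where "e i = (if i = 0 then c else d)" for i :: nat
  have v: "a 0 = x" "a 1 = \<one>" "e 0 = c" "e 1 = d" by (simp_all add: a_def e_def)
  have two: "(\<Sum>i<2. f i) = f 0 + f 1" for f :: "nat \<Rightarrow> complex" by (simp add: numeral_2_eq_2)
  have "(\<Sum>i<2. \<Sum>j<2. e i * cnj (e j) * p (a i \<otimes> inv (a j))) \<in> \<real>\<^sub>\<ge>\<^sub>0"
    by (rule pos_defD[OF p]) (simp add: a_def x)
  moreover have "x \<otimes> inv x = \<one>" "x \<otimes> inv \<one> = x" "\<one> \<otimes> inv x = inv x" "\<one> \<otimes> inv \<one> = \<one>" using x by simp_all
  ultimately show ?thesis unfolding two v by simp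
qed

lemma pos_def_one: "pos_def p \<Longrightarrow> p \<one> \<in> \<real>\<^sub>\<ge>\<^sub>0"
  using pos_def_two_points[of p \<one> 0 1] by simp

lemma pos_def_inv:
  assumes "pos_def p" "x \<in> carrier X"
  shows "p (inv x) = cnj (p x)"
proof -
  have 0: "Im (p \<one>) = 0" using pos_def_one[OF assms(1)] by (simp add: nonneg_Reals_iff)
  \<comment> \<open>The coefficients 1, 1 relate the imaginary parts; the coefficients
    \<open>\<i>\<close>, 1 below relate the real parts.\<close>
  have "Im (p x) + Im (p (inv x)) = 0"
    using pos_def_two_points[OF assms, of 1 1] 0 by (simp add: nonneg_Reals_iff)
  moreover have "Re (p x) - Re (p (inv x)) = 0"
    using pos_def_two_points[OF assms, of \<i> 1] 0 by (simp add: nonneg_Reals_iff)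
  ultimately show ?thesis by (simp add: complex_eq_iff)
qed

lemma pos_def_norm_le:
  assumes "pos_def p" "x \<in> carrier X"
  shows "norm (p x) \<le> Re (p \<one>)"
proof (cases "p x = 0")
  case True
  then show ?thesis using pos_def_one[OF assms(1)] by (simp add: nonneg_Reals_iff)
next
  case False
  \<comment> \<open>The unit scalar that rotates \<open>p x\<close> to the negative real axis, where
    the two-point form is most restrictive.\<close>
  define s where "s = - cnj (p x) / of_real (norm (p x))"
  have s: "s * cnj s = 1"
    using False complex_norm_square[of "p x"] by (simp add: s_def power2_eq_square mult.commute)
  have sp: "s * p x = - of_real (norm (p x))"
    using False complex_norm_square[of "p x"] by (simp add: s_def power2_eq_square mult.commute[of "cnj _"] divide_eq_eq)
  have "cnj s * p (inv x) = cnj (s * p x)" using pos_def_inv[OF assms] by simp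
  then have sp': "cnj s * p (inv x) = - of_real (norm (p x))" by (simp add: sp)
  have "s * cnj s * p \<one> + s * p x + (cnj s * p (inv x) + p \<one>) \<in> \<real>\<^sub>\<ge>\<^sub>0"
    using pos_def_two_points[OF assms, of s 1] by simp
  then have "p \<one> - of_real (norm (p x)) + (- of_real (norm (p x)) + p \<one>) \<in> \<real>\<^sub>\<ge>\<^sub>0" by (simp add: s sp sp')
  then show ?thesis by (simp add: nonneg_Reals_iff)
qed

lemma pos_def_lim:
  assumes "\<And>n. pos_def (P n)" "\<And>x. x \<in> carrier X \<Longrightarrow> (\<lambda>n. P n x) \<longlonglongrightarrow> p x"
  shows "pos_def p"
  unfolding pos_def_def
proof (intro allI impI)
  fix n and c :: "nat \<Rightarrow> complex" and a :: "nat \<Rightarrow> 'x" assume a: "\<forall>i<n. a i \<in> carrier X"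
  have 1: "(\<lambda>m. \<Sum>i<n. \<Sum>j<n. c i * cnj (c j) * P m (a i \<otimes> inv (a j))) \<longlonglongrightarrow> (\<Sum>i<n. \<Sum>j<n. c i * cnj (c j) * p (a i \<otimes> inv (a j)))"
    using a by (intro tendsto_intros assms(2)) auto
  have 2: "(\<Sum>i<n. \<Sum>j<n. c i * cnj (c j) * P m (a i \<otimes> inv (a j))) \<in> \<real>\<^sub>\<ge>\<^sub>0" for m
    by (rule pos_defD[OF assms(1)]) (simp add: a)
  show "(\<Sum>i<n. \<Sum>j<n. c i * cnj (c j) * p (a i \<otimes> inv (a j))) \<in> \<real>\<^sub>\<ge>\<^sub>0"
    by (rule closed_sequentially[OF closed_nonneg_Reals_complex 2 1])
qed

lemma pos_def_scale:
  assumes "pos_def p" "r \<ge> 0"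
  shows "pos_def (\<lambda>x. of_real r * p x)"
  unfolding pos_def_def
proof (intro allI impI)
  fix n and c :: "nat \<Rightarrow> complex" and a :: "nat \<Rightarrow> 'x" assume a: "\<forall>i<n. a i \<in> carrier X"
  have 1: "(\<Sum>i<n. \<Sum>j<n. c i * cnj (c j) * (of_real r * p (a i \<otimes> inv (a j))))
    = of_real r * (\<Sum>i<n. \<Sum>j<n. c i * cnj (c j) * p (a i \<otimes> inv (a j)))"
    by (simp add: sum_distrib_left mult_ac)
  have 2: "of_real r \<in> (\<real>\<^sub>\<ge>\<^sub>0 :: complex set)" using assms(2) by simp
  show "(\<Sum>i<n. \<Sum>j<n. c i * cnj (c j) * (of_real r * p (a i \<otimes> inv (a j)))) \<in> \<real>\<^sub>\<ge>\<^sub>0"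
    unfolding 1 by (rule nonneg_Reals_mult_I[OF 2 pos_defD[OF assms(1)]]) (simp add: a)
qed

text \<open>At points \<open>a i\<close> with coefficients \<open>d i\<close>, the quadratic form of the perturbed function is that
  of \<open>p\<close> at the doubled list of points \<open>a i\<close> and \<open>a i \<otimes> y\<close> with coefficients \<open>d i\<close> and \<open>d i * c\<close>.\<close>

lemma pos_def_perturb:
  assumes p: "pos_def p" and y: "y \<in> carrier X" and c: "norm c = 1"
  shows "pos_def (\<lambda>x. 2 * p x + c * p (x \<otimes> y) + cnj c * p (x \<otimes> inv y))"
  unfolding pos_def_def
proof (intro allI impI)
  fix n and d :: "nat \<Rightarrow> complex" and a :: "nat \<Rightarrow> 'x" assume a: "\<forall>i<n. a i \<in> carrier X"
  have cc: "c * cnj c = 1" using c by (simp flip: complex_norm_square)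
  define d' where "d' i = d (i div 2) * (if even i then 1 else c)" for i
  define a' where "a' i = a (i div 2) \<otimes> (if even i then \<one> else y)" for i
  have a'c: "a' i \<in> carrier X" if "i < 2 * n" for i using a y that by (auto simp: a'_def)
  have even: "d' (2 * i) = d i" "d' (2 * i + 1) = d i * c" "i < n \<Longrightarrow> a' (2 * i) = a i" "a' (2 * i + 1) = a i \<otimes> y" for i
    using a by (auto simp: d'_def a'_def)
  have "(\<Sum>i<2 * n. \<Sum>j<2 * n. d' i * cnj (d' j) * p (a' i \<otimes> inv (a' j)))
    = (\<Sum>i<n. \<Sum>j<n. d i * cnj (d j) * (2 * p (a i \<otimes> inv (a j)) + c * p (a i \<otimes> inv (a j) \<otimes> y) + cnj c * p (a i \<otimes> inv (a j) \<otimes> inv y)))"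
    unfolding sum_lessThan_double sum.distrib[symmetric]
  proof (intro sum.cong refl)
    fix i j assume "i \<in> {..<n}" "j \<in> {..<n}"
    then have ij: "i < n" "j < n" "a i \<in> carrier X" "a j \<in> carrier X" using a by auto
    have 1: "a i \<otimes> y \<otimes> inv (a j \<otimes> y) = a i \<otimes> inv (a j)"
    proof -
      have "a i \<otimes> y \<otimes> inv (a j \<otimes> y) = (a i \<otimes> inv (a j)) \<otimes> (y \<otimes> inv y)"
        using ij y by (simp only: inv_mult m_ac m_closed inv_closed)
      then show ?thesis using ij y by simp
    qed
    have 2: "a i \<otimes> y \<otimes> inv (a j) = a i \<otimes> inv (a j) \<otimes> y" using ij y by (simp add: m_ac)
    have 3: "a i \<otimes> inv (a j \<otimes> y) = a i \<otimes> inv (a j) \<otimes> inv y" using ij y by (simp add: inv_mult m_ac)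
    have "d i * c * cnj (d j * c) = (d i * cnj (d j)) * (c * cnj c)" by (simp add: mult_ac)
    then have 4: "d i * c * cnj (d j * c) = d i * cnj (d j)" by (simp add: cc)
    show "d' (2 * i) * cnj (d' (2 * j)) * p (a' (2 * i) \<otimes> inv (a' (2 * j))) +
        d' (2 * i) * cnj (d' (2 * j + 1)) * p (a' (2 * i) \<otimes> inv (a' (2 * j + 1))) +
        (d' (2 * i + 1) * cnj (d' (2 * j)) * p (a' (2 * i + 1) \<otimes> inv (a' (2 * j))) +
         d' (2 * i + 1) * cnj (d' (2 * j + 1)) * p (a' (2 * i + 1) \<otimes> inv (a' (2 * j + 1)))) =
        d i * cnj (d j) * (2 * p (a i \<otimes> inv (a j)) + c * p (a i \<otimes> inv (a j) \<otimes> y) + cnj c * p (a i \<otimes> inv (a j) \<otimes> inv y))"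
      unfolding even(3)[OF ij(1)] even(3)[OF ij(2)] even(1,2,4) 1 2 3 4 by (simp add: algebra_simps)
  qed
  then show "(\<Sum>i<n. \<Sum>j<n. d i * cnj (d j) * (2 * p (a i \<otimes> inv (a j)) + c * p (a i \<otimes> inv (a j) \<otimes> y) + cnj c * p (a i \<otimes> inv (a j) \<otimes> inv y))) \<in> \<real>\<^sub>\<ge>\<^sub>0"
    using pos_defD[OF p, of "2 * n" a' d'] a'c by simp
qed

text \<open>A matrix coefficient of the translation representation: the inner product of a translate
  of \<open>g\<close> with \<open>h\<close>.\<close>

definition correlation :: "('x \<Rightarrow> complex) \<Rightarrow> ('x \<Rightarrow> complex) \<Rightarrow> 'x \<Rightarrow> complex" where
  "correlation g h x = mean (\<lambda>y. g (y \<otimes> x) * cnj (h y))"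

lemma cont2_correlation: "cont g \<Longrightarrow> cont h \<Longrightarrow> cont2 (\<lambda>x y. g (y \<otimes> x) * cnj (h y))"
  by (intro cont2_mult cont2_swap[OF cont2_group_mult] cont2_I2 continuous_map_complex_cnj)

lemma cont_correlation: "cont g \<Longrightarrow> cont h \<Longrightarrow> cont (correlation g h)"
  unfolding correlation_def[abs_def] by (rule cont_mean[OF cont2_correlation])

text \<open>After translating the \<open>j\<close>-th variable by \<open>a j\<close>, the quadratic
  form is the squared norm of the combination \<open>h\<close> of translates of
  \<open>g\<close>.\<close>

lemma pos_def_correlation:
  assumes g: "cont g"
  shows "pos_def (correlation g g)"
  unfolding pos_def_def
proof (intro allI impI)
  fix n and c :: "nat \<Rightarrow> complex" and a :: "nat \<Rightarrow> 'x" assume a: "\<forall>i<n. a i \<in> carrier X"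
  define h where "h y = (\<Sum>i<n. c i * g (y \<otimes> a i))" for y
  have ca: "cont (\<lambda>y. g (y \<otimes> a i))" if "i < n" for i using cont_translate[OF g] a that by blast
  have h: "cont h" unfolding h_def using ca by (intro continuous_map_sum continuous_map_complex_mult) auto
  have "(\<Sum>i<n. \<Sum>j<n. c i * cnj (c j) * correlation g g (a i \<otimes> inv (a j)))
    = (\<Sum>i<n. \<Sum>j<n. mean (\<lambda>y. c i * cnj (c j) * (g (y \<otimes> a i) * cnj (g (y \<otimes> a j)))))"
  proof (intro sum.cong refl)
    fix i j assume "i \<in> {..<n}" "j \<in> {..<n}"
    then have ij: "i < n" "j < n" "a i \<in> carrier X" "a j \<in> carrier X" using a by auto
    have cc: "cont (\<lambda>y. g (y \<otimes> (a i \<otimes> inv (a j))) * cnj (g y))"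
      using ij by (intro continuous_map_complex_intros cont_translate g) auto
    have "correlation g g (a i \<otimes> inv (a j)) = mean (\<lambda>y. g ((y \<otimes> a j) \<otimes> (a i \<otimes> inv (a j))) * cnj (g (y \<otimes> a j)))"
      unfolding correlation_def by (rule mean_translate[OF cc ij(4), symmetric])
    also have "\<dots> = mean (\<lambda>y. g (y \<otimes> a i) * cnj (g (y \<otimes> a j)))"
    proof (rule mean_cong)
      fix y assume y: "y \<in> carrier X"
      have "(y \<otimes> a j) \<otimes> (a i \<otimes> inv (a j)) = (y \<otimes> a i) \<otimes> (a j \<otimes> inv (a j))"
        using ij y by (simp only: m_ac m_closed inv_closed)
      then show "g ((y \<otimes> a j) \<otimes> (a i \<otimes> inv (a j))) * cnj (g (y \<otimes> a j)) = g (y \<otimes> a i) * cnj (g (y \<otimes> a j))"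
        using ij y by simp
    qed
    finally show "c i * cnj (c j) * correlation g g (a i \<otimes> inv (a j)) = mean (\<lambda>y. c i * cnj (c j) * (g (y \<otimes> a i) * cnj (g (y \<otimes> a j))))"
      using mean_scale[of "\<lambda>y. g (y \<otimes> a i) * cnj (g (y \<otimes> a j))" "c i * cnj (c j)"] ca[OF ij(1)] ca[OF ij(2)]
      by (simp add: continuous_map_complex_mult continuous_map_complex_cnj)
  qed
  also have "\<dots> = mean (\<lambda>y. \<Sum>i<n. \<Sum>j<n. c i * cnj (c j) * (g (y \<otimes> a i) * cnj (g (y \<otimes> a j))))"
    using ca by (subst mean_sum, simp, force intro!: continuous_map_complex_intros,
      intro sum.cong refl mean_sum[symmetric]) (auto intro!: continuous_map_complex_intros)
  also have "\<dots> = mean (\<lambda>y. h y * cnj (h y))"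
    by (rule mean_cong) (simp add: h_def sum_product mult_ac)
  also have "\<dots> = of_real (sq_norm h)" by (rule mean_mult_cnj[OF h])
  also have "\<dots> \<in> \<real>\<^sub>\<ge>\<^sub>0" using sq_norm_nonneg[OF h] by simp
  finally show "(\<Sum>i<n. \<Sum>j<n. c i * cnj (c j) * correlation g g (a i \<otimes> inv (a j))) \<in> \<real>\<^sub>\<ge>\<^sub>0" .
qed

end

section \<open>Extreme states in the top eigenspace are characters\<close>

context hermitian_kernel
begin

definition eigen :: "('x \<Rightarrow> complex) \<Rightarrow> bool" where
  "eigen f \<longleftrightarrow> cont f \<and> (\<forall>x\<in>carrier X. convol2 f x = of_real top_value * f x)"

lemma eigen_cont: "eigen f \<Longrightarrow> cont f" by (simp add: eigen_def)

lemma eigen_diff_scale: "eigen f \<Longrightarrow> eigen g \<Longrightarrow> eigen (\<lambda>x. f x - c * g x)"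
  unfolding eigen_def by (auto intro!: continuous_map_complex_intros simp: convol2_diff_scale algebra_simps)

lemma eigen_scale: "eigen f \<Longrightarrow> eigen (\<lambda>x. c * f x)"
  using eigen_diff_scale[of f f "1 - c"] by (simp add: algebra_simps)

lemma eigen_translate: "eigen f \<Longrightarrow> a \<in> carrier X \<Longrightarrow> eigen (\<lambda>x. f (x \<otimes> a))"
  unfolding eigen_def by (auto simp: cont_translate convol2_translate)

lemma convol_correlation:
  assumes g: "cont g" and h: "cont h" and x: "x \<in> carrier X"
  shows "convol (correlation g h) x = correlation (convol g) h x"
proof -
  define F where "F z y = k (x \<otimes> inv z) * (g (y \<otimes> z) * cnj (h y))" for z y
  have F: "cont2 F" unfolding F_def by (intro cont2_mult[OF cont2_I1 cont2_correlation] cont_slice x g h)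
  have "convol (correlation g h) x = mean (\<lambda>z. mean (F z))"
    unfolding convol_def
  proof (rule mean_cong)
    fix z assume z: "z \<in> carrier X"
    show "k (x \<otimes> inv z) * correlation g h z = mean (F z)"
      unfolding correlation_def F_def[abs_def]
      by (rule mean_scale[symmetric]) (intro continuous_map_complex_intros cont_translate g h z)
  qed
  also have "\<dots> = mean (\<lambda>y. mean (\<lambda>z. F z y))" by (rule mean_swap[OF F])
  also have "\<dots> = correlation (convol g) h x"
    unfolding correlation_def
  proof (rule mean_cong)
    fix y assume y: "y \<in> carrier X"
    have c: "cont (\<lambda>z. k (x \<otimes> inv z) * g (z \<otimes> y))" by (intro continuous_map_complex_intros cont_slice cont_translate x g y)
    have "mean (\<lambda>z. F z y) = mean (\<lambda>z. cnj (h y) * (k (x \<otimes> inv z) * g (z \<otimes> y)))"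
      by (rule mean_cong) (simp add: F_def m_comm y mult_ac)
    also have "\<dots> = cnj (h y) * convol (\<lambda>z. g (z \<otimes> y)) x"
      unfolding convol_def by (rule mean_scale[OF c])
    also have "convol (\<lambda>z. g (z \<otimes> y)) x = convol g (y \<otimes> x)" using convol_translate[OF g x y] x y by (simp add: m_comm)
    finally show "mean (\<lambda>z. F z y) = convol g (y \<otimes> x) * cnj (h y)" by simp
  qed
  finally show ?thesis .
qed

lemma eigen_correlation:
  assumes g: "eigen g"
  shows "eigen (correlation g g)"
proof -
  have c: "cont g" using g by (rule eigen_cont)
  have "convol2 (correlation g g) x = of_real top_value * correlation g g x" if x: "x \<in> carrier X" for x
  proof -
    have "convol2 (correlation g g) x = convol (correlation (convol g) g) x"
      by (rule convol_cong) (rule convol_correlation[OF c c])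
    also have "\<dots> = correlation (convol2 g) g x" by (rule convol_correlation[OF cont_convol[OF c] c x])
    also have "\<dots> = mean (\<lambda>y. of_real top_value * (g (y \<otimes> x) * cnj (g y)))"
      unfolding correlation_def using g x by (intro mean_cong) (auto simp: eigen_def mult.assoc)
    also have "\<dots> = of_real top_value * correlation g g x"
      unfolding correlation_def by (rule mean_scale) (intro continuous_map_complex_intros cont_translate c x)
    finally show ?thesis .
  qed
  then show ?thesis using cont_correlation[OF c c] by (simp add: eigen_def)
qed

text \<open>Confinement to one eigenspace with positive eigenvalue makes this convex set compact for
  uniform convergence, so a continuous functional attains its maximum on it.\<close>

definition states :: "('x \<Rightarrow> complex) set" where
  "states = {p. eigen p \<and> pos_def p \<and> p \<one> = 1}"

lemma states_nonempty: "states \<noteq> {}"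
proof -
  obtain g where g: "cont g" "\<exists>x\<in>carrier X. g x \<noteq> 0" "\<And>x. x \<in> carrier X \<Longrightarrow> convol2 g x = of_real top_value * g x"
    by (rule top_eigenfunction) blast
  have e: "eigen g" using g by (simp add: eigen_def)
  have pos: "sq_norm g > 0" using g(2) sq_norm_eq_0[OF g(1)] by (meson not_le)
  have one: "correlation g g \<one> = of_real (sq_norm g)"
  proof -
    have "correlation g g \<one> = mean (\<lambda>y. g y * cnj (g y))" unfolding correlation_def by (rule mean_cong) simp
    then show ?thesis by (simp add: mean_mult_cnj[OF g(1)])
  qed
  have "(\<lambda>x. of_real (1 / sq_norm g) * correlation g g x) \<in> states"
    unfolding states_def mem_Collect_eq
    by (intro conjI eigen_scale eigen_correlation e pos_def_scale pos_def_correlation g(1)) (use pos one in auto)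
  then show ?thesis by blast
qed

lemma states_norm_le: "p \<in> states \<Longrightarrow> x \<in> carrier X \<Longrightarrow> norm (p x) \<le> 1"
  using pos_def_norm_le[of p x] by (simp add: states_def)

text \<open>A state equals \<open>convol2\<close> of itself divided by \<open>top_value\<close>;
  bounded states are therefore equicontinuous, and a uniform limit of a maximizing sequence is again
  a state.\<close>

lemma states_maximal:
  obtains p where "p \<in> states" "\<And>q. q \<in> states \<Longrightarrow> sq_norm q \<le> sq_norm p"
proof -
  let ?S = "sq_norm ` states"
  have le1: "sq_norm p \<le> 1" if "p \<in> states" for p
    using sq_norm_le[of p 1] states_norm_le[OF that] that by (simp add: states_def eigen_def)
  have bdd: "bdd_above ?S" using le1 by (auto simp: bdd_above_def)
  have ne: "?S \<noteq> {}" using states_nonempty by simp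
  define m where "m = Sup ?S"
  have "\<exists>p. p \<in> states \<and> m - inverse (real (Suc n)) < sq_norm p" for n
    using less_cSupD[OF ne, of "m - inverse (real (Suc n))"] by (auto simp: m_def)
  then obtain P where P: "\<And>n. P n \<in> states" "\<And>n. m - inverse (real (Suc n)) < sq_norm (P n)" by metis
  have Pe: "eigen (P n)" "pos_def (P n)" "P n \<one> = 1" "cont (P n)" for n using P(1)[of n] by (auto simp: states_def eigen_def)
  have equi: "\<exists>U. openin T U \<and> \<one> \<in> U \<and> (\<forall>n. \<forall>x\<in>carrier X. \<forall>u\<in>U. norm (P n (x \<otimes> u) - P n x) \<le> e)" if e: "e > 0" for e
  proof -
    have "e * top_value > 0" using e top_value_pos by simp
    from convol2_equicontinuous[OF this] obtain U where U: "openin T U" "\<one> \<in> U"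
      "\<And>f x u. cont f \<Longrightarrow> sq_norm f \<le> 1 \<Longrightarrow> x \<in> carrier X \<Longrightarrow> u \<in> U \<Longrightarrow> norm (convol2 f (x \<otimes> u) - convol2 f x) \<le> e * top_value"
      by blast
    have Uc: "U \<subseteq> carrier X" using openin_subset[OF U(1)] by (simp add: topspace_eq)
    have "norm (P n (x \<otimes> u) - P n x) \<le> e" if x: "x \<in> carrier X" and u: "u \<in> U" for n x u
    proof -
      have "convol2 (P n) (x \<otimes> u) - convol2 (P n) x = of_real top_value * (P n (x \<otimes> u) - P n x)"
        using Pe(1)[of n] x u Uc by (auto simp: eigen_def algebra_simps)
      then have "top_value * norm (P n (x \<otimes> u) - P n x) \<le> e * top_value"
        using U(3)[OF Pe(4) le1[OF P(1)] x u, of n] top_value_pos by (simp add: norm_mult)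
      then show ?thesis using top_value_pos by (simp add: mult.commute)
    qed
    then show ?thesis using U by blast
  qed
  obtain r p where r: "strict_mono (r :: nat \<Rightarrow> nat)" and p: "cont p"
    and lim: "\<And>e. e > 0 \<Longrightarrow> \<exists>N. \<forall>n\<ge>N. \<forall>x\<in>carrier X. norm (P (r n) x - p x) \<le> e"
    by (rule equicontinuous_subsequence[OF states_norm_le[OF P(1)] equi]) blast+
  have pl: "(\<lambda>n. P (r n) x) \<longlonglongrightarrow> p x" if x: "x \<in> carrier X" for x
    unfolding LIMSEQ_def dist_norm
  proof (intro allI impI)
    fix e :: real assume e: "e > 0"
    then have "e / 2 > 0" by simp
    from lim[OF this] obtain N where N: "\<And>n x. n \<ge> N \<Longrightarrow> x \<in> carrier X \<Longrightarrow> norm (P (r n) x - p x) \<le> e / 2" by blast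
    have "norm (P (r n) x - p x) < e" if "n \<ge> N" for n using N[OF that x] e by linarith
    then show "\<exists>N. \<forall>n\<ge>N. norm (P (r n) x - p x) < e" by blast
  qed
  have pd: "pos_def p" by (rule pos_def_lim[OF Pe(2) pl])
  have one: "p \<one> = 1" using LIMSEQ_unique[OF pl[OF one_closed]] Pe(3) by simp
  have sm: "sq_norm (\<lambda>x. P (r n) x - 1 * p x) \<le> e\<^sup>2" if "\<And>x. x \<in> carrier X \<Longrightarrow> norm (P (r n) x - p x) \<le> e" for n e
    using that by (intro sq_norm_le continuous_map_complex_intros Pe(4) p) simp
  have "convol2 p x = of_real top_value * p x" if x: "x \<in> carrier X" for x
  proof -
    define M where "M = sq_norm k * top_value"
    have M: "M > 0" using sq_norm_k_pos top_value_pos by (simp add: M_def)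
    have "(\<lambda>n. convol2 (P (r n)) x) \<longlonglongrightarrow> convol2 p x"
      unfolding LIMSEQ_def dist_norm
    proof (intro allI impI)
      fix e :: real assume e: "e > 0"
      define d where "d = e / (2 * sqrt M)"
      have d: "d > 0" using e M by (simp add: d_def)
      obtain N where N: "\<And>n x. n \<ge> N \<Longrightarrow> x \<in> carrier X \<Longrightarrow> norm (P (r n) x - p x) \<le> d" using lim[OF d] by blast
      have "norm (convol2 (P (r n)) x - convol2 p x) < e" if n: "n \<ge> N" for n
      proof -
        have c: "cont (\<lambda>x. P (r n) x - 1 * p x)" by (intro continuous_map_complex_intros Pe(4) p)
        have "(norm (convol2 (P (r n)) x - convol2 p x))\<^sup>2 \<le> M * sq_norm (\<lambda>x. P (r n) x - 1 * p x)"
          using convol2_bound[OF c x] convol2_diff_scale[OF Pe(4) p x, of "r n" 1] by (simp add: M_def)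
        also have "\<dots> \<le> M * d\<^sup>2" using sm[OF N[OF n]] M by (intro mult_left_mono) auto
        also have "\<dots> = (e / 2)\<^sup>2" using M by (simp add: d_def power_divide power_mult_distrib)
        finally have "norm (convol2 (P (r n)) x - convol2 p x) \<le> e / 2" by (rule power2_le_imp_le) (use e in simp)
        then show ?thesis using e by linarith
      qed
      then show "\<exists>N. \<forall>n\<ge>N. norm (convol2 (P (r n)) x - convol2 p x) < e" by blast
    qed
    moreover have "(\<lambda>n. convol2 (P (r n)) x) = (\<lambda>n. of_real top_value * P (r n) x)"
      using Pe(1) x by (auto simp: eigen_def)
    moreover have "(\<lambda>n. of_real top_value * P (r n) x) \<longlonglongrightarrow> of_real top_value * p x"
      by (intro tendsto_intros pl x)
    ultimately show ?thesis using LIMSEQ_unique by metis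
  qed
  then have ps: "p \<in> states" using p pd one by (simp add: states_def eigen_def)
  have "m \<le> sq_norm p"
  proof (rule field_le_epsilon)
    fix e :: real assume e: "e > 0"
    \<comment> \<open>Squared norms of states at uniform distance \<open>d\<close> differ by at most
      \<open>2 * d\<close>, half of \<open>e\<close>; the other half pays for
      near-maximality.\<close>
    define d where "d = e / 4"
    have d: "d > 0" using e by (simp add: d_def)
    obtain N where N: "\<And>n x. n \<ge> N \<Longrightarrow> x \<in> carrier X \<Longrightarrow> norm (P (r n) x - p x) \<le> d" using lim[OF d] by blast
    obtain j where j: "inverse (real (Suc j)) < e / 2" using reals_Archimedean[of "e / 2"] e by auto
    define n where "n = max N j"
    have "inverse (real (Suc (r n))) \<le> inverse (real (Suc j))"
      using seq_suble[OF r, of n] by (intro le_imp_inverse_le) (auto simp: n_def)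
    then have 1: "m - e / 2 < sq_norm (P (r n))" using P(2)[of "r n"] j by linarith
    have "sq_norm (P (r n)) \<le> sq_norm p + 2 * d"
    proof -
      have "sq_norm (P (r n)) - sq_norm p = Re (mean (\<lambda>x. P (r n) x * cnj (P (r n) x) - p x * cnj (p x)))"
        unfolding sq_norm_def by (subst mean_diff) (intro continuous_map_complex_intros Pe(4) p | simp)+
      also have "\<dots> \<le> 2 * d"
      proof (intro Re_mean_le continuous_map_complex_intros Pe(4) p)
        fix x assume x: "x \<in> carrier X"
        have n': "norm (P (r n) x) \<le> 1" "norm (p x) \<le> 1" "norm (P (r n) x - p x) \<le> d"
          using states_norm_le[OF P(1) x] states_norm_le[OF ps x] N[OF _ x, of n] by (auto simp: n_def)
        have "norm (P (r n) x) \<le> norm (p x) + d" using n'(3) norm_triangle_ineq2[of "P (r n) x" "p x"] by linarith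
        then have "(norm (P (r n) x))\<^sup>2 - (norm (p x))\<^sup>2 \<le> 2 * d"
        proof -
          have "(norm (P (r n) x))\<^sup>2 - (norm (p x))\<^sup>2 = (norm (P (r n) x) - norm (p x)) * (norm (P (r n) x) + norm (p x))"
            by (simp add: power2_eq_square algebra_simps)
          also have "\<dots> \<le> d * (norm (P (r n) x) + norm (p x))"
            using \<open>norm (P (r n) x) \<le> norm (p x) + d\<close> by (intro mult_right_mono) auto
          also have "\<dots> \<le> d * 2" using n' d by (intro mult_left_mono) auto
          finally show ?thesis by simp
        qed
        then show "Re (P (r n) x * cnj (P (r n) x) - p x * cnj (p x)) \<le> 2 * d"
          unfolding complex_norm_square[symmetric] by simp
      qed
      finally show ?thesis by simp
    qed
    then show "m \<le> sq_norm p + e" using 1 by (simp add: d_def)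
  qed
  then have "sq_norm q \<le> sq_norm p" if "q \<in> states" for q
    using cSup_upper[OF _ bdd, of "sq_norm q"] that unfolding m_def by force
  then show ?thesis using that ps by blast
qed

text \<open>A maximizer of a strictly convex functional is an extreme point, and the perturbations
  of \<open>pos_def_perturb\<close> with \<open>c\<close> and \<open>- c\<close> write \<open>4 p\<close> as a sum, so both are multiples of \<open>p\<close>.\<close>

lemma maximal_state_perturb:
  assumes p: "p \<in> states" and max: "\<And>q. q \<in> states \<Longrightarrow> sq_norm q \<le> sq_norm p"
    and y: "y \<in> carrier X" and c: "norm c = 1" and x: "x \<in> carrier X"
  shows "c * p (x \<otimes> y) + cnj c * p (x \<otimes> inv y) = 2 * of_real (Re (c * p y)) * p x"
proof -
  define P where "P c x = 2 * p x + c * p (x \<otimes> y) + cnj c * p (x \<otimes> inv y)" for c x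
  have pe: "eigen p" "pos_def p" "p \<one> = 1" "cont p" using p by (auto simp: states_def eigen_def)
  define s where "s = 2 + 2 * Re (c * p y)"
  have P1: "P b \<one> = of_real (2 + 2 * Re (b * p y))" for b
  proof -
    have 1: "cnj b * p (inv y) = cnj (b * p y)" using pos_def_inv[OF pe(2) y] by simp
    have "b * p y + cnj b * p (inv y) = of_real (2 * Re (b * p y))" unfolding 1 by (rule complex_add_cnj)
    moreover have "P b \<one> = 2 + (b * p y + cnj b * p (inv y))" using y pe(3) by (simp add: P_def)
    ultimately show ?thesis by (simp only: of_real_add of_real_numeral)
  qed
  have Ps: "P c \<one> = of_real s" "P (- c) \<one> = of_real (4 - s)" by (simp_all add: P1 s_def)
  have Ppd: "pos_def (P b)" if "norm b = 1" for b unfolding P_def by (rule pos_def_perturb[OF pe(2) y that])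
  have Pe: "eigen (P b)" for b
  proof -
    have "eigen (\<lambda>x. 2 * p x - (- b) * p (x \<otimes> y) - (- cnj b) * p (x \<otimes> inv y))"
      using y by (intro eigen_diff_scale eigen_scale eigen_translate pe(1)) auto
    then show ?thesis by (simp add: P_def[abs_def])
  qed
  have s: "0 \<le> s" "s \<le> 4"
    using pos_def_one[OF Ppd[OF c]] pos_def_one[OF Ppd[of "- c"]] c by (auto simp: Ps nonneg_Reals_iff)
  have sum: "P c x + P (- c) x = 4 * p x" for x by (simp add: P_def)
  have "P c x = of_real s * p x"
  proof -
    \<comment> \<open>A perturbation whose value at \<open>\<one>\<close> is 0 vanishes identically
      by \<open>pos_def_norm_le\<close>; if neither does, both can be normalized to states.\<close>
    consider "s = 0" | "s = 4" | "0 < s" "s < 4" using s by linarith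
    then show ?thesis
    proof cases
      case 1
      then have "norm (P c x) \<le> 0" using pos_def_norm_le[OF Ppd[OF c] x] by (simp add: Ps)
      then show ?thesis using 1 by simp
    next
      case 2
      then have "norm (P (- c) x) \<le> 0" using pos_def_norm_le[OF Ppd[of "- c"] x] c by (simp add: Ps)
      then show ?thesis using 2 sum[of x] by simp
    next
      case 3
      define q where "q x = of_real (1 / s) * P c x" for x
      define r where "r x = of_real (1 / (4 - s)) * P (- c) x" for x
      have "complex_of_real s \<noteq> 4" using 3 of_real_eq_iff[of s 4] by fastforce
      then have qr: "q \<in> states" "r \<in> states"
        unfolding states_def q_def[abs_def] r_def[abs_def] mem_Collect_eq Ps
        by (intro conjI eigen_scale Pe pos_def_scale Ppd; use 3 c in simp)+
      define D where "D x = q x - 1 * r x" for x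
      have cq: "cont q" "cont r" using qr by (auto simp: states_def eigen_def)
      have D: "cont D" unfolding D_def by (intro continuous_map_complex_intros cq)
      define t where "t = s / 4"
      have t: "0 < t" "t < 1" using 3 by (auto simp: t_def)
      have comb: "p x = of_real t * q x + of_real (1 - t) * r x" for x
      proof -
        have "of_real t * q x = (1 / 4) * P c x" using 3 by (simp add: q_def t_def)
        moreover have "of_real (1 - t) * r x = (1 / 4) * P (- c) x"
          using 3 by (simp add: r_def t_def field_simps flip: of_real_diff)
        ultimately have "of_real t * q x + of_real (1 - t) * r x = (1 / 4) * (P c x + P (- c) x)"
          by (simp only: distrib_left)
        then show ?thesis by (simp add: sum)
      qed
      have q_eq: "q x = p x - of_real (t - 1) * D x" and r_eq: "r x = p x - of_real t * D x" for x
        unfolding comb[of x] D_def by (simp_all add: algebra_simps)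
      define m where "m = Re (mean (\<lambda>x. p x * cnj (D x)))"
      have Nq: "sq_norm q = sq_norm p - 2 * ((t - 1) * m) + (t - 1)\<^sup>2 * sq_norm D"
        using sq_norm_diff_scale[OF pe(4) D, of "of_real (t - 1)"] unfolding q_eq[symmetric] m_def by (simp add: norm_of_real flip: of_real_diff)
      have Nr: "sq_norm r = sq_norm p - 2 * (t * m) + t\<^sup>2 * sq_norm D"
        using sq_norm_diff_scale[OF pe(4) D, of "of_real t"] unfolding r_eq[symmetric] m_def by simp
      \<comment> \<open>Maximality of \<open>p\<close> against \<open>q\<close> and against
        \<open>r\<close> gives two inequalities in \<open>m\<close>; in their sum \<open>m\<close>
        cancels and \<open>sq_norm D \<le> 0\<close> remains.\<close>
      have "(1 - t) * (2 * m + (1 - t) * sq_norm D) \<le> 0"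
        using max[OF qr(1)] unfolding Nq by (simp add: power2_eq_square algebra_simps)
      then have 1: "2 * m + (1 - t) * sq_norm D \<le> 0" using t by (simp add: mult_le_0_iff)
      have "t * (- 2 * m + t * sq_norm D) \<le> 0"
        using max[OF qr(2)] unfolding Nr by (simp add: power2_eq_square algebra_simps)
      then have 2: "- 2 * m + t * sq_norm D \<le> 0" using t by (simp add: mult_le_0_iff)
      have "sq_norm D \<le> 0" using 1 2 by (simp add: algebra_simps)
      then have "D x = 0" using sq_norm_eq_0[OF D _ x] by blast
      then have "q x = p x" by (simp add: q_eq)
      then show ?thesis using 3 by (simp add: q_def field_simps)
    qed
  qed
  then show ?thesis by (simp add: P_def s_def algebra_simps)
qed

text \<open>The perturbation identity for \<open>c = 1\<close> and for \<open>c = \<i>\<close> gives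
  the sum and the difference of \<open>p (x \<otimes> y)\<close> and
  \<open>p (x \<otimes> inv y)\<close>; together they say that \<open>p\<close> is multiplicative.
  If the Fourier coefficient of \<open>k\<close> at \<open>p\<close> vanished, convolution would
  kill \<open>p\<close>, against its positive eigenvalue.\<close>

theorem character_exists:
  obtains \<xi> where "cont \<xi>" "\<And>x y. x \<in> carrier X \<Longrightarrow> y \<in> carrier X \<Longrightarrow> \<xi> (x \<otimes> y) = \<xi> x * \<xi> y"
    "\<And>x. x \<in> carrier X \<Longrightarrow> norm (\<xi> x) = 1" "mean (\<lambda>x. k x * cnj (\<xi> x)) \<noteq> 0"
proof -
  obtain p where p: "p \<in> states" "\<And>q. q \<in> states \<Longrightarrow> sq_norm q \<le> sq_norm p" by (rule states_maximal) blast
  have pe: "eigen p" "pos_def p" "p \<one> = 1" "cont p" using p(1) by (auto simp: states_def eigen_def)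
  have mult: "p (x \<otimes> y) = p x * p y" if x: "x \<in> carrier X" and y: "y \<in> carrier X" for x y
  proof -
    have 1: "p (x \<otimes> y) + p (x \<otimes> inv y) = 2 * of_real (Re (p y)) * p x"
      using maximal_state_perturb[OF p y _ x, of 1] by simp
    have "\<i> * (p (x \<otimes> y) - p (x \<otimes> inv y)) = \<i> * (2 * (\<i> * of_real (Im (p y))) * p x)"
      using maximal_state_perturb[OF p y _ x, of \<i>] by (simp add: algebra_simps)
    then have 2: "p (x \<otimes> y) - p (x \<otimes> inv y) = 2 * (\<i> * of_real (Im (p y))) * p x" by simp
    have "2 * p (x \<otimes> y) = (p (x \<otimes> y) + p (x \<otimes> inv y)) + (p (x \<otimes> y) - p (x \<otimes> inv y))" by simp
    also have "\<dots> = 2 * ((of_real (Re (p y)) + \<i> * of_real (Im (p y))) * p x)"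
      unfolding 1 2 by (simp add: algebra_simps)
    also have "of_real (Re (p y)) + \<i> * of_real (Im (p y)) = p y" by (rule complex_eq[symmetric])
    finally show ?thesis by simp
  qed
  have unit: "norm (p x) = 1" if x: "x \<in> carrier X" for x
  proof -
    have "p x * cnj (p x) = 1" using mult[of x "inv x"] pos_def_inv[OF pe(2) x] x pe(3) by simp
    then have "complex_of_real ((norm (p x))\<^sup>2) = of_real 1" by (simp only: complex_norm_square of_real_1)
    then have "(norm (p x))\<^sup>2 = 1" by (simp only: of_real_eq_iff)
    then show ?thesis using norm_ge_zero[of "p x"] by (simp add: power2_eq_1_iff)
  qed
  have "mean (\<lambda>x. k x * cnj (p x)) \<noteq> 0"
  proof
    assume 0: "mean (\<lambda>x. k x * cnj (p x)) = 0"
    define h where "h z = k z * cnj (p z)" for z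
    have h: "cont h" unfolding h_def by (intro continuous_map_complex_intros cont_k pe(4))
    have "convol p x = 0" if x: "x \<in> carrier X" for x
    proof -
      have "convol p x = mean (\<lambda>y. p x * h (x \<otimes> inv y))"
        unfolding convol_def
      proof (rule mean_cong)
        fix y assume y: "y \<in> carrier X"
        have "p x * cnj (p (x \<otimes> inv y)) = p x * p (inv x \<otimes> y)"
          using pos_def_inv[OF pe(2), of "x \<otimes> inv y"] x y by (simp add: inv_mult)
        also have "\<dots> = p y" using mult[of x "inv x \<otimes> y"] x y by (simp flip: m_assoc)
        finally show "k (x \<otimes> inv y) * p y = p x * h (x \<otimes> inv y)" by (simp add: h_def mult_ac)
      qed
      also have "\<dots> = p x * mean (\<lambda>y. h (x \<otimes> inv y))"
        using x by (intro mean_scale cont2_slice(1)[OF cont2_group_div[OF h]])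
      also have "mean (\<lambda>y. h (x \<otimes> inv y)) = mean h" by (rule mean_slice[OF h x])
      also have "mean h = 0" using 0 by (simp add: h_def[abs_def])
      finally show ?thesis by simp
    qed
    then have "convol2 p \<one> = convol (\<lambda>x. 0) \<one>" by (rule convol_cong)
    also have "\<dots> = 0" by (simp add: convol_def mean_const)
    finally show False using pe(1,3) top_value_pos by (simp add: eigen_def)
  qed
  then show ?thesis using that pe(4) mult unit by blast
qed

end

subsection \<open>Pontryagin duality\<close>

context compact_metrizable_abelian_group
begin

abbreviation dual :: "('x \<Rightarrow> complex) set" where
  "dual \<equiv> carrier (pontryagin_dual X T)"

lemma dual_iff:
  "\<xi> \<in> dual \<longleftrightarrow> \<xi> \<in> extensional (carrier X) \<and> (\<forall>x\<in>carrier X. norm (\<xi> x) = 1)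
    \<and> (\<forall>x\<in>carrier X. \<forall>y\<in>carrier X. \<xi> (x \<otimes> y) = \<xi> x * \<xi> y) \<and> cont \<xi>"
  by (auto simp: pontryagin_dual_def circle_group_def hom_def Pi_iff)

lemma dualD:
  assumes "\<xi> \<in> dual"
  shows "\<xi> \<in> extensional (carrier X)" "cont \<xi>" "x \<in> carrier X \<Longrightarrow> norm (\<xi> x) = 1"
    "x \<in> carrier X \<Longrightarrow> y \<in> carrier X \<Longrightarrow> \<xi> (x \<otimes> y) = \<xi> x * \<xi> y"
  using assms by (simp_all add: dual_iff)

lemma dual_nonzero: "\<xi> \<in> dual \<Longrightarrow> x \<in> carrier X \<Longrightarrow> \<xi> x \<noteq> 0"
  using dualD(3)[of \<xi> x] by auto

lemma dual_one: "\<xi> \<in> dual \<Longrightarrow> \<xi> \<one> = 1"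
  using dualD(4)[of \<xi> \<one> \<one>] dual_nonzero[of \<xi> \<one>] by simp

lemma dual_inv:
  assumes "\<xi> \<in> dual" "x \<in> carrier X"
  shows "\<xi> (inv x) = inverse (\<xi> x)"
proof -
  have "\<xi> x * \<xi> (inv x) = 1" using dualD(4)[OF assms(1,2), of "inv x"] dual_one[OF assms(1)] assms(2) by simp
  then show ?thesis by (metis inverse_unique)
qed

lemma cont_restrict: "cont f \<Longrightarrow> cont (restrict f (carrier X))"
  by (erule continuous_map_eq) (simp add: topspace_eq)

lemma dual_restrictI:
  assumes "cont f" "\<And>x. x \<in> carrier X \<Longrightarrow> norm (f x) = 1"
    "\<And>x y. x \<in> carrier X \<Longrightarrow> y \<in> carrier X \<Longrightarrow> f (x \<otimes> y) = f x * f y"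
  shows "restrict f (carrier X) \<in> dual"
  using assms by (simp add: dual_iff cont_restrict)

lemma dual_mult_closed: "\<xi> \<in> dual \<Longrightarrow> \<eta> \<in> dual \<Longrightarrow> (\<lambda>x\<in>carrier X. \<xi> x * \<eta> x) \<in> dual"
  by (rule dual_restrictI) (simp_all add: dualD norm_mult continuous_map_complex_mult)

lemma dual_cnj_closed: "\<xi> \<in> dual \<Longrightarrow> (\<lambda>x\<in>carrier X. cnj (\<xi> x)) \<in> dual"
  by (rule dual_restrictI) (simp_all add: dualD continuous_map_complex_cnj)

lemma mean_translate_character:
  assumes g: "cont g" and \<xi>: "\<xi> \<in> dual" and b: "b \<in> carrier X"
  shows "mean (\<lambda>x. g (x \<otimes> b) * cnj (\<xi> x)) = \<xi> b * mean (\<lambda>x. g x * cnj (\<xi> x))"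
proof -
  have c: "cont (\<lambda>x. g x * cnj (\<xi> x))" by (intro continuous_map_complex_intros g dualD(2)[OF \<xi>])
  have "mean (\<lambda>x. g (x \<otimes> b) * cnj (\<xi> x)) = mean (\<lambda>x. \<xi> b * (g (x \<otimes> b) * cnj (\<xi> (x \<otimes> b))))"
  proof (rule mean_cong)
    fix x assume x: "x \<in> carrier X"
    have "\<xi> b * cnj (\<xi> b) = 1"
      using complex_norm_square[of "\<xi> b"] dualD(3)[OF \<xi> b] by simp
    moreover have "\<xi> b * (g (x \<otimes> b) * cnj (\<xi> (x \<otimes> b))) = (\<xi> b * cnj (\<xi> b)) * (g (x \<otimes> b) * cnj (\<xi> x))"
      by (simp add: dualD(4)[OF \<xi> x b] mult_ac)
    ultimately show "g (x \<otimes> b) * cnj (\<xi> x) = \<xi> b * (g (x \<otimes> b) * cnj (\<xi> (x \<otimes> b)))" by (simp only: mult_1)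
  qed
  also have "\<dots> = \<xi> b * mean (\<lambda>x. g (x \<otimes> b) * cnj (\<xi> (x \<otimes> b)))"
    using cont_translate[OF c b] by (rule mean_scale)
  also have "mean (\<lambda>x. g (x \<otimes> b) * cnj (\<xi> (x \<otimes> b))) = mean (\<lambda>x. g x * cnj (\<xi> x))"
    by (rule mean_translate[OF c b])
  finally show ?thesis .
qed

text \<open>The supremum over each coset of \<open>P\<close> of a Urysohn function that is 0 on the
  closure of \<open>P\<close> and 1 at \<open>x0\<close>. It is continuous because all translates of
  the Urysohn function share one modulus of continuity.\<close>

lemma invariant_separating_function:
  assumes P: "subgroup P X" and x0: "x0 \<in> carrier X" "x0 \<notin> T closure_of P"
  obtains f :: "'x \<Rightarrow> real" where "cont (\<lambda>x. of_real (f x))" "\<And>x. x \<in> carrier X \<Longrightarrow> 0 \<le> f x"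
    "\<And>x h. x \<in> carrier X \<Longrightarrow> h \<in> P \<Longrightarrow> f (x \<otimes> h) = f x" "f \<one> = 0" "f x0 > 0"
proof -
  have Pc: "P \<subseteq> carrier X" and P1: "\<one> \<in> P" using P by (auto simp: subgroup_def)
  have Pm: "h \<otimes> h' \<in> P" "inv h \<in> P" if "h \<in> P" "h' \<in> P" for h h'
    using that P by (auto simp: subgroup_def)
  have "closedin T {x0}"
    using closedin_Hausdorff_singleton[OF metrizable_imp_Hausdorff_space[OF metrizable]] x0 by (simp add: topspace_eq)
  moreover have "disjnt (T closure_of P) {x0}" using x0 by (simp add: disjnt_def)
  ultimately obtain g where g: "continuous_map T (top_of_set {0..1::real}) g" "g ` (T closure_of P) \<subseteq> {0}" "g ` {x0} \<subseteq> {1}"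
    by (rule Urysohn_lemma[OF metrizable_imp_normal_space[OF metrizable] closedin_closure_of _ _ zero_le_one])
  have g01: "0 \<le> g x" "g x \<le> 1" if "x \<in> carrier X" for x
    using continuous_map_image_subset_topspace[OF g(1)] that by (auto simp: topspace_eq)
  have gP: "g h = 0" if "h \<in> P" for h
    using g(2) closure_of_subset[of P T] Pc that by (auto simp: topspace_eq)
  have "continuous_map T euclidean g" using g(1) by (simp add: continuous_map_in_subtopology)
  then have cg: "cont (\<lambda>x. of_real (g x))" by (rule continuous_map_complex_of_real)
  define f where "f x = (SUP h\<in>P. g (x \<otimes> h))" for x
  have bdd: "bdd_above ((\<lambda>h. g (x \<otimes> h)) ` P)" if "x \<in> carrier X" for x
    using g01 that Pc by (intro bdd_aboveI2[of _ _ 1]) blast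
  have upper: "g (x \<otimes> h) \<le> f x" if "x \<in> carrier X" "h \<in> P" for x h
    unfolding f_def by (rule cSUP_upper[OF that(2) bdd[OF that(1)]])
  have least: "f x \<le> M" if "\<And>h. h \<in> P \<Longrightarrow> g (x \<otimes> h) \<le> M" for x M
    unfolding f_def using P1 that by (intro cSUP_least) auto
  have contf: "cont (\<lambda>x. of_real (f x))"
  proof (rule cont_if_uniform)
    fix e :: real assume e: "e > 0"
    then have e2: "e / 2 > 0" by simp
    obtain U where U: "openin T U" "\<one> \<in> U"
      and UU: "\<And>x u. x \<in> carrier X \<Longrightarrow> u \<in> U \<Longrightarrow> norm (complex_of_real (g (x \<otimes> u)) - of_real (g x)) < e / 2"
      by (rule uniform_continuity[OF cg e2]) blast
    have Uc: "U \<subseteq> carrier X" using openin_subset[OF U(1)] by (simp add: topspace_eq)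
    have near: "\<bar>g (x \<otimes> u) - g x\<bar> < e / 2" if "x \<in> carrier X" "u \<in> U" for x u
      using UU[OF that] by (simp flip: of_real_diff)
    have "norm (complex_of_real (f (x \<otimes> u)) - of_real (f x)) < e" if x: "x \<in> carrier X" and u: "u \<in> U" for x u
    proof -
      have uc: "u \<in> carrier X" using u Uc by blast
      have xh: "x \<otimes> h \<otimes> u = x \<otimes> u \<otimes> h" "x \<otimes> h \<in> carrier X" if "h \<in> P" for h
        using that Pc x uc by (auto simp: m_ac)
      have "f (x \<otimes> u) \<le> f x + e / 2"
      proof (rule least)
        fix h assume h: "h \<in> P"
        show "g (x \<otimes> u \<otimes> h) \<le> f x + e / 2"
          using near[OF xh(2)[OF h] u] upper[OF x h] unfolding xh(1)[OF h] by linarith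
      qed
      moreover have "f x \<le> f (x \<otimes> u) + e / 2"
      proof (rule least)
        fix h assume h: "h \<in> P"
        show "g (x \<otimes> h) \<le> f (x \<otimes> u) + e / 2"
          using near[OF xh(2)[OF h] u] upper[OF m_closed[OF x uc] h] unfolding xh(1)[OF h] by linarith
      qed
      ultimately have "\<bar>f (x \<otimes> u) - f x\<bar> < e" using e by linarith
      then show ?thesis by (simp flip: of_real_diff)
    qed
    then show "\<exists>U. openin T U \<and> \<one> \<in> U \<and> (\<forall>x\<in>carrier X. \<forall>u\<in>U. norm (complex_of_real (f (x \<otimes> u)) - of_real (f x)) < e)"
      using U by blast
  qed
  have mono: "f (x \<otimes> h) \<le> f x" if x: "x \<in> carrier X" and h: "h \<in> P" for x h
  proof (rule least)
    fix h' assume h': "h' \<in> P"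
    have "x \<otimes> h \<otimes> h' = x \<otimes> (h \<otimes> h')" using x h h' Pc by (intro m_assoc) auto
    then show "g (x \<otimes> h \<otimes> h') \<le> f x" using upper[OF x Pm(1)[OF h h']] by simp
  qed
  have inv: "f (x \<otimes> h) = f x" if x: "x \<in> carrier X" and h: "h \<in> P" for x h
  proof -
    have hc: "h \<in> carrier X" using h Pc by blast
    have "f (x \<otimes> h \<otimes> inv h) \<le> f (x \<otimes> h)" using mono[of "x \<otimes> h" "inv h"] Pm(2)[OF h h] x hc by simp
    moreover have "x \<otimes> h \<otimes> inv h = x" using x hc by (simp add: m_assoc)
    ultimately show ?thesis using mono[OF x h] by simp
  qed
  have nonneg: "0 \<le> f x" if x: "x \<in> carrier X" for x
    using upper[OF x P1] g01(1)[OF x] x by simp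
  have "f \<one> \<le> 0" using gP Pc by (intro least) auto
  then have "f \<one> = 0" using nonneg[of \<one>] by simp
  moreover have "f x0 > 0" using upper[OF x0(1) P1] g(3) x0(1) by simp
  ultimately show ?thesis using that contf nonneg inv by blast
qed

text \<open>The coefficient of \<open>k\<close> at \<open>\<xi>\<close> is
  \<open>2 - \<xi> x0 - inverse (\<xi> x0)\<close> times that of \<open>g\<close>. Where it is
  nonzero, the first factor gives \<open>\<xi> x0 \<noteq> 1\<close>, and the second, with the
  invariance of \<open>g\<close> under \<open>P\<close>, forces \<open>\<xi>\<close> to be 1 on
  \<open>P\<close>.\<close>

theorem subgroup_annihilator:
  assumes P: "subgroup P X" and x0: "x0 \<in> carrier X" "x0 \<notin> T closure_of P"
  obtains \<xi> where "\<xi> \<in> dual" "\<And>h. h \<in> P \<Longrightarrow> \<xi> h = 1" "\<xi> x0 \<noteq> 1"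
proof -
  have Pc: "P \<subseteq> carrier X" using P by (auto simp: subgroup_def)
  obtain f :: "'x \<Rightarrow> real" where f: "cont (\<lambda>x. of_real (f x))" "\<And>x. x \<in> carrier X \<Longrightarrow> 0 \<le> f x"
    "\<And>x h. x \<in> carrier X \<Longrightarrow> h \<in> P \<Longrightarrow> f (x \<otimes> h) = f x" "f \<one> = 0" "f x0 > 0"
    by (rule invariant_separating_function[OF assms]) blast
  \<comment> \<open>Symmetrized under inversion, so that the real kernel built from it is
    Hermitian.\<close>
  define s where "s x = f x + f (inv x)" for x
  define g where "g x = complex_of_real (s x)" for x
  have g: "cont g" unfolding g_def s_def of_real_add by (intro continuous_map_complex_intros f(1) cont_inv[OF f(1)])
  have s_inv: "s (inv x) = s x" if "x \<in> carrier X" for x using that by (simp add: s_def)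
  have gP: "g (x \<otimes> h) = g x" if "x \<in> carrier X" "h \<in> P" for x h
    using that f(3)[OF that] f(3)[of "inv x" "inv h"] P Pc by (auto simp: g_def s_def inv_mult subgroup_def)
  define k where "k x = 2 * g x - (g (x \<otimes> x0) + g (x \<otimes> inv x0))" for x
  interpret k: hermitian_kernel X T k
  proof unfold_locales
    show "cont k" unfolding k_def using x0 by (intro continuous_map_complex_intros cont_translate g) auto
    show "k (inv x) = cnj (k x)" if x: "x \<in> carrier X" for x
    proof -
      have "s (inv x \<otimes> x0) = s (x \<otimes> inv x0)" "s (inv x \<otimes> inv x0) = s (x \<otimes> x0)"
        using s_inv[of "x \<otimes> inv x0"] s_inv[of "x \<otimes> x0"] x x0 by (simp_all add: inv_mult)
      then show ?thesis using s_inv[OF x] by (simp add: k_def g_def)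
    qed
    have "s \<one> = 0" "s x0 > 0" using f(2)[of "inv x0"] f(4,5) x0(1) by (simp_all add: s_def add_pos_nonneg)
    \<comment> \<open>The value is \<open>- 2 * s x0\<close>.\<close>
    then have "k \<one> \<noteq> 0" using x0(1) s_inv[OF x0(1)] by (simp add: k_def g_def)
    then show "\<exists>x\<in>carrier X. k x \<noteq> 0" by blast
  qed
  obtain \<xi>0 where \<xi>0: "cont \<xi>0" "\<And>x y. x \<in> carrier X \<Longrightarrow> y \<in> carrier X \<Longrightarrow> \<xi>0 (x \<otimes> y) = \<xi>0 x * \<xi>0 y"
    "\<And>x. x \<in> carrier X \<Longrightarrow> norm (\<xi>0 x) = 1" "mean (\<lambda>x. k x * cnj (\<xi>0 x)) \<noteq> 0"
    by (rule k.character_exists) blast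
  define \<xi> where "\<xi> = restrict \<xi>0 (carrier X)"
  have \<xi>: "\<xi> \<in> dual" unfolding \<xi>_def by (rule dual_restrictI[OF \<xi>0(1,3,2)])
  have c: "cont \<xi>" by (rule dualD(2)[OF \<xi>])
  define a where "a = mean (\<lambda>x. g x * cnj (\<xi> x))"
  have "mean (\<lambda>x. k x * cnj (\<xi>0 x)) = mean (\<lambda>x. 2 * (g x * cnj (\<xi> x)) - (g (x \<otimes> x0) * cnj (\<xi> x) + g (x \<otimes> inv x0) * cnj (\<xi> x)))"
    by (rule mean_cong) (simp add: k_def \<xi>_def algebra_simps)
  also have "\<dots> = mean (\<lambda>x. 2 * (g x * cnj (\<xi> x))) - mean (\<lambda>x. g (x \<otimes> x0) * cnj (\<xi> x) + g (x \<otimes> inv x0) * cnj (\<xi> x))"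
    using x0 by (intro mean_diff continuous_map_complex_intros cont_translate g c) auto
  also have "mean (\<lambda>x. 2 * (g x * cnj (\<xi> x))) = 2 * a"
    unfolding a_def by (intro mean_scale continuous_map_complex_intros g c)
  also have "mean (\<lambda>x. g (x \<otimes> x0) * cnj (\<xi> x) + g (x \<otimes> inv x0) * cnj (\<xi> x))
    = mean (\<lambda>x. g (x \<otimes> x0) * cnj (\<xi> x)) + mean (\<lambda>x. g (x \<otimes> inv x0) * cnj (\<xi> x))"
    using x0 by (intro mean_add continuous_map_complex_intros cont_translate g c) auto
  also have "mean (\<lambda>x. g (x \<otimes> x0) * cnj (\<xi> x)) = \<xi> x0 * a" unfolding a_def by (rule mean_translate_character[OF g \<xi> x0(1)])
  also have "mean (\<lambda>x. g (x \<otimes> inv x0) * cnj (\<xi> x)) = inverse (\<xi> x0) * a"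
    unfolding a_def dual_inv[OF \<xi> x0(1), symmetric] using x0 by (intro mean_translate_character[OF g \<xi>]) simp
  finally have ne: "2 * a - (\<xi> x0 * a + inverse (\<xi> x0) * a) \<noteq> 0" using \<xi>0(4) by simp
  then have "\<xi> x0 \<noteq> 1" "a \<noteq> 0" by auto
  moreover have "\<xi> h = 1" if h: "h \<in> P" for h
  proof -
    have "mean (\<lambda>x. g (x \<otimes> h) * cnj (\<xi> x)) = a" unfolding a_def using gP h by (intro mean_cong) simp
    moreover have "mean (\<lambda>x. g (x \<otimes> h) * cnj (\<xi> x)) = \<xi> h * a"
      unfolding a_def using h Pc by (intro mean_translate_character[OF g \<xi>]) auto
    ultimately show ?thesis using \<open>a \<noteq> 0\<close> by simp
  qed
  ultimately show ?thesis using that \<xi> by blast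
qed

corollary dual_separates_points:
  assumes "x \<in> carrier X" "y \<in> carrier X" "\<And>\<xi>. \<xi> \<in> dual \<Longrightarrow> \<xi> x = \<xi> y"
  shows "x = y"
proof (rule ccontr)
  assume "x \<noteq> y"
  define z where "z = x \<otimes> inv y"
  have z: "z \<in> carrier X" "z \<noteq> \<one>" using assms(1,2) \<open>x \<noteq> y\<close> by (auto simp: z_def inv_solve_right')
  have "T closure_of {\<one>} = {\<one>}"
    using closedin_Hausdorff_singleton[OF metrizable_imp_Hausdorff_space[OF metrizable], of \<one>]
    by (simp add: topspace_eq closure_of_closedin)
  then have "z \<notin> T closure_of {\<one>}" using z by simp
  then obtain \<xi> where \<xi>: "\<xi> \<in> dual" "\<xi> z \<noteq> 1"
    by (rule subgroup_annihilator[OF triv_subgroup z(1)]) blast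
  have "\<xi> z = \<xi> x * inverse (\<xi> y)" unfolding z_def using assms(1,2) \<xi>(1) by (simp add: dualD(4) dual_inv)
  then show False using assms(3)[OF \<xi>(1)] \<xi> dual_nonzero[OF \<xi>(1) assms(2)] by simp
qed

end

section \<open>Every homomorphism from the dual to the circle is an evaluation\<close>

context compact_metrizable_abelian_group
begin

lemma mean_character_eq_0:
  assumes \<xi>: "\<xi> \<in> dual" and b: "b \<in> carrier X" "\<xi> b \<noteq> 1"
  shows "mean \<xi> = 0"
proof -
  have "mean \<xi> = mean (\<lambda>x. \<xi> (x \<otimes> b))" by (rule mean_translate[OF dualD(2)[OF \<xi>] b(1), symmetric])
  also have "\<dots> = mean (\<lambda>x. \<xi> b * \<xi> x)" by (rule mean_cong) (simp add: dualD(4)[OF \<xi> _ b(1)])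
  also have "\<dots> = \<xi> b * mean \<xi>" by (rule mean_scale[OF dualD(2)[OF \<xi>]])
  finally show ?thesis using b(2) by simp
qed

lemma cnj_mult_unit: "norm z = 1 \<Longrightarrow> z * cnj z = 1" "norm z = 1 \<Longrightarrow> cnj z * z = 1"
  using complex_norm_square[of z] by (simp_all add: mult.commute)

context
  fixes c :: "('x \<Rightarrow> complex) \<Rightarrow> complex"
  assumes c: "c \<in> hom (pontryagin_dual X T) circle_group"
begin

lemma c_norm: "\<xi> \<in> dual \<Longrightarrow> norm (c \<xi>) = 1"
  using c by (auto simp: hom_def circle_group_def Pi_iff)

lemma c_mult: "\<xi> \<in> dual \<Longrightarrow> \<eta> \<in> dual \<Longrightarrow> c (\<lambda>x\<in>carrier X. \<xi> x * \<eta> x) = c \<xi> * c \<eta>"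
  using c by (simp add: hom_def circle_group_def) (simp add: pontryagin_dual_def)

lemma c_trivial: "c (\<lambda>x\<in>carrier X. 1) = 1"
proof -
  have 1: "(\<lambda>x\<in>carrier X. 1) \<in> dual" by (rule dual_restrictI) simp_all
  have "(\<lambda>x\<in>carrier X. (\<lambda>x\<in>carrier X. 1) x * (\<lambda>x\<in>carrier X. 1) x) = (\<lambda>x\<in>carrier X. 1 :: complex)"
    by (rule restrict_ext) simp
  then have "c (\<lambda>x\<in>carrier X. 1) = c (\<lambda>x\<in>carrier X. 1) * c (\<lambda>x\<in>carrier X. 1)" using c_mult[OF 1 1] by simp
  moreover have "c (\<lambda>x\<in>carrier X. 1) \<noteq> 0" using c_norm[OF 1] by auto
  ultimately show ?thesis by simp
qed

lemma c_cnj: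
  assumes \<xi>: "\<xi> \<in> dual"
  shows "c (\<lambda>x\<in>carrier X. cnj (\<xi> x)) = cnj (c \<xi>)"
proof -
  have "(\<lambda>x\<in>carrier X. \<xi> x * (\<lambda>x\<in>carrier X. cnj (\<xi> x)) x) = (\<lambda>x\<in>carrier X. 1)"
    by (rule restrict_ext) (simp add: cnj_mult_unit dualD(3)[OF \<xi>])
  then have "c \<xi> * c (\<lambda>x\<in>carrier X. cnj (\<xi> x)) = 1" using c_mult[OF \<xi> dual_cnj_closed[OF \<xi>]] c_trivial by simp
  then have "cnj (c \<xi>) * (c \<xi> * c (\<lambda>x\<in>carrier X. cnj (\<xi> x))) = cnj (c \<xi>)" by simp
  then show ?thesis unfolding mult.assoc[symmetric] cnj_mult_unit(2)[OF c_norm[OF \<xi>]] by simp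
qed

text \<open>\<open>twisted f g\<close> says that \<open>f\<close> behaves like the trigonometric polynomial \<open>g\<close> with every
  character \<open>\<xi>\<close> replaced by \<open>cnj (c \<xi>) * \<xi>\<close>.\<close>

definition twisted :: "('x \<Rightarrow> complex) \<Rightarrow> ('x \<Rightarrow> complex) \<Rightarrow> bool" where
  "twisted f g \<longleftrightarrow> cont f \<and> cont g \<and> (\<forall>\<xi>\<in>dual. mean (\<lambda>x. \<xi> x * f x) * cnj (c \<xi>) = mean (\<lambda>x. \<xi> x * g x))"

lemma twisted_one: "twisted (\<lambda>x. 1) (\<lambda>x. 1)"
  unfolding twisted_def
proof (intro conjI ballI)
  fix \<xi> assume \<xi>: "\<xi> \<in> dual"
  show "mean (\<lambda>x. \<xi> x * 1) * cnj (c \<xi>) = mean (\<lambda>x. \<xi> x * 1)"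
  proof (cases "\<exists>b\<in>carrier X. \<xi> b \<noteq> 1")
    case True
    then show ?thesis using mean_character_eq_0[OF \<xi>] by auto
  next
    case False
    then have "\<xi> = (\<lambda>x\<in>carrier X. 1)" using dualD(1)[OF \<xi>] by (auto simp: extensional_def restrict_def)
    then show ?thesis by (simp add: c_trivial)
  qed
qed simp_all

lemma twisted_add:
  assumes "twisted f g" "twisted f' g'"
  shows "twisted (\<lambda>x. f x + f' x) (\<lambda>x. g x + g' x)"
  unfolding twisted_def
proof (intro conjI ballI)
  have co: "cont f" "cont g" "cont f'" "cont g'" using assms by (auto simp: twisted_def)
  show "cont (\<lambda>x. f x + f' x)" "cont (\<lambda>x. g x + g' x)" by (intro continuous_map_complex_intros co)+
  fix \<xi> assume \<xi>: "\<xi> \<in> dual"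
  have "mean (\<lambda>x. \<xi> x * (f x + f' x)) = mean (\<lambda>x. \<xi> x * f x) + mean (\<lambda>x. \<xi> x * f' x)"
    unfolding distrib_left by (intro mean_add continuous_map_complex_intros co dualD(2)[OF \<xi>])
  moreover have "mean (\<lambda>x. \<xi> x * (g x + g' x)) = mean (\<lambda>x. \<xi> x * g x) + mean (\<lambda>x. \<xi> x * g' x)"
    unfolding distrib_left by (intro mean_add continuous_map_complex_intros co dualD(2)[OF \<xi>])
  ultimately show "mean (\<lambda>x. \<xi> x * (f x + f' x)) * cnj (c \<xi>) = mean (\<lambda>x. \<xi> x * (g x + g' x))"
    using assms \<xi> by (simp add: twisted_def distrib_right)
qed

lemma twisted_zero: "twisted (\<lambda>x. 0) (\<lambda>x. 0)"
  by (simp add: twisted_def mean_const)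

lemma twisted_sum:
  "finite I \<Longrightarrow> (\<And>i. i \<in> I \<Longrightarrow> twisted (f i) (g i)) \<Longrightarrow> twisted (\<lambda>x. \<Sum>i\<in>I. f i x) (\<lambda>x. \<Sum>i\<in>I. g i x)"
  by (induction I rule: finite_induct) (simp_all add: twisted_zero twisted_add)

text \<open>The factor \<open>\<eta>\<close> shifts the test character from \<open>\<xi>\<close> to
  the product of \<open>\<xi>\<close> and \<open>\<eta>\<close>, at which \<open>c\<close> is
  multiplicative.\<close>

lemma twisted_character:
  assumes t: "twisted f g" and \<eta>: "\<eta> \<in> dual"
  shows "twisted (\<lambda>x. \<eta> x * cnj (c \<eta>) * f x) (\<lambda>x. \<eta> x * g x)"
  unfolding twisted_def
proof (intro conjI ballI)
  have co: "cont f" "cont g" using t by (auto simp: twisted_def)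
  show "cont (\<lambda>x. \<eta> x * cnj (c \<eta>) * f x)" "cont (\<lambda>x. \<eta> x * g x)"
    by (intro continuous_map_complex_intros co dualD(2)[OF \<eta>])+
  fix \<xi> assume \<xi>: "\<xi> \<in> dual"
  let ?\<zeta> = "\<lambda>x\<in>carrier X. \<xi> x * \<eta> x"
  have \<zeta>: "?\<zeta> \<in> dual" by (rule dual_mult_closed[OF \<xi> \<eta>])
  have "mean (\<lambda>x. \<xi> x * (\<eta> x * cnj (c \<eta>) * f x)) = mean (\<lambda>x. cnj (c \<eta>) * (?\<zeta> x * f x))"
    by (rule mean_cong) (simp add: mult_ac)
  also have "\<dots> = cnj (c \<eta>) * mean (\<lambda>x. ?\<zeta> x * f x)"
    by (intro mean_scale continuous_map_complex_mult dualD(2)[OF \<zeta>] co)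
  finally have "mean (\<lambda>x. \<xi> x * (\<eta> x * cnj (c \<eta>) * f x)) * cnj (c \<xi>) = mean (\<lambda>x. ?\<zeta> x * f x) * cnj (c ?\<zeta>)"
    unfolding c_mult[OF \<xi> \<eta>] by (simp only: complex_cnj_mult mult_ac)
  also have "\<dots> = mean (\<lambda>x. ?\<zeta> x * g x)" using t \<zeta> unfolding twisted_def by blast
  also have "\<dots> = mean (\<lambda>x. \<xi> x * (\<eta> x * g x))" by (rule mean_cong) simp
  finally show "mean (\<lambda>x. \<xi> x * (\<eta> x * cnj (c \<eta>) * f x)) * cnj (c \<xi>) = mean (\<lambda>x. \<xi> x * (\<eta> x * g x))" .
qed

lemma twisted_cong:
  assumes t: "twisted f g" and eq: "\<And>x. x \<in> carrier X \<Longrightarrow> f' x = f x" "\<And>x. x \<in> carrier X \<Longrightarrow> g' x = g x"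
  shows "twisted f' g'"
  unfolding twisted_def
proof (intro conjI ballI)
  have co: "cont f" "cont g" using t by (auto simp: twisted_def)
  show "cont f'" by (rule continuous_map_eq[OF co(1)]) (simp add: eq topspace_eq)
  show "cont g'" by (rule continuous_map_eq[OF co(2)]) (simp add: eq topspace_eq)
  fix \<xi> assume \<xi>: "\<xi> \<in> dual"
  have "mean (\<lambda>x. \<xi> x * f' x) = mean (\<lambda>x. \<xi> x * f x)" "mean (\<lambda>x. \<xi> x * g' x) = mean (\<lambda>x. \<xi> x * g x)"
    by (rule mean_cong, simp add: eq)+
  then show "mean (\<lambda>x. \<xi> x * f' x) * cnj (c \<xi>) = mean (\<lambda>x. \<xi> x * g' x)"
    using t \<xi> by (simp add: twisted_def)
qed

text \<open>The left factor is \<open>4 * card F\<close> exactly at the common solutions of \<open>\<xi> x = c \<xi>\<close>.\<close>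

lemma twisted_kernel:
  assumes F: "finite F" "F \<subseteq> dual" and t: "twisted f g"
  shows "twisted (\<lambda>x. of_real (\<Sum>\<xi>\<in>F. 2 + 2 * Re (\<xi> x * cnj (c \<xi>))) * f x) (\<lambda>x. of_real (\<Sum>\<xi>\<in>F. 2 + 2 * Re (\<xi> x)) * g x)"
proof -
  let ?f = "\<lambda>\<xi> x. (f x + f x) + (\<xi> x * cnj (c \<xi>) * f x
      + (\<lambda>x\<in>carrier X. cnj (\<xi> x)) x * cnj (c (\<lambda>x\<in>carrier X. cnj (\<xi> x))) * f x)"
  let ?g = "\<lambda>\<xi> x. (g x + g x) + (\<xi> x * g x + (\<lambda>x\<in>carrier X. cnj (\<xi> x)) x * g x)"
  have "twisted (\<lambda>x. \<Sum>\<xi>\<in>F. ?f \<xi> x) (\<lambda>x. \<Sum>\<xi>\<in>F. ?g \<xi> x)"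
    using F by (intro twisted_sum twisted_add twisted_character t dual_cnj_closed) auto
  then show ?thesis
  proof (rule twisted_cong)
    fix x assume x: "x \<in> carrier X"
    have cadd: "of_real (2 + 2 * Re z) * w = (w + w) + (z * w + cnj z * w)" for z w :: complex
      using complex_add_cnj[of z] by (simp add: distrib_right[symmetric])
    show "of_real (\<Sum>\<xi>\<in>F. 2 + 2 * Re (\<xi> x * cnj (c \<xi>))) * f x = (\<Sum>\<xi>\<in>F. ?f \<xi> x)"
      unfolding of_real_sum sum_distrib_right cadd using F x by (intro sum.cong refl) (simp add: c_cnj subset_iff)
    show "of_real (\<Sum>\<xi>\<in>F. 2 + 2 * Re (\<xi> x)) * g x = (\<Sum>\<xi>\<in>F. ?g \<xi> x)"
      unfolding of_real_sum sum_distrib_right cadd using x by (intro sum.cong refl) simp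
  qed
qed

text \<open>The powers \<open>q ^ n\<close> and \<open>q0 ^ n\<close> have equal means, because the
  twist does not affect the trivial character. Near \<open>\<one>\<close> the function
  \<open>q0\<close> comes close to its maximum \<open>N\<close>, so these means grow at a rate
  arbitrarily close to \<open>N\<close>. Without a common solution the maximum of \<open>q\<close>
  is smaller than \<open>N\<close>, and the means of \<open>q ^ n\<close> grow too slowly.\<close>

lemma finite_common_solution:
  assumes F: "finite F" "F \<subseteq> dual"
  shows "\<exists>x\<in>carrier X. \<forall>\<xi>\<in>F. \<xi> x = c \<xi>"
proof (rule ccontr)
  assume none: "\<not> ?thesis"
  \<comment> \<open>For a unit number z the term \<open>2 + 2 * Re z\<close> is the square of
    \<open>norm (1 + z)\<close>: nonnegative, and equal to 4 only for z = 1.\<close>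
  define q where "q x = (\<Sum>\<xi>\<in>F. 2 + 2 * Re (\<xi> x * cnj (c \<xi>)))" for x
  define q0 where "q0 x = (\<Sum>\<xi>\<in>F. 2 + 2 * Re (\<xi> x))" for x
  define N where "N = 4 * real (card F)"
  have tw: "twisted (\<lambda>x. of_real (q x ^ n)) (\<lambda>x. of_real (q0 x ^ n))" for n
  proof (induction n)
    case 0
    then show ?case by (simp add: twisted_one)
  next
    case (Suc n)
    then show ?case using twisted_kernel[OF F Suc] by (simp add: q_def q0_def)
  qed
  have contq: "cont (\<lambda>x. of_real (q x ^ n))" "cont (\<lambda>x. of_real (q0 x ^ n))" for n
    using tw[of n] by (auto simp: twisted_def)
  have means: "mean (\<lambda>x. of_real (q x ^ n)) = mean (\<lambda>x. of_real (q0 x ^ n))" for n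
  proof -
    have 1: "(\<lambda>x\<in>carrier X. 1) \<in> dual" by (rule dual_restrictI) simp_all
    have "mean (\<lambda>x. of_real (q x ^ n)) = mean (\<lambda>x. (\<lambda>x\<in>carrier X. 1) x * of_real (q x ^ n))" by (rule mean_cong) simp
    also have "\<dots> = mean (\<lambda>x. (\<lambda>x\<in>carrier X. 1) x * of_real (q0 x ^ n))"
      using tw[of n, unfolded twisted_def, THEN conjunct2, THEN conjunct2, THEN bspec, OF 1]
      by (simp only: c_trivial complex_cnj_one mult_1_right)
    also have "\<dots> = mean (\<lambda>x. of_real (q0 x ^ n))" by (rule mean_cong) simp
    finally show ?thesis .
  qed
  have unit_bounds: "0 \<le> 2 + 2 * Re z" "2 + 2 * Re z \<le> 4" if "norm z = 1" for z :: complex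
    using complex_Re_le_cmod[of z] abs_Re_le_cmod[of z] that by auto
  have unit_norm: "norm (\<xi> x * cnj (c \<xi>)) = 1" "norm (\<xi> x) = 1" if "\<xi> \<in> F" "x \<in> carrier X" for \<xi> x
    using that F by (auto simp: norm_mult c_norm dualD(3))
  have q0: "0 \<le> q x" "0 \<le> q0 x" if "x \<in> carrier X" for x
    unfolding q_def q0_def by (intro sum_nonneg unit_bounds(1) unit_norm that; assumption)+
  have q_less: "q x < N" if x: "x \<in> carrier X" for x
  proof -
    obtain \<xi> where \<xi>: "\<xi> \<in> F" "\<xi> x \<noteq> c \<xi>" using none x by blast
    have \<xi>d: "\<xi> \<in> dual" using \<xi> F by blast
    have "2 + 2 * Re (\<xi> x * cnj (c \<xi>)) < 4"
    proof (rule ccontr)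
      assume "\<not> ?thesis"
      then have R: "Re (\<xi> x * cnj (c \<xi>)) = 1" using unit_bounds(2)[OF unit_norm(1)[OF \<xi>(1) x]] by simp
      then have "Im (\<xi> x * cnj (c \<xi>)) = 0" using unit_norm(1)[OF \<xi>(1) x] cmod_power2[of "\<xi> x * cnj (c \<xi>)"] by simp
      then have "\<xi> x * cnj (c \<xi>) = 1" using R by (simp add: complex_eq_iff)
      then have "\<xi> x * (cnj (c \<xi>) * c \<xi>) = c \<xi>" by (simp flip: mult.assoc)
      then show False using \<xi>(2) by (simp add: cnj_mult_unit(2)[OF c_norm[OF \<xi>d]])
    qed
    then have "q x < (\<Sum>\<xi>\<in>F. 4)"
      unfolding q_def
    proof (intro sum_strict_mono_ex1 F(1) ballI bexI[OF _ \<xi>(1)])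
      show "2 + 2 * Re (\<eta> x * cnj (c \<eta>)) \<le> 4" if "\<eta> \<in> F" for \<eta>
        by (rule unit_bounds(2)[OF unit_norm(1)[OF that x]])
    qed
    then show ?thesis by (simp add: N_def)
  qed
  have q0_one: "q0 \<one> = N" unfolding q0_def N_def using F by (simp add: dual_one subset_iff)
  have cont1: "cont (\<lambda>x. of_real (q x))" "cont (\<lambda>x. of_real (q0 x))" using contq[of 1] by simp_all
  have "compactin euclidean ((\<lambda>x. complex_of_real (q x)) ` topspace T)"
    using compact image_compactin[OF _ cont1(1)] by (simp add: compact_space_def)
  then have "compact (Re ` ((\<lambda>x. complex_of_real (q x)) ` carrier X))"
    by (intro compact_continuous_image continuous_intros) (simp add: topspace_eq)
  then have "compact (q ` carrier X)" by (simp add: image_image)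
  moreover have "q ` carrier X \<noteq> {}" using one_closed by blast
  ultimately obtain x1 where x1: "x1 \<in> carrier X" "\<And>x. x \<in> carrier X \<Longrightarrow> q x \<le> q x1"
    using compact_attains_sup[of "q ` carrier X"] by auto
  define M where "M = q x1"
  \<comment> \<open>A rate strictly between the maximum of \<open>q\<close> and the value of
    \<open>q0\<close> at \<open>\<one>\<close>; \<open>q0\<close> exceeds it on a neighbourhood of
    \<open>\<one>\<close>.\<close>
  define M' where "M' = (M + N) / 2"
  have M: "0 \<le> M" "M < M'" "M' < N" using q0(1)[OF x1(1)] q_less[OF x1(1)] by (auto simp: M_def M'_def)
  have "N - M' > 0" using M by simp
  then obtain U where U: "openin T U" "\<one> \<in> U"
    and UU: "\<And>x u. x \<in> carrier X \<Longrightarrow> u \<in> U \<Longrightarrow> norm (complex_of_real (q0 (x \<otimes> u)) - of_real (q0 x)) < N - M'"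
    by (rule uniform_continuity[OF cont1(2)]) blast
  have Uc: "U \<subseteq> carrier X" using openin_subset[OF U(1)] by (simp add: topspace_eq)
  have big: "M' \<le> q0 (\<one> \<otimes> u)" if u: "u \<in> U" for u
    using UU[OF one_closed u] unfolding of_real_diff[symmetric] norm_of_real q0_one by linarith
  obtain d where d: "d > 0" and lower: "\<And>f x0 r. cont f \<Longrightarrow> (\<And>x. x \<in> carrier X \<Longrightarrow> 0 \<le> Re (f x)) \<Longrightarrow> x0 \<in> carrier X
      \<Longrightarrow> (\<And>u. u \<in> U \<Longrightarrow> r \<le> Re (f (x0 \<otimes> u))) \<Longrightarrow> d * r \<le> Re (mean f)"
    by (rule mean_lower_bound[OF U]) blast
  have ineq: "d * M' ^ n \<le> M ^ n" for n
  proof -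
    have "d * M' ^ n \<le> Re (mean (\<lambda>x. of_real (q0 x ^ n)))"
    proof (rule lower[OF contq(2) _ one_closed])
      show "0 \<le> Re (of_real (q0 x ^ n))" if "x \<in> carrier X" for x using q0(2)[OF that] by simp
      show "M' ^ n \<le> Re (of_real (q0 (\<one> \<otimes> u) ^ n))" if "u \<in> U" for u
        unfolding Re_complex_of_real using big[OF that] M by (intro power_mono) auto
    qed
    also have "\<dots> = Re (mean (\<lambda>x. of_real (q x ^ n)))" by (simp only: means)
    also have "\<dots> \<le> M ^ n"
    proof (rule Re_mean_le[OF contq(1)])
      show "Re (of_real (q x ^ n)) \<le> M ^ n" if "x \<in> carrier X" for x
        unfolding Re_complex_of_real M_def using x1(2)[OF that] q0(1)[OF that] by (intro power_mono)
    qed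
    finally show ?thesis .
  qed
  have M'pos: "M' > 0" using M by linarith
  have "(M / M') ^ n \<ge> d" for n using ineq[of n] M'pos by (simp add: power_divide pos_le_divide_eq)
  moreover obtain n where "(M / M') ^ n < d" using real_arch_pow_inv[OF d, of "M / M'"] M M'pos by auto
  ultimately show False using not_le by blast
qed

text \<open>The solution sets of the single equations are closed, and finitely many of them always
  meet; compactness gives a common point.\<close>

theorem dual_point:
  obtains x where "x \<in> carrier X" "\<And>\<xi>. \<xi> \<in> dual \<Longrightarrow> \<xi> x = c \<xi>"
proof -
  define C where "C \<xi> = {x \<in> topspace T. \<xi> x \<in> {c \<xi>}}" for \<xi>
  have closed: "closedin T (C \<xi>)" if "\<xi> \<in> dual" for \<xi>
    unfolding C_def by (rule closedin_continuous_map_preimage[OF dualD(2)[OF that]]) simp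
  let ?\<U> = "insert (topspace T) (C ` dual)"
  have "\<Inter>\<F> \<noteq> {}" if \<F>: "finite \<F>" "\<F> \<subseteq> ?\<U>" for \<F>
  proof -
    have "finite (\<F> - {topspace T})" "\<F> - {topspace T} \<subseteq> C ` dual" using \<F> by auto
    then obtain F where F: "F \<subseteq> dual" "finite F" "\<F> - {topspace T} = C ` F" by (meson finite_subset_image)
    obtain x where x: "x \<in> carrier X" "\<forall>\<xi>\<in>F. \<xi> x = c \<xi>" using finite_common_solution[OF F(2,1)] by blast
    have "x \<in> S" if S: "S \<in> \<F>" for S
    proof (cases "S = topspace T")
      case True
      then show ?thesis using x by (simp add: topspace_eq)
    next
      case False
      then obtain \<xi> where "\<xi> \<in> F" "S = C \<xi>" using F(3) S by blast
      then show ?thesis using x by (simp add: C_def topspace_eq)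
    qed
    then show ?thesis by blast
  qed
  moreover have "\<forall>S\<in>?\<U>. closedin T S" using closed by auto
  ultimately have "\<Inter>?\<U> \<noteq> {}"
    using compact[unfolded compact_space_fip, THEN spec[of _ ?\<U>]] by simp
  then obtain x where "x \<in> \<Inter>?\<U>" by blast
  then have "x \<in> carrier X" "\<And>\<xi>. \<xi> \<in> dual \<Longrightarrow> \<xi> x = c \<xi>" by (auto simp: C_def topspace_eq)
  then show ?thesis by (rule that)
qed

end

end

subsection \<open>Density of periodic points\<close>

text \<open>The finite quotient group with the discrete topology is itself compact and metrizable,
  so \<open>dual_separates_points\<close> supplies the character.\<close>

theorem finite_quotient_character:
  fixes B W :: "'a::ab_group_add set"
  assumes B: "add_subgroup B" "B \<subseteq> W" and W: "add_subgroup W" and fin: "finite_mod B W" and w: "w \<in> W" "w \<notin> B"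
  obtains \<psi> :: "'a \<Rightarrow> complex" where "\<And>f. f \<in> W \<Longrightarrow> norm (\<psi> f) = 1"
    "\<And>f g. f \<in> W \<Longrightarrow> g \<in> W \<Longrightarrow> \<psi> (f + g) = \<psi> f * \<psi> g" "\<And>f. f \<in> B \<Longrightarrow> \<psi> f = 1" "\<psi> w \<noteq> 1"
proof -
  define A where "A = \<lparr>carrier = W, mult = (+), one = 0 :: 'a\<rparr>"
  have Asimps: "carrier A = W" "mult A = (+)" "one A = 0" by (simp_all add: A_def)
  interpret A: comm_group A
  proof (rule comm_groupI; unfold Asimps)
    show "\<exists>y\<in>W. y + x = 0" if "x \<in> W" for x using add_subgroup_minus[OF W that] by force
  qed (use add_subgroup_zero[OF W] add_subgroup_add[OF W] in \<open>auto simp: add_ac\<close>)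
  have inv: "inv\<^bsub>A\<^esub> x = - x" if "x \<in> W" for x
    using that add_subgroup_minus[OF W that] by (intro A.inv_equality) (simp_all add: Asimps)
  have sub: "subgroup B A"
    using B add_subgroup_zero[OF B(1)] add_subgroup_add[OF B(1)] add_subgroup_minus[OF B(1)]
    by (intro A.subgroupI) (auto simp: Asimps inv subset_iff)
  have nB: "B \<lhd> A" by (rule A.subgroup_imp_normal[OF sub])
  interpret Q: comm_group "A Mod B" by (rule A.abelian_FactGroup[OF sub])
  let ?D = "discrete_topology (carrier (A Mod B))"
  have coset: "B #>\<^bsub>A\<^esub> x = {y. y - x \<in> B}" for x
    by (force simp: r_coset_def Asimps)
  obtain C where C: "finite C" "\<And>x. x \<in> W \<Longrightarrow> \<exists>c\<in>C. x - c \<in> B" using fin by (auto simp: finite_mod_def)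
  have "carrier (A Mod B) \<subseteq> (\<lambda>c. {y. y - c \<in> B}) ` C"
  proof
    fix S assume "S \<in> carrier (A Mod B)"
    then obtain x where x: "x \<in> W" "S = {y. y - x \<in> B}" by (auto simp: FactGroup_def RCOSETS_def Asimps coset)
    obtain c where c: "c \<in> C" "x - c \<in> B" using C(2)[OF x(1)] by blast
    have "y - x \<in> B \<longleftrightarrow> y - c \<in> B" for y
      using add_subgroup_cancel(1)[OF B(1) c(2), of "y - x"] by simp
    then show "S \<in> (\<lambda>c. {y. y - c \<in> B}) ` C" using c(1) x(2) by auto
  qed
  then have finQ: "finite (carrier (A Mod B))" using C(1) finite_surj by blast
  have Qm: "x <#>\<^bsub>A\<^esub> y \<in> carrier (A Mod B)" if "x \<in> carrier (A Mod B)" "y \<in> carrier (A Mod B)" for x y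
    using Q.m_closed[OF that] by simp
  interpret Q: compact_metrizable_abelian_group "A Mod B" ?D
    by unfold_locales
      (auto simp: Qm finQ compact_space_discrete_topology metrizable_space_discrete_topology
        continuous_map_from_discrete_topology prod_topology_discrete_topology[symmetric])
  have mem: "B #>\<^bsub>A\<^esub> f \<in> carrier (A Mod B)" if "f \<in> W" for f
    using that by (auto simp: FactGroup_def RCOSETS_def Asimps)
  have oneQ: "\<one>\<^bsub>A Mod B\<^esub> = B" by (simp add: FactGroup_def)
  have "B #>\<^bsub>A\<^esub> w \<noteq> B"
  proof
    assume "B #>\<^bsub>A\<^esub> w = B"
    moreover have "w \<in> B #>\<^bsub>A\<^esub> w" using add_subgroup_zero[OF B(1)] by (simp add: coset)
    ultimately show False using w(2) by simp
  qed
  then obtain \<xi> where \<xi>: "\<xi> \<in> Q.dual" "\<xi> (B #>\<^bsub>A\<^esub> w) \<noteq> \<xi> \<one>\<^bsub>A Mod B\<^esub>"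
    using Q.dual_separates_points[OF mem[OF w(1)] Q.one_closed] unfolding oneQ by blast
  show ?thesis
  proof (rule that[of "\<lambda>f. \<xi> (B #>\<^bsub>A\<^esub> f)"])
    show "norm (\<xi> (B #>\<^bsub>A\<^esub> f)) = 1" if "f \<in> W" for f by (rule Q.dualD(3)[OF \<xi>(1) mem[OF that]])
    show "\<xi> (B #>\<^bsub>A\<^esub> (f + g)) = \<xi> (B #>\<^bsub>A\<^esub> f) * \<xi> (B #>\<^bsub>A\<^esub> g)" if "f \<in> W" "g \<in> W" for f g
      using Q.dualD(4)[OF \<xi>(1) mem[OF that(1)] mem[OF that(2)]] normal.rcos_sum[OF nB, of f g] that
      by (simp add: FactGroup_def Asimps)
    show "\<xi> (B #>\<^bsub>A\<^esub> f) = 1" if "f \<in> B" for f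
      using A.coset_join2[OF _ sub that] that B(2) Q.dual_one[OF \<xi>(1)] by (auto simp: Asimps oneQ)
    show "\<xi> (B #>\<^bsub>A\<^esub> w) \<noteq> 1" using \<xi> Q.dual_one[OF \<xi>(1)] by simp
  qed
qed

section \<open>The dual as a module over the acting group\<close>

context algebraic_action
begin

sublocale acting: group \<Gamma>
  using group_hom by (simp add: group_hom_def)

lemma action_closed: "g \<in> carrier \<Gamma> \<Longrightarrow> x \<in> carrier X \<Longrightarrow> \<alpha> g x \<in> carrier X"
  using element_image by blast

lemma action_mult:
  "g \<in> carrier \<Gamma> \<Longrightarrow> x \<in> carrier X \<Longrightarrow> y \<in> carrier X \<Longrightarrow> \<alpha> g (x \<otimes>\<^bsub>X\<^esub> y) = \<alpha> g x \<otimes>\<^bsub>X\<^esub> \<alpha> g y"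
  using action_hom by (auto simp: hom_def)

lemma action_one: "g \<in> carrier \<Gamma> \<Longrightarrow> \<alpha> g \<one>\<^bsub>X\<^esub> = \<one>\<^bsub>X\<^esub>"
  using action_mult[of g "\<one>\<^bsub>X\<^esub>" "\<one>\<^bsub>X\<^esub>"] action_closed[of g "\<one>\<^bsub>X\<^esub>"] by simp

lemma action_inv: "g \<in> carrier \<Gamma> \<Longrightarrow> x \<in> carrier X \<Longrightarrow> \<alpha> g (inv\<^bsub>X\<^esub> x) = inv\<^bsub>X\<^esub> \<alpha> g x"
  using action_mult[of g "inv\<^bsub>X\<^esub> x" x] action_closed action_one by (simp add: inv_equality)

lemma action_id: "x \<in> carrier X \<Longrightarrow> \<alpha> \<one>\<^bsub>\<Gamma>\<^esub> x = x"
  using id_eq_one by (metis restrict_apply')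

lemma periodic_points_subgroup: "subgroup (periodic_points \<Gamma> X \<alpha>) X"
proof (rule subgroupI)
  show "periodic_points \<Gamma> X \<alpha> \<subseteq> carrier X" by (auto simp: periodic_points_def)
  have "orbit \<Gamma> \<alpha> \<one>\<^bsub>X\<^esub> \<subseteq> {\<one>\<^bsub>X\<^esub>}" by (auto simp: orbit_def action_one)
  then have "\<one>\<^bsub>X\<^esub> \<in> periodic_points \<Gamma> X \<alpha>" by (auto simp: periodic_points_def intro: finite_subset)
  then show "periodic_points \<Gamma> X \<alpha> \<noteq> {}" by blast
next
  fix x assume x: "x \<in> periodic_points \<Gamma> X \<alpha>"
  have "orbit \<Gamma> \<alpha> (inv\<^bsub>X\<^esub> x) \<subseteq> (\<lambda>y. inv\<^bsub>X\<^esub> y) ` orbit \<Gamma> \<alpha> x"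
    using x by (auto simp: orbit_def periodic_points_def action_inv)
  then show "inv\<^bsub>X\<^esub> x \<in> periodic_points \<Gamma> X \<alpha>" using x by (auto simp: periodic_points_def intro: finite_subset)
next
  fix x y assume xy: "x \<in> periodic_points \<Gamma> X \<alpha>" "y \<in> periodic_points \<Gamma> X \<alpha>"
  have "orbit \<Gamma> \<alpha> (x \<otimes>\<^bsub>X\<^esub> y) \<subseteq> (\<lambda>(u, v). u \<otimes>\<^bsub>X\<^esub> v) ` (orbit \<Gamma> \<alpha> x \<times> orbit \<Gamma> \<alpha> y)"
  proof
    fix z assume "z \<in> orbit \<Gamma> \<alpha> (x \<otimes>\<^bsub>X\<^esub> y)"
    then obtain g where g: "g \<in> carrier \<Gamma>" "z = \<alpha> g (x \<otimes>\<^bsub>X\<^esub> y)" by (auto simp: orbit_def)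
    then have "z = \<alpha> g x \<otimes>\<^bsub>X\<^esub> \<alpha> g y" using xy by (simp add: periodic_points_def action_mult)
    then show "z \<in> (\<lambda>(u, v). u \<otimes>\<^bsub>X\<^esub> v) ` (orbit \<Gamma> \<alpha> x \<times> orbit \<Gamma> \<alpha> y)"
      using g(1) by (auto simp: orbit_def)
  qed
  moreover have "finite ((\<lambda>(u, v). u \<otimes>\<^bsub>X\<^esub> v) ` (orbit \<Gamma> \<alpha> x \<times> orbit \<Gamma> \<alpha> y))"
    using xy by (simp add: periodic_points_def)
  ultimately show "x \<otimes>\<^bsub>X\<^esub> y \<in> periodic_points \<Gamma> X \<alpha>"
    using xy by (auto simp: periodic_points_def intro: finite_subset)
qed

definition act :: "'g \<Rightarrow> ('x \<Rightarrow> complex) \<Rightarrow> 'x \<Rightarrow> complex" where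
  "act g \<xi> = (\<lambda>x\<in>carrier X. \<xi> (\<alpha> (inv\<^bsub>\<Gamma>\<^esub> g) x))"

lemma act_dual: "g \<in> carrier \<Gamma> \<Longrightarrow> \<xi> \<in> dual \<Longrightarrow> act g \<xi> \<in> dual"
  unfolding act_def
  by (rule dual_restrictI)
    (auto simp: action_closed action_mult dualD intro: cont_comp[OF _ action_continuous] dualD)

lemma act_mult:
  assumes "g \<in> carrier \<Gamma>" "h \<in> carrier \<Gamma>"
  shows "act (g \<otimes>\<^bsub>\<Gamma>\<^esub> h) \<xi> = act g (act h \<xi>)"
  unfolding act_def using assms
  by (intro restrict_ext) (simp add: acting.inv_mult_group action_closed composition_rule)

lemma act_one: "\<xi> \<in> dual \<Longrightarrow> act \<one>\<^bsub>\<Gamma>\<^esub> \<xi> = \<xi>"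
  using dualD(1)[of \<xi>] by (auto simp: act_def action_id extensional_def restrict_def)

text \<open>The submodules of the dual, described by the group action instead of the group ring.\<close>

definition dual_closed :: "('x \<Rightarrow> complex) set \<Rightarrow> bool" where
  "dual_closed N \<longleftrightarrow> N \<subseteq> dual \<and> (\<lambda>x\<in>carrier X. 1) \<in> N \<and> (\<forall>\<xi>\<in>N. \<forall>\<eta>\<in>N. (\<lambda>x\<in>carrier X. \<xi> x * \<eta> x) \<in> N)
    \<and> (\<forall>\<xi>\<in>N. (\<lambda>x\<in>carrier X. cnj (\<xi> x)) \<in> N) \<and> (\<forall>g\<in>carrier \<Gamma>. \<forall>\<xi>\<in>N. act g \<xi> \<in> N)"

lemma dual_one_closed: "(\<lambda>x\<in>carrier X. 1) \<in> dual"
  by (rule dual_restrictI) simp_all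

lemma dual_closed_dual: "dual_closed dual"
  by (simp add: dual_closed_def dual_one_closed dual_mult_closed dual_cnj_closed act_dual)

lemma dual_closedD:
  assumes "dual_closed N"
  shows "\<xi> \<in> N \<Longrightarrow> \<xi> \<in> dual" "(\<lambda>x\<in>carrier X. 1) \<in> N"
    "\<xi> \<in> N \<Longrightarrow> \<eta> \<in> N \<Longrightarrow> (\<lambda>x\<in>carrier X. \<xi> x * \<eta> x) \<in> N"
    "\<xi> \<in> N \<Longrightarrow> (\<lambda>x\<in>carrier X. cnj (\<xi> x)) \<in> N" "g \<in> carrier \<Gamma> \<Longrightarrow> \<xi> \<in> N \<Longrightarrow> act g \<xi> \<in> N"
  using assms by (auto simp: dual_closed_def)

lemma dual_closed_power:
  assumes N: "dual_closed N" and \<xi>: "\<xi> \<in> N"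
  shows "(\<lambda>x\<in>carrier X. \<xi> x powi k) \<in> N"
proof -
  have pow: "(\<lambda>x\<in>carrier X. \<eta> x ^ n) \<in> N" if \<eta>: "\<eta> \<in> N" for \<eta> n
  proof -
    define p where "p n = (\<lambda>x\<in>carrier X. \<eta> x ^ n)" for n
    have p0: "p 0 = (\<lambda>x\<in>carrier X. 1)" by (simp add: p_def)
    have pS: "p (Suc n) = (\<lambda>x\<in>carrier X. \<eta> x * p n x)" for n unfolding p_def by (rule restrict_ext) simp
    have "p n \<in> N"
      by (induction n) (simp_all only: p0 pS dual_closedD(2)[OF N] dual_closedD(3)[OF N \<eta>])
    then show ?thesis by (simp only: p_def)
  qed
  have \<xi>d: "\<xi> \<in> dual" using N \<xi> by (auto simp: dual_closed_def)
  show ?thesis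
  proof (cases "k \<ge> 0")
    case True
    then show ?thesis using pow[OF \<xi>, of "nat k"] by (simp add: power_int_def)
  next
    case False
    let ?\<eta> = "\<lambda>x\<in>carrier X. cnj (\<xi> x)"
    have "?\<eta> \<in> N" using N \<xi> by (simp add: dual_closed_def)
    then have "(\<lambda>x\<in>carrier X. ?\<eta> x ^ nat (- k)) \<in> N" by (rule pow)
    moreover have "(\<lambda>x\<in>carrier X. ?\<eta> x ^ nat (- k)) = (\<lambda>x\<in>carrier X. \<xi> x powi k)"
    proof (rule restrict_ext)
      fix x assume x: "x \<in> carrier X"
      have "inverse (\<xi> x) = cnj (\<xi> x)" using cnj_mult_unit(1)[OF dualD(3)[OF \<xi>d x]] by (rule inverse_unique)
      then show "?\<eta> x ^ nat (- k) = \<xi> x powi k" using False x by (simp add: power_int_def power_inverse)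
    qed
    ultimately show ?thesis by simp
  qed
qed

lemma dual_closed_submodule:
  assumes N: "dual_closed N"
  shows "submodule N (integral_group_ring \<Gamma>) (dual_module \<Gamma> X T \<alpha>)"
proof -
  let ?M = "dual_module \<Gamma> X T \<alpha>"
  interpret M: left_module "integral_group_ring \<Gamma>" ?M by (rule dual_left_module)
  have simps: "carrier ?M = dual" "\<zero>\<^bsub>?M\<^esub> = (\<lambda>x\<in>carrier X. 1)" "u \<oplus>\<^bsub>?M\<^esub> v = (\<lambda>x\<in>carrier X. u x * v x)" for u v
    by (simp_all add: dual_module_def pontryagin_dual_def)
  have Nd: "\<xi> \<in> N \<Longrightarrow> \<xi> \<in> dual" for \<xi> using N by (auto simp: dual_closed_def)
  show ?thesis
  proof (intro submodule.intro submodule_axioms.intro subgroup.intro)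
    show "N \<subseteq> carrier (add_monoid ?M)" using Nd by (auto simp: simps)
    show "\<xi> \<otimes>\<^bsub>add_monoid ?M\<^esub> \<eta> \<in> N" if "\<xi> \<in> N" "\<eta> \<in> N" for \<xi> \<eta> using that N by (simp add: simps dual_closed_def)
    show "\<one>\<^bsub>add_monoid ?M\<^esub> \<in> N" using N by (simp add: simps dual_closed_def)
    show "inv\<^bsub>add_monoid ?M\<^esub> \<xi> \<in> N" if \<xi>: "\<xi> \<in> N" for \<xi>
    proof -
      have "(\<lambda>x\<in>carrier X. (\<lambda>x\<in>carrier X. cnj (\<xi> x)) x * \<xi> x) = (\<lambda>x\<in>carrier X. 1)"
        by (rule restrict_ext) (simp add: cnj_mult_unit dualD(3)[OF Nd[OF \<xi>]])
      then have "\<ominus>\<^bsub>?M\<^esub> \<xi> = (\<lambda>x\<in>carrier X. cnj (\<xi> x))"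
        using Nd[OF \<xi>] by (intro M.minus_equality) (simp_all add: simps dual_cnj_closed)
      then show ?thesis using \<xi> N by (simp add: a_inv_def dual_closed_def)
    qed
    fix f \<xi> assume f: "f \<in> carrier (integral_group_ring \<Gamma>)" and \<xi>: "\<xi> \<in> N"
    define p where "p S = (\<lambda>x\<in>carrier X. \<Prod>g\<in>S. \<xi> (\<alpha> (inv\<^bsub>\<Gamma>\<^esub> g) x) powi f g)" for S
    have p0: "p {} = (\<lambda>x\<in>carrier X. 1)" by (simp add: p_def)
    have pS: "p (insert g S) = (\<lambda>x\<in>carrier X. (\<lambda>x\<in>carrier X. act g \<xi> x powi f g) x * p S x)" if "finite S" "g \<notin> S" for g S
      unfolding p_def by (rule restrict_ext) (simp add: act_def that)
    have "p S \<in> N" if "finite S" "S \<subseteq> carrier \<Gamma>" for S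
      using that
    proof (induction S)
      case empty
      show ?case unfolding p0 by (rule dual_closedD(2)[OF N])
    next
      case (insert g S)
      have "act g \<xi> \<in> N" using dual_closedD(5)[OF N _ \<xi>] insert.prems by simp
      from dual_closedD(3)[OF N dual_closed_power[OF N this] insert.IH] insert.prems
      show ?case unfolding pS[OF insert.hyps(1,2)] by blast
    qed
    then have "p (support f) \<in> N"
      using f by (simp add: integral_group_ring_def)
    then have "(\<lambda>x\<in>carrier X. \<Prod>g\<in>support f. \<xi> (\<alpha> (inv\<^bsub>\<Gamma>\<^esub> g) x) powi f g) \<in> N"
      by (simp only: p_def)
    then show "f \<odot>\<^bsub>?M\<^esub> \<xi> \<in> N" by (simp add: dual_module_def)
  qed
qed

text \<open>Otherwise adjoining one missing character after another would give a strictly increasing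
  chain of submodules.\<close>

lemma noetherian_dual_finitely_generated:
  assumes "noetherian_left_module (integral_group_ring \<Gamma>) (dual_module \<Gamma> X T \<alpha>)"
  obtains E where "finite E" "E \<subseteq> dual" "\<And>N. dual_closed N \<Longrightarrow> E \<subseteq> N \<Longrightarrow> N = dual"
proof -
  define gen where "gen E = \<Inter>{N. dual_closed N \<and> E \<subseteq> N}" for E
  have gen: "dual_closed (gen E)" if "E \<subseteq> dual" for E
    unfolding dual_closed_def
  proof (intro conjI ballI)
    show "gen E \<subseteq> dual" using that dual_closed_dual by (auto simp: gen_def)
  qed (auto simp: gen_def intro: dual_closedD)
  have incl: "E \<subseteq> gen E" for E by (auto simp: gen_def)
  have mono: "gen E \<subseteq> gen E'" if "E \<subseteq> E'" for E E' using that by (auto simp: gen_def)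
  have "\<exists>E. finite E \<and> E \<subseteq> dual \<and> gen E = dual"
  proof (rule ccontr)
    assume "\<not> ?thesis"
    then have ex: "\<exists>\<xi>. \<xi> \<in> dual \<and> \<xi> \<notin> gen E" if "finite E" "E \<subseteq> dual" for E
    proof -
      have "gen E \<noteq> dual" using \<open>\<not> (\<exists>E. finite E \<and> E \<subseteq> dual \<and> gen E = dual)\<close> that by blast
      moreover have "gen E \<subseteq> dual" using dual_closedD(1)[OF gen[OF that(2)]] by (rule subsetI)
      ultimately show ?thesis by blast
    qed
    define pick where "pick E = (SOME \<xi>. \<xi> \<in> dual \<and> \<xi> \<notin> gen E)" for E
    have pick: "pick E \<in> dual" "pick E \<notin> gen E" if "finite E" "E \<subseteq> dual" for E
      using someI_ex[OF ex[OF that]] by (auto simp: pick_def)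
    define F where "F n = ((\<lambda>E. insert (pick E) E) ^^ n) {}" for n :: nat
    have FS: "F (Suc n) = insert (pick (F n)) (F n)" for n by (simp add: F_def)
    have F: "finite (F n) \<and> F n \<subseteq> dual" for n
      by (induction n) (auto simp: FS pick, simp_all add: F_def)
    have "\<exists>n. \<forall>m\<ge>n. gen (F m) = gen (F n)"
      using F by (intro noetherian_left_module.ascending_chain_condition[OF assms] dual_closed_submodule gen mono) (auto simp: FS)
    then obtain n where "gen (F (Suc n)) = gen (F n)" by (meson le_Suc_eq order_refl)
    moreover have "pick (F n) \<in> gen (F (Suc n))" using incl[of "F (Suc n)"] by (auto simp: FS)
    ultimately show False using pick(2) F by blast
  qed
  then obtain E where E: "finite E" "E \<subseteq> dual" "gen E = dual" by blast
  have "N = dual" if N: "dual_closed N" "E \<subseteq> N" for N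
  proof (rule subset_antisym)
    show "N \<subseteq> dual" using dual_closedD(1)[OF N(1)] by (rule subsetI)
    have "gen E \<subseteq> N" using N by (auto simp: gen_def)
    then show "dual \<subseteq> N" by (simp add: E(3))
  qed
  then show ?thesis using that E by blast
qed

end

text \<open>Used to bound an orbit: finitely many tables of character values leave finitely many
  orbit points.\<close>

lemma finite_image_factor:
  assumes "finite (F ` H)" "\<And>x y. x \<in> H \<Longrightarrow> y \<in> H \<Longrightarrow> F x = F y \<Longrightarrow> p x = p y"
  shows "finite (p ` H)"
proof -
  have "p ` H \<subseteq> (\<lambda>v. p (SOME x. x \<in> H \<and> F x = v)) ` F ` H"
  proof
    fix z assume "z \<in> p ` H"
    then obtain x where x: "x \<in> H" "z = p x" by blast
    define y where "y = (SOME y. y \<in> H \<and> F y = F x)"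
    have y: "y \<in> H" "F y = F x" using someI[of "\<lambda>y. y \<in> H \<and> F y = F x" x] x by (auto simp: y_def)
    then have "z = p y" using assms(2)[OF y(1) x(1) y(2)] x(2) by simp
    then show "z \<in> (\<lambda>v. p (SOME x. x \<in> H \<and> F x = v)) ` F ` H" using x(1) by (auto simp: y_def)
  qed
  then show ?thesis using assms(1) finite_subset by blast
qed

section \<open>Lifts of characters and the density argument\<close>

context algebraic_action
begin

text \<open>Characters are handled through real lifts of their arguments, so that the additive theory of
  group representations applies: \<open>expo\<close> maps lifts onto characters and intertwines \<open>pull\<close> with
  \<open>act\<close>.\<close>

definition pull :: "'g \<Rightarrow> ('x \<Rightarrow> real) \<Rightarrow> 'x \<Rightarrow> real" where
  "pull g f x = (if x \<in> carrier X then f (\<alpha> (inv\<^bsub>\<Gamma>\<^esub> g) x) else f x)"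

definition expo :: "('x \<Rightarrow> real) \<Rightarrow> 'x \<Rightarrow> complex" where
  "expo f = (\<lambda>x\<in>carrier X. cis (f x))"

text \<open>Since \<open>pull\<close> does nothing outside \<open>carrier X\<close>, the laws hold
  as equations between functions on the whole type. The acting group is cut down to a subgroup
  because the central chain exists only in the nilpotent one.\<close>

lemma pull_rep:
  assumes H: "subgroup H \<Gamma>"
  shows "group_rep (\<Gamma>\<lparr>carrier := H\<rparr>) pull"
proof (intro group_rep.intro group_rep_axioms.intro)
  have Hc: "h \<in> H \<Longrightarrow> h \<in> carrier \<Gamma>" for h using subgroup.subset[OF H] by blast
  show "Group.group (\<Gamma>\<lparr>carrier := H\<rparr>)" by (rule subgroup.subgroup_is_group[OF H acting.is_group])
  show "pull g (x + y) = pull g x + pull g y" for g x y by (rule ext) (simp add: pull_def)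
  show "pull \<one>\<^bsub>\<Gamma>\<lparr>carrier := H\<rparr>\<^esub> f = f" for f by (rule ext) (simp add: pull_def action_id)
  show "pull (g \<otimes>\<^bsub>\<Gamma>\<lparr>carrier := H\<rparr>\<^esub> h) f = pull g (pull h f)"
    if "g \<in> carrier (\<Gamma>\<lparr>carrier := H\<rparr>)" "h \<in> carrier (\<Gamma>\<lparr>carrier := H\<rparr>)" for g h f
    using that Hc by (intro ext) (simp add: pull_def acting.inv_mult_group action_closed composition_rule)
qed

lemma expo_add: "expo (f + f') = (\<lambda>x\<in>carrier X. expo f x * expo f' x)"
  unfolding expo_def by (rule restrict_ext) (simp add: cis_mult)

lemma expo_minus: "expo (- f) = (\<lambda>x\<in>carrier X. cnj (expo f x))"
  unfolding expo_def by (rule restrict_ext) (simp add: cis_cnj)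

lemma expo_zero: "expo 0 = (\<lambda>x\<in>carrier X. 1)"
  unfolding expo_def by (rule restrict_ext) simp

lemma expo_pull: "g \<in> carrier \<Gamma> \<Longrightarrow> expo (pull g f) = act g (expo f)"
  unfolding expo_def act_def by (rule restrict_ext) (simp add: pull_def action_closed)

text \<open>The lift is the pointwise argument and may be discontinuous; continuity is only ever
  required of its image under \<open>expo\<close>.\<close>

lemma expo_surj:
  assumes "\<xi> \<in> dual"
  obtains f where "expo f = \<xi>"
proof
  show "expo (\<lambda>x. Arg (\<xi> x)) = \<xi>"
  proof
    fix x
    show "expo (\<lambda>x. Arg (\<xi> x)) x = \<xi> x"
    proof (cases "x \<in> carrier X")
      case True
      have "cis (Arg (\<xi> x)) = \<xi> x"
        unfolding cis_Arg[OF dual_nonzero[OF assms True]] sgn_div_norm dualD(3)[OF assms True] by simp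
      then show ?thesis using True by (simp add: expo_def)
    next
      case False
      then show ?thesis using extensional_arb[OF dualD(1)[OF assms] False] by (simp add: expo_def)
    qed
  qed
qed

lemma expo_diff_trivial:
  assumes "expo f = expo f'"
  shows "expo (f - f') = (\<lambda>x\<in>carrier X. 1)"
proof -
  have "expo (f + - f') = (\<lambda>x\<in>carrier X. 1)"
    unfolding expo_add expo_minus assms
    by (rule restrict_ext) (simp add: expo_def cnj_mult_unit)
  then show ?thesis by simp
qed

theorem periodic_points_dense:
  assumes fg: "finitely_generated_group \<Gamma>" and vn: "virtually_nilpotent_group \<Gamma>"
    and noeth: "noetherian_left_module (integral_group_ring \<Gamma>) (dual_module \<Gamma> X T \<alpha>)"
  shows "T closure_of periodic_points \<Gamma> X \<alpha> = carrier X"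
proof (rule ccontr)
  let ?P = "periodic_points \<Gamma> X \<alpha>"
  assume "T closure_of ?P \<noteq> carrier X"
  then obtain x0 where x0: "x0 \<in> carrier X" "x0 \<notin> T closure_of ?P"
    using closure_of_subset_topspace[of T ?P] by (auto simp: topspace_eq)
  obtain \<xi> where \<xi>: "\<xi> \<in> dual" "\<And>h. h \<in> ?P \<Longrightarrow> \<xi> h = 1" "\<xi> x0 \<noteq> 1"
    by (rule subgroup_annihilator[OF periodic_points_subgroup x0]) blast
  obtain H where H: "subgroup H \<Gamma>" "finite (rcosets\<^bsub>\<Gamma>\<^esub> H)" "nilpotent_group (\<Gamma>\<lparr>carrier := H\<rparr>)"
    using vn by (auto simp: virtually_nilpotent_group_def)
  have Hc: "h \<in> H \<Longrightarrow> h \<in> carrier \<Gamma>" for h using subgroup.subset[OF H(1)] by blast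
  interpret R: group_rep "\<Gamma>\<lparr>carrier := H\<rparr>" pull by (rule pull_rep[OF H(1)])
  obtain gs where gs: "R.central_chain {\<one>\<^bsub>\<Gamma>\<^esub>} gs"
  proof -
    obtain S where S: "finite S" "S \<subseteq> carrier \<Gamma>" "generate \<Gamma> S = carrier \<Gamma>"
      using fg by (auto simp: finitely_generated_group_def)
    obtain A where A: "finite A" "A \<subseteq> H" "generate \<Gamma> A = H"
      by (rule acting.finite_index_subgroup_finitely_generated[OF S H(1,2)]) blast
    have "generate (\<Gamma>\<lparr>carrier := H\<rparr>) A = carrier (\<Gamma>\<lparr>carrier := H\<rparr>)"
      using acting.generate_consistent[OF A(2) H(1)] A(3) by simp
    moreover obtain n where "lower_central_series (\<Gamma>\<lparr>carrier := H\<rparr>) n = {\<one>\<^bsub>\<Gamma>\<lparr>carrier := H\<rparr>\<^esub>}"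
      using H(3) by (auto simp: nilpotent_group_def)
    ultimately show ?thesis
      using R.nilpotent_central_chain[OF A(1)] A(2) that by auto
  qed
  obtain Tr where Tr: "finite Tr" "Tr \<subseteq> carrier \<Gamma>" "\<And>x. x \<in> carrier \<Gamma> \<Longrightarrow> \<exists>h\<in>H. \<exists>t\<in>Tr. x = h \<otimes>\<^bsub>\<Gamma>\<^esub> t"
    by (rule acting.right_transversal[OF H(1,2)]) blast
  obtain E where E: "finite E" "E \<subseteq> dual" "\<And>N. dual_closed N \<Longrightarrow> E \<subseteq> N \<Longrightarrow> N = dual"
    by (rule noetherian_dual_finitely_generated[OF noeth]) blast
  \<comment> \<open>Every group element is \<open>h\<close> times a representative \<open>t\<close>,
    so these translates of the generators generate the dual over \<open>H\<close>.\<close>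
  define E' where "E' = (\<lambda>(t, \<eta>). act t \<eta>) ` (Tr \<times> E)"
  have E': "finite E'" "E' \<subseteq> dual" using Tr E by (auto simp: E'_def act_dual subset_iff)
  have "\<exists>f. expo f = \<eta>" if "\<eta> \<in> dual" for \<eta> using expo_surj[OF that] by blast
  then obtain lift where lift: "\<And>\<eta>. \<eta> \<in> dual \<Longrightarrow> expo (lift \<eta>) = \<eta>" by metis
  obtain fs where fs: "set fs = lift ` E'" using finite_list[of "lift ` E'"] E'(1) by auto
  define W where "W = R.generated fs"
  have W: "R.invariant_subgroup H W" using R.generated_invariant by (simp add: W_def)
  have Wsub: "add_subgroup W" by (rule R.invariant_add_subgroup[OF W])
  have Wpull: "pull h f \<in> W" if "h \<in> H" "f \<in> W" for h f by (rule R.invariant_rep[OF W that])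
  have W_dual: "expo f \<in> dual" if "f \<in> W" for f
  proof -
    have "R.invariant_subgroup H {f. expo f \<in> dual}"
      unfolding R.invariant_subgroup_def add_subgroup_def
    proof (intro conjI ballI)
      fix f f' assume "f \<in> {f. expo f \<in> dual}" "f' \<in> {f. expo f \<in> dual}"
      then have "expo (f + - f') \<in> dual"
        unfolding expo_add expo_minus by (intro dual_mult_closed dual_cnj_closed) simp_all
      then show "f - f' \<in> {f. expo f \<in> dual}" by simp
    qed (auto simp: expo_zero dual_one_closed expo_pull Hc act_dual simp del: restrict_apply)
    moreover have "set fs \<subseteq> {f. expo f \<in> dual}" using fs E'(2) lift by auto
    ultimately have "W \<subseteq> {f. expo f \<in> dual}" unfolding W_def by (intro R.generated_subset) simp_all
    then show ?thesis using that by blast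
  qed
  have W_surj: "\<exists>f\<in>W. expo f = \<eta>" if \<eta>: "\<eta> \<in> dual" for \<eta>
  proof -
    \<comment> \<open>The image of \<open>W\<close> under \<open>expo\<close> is closed under
      \<open>H\<close> by construction. Requiring all translates to lie in it gives a set closed
      under the whole group.\<close>
    define N where "N = {\<eta> \<in> dual. \<forall>g\<in>carrier \<Gamma>. act g \<eta> \<in> expo ` W}"
    have act_prod: "act g (\<lambda>x\<in>carrier X. \<eta> x * \<eta>' x) = (\<lambda>x\<in>carrier X. act g \<eta> x * act g \<eta>' x)"
      and act_cnj: "act g (\<lambda>x\<in>carrier X. cnj (\<eta> x)) = (\<lambda>x\<in>carrier X. cnj (act g \<eta> x))"
      and act_triv: "act g (\<lambda>x\<in>carrier X. 1) = (\<lambda>x\<in>carrier X. 1)" if "g \<in> carrier \<Gamma>" for g \<eta> \<eta>'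
      unfolding act_def using that by (auto intro!: restrict_ext simp: action_closed)
    have img_mult: "(\<lambda>x\<in>carrier X. \<eta> x * \<eta>' x) \<in> expo ` W" if "\<eta> \<in> expo ` W" "\<eta>' \<in> expo ` W" for \<eta> \<eta>'
    proof -
      obtain f f' where "f \<in> W" "f' \<in> W" "\<eta> = expo f" "\<eta>' = expo f'" using \<open>\<eta> \<in> expo ` W\<close> \<open>\<eta>' \<in> expo ` W\<close> by blast
      then show ?thesis using add_subgroup_add[OF Wsub] by (auto simp flip: expo_add)
    qed
    have img_cnj: "(\<lambda>x\<in>carrier X. cnj (\<eta> x)) \<in> expo ` W" if "\<eta> \<in> expo ` W" for \<eta>
      using that add_subgroup_minus[OF Wsub] by (auto simp flip: expo_minus)
    have img_one: "(\<lambda>x\<in>carrier X. 1) \<in> expo ` W"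
      using add_subgroup_zero[OF Wsub] expo_zero by (metis image_eqI)
    have "dual_closed N"
      unfolding dual_closed_def
    proof (intro conjI ballI)
      show "N \<subseteq> dual" by (auto simp: N_def)
      show "(\<lambda>x\<in>carrier X. 1) \<in> N"
        unfolding N_def using dual_one_closed img_one by (simp add: act_triv del: restrict_apply)
    next
      fix \<eta> \<eta>' assume h: "\<eta> \<in> N" "\<eta>' \<in> N"
      show "(\<lambda>x\<in>carrier X. \<eta> x * \<eta>' x) \<in> N"
        unfolding N_def mem_Collect_eq
      proof (intro conjI ballI)
        show "(\<lambda>x\<in>carrier X. \<eta> x * \<eta>' x) \<in> dual" using h by (intro dual_mult_closed) (auto simp: N_def)
        show "act g (\<lambda>x\<in>carrier X. \<eta> x * \<eta>' x) \<in> expo ` W" if "g \<in> carrier \<Gamma>" for g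
          unfolding act_prod[OF that] by (rule img_mult) (use h that in \<open>auto simp: N_def\<close>)
      qed
    next
      fix \<eta> assume h: "\<eta> \<in> N"
      show "(\<lambda>x\<in>carrier X. cnj (\<eta> x)) \<in> N"
        unfolding N_def mem_Collect_eq
      proof (intro conjI ballI)
        show "(\<lambda>x\<in>carrier X. cnj (\<eta> x)) \<in> dual" using h by (intro dual_cnj_closed) (auto simp: N_def)
        show "act g (\<lambda>x\<in>carrier X. cnj (\<eta> x)) \<in> expo ` W" if "g \<in> carrier \<Gamma>" for g
          unfolding act_cnj[OF that] by (rule img_cnj) (use h that in \<open>auto simp: N_def\<close>)
      qed
    next
      fix g \<eta> assume h: "g \<in> carrier \<Gamma>" "\<eta> \<in> N"
      then show "act g \<eta> \<in> N" by (auto simp: N_def act_dual simp flip: act_mult)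
    qed
    moreover have "E \<subseteq> N"
    proof
      fix \<eta> assume \<eta>: "\<eta> \<in> E"
      have "act g \<eta> \<in> expo ` W" if g: "g \<in> carrier \<Gamma>" for g
      proof -
        obtain h t where ht: "h \<in> H" "t \<in> Tr" "g = h \<otimes>\<^bsub>\<Gamma>\<^esub> t" using Tr(3)[OF g] by blast
        have e: "act t \<eta> \<in> E'" using ht(2) \<eta> by (auto simp: E'_def)
        then have "lift (act t \<eta>) \<in> W" using R.set_subset_generated[of fs] fs by (auto simp: W_def)
        then have "pull h (lift (act t \<eta>)) \<in> W" by (rule Wpull[OF ht(1)])
        moreover have "act g \<eta> = expo (pull h (lift (act t \<eta>)))"
          using ht Tr(2) E'(2) e by (simp add: expo_pull Hc lift act_mult subset_iff)
        ultimately show ?thesis by simp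
      qed
      then show "\<eta> \<in> N" using \<eta> E(2) by (auto simp: N_def)
    qed
    ultimately have "N = dual" by (rule E(3))
    then have "act \<one>\<^bsub>\<Gamma>\<^esub> \<eta> \<in> expo ` W" using \<eta> by (auto simp: N_def)
    then show ?thesis using act_one[OF \<eta>] by auto
  qed
  \<comment> \<open>Two lifts in \<open>W\<close> of one character differ by an element of
    \<open>K\<close>. As \<open>B\<close> will contain \<open>K\<close>, a character of
    \<open>W\<close> modulo \<open>B\<close> depends only on the image under \<open>expo\<close> and
    so defines a homomorphism \<open>c\<close> on the dual.\<close>
  define K where "K = {f \<in> W. expo f = (\<lambda>x\<in>carrier X. 1)}"
  have K: "R.invariant_subgroup H K"
    unfolding R.invariant_subgroup_def add_subgroup_def
  proof (intro conjI ballI)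
    show "0 \<in> K" using add_subgroup_zero[OF Wsub] expo_zero by (simp add: K_def)
    show "f - f' \<in> K" if "f \<in> K" "f' \<in> K" for f f'
      using that expo_diff_trivial[of f f'] add_subgroup_diff[OF Wsub] by (simp add: K_def)
    show "pull h f \<in> K" if "h \<in> H" "f \<in> K" for h f
    proof -
      have "expo (pull h f) = act h (\<lambda>x\<in>carrier X. 1)" using that by (simp add: K_def expo_pull Hc)
      also have "\<dots> = (\<lambda>x\<in>carrier X. 1)"
        unfolding act_def using that by (intro restrict_ext) (simp add: action_closed Hc)
      finally show ?thesis using that Wpull by (simp add: K_def)
    qed
  qed
  obtain w where w: "w \<in> W" "expo w = \<xi>" using W_surj[OF \<xi>(1)] by blast
  have "w \<notin> K" using w \<xi>(3) x0(1) by (auto simp: K_def)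
  have Wn: "R.noetherian_between H {0} W" using R.generated_noetherian[of gs fs] gs by (simp add: W_def)
  obtain B where B: "R.invariant_subgroup H B" "K \<subseteq> B" "B \<subseteq> W" "w \<notin> B" "finite_mod B W"
    using R.residually_finite[of gs K W w] gs K W Wn w(1) \<open>w \<notin> K\<close> by (auto simp: K_def)
  have Bsub: "add_subgroup B" by (rule R.invariant_add_subgroup[OF B(1)])
  obtain \<psi> :: "('x \<Rightarrow> real) \<Rightarrow> complex" where \<psi>: "\<And>f. f \<in> W \<Longrightarrow> norm (\<psi> f) = 1"
    "\<And>f g. f \<in> W \<Longrightarrow> g \<in> W \<Longrightarrow> \<psi> (f + g) = \<psi> f * \<psi> g" "\<And>f. f \<in> B \<Longrightarrow> \<psi> f = 1" "\<psi> w \<noteq> 1"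
    by (rule finite_quotient_character[OF Bsub B(3) Wsub B(5) w(1) B(4)]) blast
  have \<psi>_cong: "\<psi> f = \<psi> f'" if "f \<in> W" "f' \<in> W" "f - f' \<in> B" for f f'
    using \<psi>(2)[of "f - f'" f'] \<psi>(3)[OF that(3)] that B(3) by auto
  define pre where "pre \<eta> = (SOME f. f \<in> W \<and> expo f = \<eta>)" for \<eta>
  have pre: "pre \<eta> \<in> W" "expo (pre \<eta>) = \<eta>" if "\<eta> \<in> dual" for \<eta>
    using someI_ex[of "\<lambda>f. f \<in> W \<and> expo f = \<eta>"] W_surj[OF that] by (auto simp: pre_def)
  define c where "c \<eta> = \<psi> (pre \<eta>)" for \<eta>
  have c_expo: "c (expo f) = \<psi> f" if f: "f \<in> W" for f
  proof -
    note p = pre[OF W_dual[OF f]]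
    have "pre (expo f) - f \<in> K"
      using expo_diff_trivial[OF p(2)] add_subgroup_diff[OF Wsub p(1) f] by (simp add: K_def)
    then show ?thesis unfolding c_def using \<psi>_cong[OF p(1) f] B(2) by blast
  qed
  have "c \<in> hom (pontryagin_dual X T) circle_group"
  proof (rule homI)
    fix \<eta> assume "\<eta> \<in> dual"
    then show "c \<eta> \<in> carrier circle_group" using \<psi>(1)[OF pre(1)] by (simp add: c_def circle_group_def)
  next
    fix \<eta> \<eta>' assume h: "\<eta> \<in> dual" "\<eta>' \<in> dual"
    have "\<eta> \<otimes>\<^bsub>pontryagin_dual X T\<^esub> \<eta>' = expo (pre \<eta> + pre \<eta>')"
      unfolding expo_add pre(2)[OF h(1)] pre(2)[OF h(2)] by (simp add: pontryagin_dual_def)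
    then have "c (\<eta> \<otimes>\<^bsub>pontryagin_dual X T\<^esub> \<eta>') = \<psi> (pre \<eta> + pre \<eta>')"
      using c_expo[OF add_subgroup_add[OF Wsub pre(1)[OF h(1)] pre(1)[OF h(2)]]] by simp
    then show "c (\<eta> \<otimes>\<^bsub>pontryagin_dual X T\<^esub> \<eta>') = c \<eta> \<otimes>\<^bsub>circle_group\<^esub> c \<eta>'"
      using \<psi>(2)[OF pre(1)[OF h(1)] pre(1)[OF h(2)]] by (simp add: c_def circle_group_def)
  qed
  then obtain x where x: "x \<in> carrier X" "\<And>\<eta>. \<eta> \<in> dual \<Longrightarrow> \<eta> x = c \<eta>" by (rule dual_point) blast
  obtain C0 where C0: "finite C0" "\<And>f. f \<in> W \<Longrightarrow> \<exists>r\<in>C0. f - r \<in> B" using B(5) by (auto simp: finite_mod_def)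
  \<comment> \<open>The representatives are cut down to \<open>W\<close>, where
    \<open>\<psi>\<close> is controlled; one that is congruent modulo \<open>B\<close> to an element
    of \<open>W\<close> lies in \<open>W\<close> itself.\<close>
  define C where "C = C0 \<inter> W"
  have C: "finite C" "\<exists>r\<in>C. f - r \<in> B" if "f \<in> W" for f
  proof -
    show "finite C" using C0(1) by (simp add: C_def)
    obtain r where r: "r \<in> C0" "f - r \<in> B" using C0(2)[OF \<open>f \<in> W\<close>] by blast
    have "f - (f - r) \<in> W" by (rule add_subgroup_diff[OF Wsub \<open>f \<in> W\<close>]) (use r(2) B(3) in blast)
    then have "r \<in> W" by (simp add: algebra_simps)
    then show "\<exists>r\<in>C. f - r \<in> B" using r by (auto simp: C_def)
  qed
  have inv_H: "inv\<^bsub>\<Gamma>\<^esub> h \<in> H" if "h \<in> H" for h by (rule subgroup.m_inv_closed[OF H(1) that])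
  have eval: "expo f (\<alpha> h x) = \<psi> (pull (inv\<^bsub>\<Gamma>\<^esub> h) f)" if "h \<in> H" "f \<in> W" for h f
  proof -
    have "expo f (\<alpha> h x) = expo (pull (inv\<^bsub>\<Gamma>\<^esub> h) f) x"
      using that x(1) by (simp add: expo_pull Hc act_def)
    then show ?thesis
      using that Wpull[OF inv_H] x(2)[OF W_dual] c_expo by simp
  qed
  \<comment> \<open>The table of values of \<open>\<psi>\<close> at the translated representatives.
    Only finitely many tables occur, and the table determines all characters at
    \<open>\<alpha> h x\<close>, hence this point.\<close>
  define F where "F h = (\<lambda>r\<in>C. \<psi> (pull (inv\<^bsub>\<Gamma>\<^esub> h) r))" for h
  have "F ` H \<subseteq> (\<Pi>\<^sub>E r\<in>C. \<psi> ` C)"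
  proof (intro image_subsetI PiE_I)
    fix h r assume h: "h \<in> H" and r: "r \<in> C"
    have "pull (inv\<^bsub>\<Gamma>\<^esub> h) r \<in> W" using Wpull[OF inv_H[OF h]] r by (simp add: C_def)
    moreover from C(2)[OF this] obtain r' where "r' \<in> C" "pull (inv\<^bsub>\<Gamma>\<^esub> h) r - r' \<in> B" by blast
    ultimately show "F h r \<in> \<psi> ` C" using \<psi>_cong[of "pull (inv\<^bsub>\<Gamma>\<^esub> h) r" r'] r by (auto simp: F_def C_def)
  qed (simp add: F_def)
  moreover have "finite (\<Pi>\<^sub>E r\<in>C. \<psi> ` C)" using C(1)[OF w(1)] by (intro finite_PiE) auto
  ultimately have "finite (F ` H)" by (rule finite_subset)
  then have finH: "finite ((\<lambda>h. \<alpha> h x) ` H)"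
  proof (rule finite_image_factor)
    fix h h' assume h: "h \<in> H" "h' \<in> H" "F h = F h'"
    have "pull (inv\<^bsub>\<Gamma>\<^esub> k) f - pull (inv\<^bsub>\<Gamma>\<^esub> k) r \<in> B" if "k \<in> H" "f - r \<in> B" for k f r
    proof -
      have "pull (inv\<^bsub>\<Gamma>\<^esub> k) (f - r) \<in> B" by (rule R.invariant_rep[OF B(1) inv_H[OF that(1)] that(2)])
      moreover have "pull (inv\<^bsub>\<Gamma>\<^esub> k) (f - r) = pull (inv\<^bsub>\<Gamma>\<^esub> k) f - pull (inv\<^bsub>\<Gamma>\<^esub> k) r" by (rule ext) (simp add: pull_def)
      ultimately show ?thesis by simp
    qed note pB = this
    show "\<alpha> h x = \<alpha> h' x"
    proof (rule dual_separates_points)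
      show "\<alpha> h x \<in> carrier X" "\<alpha> h' x \<in> carrier X" using h x(1) by (simp_all add: action_closed Hc)
      fix \<eta> assume "\<eta> \<in> dual"
      then obtain f where f: "f \<in> W" "expo f = \<eta>" using W_surj by blast
      obtain r where r: "r \<in> C" "f - r \<in> B" using C(2)[OF f(1)] by blast
      have rW: "r \<in> W" using r(1) by (simp add: C_def)
      have "\<psi> (pull (inv\<^bsub>\<Gamma>\<^esub> h) r) = \<psi> (pull (inv\<^bsub>\<Gamma>\<^esub> h') r)"
        using fun_cong[OF h(3), of r] r(1) by (simp add: F_def)
      moreover have "\<psi> (pull (inv\<^bsub>\<Gamma>\<^esub> k) f) = \<psi> (pull (inv\<^bsub>\<Gamma>\<^esub> k) r)" if k: "k \<in> H" for k
        by (rule \<psi>_cong[OF Wpull[OF inv_H[OF k] f(1)] Wpull[OF inv_H[OF k] rW] pB[OF k r(2)]])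
      ultimately show "\<eta> (\<alpha> h x) = \<eta> (\<alpha> h' x)"
        using eval[OF h(1) f(1)] eval[OF h(2) f(1)] h(1,2) f(2) by simp
    qed
  qed
  \<comment> \<open>The transversal decomposes elements as \<open>h\<close> followed on the right by
    \<open>t\<close>; applied to \<open>inv g\<close> and inverted, it puts the representative on
    the left of an element of \<open>H\<close>.\<close>
  have "orbit \<Gamma> \<alpha> x \<subseteq> (\<lambda>(t, y). \<alpha> (inv\<^bsub>\<Gamma>\<^esub> t) y) ` (Tr \<times> (\<lambda>h. \<alpha> h x) ` H)"
  proof
    fix y assume "y \<in> orbit \<Gamma> \<alpha> x"
    then obtain g where g: "g \<in> carrier \<Gamma>" "y = \<alpha> g x" by (auto simp: orbit_def)
    obtain h t where ht: "h \<in> H" "t \<in> Tr" "inv\<^bsub>\<Gamma>\<^esub> g = h \<otimes>\<^bsub>\<Gamma>\<^esub> t" using Tr(3)[OF acting.inv_closed[OF g(1)]] by blast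
    have tc: "t \<in> carrier \<Gamma>" using ht(2) Tr(2) by blast
    have "g = inv\<^bsub>\<Gamma>\<^esub> (h \<otimes>\<^bsub>\<Gamma>\<^esub> t)" using g(1) ht(3) by (metis acting.inv_inv)
    then have "g = inv\<^bsub>\<Gamma>\<^esub> t \<otimes>\<^bsub>\<Gamma>\<^esub> inv\<^bsub>\<Gamma>\<^esub> h" using acting.inv_mult_group[OF Hc[OF ht(1)] tc] by simp
    then have "y = \<alpha> (inv\<^bsub>\<Gamma>\<^esub> t) (\<alpha> (inv\<^bsub>\<Gamma>\<^esub> h) x)"
      using g(2) composition_rule[OF x(1), of "inv\<^bsub>\<Gamma>\<^esub> t" "inv\<^bsub>\<Gamma>\<^esub> h"] tc Hc[OF ht(1)] by simp
    then show "y \<in> (\<lambda>(t, y). \<alpha> (inv\<^bsub>\<Gamma>\<^esub> t) y) ` (Tr \<times> (\<lambda>h. \<alpha> h x) ` H)"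
      using ht(2) inv_H[OF ht(1)] by force
  qed
  then have "finite (orbit \<Gamma> \<alpha> x)" by (rule finite_subset) (use finH Tr(1) in auto)
  then have "x \<in> ?P" using x(1) by (simp add: periodic_points_def)
  then have "\<xi> x = 1" by (rule \<xi>(2))
  moreover have "\<xi> x = \<psi> w" using x(2)[OF \<xi>(1)] c_expo[OF w(1)] w(2) by simp
  ultimately show False using \<psi>(4) by simp
qed

end

theorem theorem1p1:
  fixes \<Gamma> :: "('g, 'n) monoid_scheme"
    and X :: "('x, 'm) monoid_scheme"
    and T :: "'x topology"
    and \<alpha> :: "'g \<Rightarrow> 'x \<Rightarrow> 'x"
  assumes "finitely_generated_group \<Gamma>"
    and "virtually_nilpotent_group \<Gamma>"
    and "algebraic_action \<Gamma> X T \<alpha>"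
    and "noetherian_action \<Gamma> X T \<alpha>"
  shows "T closure_of periodic_points \<Gamma> X \<alpha> = carrier X"
  using algebraic_action.periodic_points_dense[OF assms(3,1,2)] assms(4) by (simp add: noetherian_action_def)

end
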